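(* Let $q\in\mathbb{N}$ and let $(X_t)_{t\in\mathbb{R}_+}$, $X_t=(X_{t,1},\ldots,X_{t,d})^\top$, be a multi-type CBI process with parameters $(d,c,\beta,B,\nu,\mu)$ such that $\mathbb{E}(\|X_0\|^q)<\infty$ and $$\int_{U_d}\|z\|^q\mathbf{1}_{\{\|z\|\ge 1\}}\,\nu(dz)<\infty,\qquad \int_{U_d}\|z\|^q\mathbf{1}_{\{\|z\|\ge1\}}\,\mu_i(dz)<\infty,\quad i\in\{1,\ldots,d\}.$$ Then $$\begin{aligned} \mathbb{E}\big[(X_{t,j}-\mathbb{E}(X_{t,j}))^k\big] &=k(k-1)\sum_{i=1}^d c_i\int_0^t (e_j^\top e^{(t-s)\widetilde B}e_i)^2\,\mathbb{E}\big[(e_j^\top e^{(t-s)\widetilde B}(X_s-\mathbb{E}(X_s)))^{k-2}X_{s,i}\big]\,ds\\ &\quad+\sum_{\ell=0}^{k-2}\binom{k}{\ell}\sum_{i=1}^d\int_0^t\int_{U_d}(e_j^\top e^{(t-s)\widetilde B}z)^{k-\ell}\,\mathbb{E}\big[(e_j^\top e^{(t-s)\widetilde B}(X_s-\mathbb{E}(X_s)))^{\ell}X_{s,i}\big]\,ds\,\mu_i(dz)\\ &\quad+\sum_{\ell=0}^{k-2}\binom{k}{\ell}\int_0^t\int_{U_d}(e_j^\top e^{(t-s)\widetilde B}z)^{k-\ell}\,\mathbb{E}\big[(e_j^\top e^{(t-s)\widetilde B}(X_s-\mathbb{E}(X_s)))^{\ell}\big]\,ds\,\nu(dz) \end{aligned}$$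 for all $k\in\{1,\ldots,q\}$, $j\in\{1,\ldots,d\}$ and $t\in\mathbb{R}_+$. Moreover, for each $t\in\mathbb{R}_+$, $k\in\{1,\ldots,q\}$ and $j\in\{1,\ldots,d\}$, there exists a polynomial $P_{t,k,j}:\mathbb{R}^d\to\mathbb{R}$ having degree at most $\lfloor k/2\rfloor$ such that $$\mathbb{E}\big[(X_{t,j}-\mathbb{E}(X_{t,j}))^k\big]=\mathbb{E}[P_{t,k,j}(X_0)],\qquad t\in\mathbb{R}_+.$$ The coefficients of the polynomial $P_{t,k,j}$ depend on $d,c,\beta,B,\nu,\mu_1,\ldots,\mu_d$.
   Context: Notation: $\mathbb{R}_+=[0,\infty)$, $\mathbb{N}=\{1,2,\ldots\}$, $x\wedge y=\min\{x,y\}$, $x^+=\max\{0,x\}$, $\|\cdot\|$ is the Euclidean norm, $e_1,\ldots,e_d$ is the natural basis of $\mathbb{R}^d$, $U_d=\mathbb{R}_+^d\setminus\{0\}$, $\delta_{i,j}$ is the Kronecker delta. Zeroth powers equal $1$; empty sums are $0$ and terms with factor $k(k-1)=0$ are $0$. Admissible parameters: $(d,c,\beta,B,\nu,\mu)$ is a set of admissible parameters if $d\in\mathbb{N}$; $c=(c_i)\in\mathbb{R}_+^d$; $\beta=(\beta_i)\in\mathbb{R}_+^d$; $B=(b_{i,j})\in\mathbb{R}^{d\times d}$ has non-negative off-diagonal entries; $\nu$ is a Borel measure on $U_d$ with $\int_{U_d}(1\wedge\|z\|)\,\nu(dz)<\infty$; $\mu=(\mu_1,\ldots,\mu_d)$,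 each $\mu_i$ a Borel measure on $U_d$ with $\int_{U_d}\big[\|z\|\wedge\|z\|^2+\sum_{j\ne i}z_j\big]\mu_i(dz)<\infty$. CBI process: a multi-type CBI process with (admissible) parameters $(d,c,\beta,B,\nu,\mu)$ is a conservative Markov process with state space $\mathbb{R}_+^d$ whose transition semigroup $(P_t)_{t\ge0}$ is determined by $$\int_{\mathbb{R}_+^d}e^{-\langle\lambda,y\rangle}P_t(x,dy)=e^{-\langle x,v(t,\lambda)\rangle-\int_0^t\psi(v(s,\lambda))\,ds},\qquad x,\lambda\in\mathbb{R}_+^d,\ t\in\mathbb{R}_+,$$ where the continuously differentiable function $t\mapsto v(t,\lambda)\in\mathbb{R}_+^d$ is the unique locally bounded solution of $\partial_tv_i(t,\lambda)=-\varphi_i(v(t,\lambda))$, $v_i(0,\lambda)=\lambda_i$, $i\in\{1,\ldots,d\}$, with $\varphi_i(\lambda)=c_i\lambda_i^2-\langle Be_i,\lambda\rangle+\int_{U_d}\big(e^{-\langle\lambda,z\rangle}-1+\lambda_i(1\wedge z_i)\big)\mu_i(dz)$ and $\psi(\lambda)=\langle\beta,\lambda\rangle-\int_{U_d}\big(e^{-\langle\lambda,z\rangle}-1\big)\nu(dz)$. Modified parameter: $\widetilde B=(\widetilde b_{i,j})_{i,j\in\{1,\ldots,d\}}$ with $\widetilde b_{i,j}=b_{i,j}+\int_{U_d}(z_i-\delta_{i,j})^+\,\mu_j(dz)$.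
   Formalization: For random X_0 the formula gains the initial term E[(e_j^T e^{tB~}(X_0-E X_0))^k], and the polynomial identity centres X_{t,j} at E(X_{t,j}|X_0); both hold as printed if k=1 or X_0 is a.s. constant. P is uniform over processes on one sample set. *)

theory Defs
  imports "HOL-Probability.Probability"
begin

section \<open>State space and parameters\<close>

definition orthant :: "(real ^ 'd) set" where
  "orthant = {x. \<forall>i. 0 \<le> x $ i}"

abbreviation orthant_borel :: "(real ^ 'd) measure" where
  "orthant_borel \<equiv> restrict_space borel orthant"

abbreviation punctured_borel :: "(real ^ 'd) measure" where
  "punctured_borel \<equiv> restrict_space borel (orthant - {0})"

text \<open>The measures \<open>\<nu>\<close> and \<open>\<mu> i\<close> live on the punctured orthant itself, so an integral over
  the whole measure space is an integral over \<open>U\<^sub>d\<close>.  As the integrands below are non-negative and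
  Borel measurable, \<open>integrable\<close> says exactly that the integral is finite.\<close>

definition admissible ::
  "real ^ 'd \<Rightarrow> real ^ 'd \<Rightarrow> real ^ 'd ^ 'd \<Rightarrow> (real ^ 'd) measure \<Rightarrow> ('d \<Rightarrow> (real ^ 'd) measure) \<Rightarrow> bool"
where
  "admissible c \<beta> B \<nu> \<mu> \<longleftrightarrow>
     c \<in> orthant \<and> \<beta> \<in> orthant \<and>
     (\<forall>i j. i \<noteq> j \<longrightarrow> 0 \<le> B $ i $ j) \<and>
     sets \<nu> = sets punctured_borel \<and>
     integrable \<nu> (\<lambda>z. min 1 (norm z)) \<and>
     (\<forall>i. sets (\<mu> i) = sets punctured_borel \<and>
          integrable (\<mu> i) (\<lambda>z. min (norm z) ((norm z)\<^sup>2) + (\<Sum>j\<in>UNIV - {i}. z $ j)))"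

definition phi ::
  "real ^ 'd \<Rightarrow> real ^ 'd ^ 'd \<Rightarrow> ('d \<Rightarrow> (real ^ 'd) measure) \<Rightarrow> real ^ 'd \<Rightarrow> real ^ 'd"
where
  "phi c B \<mu> \<theta> = (\<chi> i. c $ i * (\<theta> $ i)\<^sup>2 - (B *v axis i 1) \<bullet> \<theta>
     + (\<integral>z. (exp (- (\<theta> \<bullet> z)) - 1 + \<theta> $ i * min 1 (z $ i)) \<partial>\<mu> i))"

definition psi :: "real ^ 'd \<Rightarrow> (real ^ 'd) measure \<Rightarrow> real ^ 'd \<Rightarrow> real" where
  "psi \<beta> \<nu> \<theta> = \<beta> \<bullet> \<theta> - (\<integral>z. (exp (- (\<theta> \<bullet> z)) - 1) \<partial>\<nu>)"

definition B_tilde ::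
  "real ^ 'd ^ 'd \<Rightarrow> ('d \<Rightarrow> (real ^ 'd) measure) \<Rightarrow> real ^ 'd ^ 'd"
where
  "B_tilde B \<mu> =
     (\<chi> i j. B $ i $ j + (\<integral>z. max 0 (z $ i - (if i = j then 1 else 0)) \<partial>\<mu> j))"

section \<open>CBI processes\<close>

text \<open>A solution is differentiable, hence continuous and locally bounded, on \<open>[0,\<infinity>)\<close>.  It is
  unique on the orthant, because \<open>phi\<close> is locally Lipschitz there for admissible parameters.\<close>

definition cbi_flow ::
  "real ^ 'd \<Rightarrow> real ^ 'd ^ 'd \<Rightarrow> ('d \<Rightarrow> (real ^ 'd) measure) \<Rightarrow> (real \<Rightarrow> real ^ 'd \<Rightarrow> real ^ 'd) \<Rightarrow> bool"
where
  "cbi_flow c B \<mu> v \<longleftrightarrow>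
     (\<forall>\<theta>\<in>orthant. v 0 \<theta> = \<theta> \<and>
        (\<forall>t\<ge>0. v t \<theta> \<in> orthant \<and>
           ((\<lambda>s. v s \<theta>) has_vector_derivative - phi c B \<mu> (v t \<theta>)) (at t within {0..})))"

text \<open>Values in \<open>prob_algebra\<close> make the kernels conservative.\<close>

definition transition_semigroup :: "(real \<Rightarrow> real ^ 'd \<Rightarrow> (real ^ 'd) measure) \<Rightarrow> bool" where
  "transition_semigroup P \<longleftrightarrow>
     (\<forall>t\<ge>0. P t \<in> orthant_borel \<rightarrow>\<^sub>M prob_algebra orthant_borel) \<and>
     (\<forall>x\<in>orthant. P 0 x = return orthant_borel x) \<and>
     (\<forall>s\<ge>0. \<forall>t\<ge>0. \<forall>x\<in>orthant. P (s + t) x = P s x \<bind> P t)"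

definition cbi_semigroup ::
  "real ^ 'd \<Rightarrow> real ^ 'd \<Rightarrow> real ^ 'd ^ 'd \<Rightarrow> (real ^ 'd) measure \<Rightarrow> ('d \<Rightarrow> (real ^ 'd) measure)
     \<Rightarrow> (real \<Rightarrow> real ^ 'd \<Rightarrow> (real ^ 'd) measure) \<Rightarrow> bool"
where
  "cbi_semigroup c \<beta> B \<nu> \<mu> P \<longleftrightarrow>
     transition_semigroup P \<and>
     (\<exists>v. cbi_flow c B \<mu> v \<and>
        (\<forall>x\<in>orthant. \<forall>\<theta>\<in>orthant. \<forall>t\<ge>0.
           (\<integral>y. exp (- (\<theta> \<bullet> y)) \<partial>P t x) =
             exp (- (x \<bullet> v t \<theta>) - (LINT s:{0..t}|lborel. psi \<beta> \<nu> (v s \<theta>)))))"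

definition natural_filtration :: "'w measure \<Rightarrow> (real \<Rightarrow> 'w \<Rightarrow> real ^ 'd) \<Rightarrow> real \<Rightarrow> 'w measure" where
  "natural_filtration M X s =
     sigma (space M) {X u -` A \<inter> space M | u A. 0 \<le> u \<and> u \<le> s \<and> A \<in> sets borel}"

text \<open>The Markov property is required for the natural filtration only; it follows from the Markov
  property with respect to any larger filtration.\<close>

definition markov_process ::
  "'w measure \<Rightarrow> (real \<Rightarrow> real ^ 'd \<Rightarrow> (real ^ 'd) measure) \<Rightarrow> (real \<Rightarrow> 'w \<Rightarrow> real ^ 'd) \<Rightarrow> bool"
where
  "markov_process M P X \<longleftrightarrow>
     prob_space M \<and>
     (\<forall>t\<ge>0. X t \<in> M \<rightarrow>\<^sub>M orthant_borel) \<and>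
     (\<forall>s t. 0 \<le> s \<and> s \<le> t \<longrightarrow> (\<forall>A\<in>sets orthant_borel.
        AE \<omega> in M. real_cond_exp M (natural_filtration M X s) (\<lambda>\<omega>. indicator A (X t \<omega>)) \<omega>
          = measure (P (t - s) (X s \<omega>)) A))"

definition cbi_process ::
  "real ^ 'd \<Rightarrow> real ^ 'd \<Rightarrow> real ^ 'd ^ 'd \<Rightarrow> (real ^ 'd) measure \<Rightarrow> ('d \<Rightarrow> (real ^ 'd) measure)
     \<Rightarrow> 'w measure \<Rightarrow> (real \<Rightarrow> 'w \<Rightarrow> real ^ 'd) \<Rightarrow> bool"
where
  "cbi_process c \<beta> B \<nu> \<mu> M X \<longleftrightarrow>
     admissible c \<beta> B \<nu> \<mu> \<and> (\<exists>P. cbi_semigroup c \<beta> B \<nu> \<mu> P \<and> markov_process M P X)"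

section \<open>Matrix exponential and polynomials\<close>

text \<open>Square matrices of type \<open>real ^ 'd ^ 'd\<close> are not a normed algebra in the library, so \<open>exp\<close> is
  not available for them.\<close>

definition mat_exp :: "real ^ 'd ^ 'd \<Rightarrow> real ^ 'd ^ 'd" where
  "mat_exp A = (\<Sum>n. (1 / fact n) *\<^sub>R (((**) A ^^ n) (mat 1)))"

text \<open>\<open>entry A r j x\<close> is \<open>e\<^sub>j\<^sup>T exp(r A) x\<close>.\<close>

definition entry :: "real ^ 'd ^ 'd \<Rightarrow> real \<Rightarrow> 'd \<Rightarrow> real ^ 'd \<Rightarrow> real" where
  "entry A r j x = axis j 1 \<bullet> (mat_exp (r *\<^sub>R A) *v x)"

text \<open>Real polynomials in the coordinates, of total degree at most \<open>n\<close>; \<open>\<alpha>\<close> runs over the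
  multi-indices.\<close>

definition polynomial_deg_le :: "nat \<Rightarrow> (real ^ 'd \<Rightarrow> real) \<Rightarrow> bool" where
  "polynomial_deg_le n p \<longleftrightarrow>
     (\<exists>a :: ('d \<Rightarrow> nat) \<Rightarrow> real. \<forall>x.
        p x = (\<Sum>\<alpha> | (\<Sum>i\<in>UNIV. \<alpha> i) \<le> n. a \<alpha> * (\<Prod>i\<in>UNIV. (x $ i) ^ \<alpha> i)))"

lemma finite_multi_indices: "finite {\<alpha> :: 'd::finite \<Rightarrow> nat. (\<Sum>i\<in>UNIV. \<alpha> i) \<le> n}"
proof (rule finite_subset)
  show "{\<alpha> :: 'd \<Rightarrow> nat. (\<Sum>i\<in>UNIV. \<alpha> i) \<le> n} \<subseteq> PiE UNIV (\<lambda>_. {..n})"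
  proof
    fix \<alpha> :: "'d \<Rightarrow> nat" assume "\<alpha> \<in> {\<alpha>. (\<Sum>i\<in>UNIV. \<alpha> i) \<le> n}"
    moreover have "\<alpha> i \<le> (\<Sum>i\<in>UNIV. \<alpha> i)" for i
      by (rule member_le_sum) auto
    ultimately show "\<alpha> \<in> PiE UNIV (\<lambda>_. {..n})"
      by (auto simp: PiE_def intro: le_trans)
  qed
  show "finite (PiE (UNIV :: 'd set) (\<lambda>_. {..n}))"
    by (intro finite_PiE) auto
qed

section \<open>Centred moments\<close>

text \<open>\<open>centred M X A t j s\<close> is \<open>e\<^sub>j\<^sup>T exp((t - s) A) (X\<^sub>s - E(X\<^sub>s))\<close>.\<close>

definition centred ::
  "'w measure \<Rightarrow> (real \<Rightarrow> 'w \<Rightarrow> real ^ 'd) \<Rightarrow> real ^ 'd ^ 'd \<Rightarrow> real \<Rightarrow> 'd \<Rightarrow> real \<Rightarrow> 'w \<Rightarrow> real"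
where
  "centred M X A t j s \<omega> = entry A (t - s) j (X s \<omega> - (\<integral>\<omega>'. X s \<omega>' \<partial>M))"

end

theory Submission
  imports Defs
begin

text \<open>
  Only the Laplace transform of the semigroup and the Markov property are used. They give Dynkin's
  formula for the functions \<open>exp (- \<theta> (w s \<bullet> x - a s))\<close> along a path of weights \<open>w\<close> that solves the
  adjoint linear equation of \<open>B_tilde\<close>; along such a path the first-order part of the generator
  cancels, because \<open>phi\<close> differs from the linear map of \<open>B_tilde\<close> only by terms of second order. The
  functions \<open>(n (1 - exp (- z / n))) ^ k\<close> are linear combinations of exponentials and increase to
  \<open>z ^ k\<close>, with derivatives under control. As the generator applied to a power of order \<open>k\<close> only
  needs moments of order \<open>k - 1\<close>, the existence of moments and the formula follow by induction on \<open>k\<close>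
  and dominated convergence.

  For the polynomials, the cumulant generating function of the kernel started at \<open>x\<close> is affine in
  \<open>x\<close>, so all cumulants are; a central moment of order \<open>k\<close> is a polynomial in the cumulants of order
  at least two.
\<close>


section \<open>The matrix exponential\<close>

text \<open>The Laplace identity between times \<open>s\<close> and \<open>s + h\<close> turns an
  increment of an expectation into one integral against the law at time \<open>s\<close>. The limit
  is therefore taken from the right, and integration in time goes through a fundamental theorem for
  Lipschitz functions with right derivatives. Exponents must stay in the orthant, where the Laplace
  transform is given. This holds because the weights \<open>w\<close> are rows of the exponential of
  \<open>B_tilde\<close>, whose off-diagonal entries are non-negative. The approximants have power
  growth, uniformly in \<open>n\<close>, on half-lines \<open>[-A, \<infinity>)\<close> only;
  positivity of \<open>w \<bullet> x\<close> and boundedness of the centring keep the arguments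
  there. Measurability of the laws in time is not part of the hypotheses. It is recovered for
  moments from the continuity of expectations of exponentials. The process and the kernel started at
  a point need the same moment results, so these are proved for an abstract family of laws. The
  polynomials have to be fixed before the process, which is why uniqueness of the flow is
  needed.\<close>

lemma matrix_mult_scaleR: "(r *\<^sub>R A) ** (s *\<^sub>R X) = (r * s) *\<^sub>R (A ** X)"
  for A X :: "real ^ 'd ^ 'd"
  by (simp add: vec_eq_iff matrix_matrix_mult_def sum_distrib_left algebra_simps)

lemma matrix_funpow_scaleR:
  "((**) (r *\<^sub>R A) ^^ n) (mat 1) = r ^ n *\<^sub>R ((**) A ^^ n) (mat 1)" for A :: "real ^ 'd ^ 'd"
  by (induction n) (simp_all add: matrix_mult_scaleR)

lemma matrix_funpow_mult_vec: "((**) A ^^ n) (mat 1) *v x = ((*v) A ^^ n) x" for A :: "real ^ 'd ^ 'd"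
  by (induction n) (simp_all flip: matrix_vector_mul_assoc)

text \<open>Left multiplication by \<open>A\<close> is a bounded linear map on matrices, so its
  iterates grow at most geometrically with its operator bound \<open>K\<close>, and the exponential
  series of \<open>K\<close> dominates.\<close>

lemma summable_mat_exp: "summable (\<lambda>n. (1 / fact n) *\<^sub>R (((**) A ^^ n) (mat 1)))" for A :: "real ^ 'd ^ 'd"
proof -
  have lin: "linear (\<lambda>X :: real ^ 'd ^ 'd. A ** X)"
    by (rule linearI)
      (simp_all add: matrix_add_ldistrib vec_eq_iff matrix_matrix_mult_def sum_distrib_left algebra_simps sum.distrib)
  then have bl: "bounded_linear (\<lambda>X :: real ^ 'd ^ 'd. A ** X)"
    using linear_conv_bounded_linear by blast
  obtain K where K: "0 < K" "\<And>X :: real ^ 'd ^ 'd. norm (A ** X) \<le> norm X * K"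
    using bounded_linear.pos_bounded[OF bl] by blast
  have pow: "norm (((**) A ^^ n) (mat 1)) \<le> K ^ n * norm (mat 1 :: real ^ 'd ^ 'd)" for n
  proof (induction n)
    case (Suc n)
    have "norm (((**) A ^^ Suc n) (mat 1)) \<le> norm (((**) A ^^ n) (mat 1)) * K"
      using K(2) by simp
    also have "\<dots> \<le> (K ^ n * norm (mat 1 :: real ^ 'd ^ 'd)) * K"
      using Suc K(1) by (intro mult_right_mono) auto
    finally show ?case by (simp add: mult_ac)
  qed simp
  have "summable (\<lambda>n. norm (mat 1 :: real ^ 'd ^ 'd) * (K ^ n /\<^sub>R fact n))"
    by (intro summable_mult summable_exp_generic)
  then show ?thesis
  proof (rule summable_comparison_test[rotated], intro exI[of _ 0] allI impI)
    fix n
    have "norm ((1 / fact n) *\<^sub>R (((**) A ^^ n) (mat 1))) = norm (((**) A ^^ n) (mat 1)) / fact n"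
      by simp
    also have "\<dots> \<le> K ^ n * norm (mat 1 :: real ^ 'd ^ 'd) / fact n"
      using pow by (intro divide_right_mono) auto
    finally show "norm ((1 / fact n) *\<^sub>R (((**) A ^^ n) (mat 1)))
        \<le> norm (mat 1 :: real ^ 'd ^ 'd) * (K ^ n /\<^sub>R fact n)"
      by (simp add: field_simps)
  qed
qed

text \<open>As a function of \<open>r\<close> this entry is a real power series whose coefficients
  come from iterating \<open>A\<close> on \<open>x\<close>. The scalar series makes termwise
  differentiation and Cauchy products available.\<close>

lemma entry_sums: "(\<lambda>n. (((*v) A ^^ n) x $ j / fact n) * r ^ n) sums entry A r j x"
  for A :: "real ^ 'd ^ 'd"
proof -
  have bl: "bounded_linear (\<lambda>X :: real ^ 'd ^ 'd. (X *v x) $ j)"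
    by (subst linear_conv_bounded_linear[symmetric], rule linearI)
       (simp_all add: matrix_vector_mult_add_rdistrib scaleR_matrix_vector_assoc[symmetric])
  have "(\<lambda>n. (((1 / fact n) *\<^sub>R (((**) (r *\<^sub>R A) ^^ n) (mat 1))) *v x) $ j) sums (mat_exp (r *\<^sub>R A) *v x) $ j"
    unfolding mat_exp_def by (rule bounded_linear.sums[OF bl summable_sums[OF summable_mat_exp]])
  then show ?thesis
    by (simp add: entry_def inner_axis' matrix_funpow_scaleR scaleR_matrix_vector_assoc[symmetric]
        matrix_funpow_mult_vec mult_ac)
qed

lemma entry_0: "entry A 0 j x = x $ j"
proof -
  have "(\<lambda>n. (((*v) A ^^ n) x $ j / fact n) * 0 ^ n) sums ((((*v) A ^^ 0) x $ j) / fact 0)"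
    using powser_sums_zero[of "\<lambda>n. ((*v) A ^^ n) x $ j / fact n"] by simp
  with entry_sums[of A x j 0] show ?thesis
    by (simp add: sums_unique2)
qed

text \<open>Formal differentiation shifts the coefficient sequence, and the shifted sequence belongs
  to the vector \<open>A *v x\<close>; this is \<open>d/dr exp(r A) = exp(r A) A\<close>.\<close>

lemma has_real_derivative_entry:
  "((\<lambda>r. entry A r j x) has_real_derivative entry A r j (A *v x)) (at r)"
proof -
  let ?c = "\<lambda>n. ((*v) A ^^ n) x $ j / fact n"
  have e: "entry A r j x = (\<Sum>n. ?c n * r ^ n)" for r
    using entry_sums[of A x j r] by (simp only: sums_iff)
  have "((\<lambda>r. \<Sum>n. ?c n * r ^ n) has_real_derivative (\<Sum>n. diffs ?c n * r ^ n)) (at r)"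
    by (rule termdiffs_strong_converges_everywhere) (use entry_sums sums_iff in blast)
  moreover have "diffs ?c n = ((*v) A ^^ n) (A *v x) $ j / fact n" for n
    by (simp add: diffs_def funpow_swap1 field_simps del: funpow.simps of_nat_Suc flip: funpow_Suc_right)
       (simp add: funpow_swap1)
  ultimately show ?thesis
    using entry_sums[of A "A *v x" j r] by (simp add: e sums_iff)
qed

lemma linear_entry: "linear (entry A r j)"
  unfolding entry_def by (rule linearI) (simp_all add: inner_add_right matrix_vector_right_distrib
      matrix_vector_mult_scaleR)

text \<open>Exhibits row \<open>j\<close> of the exponential as a vector of weights, so that the
  linear functional can be handled as an inner product.\<close>

lemma entry_eq_inner: "entry A r j x = (\<chi> i. entry A r j (axis i 1)) \<bullet> x"
proof -
  interpret linear "entry A r j" by (rule linear_entry)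
  have "entry A r j x = entry A r j (\<Sum>i\<in>UNIV. (x $ i) *\<^sub>R axis i 1)"
    by (simp add: basis_expansion scalar_mult_eq_scaleR[symmetric])
  also have "\<dots> = (\<Sum>i\<in>UNIV. x $ i * entry A r j (axis i 1))"
    by (simp add: sum scale)
  finally show ?thesis
    by (simp add: inner_vec_def mult_ac)
qed

text \<open>\<open>A\<close> and the multiple of the identity commute, so the binomial theorem holds
  for powers of their sum. The induction step is Pascal's rule after an index shift.\<close>

lemma funpow_shift_binomial:
  "((*v) (A + K *\<^sub>R mat 1) ^^ n) x = (\<Sum>m\<le>n. (real (n choose m) * K ^ (n - m)) *\<^sub>R ((*v) A ^^ m) x)"
  for A :: "real ^ 'd ^ 'd"
proof (induction n)
  case (Suc n)
  let ?p = "\<lambda>m. ((*v) A ^^ m) x"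
  have step: "(A + K *\<^sub>R mat 1) *v y = A *v y + K *\<^sub>R y" for y
    by (simp add: matrix_vector_mult_add_rdistrib flip: scaleR_matrix_vector_assoc)
  have "((*v) (A + K *\<^sub>R mat 1) ^^ Suc n) x
      = (\<Sum>m\<le>n. (real (n choose m) * K ^ (n - m)) *\<^sub>R ?p (Suc m))
        + (\<Sum>m\<le>n. (real (n choose m) * K ^ (Suc n - m)) *\<^sub>R ?p m)"
    by (simp add: Suc step matrix_vector_mult_scaleR scaleR_sum_right Suc_diff_le mult_ac scaleR_add_right sum.distrib
        linear_sum[OF matrix_vector_mul_linear])
  also have "(\<Sum>m\<le>n. (real (n choose m) * K ^ (Suc n - m)) *\<^sub>R ?p m)
      = (\<Sum>m\<le>Suc n. (real (n choose m) * K ^ (Suc n - m)) *\<^sub>R ?p m)"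
    by simp
  also have "\<dots> = K ^ Suc n *\<^sub>R x + (\<Sum>m\<le>n. (real (n choose Suc m) * K ^ (n - m)) *\<^sub>R ?p (Suc m))"
    by (subst sum.atMost_Suc_shift) simp
  finally have "((*v) (A + K *\<^sub>R mat 1) ^^ Suc n) x
      = K ^ Suc n *\<^sub>R x + (\<Sum>m\<le>n. (real (Suc n choose Suc m) * K ^ (n - m)) *\<^sub>R ?p (Suc m))"
    by (simp add: sum.distrib[symmetric] scaleR_add_left distrib_right add.commute del: funpow.simps)
  then show ?case
    by (subst sum.atMost_Suc_shift) simp
qed simp

text \<open>Shifting by a multiple of the identity makes all entries of the matrix non-negative, and
  multiplies its exponential by a positive number.\<close>

lemma entry_nonneg:
  assumes off: "\<And>i k. i \<noteq> k \<Longrightarrow> 0 \<le> A $ i $ k" and x: "x \<in> orthant" and r: "0 \<le> r"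
  shows "0 \<le> entry A r j x"
proof -
  \<comment> \<open>Dominates every diagonal entry in absolute value, so that the shifted matrix has
    no negative entry.\<close>
  define K where "K = (\<Sum>i\<in>UNIV. \<bar>A $ i $ i\<bar>)"
  let ?A = "A + K *\<^sub>R mat 1"
  have K: "\<bar>A $ i $ i\<bar> \<le> K" for i
    unfolding K_def by (rule member_le_sum) auto
  have A: "0 \<le> ?A $ i $ k" for i k
    using off[of i k] K[of i] by (cases "i = k") (auto simp: mat_def)
  have pos: "0 \<le> ((*v) ?A ^^ n) x $ i" for n i
    using x A by (induction n arbitrary: i)
      (auto simp: orthant_def matrix_vector_mult_def intro!: sum_nonneg mult_nonneg_nonneg)
  \<comment> \<open>The Cauchy product of the series for \<open>exp(r A)\<close> and
    \<open>exp(K r)\<close> has the coefficients of the exponential of the shifted matrix, and these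
    are non-negative.\<close>
  have c: "(\<Sum>m\<le>n. (((*v) A ^^ m) x $ j / fact m * r ^ m) * ((K * r) ^ (n - m) /\<^sub>R fact (n - m)))
      = (((*v) ?A ^^ n) x $ j / fact n) * r ^ n" for n
    unfolding funpow_shift_binomial sum_component sum_divide_distrib sum_distrib_right
  proof (rule sum.cong)
    fix m assume "m \<in> {..n}"
    then have m: "m \<le> n" by simp
    then have "r ^ n = r ^ m * r ^ (n - m)"
      by (simp flip: power_add)
    then show "(((*v) A ^^ m) x $ j / fact m * r ^ m) * ((K * r) ^ (n - m) /\<^sub>R fact (n - m))
      = ((real (n choose m) * K ^ (n - m)) *\<^sub>R ((*v) A ^^ m) x) $ j / fact n * r ^ n"
      using m by (simp add: binomial_fact field_simps power_mult_distrib)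
  qed simp
  have s1: "summable (\<lambda>n. norm (((*v) A ^^ n) x $ j / fact n * r ^ n))"
    by (rule powser_insidea[of _ "r + 1"]) (use entry_sums[of A x j "r + 1"] r in \<open>auto simp: sums_iff\<close>)
  have "(\<lambda>n. \<Sum>m\<le>n. (((*v) A ^^ m) x $ j / fact m * r ^ m) * ((K * r) ^ (n - m) /\<^sub>R fact (n - m)))
      sums (entry A r j x * exp (K * r))"
    using Cauchy_product_sums[OF s1 summable_norm_exp[of "K * r"]] entry_sums[of A x j r]
    by (simp add: exp_def sums_iff)
  then have "(\<lambda>n. (((*v) ?A ^^ n) x $ j / fact n) * r ^ n) sums (entry A r j x * exp (K * r))"
    by (simp only: c)
  then have "0 \<le> entry A r j x * exp (K * r)"
    by (rule sums_le[OF _ sums_zero, rotated]) (use pos r in auto)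
  then show ?thesis
    by (simp add: zero_le_mult_iff)
qed

section \<open>Polynomials in the coordinates\<close>

lemma polynomial_deg_le_monomial:
  assumes "(\<Sum>i\<in>UNIV. \<alpha> i) \<le> n"
  shows "polynomial_deg_le n (\<lambda>x. c * (\<Prod>i\<in>UNIV. (x $ i) ^ \<alpha> i))"
  unfolding polynomial_deg_le_def
proof (intro exI[of _ "\<lambda>\<gamma>. if \<gamma> = \<alpha> then c else 0"] allI)
  fix x :: "real ^ 'a"
  have "(\<Sum>\<gamma> | (\<Sum>i\<in>UNIV. \<gamma> i) \<le> n. (if \<gamma> = \<alpha> then c else 0) * (\<Prod>i\<in>UNIV. (x $ i) ^ \<gamma> i))
      = (\<Sum>\<gamma> | (\<Sum>i\<in>UNIV. \<gamma> i) \<le> n. if \<gamma> = \<alpha> then c * (\<Prod>i\<in>UNIV. (x $ i) ^ \<gamma> i) else 0)"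
    by (intro sum.cong) auto
  then show "c * (\<Prod>i\<in>UNIV. (x $ i) ^ \<alpha> i)
      = (\<Sum>\<gamma> | (\<Sum>i\<in>UNIV. \<gamma> i) \<le> n. (if \<gamma> = \<alpha> then c else 0) * (\<Prod>i\<in>UNIV. (x $ i) ^ \<gamma> i))"
    using assms by (simp add: sum.delta finite_multi_indices)
qed

lemma polynomial_deg_le_add:
  assumes "polynomial_deg_le n p" "polynomial_deg_le n r"
  shows "polynomial_deg_le n (\<lambda>x. p x + r x)"
proof -
  obtain a b where "\<And>x. p x = (\<Sum>\<alpha> | (\<Sum>i\<in>UNIV. \<alpha> i) \<le> n. a \<alpha> * (\<Prod>i\<in>UNIV. (x $ i) ^ \<alpha> i))"
    "\<And>x. r x = (\<Sum>\<alpha> | (\<Sum>i\<in>UNIV. \<alpha> i) \<le> n. b \<alpha> * (\<Prod>i\<in>UNIV. (x $ i) ^ \<alpha> i))"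
    using assms unfolding polynomial_deg_le_def by blast
  then show ?thesis
    unfolding polynomial_deg_le_def
    by (intro exI[of _ "\<lambda>\<alpha>. a \<alpha> + b \<alpha>"]) (simp add: sum.distrib distrib_right)
qed

lemma polynomial_deg_le_0: "polynomial_deg_le n (\<lambda>x. 0)"
  unfolding polynomial_deg_le_def by (intro exI[of _ "\<lambda>_. 0"]) simp

lemma polynomial_deg_le_sum:
  assumes "\<And>i. i \<in> I \<Longrightarrow> polynomial_deg_le n (p i)"
  shows "polynomial_deg_le n (\<lambda>x. \<Sum>i\<in>I. p i x)"
  using assms by (induction I rule: infinite_finite_induct)
    (auto intro: polynomial_deg_le_0 polynomial_deg_le_add)

lemma polynomial_deg_le_cmult:
  assumes "polynomial_deg_le n p"
  shows "polynomial_deg_le n (\<lambda>x. c * p x)"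
proof -
  obtain a where "\<And>x. p x = (\<Sum>\<alpha> | (\<Sum>i\<in>UNIV. \<alpha> i) \<le> n. a \<alpha> * (\<Prod>i\<in>UNIV. (x $ i) ^ \<alpha> i))"
    using assms unfolding polynomial_deg_le_def by blast
  then show ?thesis
    unfolding polynomial_deg_le_def
    by (intro exI[of _ "\<lambda>\<alpha>. c * a \<alpha>"]) (simp add: sum_distrib_left mult_ac)
qed

lemma polynomial_deg_le_mono:
  assumes "polynomial_deg_le n p" "n \<le> m"
  shows "polynomial_deg_le m p"
proof -
  obtain a where a: "\<And>x. p x = (\<Sum>\<alpha> | (\<Sum>i\<in>UNIV. \<alpha> i) \<le> n. a \<alpha> * (\<Prod>i\<in>UNIV. (x $ i) ^ \<alpha> i))"
    using assms unfolding polynomial_deg_le_def by blast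
  have "polynomial_deg_le m (\<lambda>x. \<Sum>\<alpha> | (\<Sum>i\<in>UNIV. \<alpha> i) \<le> n. a \<alpha> * (\<Prod>i\<in>UNIV. (x $ i) ^ \<alpha> i))"
    using assms(2) by (intro polynomial_deg_le_sum polynomial_deg_le_monomial) auto
  then show ?thesis
    by (simp add: a[abs_def])
qed

lemma polynomial_deg_le_mult_coord:
  assumes "polynomial_deg_le n p"
  shows "polynomial_deg_le (Suc n) (\<lambda>x. x $ k * p x)"
proof -
  obtain a where a: "\<And>x. p x = (\<Sum>\<alpha> | (\<Sum>i\<in>UNIV. \<alpha> i) \<le> n. a \<alpha> * (\<Prod>i\<in>UNIV. (x $ i) ^ \<alpha> i))"
    using assms unfolding polynomial_deg_le_def by blast
  have deg: "(\<Sum>i\<in>UNIV. (\<alpha>(k := Suc (\<alpha> k))) i) = Suc (\<Sum>i\<in>UNIV. \<alpha> i)" for \<alpha> :: "'a \<Rightarrow> nat"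
    by (simp add: sum.remove[of UNIV k])
  have mon: "(\<Prod>i\<in>UNIV. (x $ i) ^ (\<alpha>(k := Suc (\<alpha> k))) i) = x $ k * (\<Prod>i\<in>UNIV. (x $ i) ^ \<alpha> i)"
    for \<alpha> :: "'a \<Rightarrow> nat" and x :: "real ^ 'a"
    by (simp add: prod.remove[of UNIV k])
  have "polynomial_deg_le (Suc n) (\<lambda>x. \<Sum>\<alpha> | (\<Sum>i\<in>UNIV. \<alpha> i) \<le> n.
      a \<alpha> * (\<Prod>i\<in>UNIV. (x $ i) ^ (\<alpha>(k := Suc (\<alpha> k))) i))"
    by (intro polynomial_deg_le_sum polynomial_deg_le_monomial) (simp only: deg mem_Collect_eq Suc_le_mono)
  then show ?thesis
    by (simp only: mon a sum_distrib_left mult.left_commute)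
qed

text \<open>Cumulants of a transition kernel are affine in the starting point, so a factor of this
  kind is what one step of the cumulant recursion adds to the degree.\<close>

lemma polynomial_deg_le_mult_affine:
  assumes "polynomial_deg_le n p"
  shows "polynomial_deg_le (Suc n) (\<lambda>x. (b + (\<Sum>i\<in>UNIV. x $ i * a i)) * p x)"
proof -
  have "polynomial_deg_le (Suc n) (\<lambda>x. b * p x + (\<Sum>i\<in>UNIV. a i * (x $ i * p x)))"
    by (intro polynomial_deg_le_add polynomial_deg_le_sum polynomial_deg_le_cmult
        polynomial_deg_le_mult_coord assms polynomial_deg_le_mono[OF assms]) simp
  then show ?thesis
    by (simp add: distrib_right sum_distrib_right mult.assoc mult.left_commute)
qed

section \<open>One-sided derivatives of Lipschitz functions\<close>

text \<open>The forward difference quotients are bounded by the Lipschitz constant and converge to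
  \<open>D\<close> on \<open>[0,t)\<close>, so dominated convergence applies. The integral of a
  quotient telescopes into an average over a short window after \<open>t\<close> minus one over a
  short window after \<open>0\<close>, and these averages tend to the end values.\<close>

lemma FTC_right_derivative:
  fixes G D :: "real \<Rightarrow> real"
  assumes t: "0 \<le> t"
    and lip: "\<And>x y. x \<in> {0..t} \<Longrightarrow> y \<in> {0..t} \<Longrightarrow> \<bar>G x - G y\<bar> \<le> L * \<bar>x - y\<bar>"
    and D: "\<And>s. 0 \<le> s \<Longrightarrow> s < t \<Longrightarrow> ((\<lambda>h. (G (s + h) - G s) / h) \<longlongrightarrow> D s) (at_right 0)"
  shows "set_integrable lborel {0..t} D" "(LINT s:{0..t}|lborel. D s) = G t - G 0"
proof -
  define L' where "L' = max L 0"
  have lip: "\<bar>G x - G y\<bar> \<le> L' * \<bar>x - y\<bar>" if "x \<in> {0..t}" "y \<in> {0..t}" for x y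
    using lip[OF that] by (rule order_trans) (auto simp: L'_def intro!: mult_right_mono)
  \<comment> \<open>Freezing \<open>G\<close> outside \<open>[0,t]\<close> keeps the Lipschitz bound
    and allows forward quotients at points close to \<open>t\<close>.\<close>
  define F where "F s = G (min t (max 0 s))" for s
  have F: "\<bar>F x - F y\<bar> \<le> L' * \<bar>x - y\<bar>" for x y
  proof -
    have "\<bar>F x - F y\<bar> \<le> L' * \<bar>min t (max 0 x) - min t (max 0 y)\<bar>"
      unfolding F_def using t by (intro lip) auto
    also have "\<dots> \<le> L' * \<bar>x - y\<bar>"
      by (intro mult_left_mono) (auto simp: L'_def)
    finally show ?thesis .
  qed
  have cont: "isCont F x" for x
  proof -
    have "(F \<longlongrightarrow> F x) (at x)"
    proof (rule LIM_I)
      fix r :: real assume "0 < r"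
      moreover have "0 \<le> L'" by (simp add: L'_def)
      ultimately have "\<bar>F y - F x\<bar> < r" if "\<bar>y - x\<bar> < r / (L' + 1)" for y
        using F[of y x] that by (smt (verit) mult_left_mono pos_less_divide_eq mult.commute distrib_left mult_cancel_left1)
      then show "\<exists>s>0. \<forall>y. y \<noteq> x \<and> norm (y - x) < s \<longrightarrow> norm (F y - F x) < r"
        using \<open>0 < r\<close> \<open>0 \<le> L'\<close> by (intro exI[of _ "r / (L' + 1)"]) auto
    qed
    then show ?thesis by (simp add: isCont_def)
  qed
  have [measurable]: "F \<in> borel_measurable borel"
    by (intro borel_measurable_continuous_onI continuous_at_imp_continuous_on ballI cont)
  \<comment> \<open>The interval overshoots \<open>[0,t]\<close>: the windows
    \<open>[t, t + h n]\<close> with \<open>h n \<le> 1\<close> lie to the right of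
    \<open>t\<close>, and \<open>H\<close> has to be differentiable at interior points.\<close>
  obtain H where H: "\<And>x. x \<in> {-1..t+2} \<Longrightarrow> (H has_vector_derivative F x) (at x within {-1..t+2})"
    using antiderivative_continuous[of "-1" "t+2" F] cont continuous_at_imp_continuous_on by blast
  have DH: "DERIV H x :> F x" if "0 \<le> x" "x \<le> t + 1" for x
    using H[of x] that at_within_interior[of x "{-1..t+2}"]
    by (simp add: has_real_derivative_iff_has_vector_derivative)
  define h where "h n = 1 / real (Suc n)" for n
  have h: "0 < h n" "h n \<le> 1" for n
    by (auto simp: h_def)
  have h0: "filterlim h (at_right 0) sequentially"
    unfolding filterlim_at using h LIMSEQ_inverse_real_of_nat[unfolded inverse_eq_divide]
    by (auto simp del: of_nat_Suc simp: h_def[abs_def] intro!: always_eventually)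
  \<comment> \<open>The value \<open>D t\<close> is not controlled by the hypotheses. It is cut off
    here and put back at the end as a function supported on one point.\<close>
  define D' where "D' s = (if 0 \<le> s \<and> s < t then D s else 0)" for s
  define d where "d n s = indicator {0..<t} s * ((F (s + h n) - F s) / h n)" for n s
  have lim: "(\<lambda>n. d n s) \<longlonglongrightarrow> D' s" for s
  proof (cases "0 \<le> s \<and> s < t")
    case True
    have "((\<lambda>u. (F (s + u) - F s) / u) \<longlongrightarrow> D s) (at_right 0)"
    proof (rule Lim_transform_eventually[OF D])
      show "\<forall>\<^sub>F u in at_right 0. (G (s + u) - G s) / u = (F (s + u) - F s) / u"
        using True by (intro eventually_at_rightI[of 0 "t - s"]) (auto simp: F_def min_def max_def)
    qed (use True in auto)
    from filterlim_compose[OF this h0] show ?thesis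
      using True by (simp add: d_def D'_def)
  next
    case False
    then have "d n s = 0" "D' s = 0" for n
      by (auto simp: d_def D'_def)
    then show ?thesis by simp
  qed
  have [measurable]: "d n \<in> borel_measurable borel" for n
    unfolding d_def by measurable
  have [measurable]: "D' \<in> borel_measurable borel"
    by (rule borel_measurable_LIMSEQ_real[OF lim]) simp_all
  have bound: "\<bar>d n s\<bar> \<le> L' * indicator {0..t} s" for n s
    using F[of "s + h n" s] h(1)[of n]
    by (auto simp: d_def field_simps split: split_indicator)
  have int: "integrable lborel (\<lambda>s. L' * indicator {0..t} s)"
    using t by (intro integrable_mult_right integrable_real_indicator) (auto simp: emeasure_lborel_Icc_eq)
  have D': "integrable lborel D'"
    by (rule integrable_dominated_convergence[where s = d and w = "\<lambda>s. L' * indicator {0..t} s"])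
      (use lim bound int in auto)
  have to: "(\<lambda>n. \<integral>s. d n s \<partial>lborel) \<longlonglongrightarrow> (\<integral>s. D' s \<partial>lborel)"
    by (rule integral_dominated_convergence[OF _ _ int]) (use lim bound in auto)
  have val: "(\<integral>s. d n s \<partial>lborel) = (H (t + h n) - H t) / h n - (H (0 + h n) - H 0) / h n" for n
  proof -
    have fi: "integrable lborel (\<lambda>s. F (s + a) * indicator {0..t} s)" for a
      by (rule borel_integrable_atLeastAtMost) (auto intro!: cont continuous_intros isCont_o2[OF _ cont])
    have a: "(\<integral>s. F (s + a) * indicator {0..t} s \<partial>lborel) = H (t + a) - H (0 + a)" if "0 \<le> a" "a \<le> 1" for a
    proof (rule integral_FTC_Icc_real[OF t])
      show "DERIV (\<lambda>s. H (s + a)) s :> F (s + a)" if "0 \<le> s" "s \<le> t" for s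
        using DH[of "s + a"] that \<open>0 \<le> a\<close> \<open>a \<le> 1\<close> by (simp add: DERIV_shift)
      show "isCont (\<lambda>s. F (s + a)) s" if "0 \<le> s" "s \<le> t" for s
        by (auto intro!: continuous_intros isCont_o2[OF _ cont])
    qed
    have "(\<integral>s. d n s \<partial>lborel)
        = (\<integral>s. (F (s + h n) * indicator {0..t} s - F (s + 0) * indicator {0..t} s) / h n \<partial>lborel)"
    proof (rule integral_cong_AE)
      show "AE s in lborel. d n s = (F (s + h n) * indicator {0..t} s - F (s + 0) * indicator {0..t} s) / h n"
        using AE_lborel_singleton[of t] by eventually_elim (auto simp: d_def split: split_indicator)
    qed measurable
    also have "\<dots> = ((H (t + h n) - H (0 + h n)) - (H (t + 0) - H (0 + 0))) / h n"
      using fi[of "h n"] fi[of 0] h[of n] a[of "h n"] a[of 0] by (simp add: Bochner_Integration.integral_diff)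
    finally show ?thesis
      by (simp add: diff_divide_distrib)
  qed
  have DHlim: "(\<lambda>n. (H (x + h n) - H x) / h n) \<longlonglongrightarrow> F x" if "0 \<le> x" "x \<le> t + 1" for x
  proof -
    have "((\<lambda>u. (H (x + u) - H x) / u) \<longlongrightarrow> F x) (at_right 0)"
      using DH[OF that] unfolding DERIV_def by (rule filterlim_mono) (auto simp: at_le)
    from filterlim_compose[OF this h0] show ?thesis .
  qed
  have "(\<lambda>n. \<integral>s. d n s \<partial>lborel) \<longlonglongrightarrow> F t - F 0"
    unfolding val using t by (intro tendsto_diff DHlim) auto
  then have eq: "(\<integral>s. D' s \<partial>lborel) = G t - G 0"
    using LIMSEQ_unique[OF to] t by (auto simp: F_def)
  have dd: "indicator {0..t} s *\<^sub>R D s = D' s + D t * indicator {t} s" for s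
    using t by (auto simp: D'_def split: split_indicator)
  have z: "integrable lborel (\<lambda>s. D t * indicator {t} s)" "(\<integral>s. D t * indicator {t} s \<partial>lborel) = 0"
    by (auto intro!: integrable_mult_right integrable_real_indicator)
  show "set_integrable lborel {0..t} D"
    unfolding set_integrable_def dd using D' z by auto
  show "(LINT s:{0..t}|lborel. D s) = G t - G 0"
    unfolding set_lebesgue_integral_def dd using D' z eq by (subst Bochner_Integration.integral_add) auto
qed


section \<open>Branching and immigration mechanisms\<close>

lemma abs_integral_le:
  fixes f g :: "'a \<Rightarrow> real"
  assumes "integrable M f" "integrable M g" "\<And>x. x \<in> space M \<Longrightarrow> \<bar>f x\<bar> \<le> g x"
  shows "\<bar>\<integral>x. f x \<partial>M\<bar> \<le> (\<integral>x. g x \<partial>M)"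
  using assms by (intro order_trans[OF integral_abs_bound] integral_mono) auto

text \<open>The level sets \<open>1 / (n + 1) \<le> f\<close> have finite measure by Markov's
  inequality and exhaust the space. The jump measures may have infinite mass near the origin; this
  makes Fubini's theorem applicable to them.\<close>

lemma sigma_finite_of_integrable_pos:
  fixes f :: "'a \<Rightarrow> real"
  assumes f: "integrable m f" and pos: "\<And>x. x \<in> space m \<Longrightarrow> 0 < f x"
  shows "sigma_finite_measure m"
proof
  have [measurable]: "f \<in> borel_measurable m" using f by simp
  define A where "A n = {x \<in> space m. 1 / real (Suc n) \<le> f x}" for n
  have "A n \<in> sets m" for n
    unfolding A_def by measurable
  moreover have "emeasure m (A n) \<noteq> \<infinity>" for n
  proof -
    have "emeasure m (A n) \<le> ennreal (1 / (1 / real (Suc n)) * (\<integral>x. f x \<partial>m))"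
      unfolding A_def using f pos by (intro integral_Markov_inequality) (auto simp: less_imp_le)
    then show ?thesis
      by (auto simp: top_unique)
  qed
  moreover have "(\<Union>n. A n) = space m"
  proof (intro equalityI subsetI)
    fix x assume x: "x \<in> space m"
    then obtain n where "inverse (real (Suc n)) < f x"
      using reals_Archimedean[OF pos[OF x]] by blast
    with x show "x \<in> (\<Union>n. A n)"
      by (intro UN_I[of n]) (auto simp: A_def field_simps)
  qed (auto simp: A_def)
  ultimately show "\<exists>A. countable A \<and> A \<subseteq> sets m \<and> \<Union> A = space m \<and> (\<forall>a\<in>A. emeasure m a \<noteq> \<infinity>)"
    by (intro exI[of _ "range A"]) auto
qed

text \<open>Taylor remainder of \<open>exp (- x)\<close> after the linear term. The truncated
  compensator \<open>min 1 (z $ i)\<close> in \<open>phi\<close> will be traded for the full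
  \<open>\<theta> \<bullet> z\<close>, the difference going into \<open>B_tilde\<close>; this
  function is what remains under the integral.\<close>

definition exp_rem2 :: "real \<Rightarrow> real" where "exp_rem2 x = exp (- x) - 1 + x"

lemma exp_rem2_measurable [measurable]: "exp_rem2 \<in> borel_measurable borel"
  unfolding exp_rem2_def[abs_def] by measurable

lemma exp_rem2_nonneg: "0 \<le> exp_rem2 x"
  using exp_ge_add_one_self[of "- x"] by (simp add: exp_rem2_def)

lemma exp_rem2_0 [simp]: "exp_rem2 0 = 0"
  by (simp add: exp_rem2_def)

text \<open>The derivative is \<open>1 - exp (- z)\<close>, which lies below both \<open>1\<close>
  and \<open>z\<close>. Hence linear growth for large arguments and quadratic growth for small ones,
  the two regimes in which \<open>min (norm z) ((norm z)\<^sup>2)\<close> is integrable.\<close>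

lemma exp_rem2_diff_bound:
  assumes "0 \<le> a" "0 \<le> b"
  shows "\<bar>exp_rem2 a - exp_rem2 b\<bar> \<le> min 1 (max a b) * \<bar>a - b\<bar>"
proof -
  have "norm (exp_rem2 a - exp_rem2 b) \<le> min 1 (max a b) * norm (a - b)"
  proof (rule field_differentiable_bound[of "{0..max a b}"])
    show "(exp_rem2 has_field_derivative 1 - exp (- z)) (at z within {0..max a b})" for z
      unfolding exp_rem2_def[abs_def] by (auto intro!: derivative_eq_intros)
    show "norm (1 - exp (- z)) \<le> min 1 (max a b)" if "z \<in> {0..max a b}" for z
      using that exp_ge_add_one_self[of "- z"] by auto
  qed (use assms in auto)
  then show ?thesis by simp
qed

lemma orthant_inner_nonneg: "x \<in> orthant \<Longrightarrow> y \<in> orthant \<Longrightarrow> 0 \<le> x \<bullet> y"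
  by (auto simp: orthant_def inner_vec_def intro!: sum_nonneg)

lemma orthant_inner_bounds:
  assumes "\<theta> \<in> orthant" "z \<in> orthant"
  shows "0 \<le> \<theta> \<bullet> z" "\<theta> \<bullet> z \<le> norm \<theta> * norm z"
  using orthant_inner_nonneg[OF assms] norm_cauchy_schwarz by auto

lemma norm_le_sum_orthant: "x \<in> orthant \<Longrightarrow> norm x \<le> (\<Sum>i\<in>UNIV. x $ i)"
  using norm_le_l1_cart[of x] by (simp add: orthant_def)

lemma sum_le_card_norm: "(\<Sum>i\<in>UNIV. x $ i) \<le> real CARD('d) * norm (x :: real ^ 'd)"
proof -
  have "x $ i \<le> norm x" for i
    using component_le_norm_cart[of x i] by simp
  then have "(\<Sum>i\<in>UNIV. x $ i) \<le> (\<Sum>i\<in>(UNIV :: 'd set). norm x)"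
    by (intro sum_mono)
  then show ?thesis by simp
qed

text \<open>The size of a second-order Taylor remainder, over a jump \<open>y\<close>, of a function
  growing like a \<open>k\<close>-th power: quadratic for small jumps, where \<open>\<mu> i\<close>
  need not integrate the first power, and of order \<open>k\<close> for large ones.\<close>

definition jump_weight :: "nat \<Rightarrow> real \<Rightarrow> real" where
  "jump_weight k y = (if y \<le> 1 then y\<^sup>2 else y ^ k)"

lemma jump_weight_measurable [measurable]: "jump_weight k \<in> borel_measurable borel"
  unfolding jump_weight_def[abs_def] by measurable

lemma jump_weight_nonneg: "0 \<le> y \<Longrightarrow> 0 \<le> jump_weight k y"
  by (simp add: jump_weight_def)

lemma jump_weight_scale_le:
  assumes "0 \<le> x" "x \<le> C * y" "1 \<le> C" "0 \<le> y" "1 \<le> k"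
  shows "jump_weight k x \<le> C ^ (k + 1) * jump_weight k y"
proof -
  \<comment> \<open>The exponent \<open>k + 1\<close> serves both regimes at once: it exceeds
    \<open>k\<close>, and it is at least \<open>2\<close> because \<open>1 \<le> k\<close>.\<close>
  have C: "C\<^sup>2 \<le> C ^ (k + 1)" "C ^ k \<le> C ^ (k + 1)"
    using assms by (intro power_increasing; simp)+
  have x2: "x\<^sup>2 \<le> C\<^sup>2 * y\<^sup>2" and xk: "x ^ k \<le> C ^ k * y ^ k"
    using power_mono[OF assms(2,1)] by (simp_all add: power_mult_distrib)
  show ?thesis
  proof (cases "y \<le> 1")
    case y: True
    show ?thesis
    proof (cases "x \<le> 1")
      case True
      have "x\<^sup>2 \<le> C ^ (k + 1) * y\<^sup>2"
        using x2 C(1) by (smt (verit) mult_right_mono zero_le_power2)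
      then show ?thesis using True y by (simp add: jump_weight_def)
    next
      case False
      have "x ^ k \<le> C ^ (k + 1) * y\<^sup>2"
      \<comment> \<open>For \<open>k = 1\<close> the comparison \<open>y ^ k \<le> y\<^sup>2\<close>
        fails on \<open>[0,1]\<close>; there \<open>1 < x\<close> gives
        \<open>x \<le> x\<^sup>2\<close> instead.\<close>
      proof (cases "k = 1")
        case True
        have "x \<le> x\<^sup>2" using False by (simp add: power2_eq_square)
        with x2 C(1) show ?thesis
          using True by (smt (verit) mult_right_mono zero_le_power2 power_one_right)
      next
        case False
        then have "y ^ k \<le> y\<^sup>2"
          using assms y by (intro power_decreasing) auto
        then have "C ^ k * y ^ k \<le> C ^ (k + 1) * y\<^sup>2"
          using C(2) assms by (intro mult_mono) auto
        with xk show ?thesis by simp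
      qed
      then show ?thesis using False y by (simp add: jump_weight_def)
    qed
  next
    case y: False
    show ?thesis
    proof (cases "x \<le> 1")
      case True
      then have "x\<^sup>2 \<le> 1" using assms(1) by (simp add: power_le_one)
      moreover have "1 \<le> C ^ (k + 1)" "1 \<le> y ^ k"
        using assms y by (auto intro!: one_le_power simp del: power_Suc)
      then have "1 * 1 \<le> C ^ (k + 1) * y ^ k"
        by (intro mult_mono) auto
      ultimately show ?thesis using True y by (simp add: jump_weight_def)
    next
      case False
      have "C ^ k * y ^ k \<le> C ^ (k + 1) * y ^ k"
        using C(2) assms by (intro mult_right_mono) auto
      with xk False y show ?thesis by (simp add: jump_weight_def)
    qed
  qed
qed

lemma exp_diff_bound:
  assumes "0 \<le> a" "0 \<le> b"
  shows "\<bar>exp (- a) - exp (- b :: real)\<bar> \<le> \<bar>a - b\<bar>"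
proof -
  have *: "exp (- x) - exp (- y) \<le> y - x" "0 \<le> exp (- x) - exp (- y)" if "0 \<le> x" "x \<le> y" for x y :: real
  proof -
    have "exp (- x) * (1 - exp (- (y - x))) \<le> 1 * (y - x)"
    proof (rule mult_mono)
      show "1 - exp (- (y - x)) \<le> y - x"
        using exp_ge_add_one_self[of "- (y - x)"] by linarith
    qed (use that in auto)
    moreover have "exp (- x) * exp (- (y - x)) = exp (- y)"
      by (simp flip: exp_add)
    ultimately show "exp (- x) - exp (- y) \<le> y - x"
      by (simp add: right_diff_distrib)
    show "0 \<le> exp (- x) - exp (- y)" using that by simp
  qed
  show ?thesis
    using *[of a b] *[of b a] assms by (cases "a \<le> b") auto
qed

text \<open>Moves the scale \<open>r\<close> into the constant, so that only the weight from the
  admissibility condition is left to integrate.\<close>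

lemma min_mult_bound:
  assumes "0 \<le> r" "0 \<le> (n :: real)"
  shows "min 1 (r * n) * (r * n) \<le> (1 + r)\<^sup>2 * min n (n\<^sup>2)"
proof -
  have r: "r \<le> (1 + r)\<^sup>2" "r\<^sup>2 \<le> (1 + r)\<^sup>2"
    using assms by (auto simp: power2_eq_square algebra_simps)
  have "min 1 (r * n) * (r * n) \<le> r * n"
    using assms by (intro mult_left_le_one_le) auto
  also have "\<dots> \<le> (1 + r)\<^sup>2 * n"
    using r assms by (intro mult_right_mono) auto
  finally have 1: "min 1 (r * n) * (r * n) \<le> (1 + r)\<^sup>2 * n" .
  have "min 1 (r * n) * (r * n) \<le> (r * n) * (r * n)"
    using assms by (intro mult_right_mono) auto
  also have "\<dots> = r\<^sup>2 * n\<^sup>2" by (simp add: power2_eq_square)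
  also have "\<dots> \<le> (1 + r)\<^sup>2 * n\<^sup>2"
    using r by (intro mult_right_mono) auto
  finally show ?thesis using 1 by (simp add: min_def)
qed

lemma min_mult_bound1:
  assumes "0 \<le> r" "0 \<le> (n :: real)"
  shows "min 1 (r * n) * n \<le> (1 + r) * min n (n\<^sup>2)"
proof -
  have "min 1 (r * n) * n \<le> 1 * n" "min 1 (r * n) * n \<le> (r * n) * n"
    using assms by (intro mult_right_mono; simp)+
  moreover have "1 * n \<le> (1 + r) * n" "(r * n) * n \<le> (1 + r) * n\<^sup>2"
    using assms by (auto simp: power2_eq_square algebra_simps)
  ultimately show ?thesis by (simp add: min_def)
qed

section \<open>Integrability of the jump measures, and Lipschitz bounds for \<open>phi\<close> and
  \<open>psi\<close>\<close>

locale cbi_param =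
  fixes c \<beta> :: "real ^ 'd" and B :: "real ^ 'd ^ 'd"
    and \<nu> :: "(real ^ 'd) measure" and \<mu> :: "'d \<Rightarrow> (real ^ 'd) measure"
    and q :: nat
  assumes q: "1 \<le> q"
    and adm: "admissible c \<beta> B \<nu> \<mu>"
    and nu: "integrable \<nu> (\<lambda>z. norm z ^ q * indicator {z. 1 \<le> norm z} z)"
    and mu: "\<And>i. integrable (\<mu> i) (\<lambda>z. norm z ^ q * indicator {z. 1 \<le> norm z} z)"
begin

lemma sets_jump: "sets \<nu> = sets punctured_borel" "sets (\<mu> i) = sets punctured_borel"
  using adm by (auto simp: admissible_def)

lemma id_jump: "(\<lambda>z. z) \<in> \<nu> \<rightarrow>\<^sub>M borel" "(\<lambda>z. z) \<in> \<mu> i \<rightarrow>\<^sub>M borel"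
  unfolding measurable_cong_sets[OF sets_jump(1) refl] measurable_cong_sets[OF sets_jump(2) refl]
  by (auto intro!: measurable_restrict_space1)

lemma meas_jump:
  assumes f: "f \<in> borel_measurable borel"
  shows "f \<in> borel_measurable \<nu>" "f \<in> borel_measurable (\<mu> i)"
  using measurable_compose[OF id_jump(1) f] measurable_compose[OF id_jump(2) f] by auto

lemma space_jump: "space \<nu> = orthant - {0}" "space (\<mu> i) = orthant - {0}"
  using sets_eq_imp_space_eq[OF sets_jump(1)] sets_eq_imp_space_eq[OF sets_jump(2)]
  by (auto simp: space_restrict_space)

lemma c_nonneg: "0 \<le> c $ i" and \<beta>_orthant: "\<beta> \<in> orthant"
  using adm by (auto simp: admissible_def orthant_def)

lemma int_nu_min: "integrable \<nu> (\<lambda>z. min 1 (norm z))"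
  using adm by (simp add: admissible_def)

lemma int_mu_adm: "integrable (\<mu> i) (\<lambda>z. min (norm z) ((norm z)\<^sup>2) + (\<Sum>j\<in>UNIV - {i}. z $ j))"
  using adm by (simp add: admissible_def)

lemma int_mu_min: "integrable (\<mu> i) (\<lambda>z. min (norm z) ((norm z)\<^sup>2))"
proof (rule Bochner_Integration.integrable_bound[OF int_mu_adm[of i]])
  show "AE z in \<mu> i. norm (min (norm z) ((norm z)\<^sup>2))
      \<le> norm (min (norm z) ((norm z)\<^sup>2) + (\<Sum>j\<in>UNIV - {i}. z $ j))"
  proof (rule AE_I2)
    fix z assume "z \<in> space (\<mu> i)"
    then have "0 \<le> (\<Sum>j\<in>UNIV - {i}. z $ j)"
      by (auto simp: space_jump orthant_def intro!: sum_nonneg)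
    then show "norm (min (norm z) ((norm z)\<^sup>2))
      \<le> norm (min (norm z) ((norm z)\<^sup>2) + (\<Sum>j\<in>UNIV - {i}. z $ j))"
      by simp
  qed
qed (auto intro!: meas_jump)

lemma int_mu_offdiag:
  assumes "j \<noteq> i"
  shows "integrable (\<mu> i) (\<lambda>z. z $ j)"
proof (rule Bochner_Integration.integrable_bound[OF int_mu_adm[of i]])
  show "AE z in \<mu> i. norm (z $ j)
      \<le> norm (min (norm z) ((norm z)\<^sup>2) + (\<Sum>j\<in>UNIV - {i}. z $ j))"
  proof (rule AE_I2)
    fix z assume "z \<in> space (\<mu> i)"
    then have z: "0 \<le> z $ k" for k
      by (auto simp: space_jump orthant_def)
    then have "z $ j \<le> (\<Sum>j\<in>UNIV - {i}. z $ j)"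
      using assms by (intro member_le_sum) auto
    moreover have "0 \<le> min (norm z) ((norm z)\<^sup>2)" by simp
    ultimately show "norm (z $ j)
      \<le> norm (min (norm z) ((norm z)\<^sup>2) + (\<Sum>j\<in>UNIV - {i}. z $ j))"
      using z[of j] unfolding real_norm_def by linarith
  qed
qed (auto intro!: meas_jump)

lemma int_mu_diag: "integrable (\<mu> i) (\<lambda>z. max 0 (z $ i - 1))"
proof (rule Bochner_Integration.integrable_bound[OF int_mu_min[of i]])
  show "AE z in \<mu> i. norm (max 0 (z $ i - 1)) \<le> norm (min (norm z) ((norm z)\<^sup>2))"
  proof (rule AE_I2)
    fix z :: "real ^ 'd"
    have *: "z $ i \<le> norm z" using component_le_norm_cart[of z i] by simp
    have "max 0 (z $ i - 1) \<le> (norm z)\<^sup>2"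
    proof (cases "1 \<le> norm z")
      case True
      then have "norm z \<le> (norm z)\<^sup>2" by (intro self_le_power) auto
      with * show ?thesis by auto
    qed (use * in auto)
    with * show "norm (max 0 (z $ i - 1)) \<le> norm (min (norm z) ((norm z)\<^sup>2))"
      by auto
  qed
qed (auto intro!: meas_jump)

text \<open>These are the integrals that enter \<open>B_tilde\<close>. Off the diagonal they are
  first moments; on the diagonal the unit shift removes the small jumps.\<close>

lemma int_mu_pos_part: "integrable (\<mu> i) (\<lambda>z. max 0 (z $ k - (if k = i then 1 else 0)))"
proof (cases "k = i")
  case False
  have "integrable (\<mu> i) (\<lambda>z. max 0 (z $ k - (if k = i then 1 else 0))) = integrable (\<mu> i) (\<lambda>z. z $ k)"
    by (rule Bochner_Integration.integrable_cong) (use False in \<open>auto simp: space_jump orthant_def\<close>)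
  with int_mu_offdiag[OF False] show ?thesis by simp
qed (use int_mu_diag in simp)

lemma int_nu_power:
  assumes "1 \<le> m" "m \<le> q"
  shows "integrable \<nu> (\<lambda>z. norm z ^ m)"
proof (rule Bochner_Integration.integrable_bound[OF Bochner_Integration.integrable_add[OF int_nu_min nu]])
  show "AE z in \<nu>. norm (norm z ^ m) \<le> norm (min 1 (norm z) + norm z ^ q * indicator {z. 1 \<le> norm z} z)"
  proof (rule AE_I2)
    fix z :: "real ^ 'd"
    show "norm (norm z ^ m) \<le> norm (min 1 (norm z) + norm z ^ q * indicator {z. 1 \<le> norm z} z)"
    proof (cases "1 \<le> norm z")
      case True
      then have "norm z ^ m \<le> norm z ^ q" using assms by (intro power_increasing) auto
      with True show ?thesis by auto
    next
      case False
      then have "norm z ^ m \<le> norm z ^ 1" using assms by (intro power_decreasing) auto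
      with False show ?thesis by auto
    qed
  qed
qed (auto intro!: meas_jump)

lemma int_mu_J:
  assumes "1 \<le> k" "k \<le> q"
  shows "integrable (\<mu> i) (\<lambda>z. jump_weight k (norm z))"
proof (rule Bochner_Integration.integrable_bound[OF Bochner_Integration.integrable_add[OF int_mu_min mu]])
  show "AE z in \<mu> i. norm (jump_weight k (norm z)) \<le> norm (min (norm z) ((norm z)\<^sup>2) + norm z ^ q * indicator {z. 1 \<le> norm z} z)"
  proof (rule AE_I2)
    fix z :: "real ^ 'd"
    show "norm (jump_weight k (norm z)) \<le> norm (min (norm z) ((norm z)\<^sup>2) + norm z ^ q * indicator {z. 1 \<le> norm z} z)"
    proof (cases "1 < norm z")
      case True
      then have "norm z ^ k \<le> norm z ^ q" using assms by (intro power_increasing) auto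
      then have "norm z ^ k \<le> min (norm z) ((norm z)\<^sup>2) + norm z ^ q"
        by (intro add_increasing) auto
      with True show ?thesis by (auto simp: jump_weight_def)
    next
      case False
      then have "(norm z)\<^sup>2 \<le> norm z" by (simp add: power2_eq_square mult_left_le)
      with False show ?thesis by (auto simp: jump_weight_def)
    qed
  qed
qed (auto intro!: meas_jump)

text \<open>Small jumps are only guaranteed to be square integrable under \<open>\<mu> i\<close>, so
  exponents start at \<open>2\<close>, whereas \<open>\<nu>\<close> allows \<open>1\<close>. The
  recursion uses \<open>k - l\<close> with \<open>l < k - 1\<close>, which is at least
  \<open>2\<close>.\<close>

lemma int_mu_power:
  assumes "2 \<le> m" "m \<le> q"
  shows "integrable (\<mu> i) (\<lambda>z. norm z ^ m)"
proof (rule Bochner_Integration.integrable_bound[OF int_mu_J[of m i]])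
  show "AE z in \<mu> i. norm (norm z ^ m) \<le> norm (jump_weight m (norm z))"
  proof (rule AE_I2)
    fix z :: "real ^ 'd"
    have "norm z ^ m \<le> norm z ^ 2" if "norm z \<le> 1"
      using assms that by (intro power_decreasing) auto
    then show "norm (norm z ^ m) \<le> norm (jump_weight m (norm z))"
      by (auto simp: jump_weight_def)
  qed
qed (use assms in \<open>auto intro!: meas_jump\<close>)

lemma sigma_finite_jump: "sigma_finite_measure \<nu>" "sigma_finite_measure (\<mu> i)"
  by (rule sigma_finite_of_integrable_pos[OF int_nu_min] sigma_finite_of_integrable_pos[OF int_mu_min],
      auto simp: space_jump)+

definition Bt :: "real ^ 'd ^ 'd" where "Bt = B_tilde B \<mu>"

lemma Bt_offdiag: "i \<noteq> k \<Longrightarrow> 0 \<le> Bt $ i $ k"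
  using adm by (auto simp: Bt_def B_tilde_def admissible_def intro!: add_nonneg_nonneg integral_nonneg)

lemma int_r2:
  assumes "\<theta> \<in> orthant"
  shows "integrable (\<mu> i) (\<lambda>z. exp_rem2 (\<theta> \<bullet> z))"
proof (rule Bochner_Integration.integrable_bound[OF integrable_mult_right[where c = "(1 + norm \<theta>)\<^sup>2", OF int_mu_min]])
  show "AE z in \<mu> i. norm (exp_rem2 (\<theta> \<bullet> z)) \<le> norm ((1 + norm \<theta>)\<^sup>2 * min (norm z) ((norm z)\<^sup>2))"
  proof (rule AE_I2)
    fix z assume "z \<in> space (\<mu> i)"
    then have z: "0 \<le> \<theta> \<bullet> z" "\<theta> \<bullet> z \<le> norm \<theta> * norm z"
      using orthant_inner_bounds[OF assms, of z] by (auto simp: space_jump)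
    have "exp_rem2 (\<theta> \<bullet> z) \<le> min 1 (\<theta> \<bullet> z) * (\<theta> \<bullet> z)"
      using exp_rem2_diff_bound[OF z(1), of 0] exp_rem2_nonneg[of "\<theta> \<bullet> z"] z by simp
    also have "\<dots> \<le> min 1 (norm \<theta> * norm z) * (norm \<theta> * norm z)"
      using z by (intro mult_mono) auto
    also have "\<dots> \<le> (1 + norm \<theta>)\<^sup>2 * min (norm z) ((norm z)\<^sup>2)"
      by (rule min_mult_bound) auto
    finally show "norm (exp_rem2 (\<theta> \<bullet> z)) \<le> norm ((1 + norm \<theta>)\<^sup>2 * min (norm z) ((norm z)\<^sup>2))"
      using exp_rem2_nonneg[of "\<theta> \<bullet> z"] by simp
  qed
qed (auto intro!: meas_jump)

lemma inner_Bt_column: "(Bt *v axis i 1) \<bullet> \<theta> = (\<Sum>k\<in>UNIV. Bt $ k $ i * \<theta> $ k)"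
  by (simp add: matrix_vector_mult_basis column_def inner_vec_def)

text \<open>On the orthant \<open>z $ i - min 1 (z $ i)\<close> is the positive part of
  \<open>z $ i - 1\<close>, and \<open>z $ k\<close> is its own positive part for
  \<open>k \<noteq> i\<close>. Completing the truncated compensator to
  \<open>\<theta> \<bullet> z\<close> therefore costs exactly the integrals that turn
  \<open>B\<close> into \<open>B_tilde\<close>, and \<open>phi\<close> becomes non-negative
  second-order terms minus a linear map.\<close>

lemma phi_eq:
  assumes "\<theta> \<in> orthant"
  shows "phi c B \<mu> \<theta> $ i = c $ i * (\<theta> $ i)\<^sup>2 + (\<integral>z. exp_rem2 (\<theta> \<bullet> z) \<partial>\<mu> i) - (Bt *v axis i 1) \<bullet> \<theta>"
proof -
  define pp where "pp k z = max 0 (z $ k - (if k = i then 1 else 0))" for k and z :: "real ^ 'd"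
  have "(\<integral>z. (exp (- (\<theta> \<bullet> z)) - 1 + \<theta> $ i * min 1 (z $ i)) \<partial>\<mu> i)
      = (\<integral>z. exp_rem2 (\<theta> \<bullet> z) - (\<Sum>k\<in>UNIV. \<theta> $ k * pp k z) \<partial>\<mu> i)"
  proof (rule Bochner_Integration.integral_cong)
    fix z assume "z \<in> space (\<mu> i)"
    then have z: "0 \<le> z $ k" for k by (auto simp: space_jump orthant_def)
    have "(\<Sum>k\<in>UNIV. \<theta> $ k * pp k z) = (\<Sum>k\<in>UNIV. \<theta> $ k * z $ k - (if k = i then \<theta> $ i * min 1 (z $ i) else 0))"
    proof (rule sum.cong)
      fix k
      show "\<theta> $ k * pp k z = \<theta> $ k * z $ k - (if k = i then \<theta> $ i * min 1 (z $ i) else 0)"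
      proof (cases "k = i")
        case True
        have "pp i z = z $ i - min 1 (z $ i)" by (auto simp: pp_def)
        with True show ?thesis by (simp add: right_diff_distrib)
      qed (use z[of k] in \<open>simp add: pp_def\<close>)
    qed simp
    also have "\<dots> = \<theta> \<bullet> z - \<theta> $ i * min 1 (z $ i)"
      by (simp add: sum_subtractf inner_vec_def)
    finally show "exp (- (\<theta> \<bullet> z)) - 1 + \<theta> $ i * min 1 (z $ i) = exp_rem2 (\<theta> \<bullet> z) - (\<Sum>k\<in>UNIV. \<theta> $ k * pp k z)"
      by (simp add: exp_rem2_def)
  qed simp
  also have "\<dots> = (\<integral>z. exp_rem2 (\<theta> \<bullet> z) \<partial>\<mu> i) - (\<Sum>k\<in>UNIV. \<theta> $ k * (\<integral>z. pp k z \<partial>\<mu> i))"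
    using int_mu_pos_part[of i] int_r2[OF assms, of i]
    by (simp add: pp_def Bochner_Integration.integral_diff Bochner_Integration.integral_sum)
  finally have 1: "(\<integral>z. (exp (- (\<theta> \<bullet> z)) - 1 + \<theta> $ i * min 1 (z $ i)) \<partial>\<mu> i)
      = (\<integral>z. exp_rem2 (\<theta> \<bullet> z) \<partial>\<mu> i) - (\<Sum>k\<in>UNIV. \<theta> $ k * (\<integral>z. pp k z \<partial>\<mu> i))" .
  have 2: "(Bt *v axis i 1) \<bullet> \<theta> = (B *v axis i 1) \<bullet> \<theta> + (\<Sum>k\<in>UNIV. \<theta> $ k * (\<integral>z. pp k z \<partial>\<mu> i))"
    unfolding inner_Bt_column pp_def Bt_def B_tilde_def
    by (simp add: matrix_vector_mult_basis column_def inner_vec_def distrib_left sum.distrib mult.commute[of _ "\<theta> $ _"])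
  show ?thesis
    unfolding phi_def by (simp add: 1 2)
qed

text \<open>Three parts are estimated separately: the square contributes \<open>2 * r\<close>, the
  remainder \<open>exp_rem2\<close> contributes the integrable function
  \<open>min 1 (r * norm z) * norm z\<close>, the linear part its norm. The radius enters through
  the square and through the small jumps.\<close>

lemma phi_lipschitz:
  "\<exists>L\<ge>0. \<forall>\<theta>\<in>orthant. \<forall>\<theta>'\<in>orthant. norm \<theta> \<le> r \<longrightarrow> norm \<theta>' \<le> r \<longrightarrow>
    norm (phi c B \<mu> \<theta> - phi c B \<mu> \<theta>') \<le> L * norm (\<theta> - \<theta>')"
proof (cases "0 \<le> r")
  case False
  then have "\<not> norm \<theta> \<le> r" for \<theta> :: "real ^ 'd"
    using norm_ge_zero[of \<theta>] by linarith
  then show ?thesis by auto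
next
  case r: True
  define K where "K i = c $ i * (2 * r) + (1 + r) * (\<integral>z. min (norm z) ((norm z)\<^sup>2) \<partial>\<mu> i)
    + norm (Bt *v axis i 1)" for i
  have K: "0 \<le> K i" for i
    unfolding K_def using r c_nonneg by (intro add_nonneg_nonneg mult_nonneg_nonneg integral_nonneg) auto
  have main: "\<bar>(phi c B \<mu> \<theta> - phi c B \<mu> \<theta>') $ i\<bar> \<le> K i * norm (\<theta> - \<theta>')"
    if t: "\<theta> \<in> orthant" "\<theta>' \<in> orthant" "norm \<theta> \<le> r" "norm \<theta>' \<le> r" for \<theta> \<theta>' i
  proof -
    have ti: "\<bar>\<theta> $ i\<bar> \<le> r" "\<bar>\<theta>' $ i\<bar> \<le> r" "\<bar>\<theta> $ i - \<theta>' $ i\<bar> \<le> norm (\<theta> - \<theta>')"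
      using component_le_norm_cart[of \<theta> i] component_le_norm_cart[of \<theta>' i]
        component_le_norm_cart[of "\<theta> - \<theta>'" i] t by auto
    have "\<bar>(\<theta> $ i)\<^sup>2 - (\<theta>' $ i)\<^sup>2\<bar> = \<bar>\<theta> $ i + \<theta>' $ i\<bar> * \<bar>\<theta> $ i - \<theta>' $ i\<bar>"
      by (simp add: power2_eq_square algebra_simps flip: abs_mult)
    also have "\<dots> \<le> (2 * r) * norm (\<theta> - \<theta>')"
      using ti by (intro mult_mono) auto
    finally have "c $ i * \<bar>(\<theta> $ i)\<^sup>2 - (\<theta>' $ i)\<^sup>2\<bar> \<le> c $ i * ((2 * r) * norm (\<theta> - \<theta>'))"
      using c_nonneg by (intro mult_left_mono) auto
    then have b1: "\<bar>c $ i * (\<theta> $ i)\<^sup>2 - c $ i * (\<theta>' $ i)\<^sup>2\<bar> \<le> c $ i * (2 * r) * norm (\<theta> - \<theta>')"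
      using c_nonneg[of i] by (simp add: abs_mult mult_ac flip: right_diff_distrib)
    have "\<bar>(\<integral>z. exp_rem2 (\<theta> \<bullet> z) \<partial>\<mu> i) - (\<integral>z. exp_rem2 (\<theta>' \<bullet> z) \<partial>\<mu> i)\<bar>
        = \<bar>\<integral>z. exp_rem2 (\<theta> \<bullet> z) - exp_rem2 (\<theta>' \<bullet> z) \<partial>\<mu> i\<bar>"
      using int_r2 t by (simp add: Bochner_Integration.integral_diff)
    also have "\<dots> \<le> (\<integral>z. ((1 + r) * norm (\<theta> - \<theta>')) * min (norm z) ((norm z)\<^sup>2) \<partial>\<mu> i)"
    proof (rule abs_integral_le)
      fix z assume "z \<in> space (\<mu> i)"
      then have z: "z \<in> orthant" by (simp add: space_jump)
      have n: "norm \<theta> * norm z \<le> r * norm z" "norm \<theta>' * norm z \<le> r * norm z"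
        using t by (auto intro!: mult_right_mono)
      have "\<bar>exp_rem2 (\<theta> \<bullet> z) - exp_rem2 (\<theta>' \<bullet> z)\<bar> \<le> min 1 (max (\<theta> \<bullet> z) (\<theta>' \<bullet> z)) * \<bar>\<theta> \<bullet> z - \<theta>' \<bullet> z\<bar>"
        by (rule exp_rem2_diff_bound) (use orthant_inner_bounds z t in auto)
      also have "\<dots> \<le> min 1 (r * norm z) * (norm (\<theta> - \<theta>') * norm z)"
        using orthant_inner_bounds[OF t(1) z] orthant_inner_bounds[OF t(2) z] n
          Cauchy_Schwarz_ineq2[of "\<theta> - \<theta>'" z] r
        by (intro mult_mono) (auto simp: inner_diff_left min_def)
      also have "\<dots> = norm (\<theta> - \<theta>') * (min 1 (r * norm z) * norm z)"
        by simp
      also have "\<dots> \<le> norm (\<theta> - \<theta>') * ((1 + r) * min (norm z) ((norm z)\<^sup>2))"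
        using r by (intro mult_left_mono min_mult_bound1) auto
      finally show "\<bar>exp_rem2 (\<theta> \<bullet> z) - exp_rem2 (\<theta>' \<bullet> z)\<bar> \<le> ((1 + r) * norm (\<theta> - \<theta>')) * min (norm z) ((norm z)\<^sup>2)"
        by (simp add: mult_ac)
    qed (use int_r2 t int_mu_min in auto)
    finally have b2: "\<bar>(\<integral>z. exp_rem2 (\<theta> \<bullet> z) \<partial>\<mu> i) - (\<integral>z. exp_rem2 (\<theta>' \<bullet> z) \<partial>\<mu> i)\<bar>
        \<le> (1 + r) * (\<integral>z. min (norm z) ((norm z)\<^sup>2) \<partial>\<mu> i) * norm (\<theta> - \<theta>')"
      by (simp add: mult_ac)
    have b3: "\<bar>(Bt *v axis i 1) \<bullet> \<theta> - (Bt *v axis i 1) \<bullet> \<theta>'\<bar> \<le> norm (Bt *v axis i 1) * norm (\<theta> - \<theta>')"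
      using Cauchy_Schwarz_ineq2[of "Bt *v axis i 1" "\<theta> - \<theta>'"] by (simp add: inner_diff_right)
    show ?thesis
      unfolding vector_minus_component phi_eq[OF t(1)] phi_eq[OF t(2)] K_def
      using b1 b2 b3 unfolding distrib_right[of _ _ "norm (\<theta> - \<theta>')"] by linarith
  qed
  have "norm (phi c B \<mu> \<theta> - phi c B \<mu> \<theta>') \<le> (\<Sum>i\<in>UNIV. K i) * norm (\<theta> - \<theta>')"
    if "\<theta> \<in> orthant" "\<theta>' \<in> orthant" "norm \<theta> \<le> r" "norm \<theta>' \<le> r" for \<theta> \<theta>'
    unfolding sum_distrib_right by (rule order_trans[OF norm_le_l1_cart sum_mono[OF main[OF that]]])
  then show ?thesis
    using K by (intro exI[of _ "\<Sum>i\<in>UNIV. K i"]) (auto intro!: sum_nonneg)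
qed

lemma phi_0 [simp]: "phi c B \<mu> 0 = 0"
  by (simp add: phi_def vec_eq_iff)

definition Lpsi :: real where "Lpsi = norm \<beta> + (\<integral>z. norm z \<partial>\<nu>)"

lemma Lpsi_nonneg: "0 \<le> Lpsi"
  by (simp add: Lpsi_def integral_nonneg)

lemma int_nu_norm: "integrable \<nu> norm"
  using int_nu_power[of 1] q by simp

lemma int_nu_exp:
  assumes "\<theta> \<in> orthant"
  shows "integrable \<nu> (\<lambda>z. exp (- (\<theta> \<bullet> z)) - 1)"
proof (rule Bochner_Integration.integrable_bound[OF integrable_mult_right[where c = "norm \<theta>", OF int_nu_norm]])
  show "AE z in \<nu>. norm (exp (- (\<theta> \<bullet> z)) - 1) \<le> norm (norm \<theta> * norm z)"
  proof (rule AE_I2)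
    fix z assume "z \<in> space \<nu>"
    then show "norm (exp (- (\<theta> \<bullet> z)) - 1) \<le> norm (norm \<theta> * norm z)"
      using orthant_inner_bounds[OF assms, of z] exp_diff_bound[of "\<theta> \<bullet> z" 0] by (auto simp: space_jump)
  qed
qed (auto intro!: meas_jump)

text \<open>Global, in contrast to \<open>phi\<close>: the first moment of \<open>\<nu>\<close> is
  finite because \<open>1 \<le> q\<close>, and \<open>exp (- x)\<close> is 1-Lipschitz on the
  half-line.\<close>

lemma psi_lipschitz:
  assumes t: "\<theta> \<in> orthant" "\<theta>' \<in> orthant"
  shows "\<bar>psi \<beta> \<nu> \<theta> - psi \<beta> \<nu> \<theta>'\<bar> \<le> Lpsi * norm (\<theta> - \<theta>')"
proof -
  have "\<bar>(\<integral>z. (exp (- (\<theta> \<bullet> z)) - 1) \<partial>\<nu>) - (\<integral>z. (exp (- (\<theta>' \<bullet> z)) - 1) \<partial>\<nu>)\<bar>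
      = \<bar>\<integral>z. (exp (- (\<theta> \<bullet> z)) - 1) - (exp (- (\<theta>' \<bullet> z)) - 1) \<partial>\<nu>\<bar>"
    using int_nu_exp t by (subst Bochner_Integration.integral_diff) auto
  also have "\<dots> \<le> (\<integral>z. norm (\<theta> - \<theta>') * norm z \<partial>\<nu>)"
  proof (rule abs_integral_le)
    fix z assume "z \<in> space \<nu>"
    then have z: "z \<in> orthant" by (simp add: space_jump)
    show "\<bar>exp (- (\<theta> \<bullet> z)) - 1 - (exp (- (\<theta>' \<bullet> z)) - 1)\<bar> \<le> norm (\<theta> - \<theta>') * norm z"
      using exp_diff_bound[of "\<theta> \<bullet> z" "\<theta>' \<bullet> z"] orthant_inner_bounds[OF t(1) z] orthant_inner_bounds[OF t(2) z]
        Cauchy_Schwarz_ineq2[of "\<theta> - \<theta>'" z]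
      by (simp add: inner_diff_left)
  qed (use Bochner_Integration.integrable_diff[OF int_nu_exp[OF t(1)] int_nu_exp[OF t(2)]] int_nu_norm in auto)
  finally have 1: "\<bar>(\<integral>z. (exp (- (\<theta> \<bullet> z)) - 1) \<partial>\<nu>) - (\<integral>z. (exp (- (\<theta>' \<bullet> z)) - 1) \<partial>\<nu>)\<bar>
      \<le> (\<integral>z. norm z \<partial>\<nu>) * norm (\<theta> - \<theta>')"
    by (simp add: mult.commute)
  have 2: "\<bar>\<beta> \<bullet> \<theta> - \<beta> \<bullet> \<theta>'\<bar> \<le> norm \<beta> * norm (\<theta> - \<theta>')"
    using Cauchy_Schwarz_ineq2[of \<beta> "\<theta> - \<theta>'"] by (simp add: inner_diff_right)
  show ?thesis
    unfolding psi_def Lpsi_def distrib_right using 1 2 by linarith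
qed

lemma psi_0 [simp]: "psi \<beta> \<nu> 0 = 0"
  by (simp add: psi_def)

lemma zero_orthant [simp]: "0 \<in> orthant"
  by (simp add: orthant_def)

lemma psi_nonneg: "\<theta> \<in> orthant \<Longrightarrow> 0 \<le> psi \<beta> \<nu> \<theta>"
proof -
  assume t: "\<theta> \<in> orthant"
  have "(\<integral>z. (exp (- (\<theta> \<bullet> z)) - 1) \<partial>\<nu>) \<le> (\<integral>z. 0 \<partial>\<nu>)"
  proof (rule integral_mono)
    fix z assume "z \<in> space \<nu>"
    then show "exp (- (\<theta> \<bullet> z)) - 1 \<le> 0"
      using orthant_inner_bounds[OF t, of z] by (simp add: space_jump)
  qed (use int_nu_exp[OF t] in auto)
  then show ?thesis
    using orthant_inner_nonneg[OF \<beta>_orthant t] by (simp add: psi_def)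
qed

lemma psi_le: "\<theta> \<in> orthant \<Longrightarrow> psi \<beta> \<nu> \<theta> \<le> Lpsi * norm \<theta>"
  using psi_lipschitz[of \<theta> 0] by simp

end


section \<open>The flow\<close>

lemma set_integral_abs_le:
  fixes f :: "real \<Rightarrow> real"
  assumes "0 \<le> h" "set_integrable lborel {0..h} f" "\<And>s. s \<in> {0..h} \<Longrightarrow> \<bar>f s\<bar> \<le> K"
  shows "\<bar>LINT s:{0..h}|lborel. f s\<bar> \<le> h * K"
proof -
  have "\<bar>LINT s:{0..h}|lborel. f s\<bar> \<le> (\<integral>s. indicator {0..h} s *\<^sub>R K \<partial>lborel)"
    unfolding set_lebesgue_integral_def
    by (rule abs_integral_le) (use assms in \<open>auto simp: set_integrable_def emeasure_lborel_Icc_eq split: split_indicator\<close>)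
  also have "\<dots> = h * K"
    using assms(1) by simp
  finally show ?thesis .
qed

locale cbi_flow_param = cbi_param c \<beta> B \<nu> \<mu> q
  for c \<beta> :: "real ^ 'd" and B :: "real ^ 'd ^ 'd"
    and \<nu> :: "(real ^ 'd) measure" and \<mu> :: "'d \<Rightarrow> (real ^ 'd) measure" and q :: nat +
  fixes v :: "real \<Rightarrow> real ^ 'd \<Rightarrow> real ^ 'd"
  assumes flow: "cbi_flow c B \<mu> v"
begin

lemma v_0: "\<theta> \<in> orthant \<Longrightarrow> v 0 \<theta> = \<theta>"
  and v_orthant: "\<theta> \<in> orthant \<Longrightarrow> 0 \<le> t \<Longrightarrow> v t \<theta> \<in> orthant"
  and v_deriv: "\<theta> \<in> orthant \<Longrightarrow> 0 \<le> t \<Longrightarrow>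
    ((\<lambda>s. v s \<theta>) has_vector_derivative - phi c B \<mu> (v t \<theta>)) (at t within {0..})"
  using flow by (auto simp: cbi_flow_def)

lemma v_deriv_at:
  assumes "\<theta> \<in> orthant" "0 < t"
  shows "((\<lambda>s. v s \<theta>) has_vector_derivative - phi c B \<mu> (v t \<theta>)) (at t)"
  using v_deriv[of \<theta> t] assms at_within_interior[of t "{0..}"] by simp

lemma cont_v: "\<theta> \<in> orthant \<Longrightarrow> continuous_on {0..} (\<lambda>s. v s \<theta>)"
  using v_deriv unfolding continuous_on_eq_continuous_within
  by (auto intro: has_vector_derivative_continuous)

definition Bt_l1 :: real where "Bt_l1 = (\<Sum>i\<in>UNIV. \<Sum>k\<in>UNIV. \<bar>Bt $ k $ i\<bar>)"

lemma Bt_l1_nonneg: "0 \<le> Bt_l1"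
  by (simp add: Bt_l1_def sum_nonneg)

text \<open>The two second-order terms in \<open>phi_eq\<close> are non-negative, so only the linear
  part can make the flow grow.\<close>

lemma sum_minus_phi_le:
  assumes "\<theta> \<in> orthant"
  shows "(\<Sum>i\<in>UNIV. - phi c B \<mu> \<theta> $ i) \<le> Bt_l1 * (\<Sum>i\<in>UNIV. \<theta> $ i)"
proof -
  have pos: "0 \<le> \<theta> $ k" for k using assms by (simp add: orthant_def)
  have "- phi c B \<mu> \<theta> $ i \<le> (\<Sum>k\<in>UNIV. \<bar>Bt $ k $ i\<bar>) * (\<Sum>k\<in>UNIV. \<theta> $ k)" for i
  proof -
    have "- phi c B \<mu> \<theta> $ i \<le> (Bt *v axis i 1) \<bullet> \<theta>"
    proof -
      have "0 \<le> c $ i * (\<theta> $ i)\<^sup>2" using c_nonneg[of i] by simp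
      moreover have "0 \<le> (\<integral>z. exp_rem2 (\<theta> \<bullet> z) \<partial>\<mu> i)"
        by (rule Bochner_Integration.integral_nonneg) (rule exp_rem2_nonneg)
      ultimately show ?thesis unfolding vector_uminus_component phi_eq[OF assms] by linarith
    qed
    also have "\<dots> \<le> (\<Sum>k\<in>UNIV. \<bar>Bt $ k $ i\<bar> * (\<Sum>k\<in>UNIV. \<theta> $ k))"
      unfolding inner_Bt_column
    proof (rule sum_mono)
      fix k
      have "\<theta> $ k \<le> (\<Sum>k\<in>UNIV. \<theta> $ k)" using pos by (intro member_le_sum) auto
      then show "Bt $ k $ i * \<theta> $ k \<le> \<bar>Bt $ k $ i\<bar> * (\<Sum>k\<in>UNIV. \<theta> $ k)"
        using pos by (intro mult_mono) (auto intro!: sum_nonneg)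
    qed
    finally show ?thesis by (simp add: sum_distrib_right)
  qed
  then have "(\<Sum>i\<in>UNIV. - phi c B \<mu> \<theta> $ i) \<le> (\<Sum>i\<in>UNIV. (\<Sum>k\<in>UNIV. \<bar>Bt $ k $ i\<bar>) * (\<Sum>k\<in>UNIV. \<theta> $ k))"
    by (intro sum_mono)
  then show ?thesis by (simp add: Bt_l1_def sum_distrib_right)
qed

text \<open>Gronwall's argument with integrating factor \<open>exp (- Bt_l1 * s)\<close>. On the
  orthant the coordinate sum bounds the norm, so a one-sided estimate of the sum suffices. The bound
  is linear in \<open>\<theta>\<close>, as the first moment will need.\<close>

lemma flow_sum_bound:
  assumes th: "\<theta> \<in> orthant" and t: "0 \<le> t"
  shows "(\<Sum>i\<in>UNIV. v t \<theta> $ i) \<le> exp (Bt_l1 * t) * (\<Sum>i\<in>UNIV. \<theta> $ i)"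
proof -
  let ?S = "\<lambda>s. \<Sum>i\<in>UNIV. v s \<theta> $ i"
  define f where "f s = exp (- Bt_l1 * s) * ?S s" for s
  have "f t \<le> f 0"
  proof (rule DERIV_nonpos_imp_decreasing_open[OF t])
    show "continuous_on {0..t} f"
      unfolding f_def using continuous_on_subset[OF cont_v[OF th], of "{0..t}"]
      by (auto intro!: continuous_intros)
    fix s assume s: "0 < s" "s < t"
    have comp: "((\<lambda>s. v s \<theta> $ i) has_real_derivative - phi c B \<mu> (v s \<theta>) $ i) (at s)" for i
      using bounded_linear.has_vector_derivative[OF bounded_linear_vec_nth v_deriv_at[OF th s(1)], of i]
      by (simp add: has_real_derivative_iff_has_vector_derivative)
    have D: "(f has_real_derivative exp (- Bt_l1 * s) * (\<Sum>i\<in>UNIV. - phi c B \<mu> (v s \<theta>) $ i)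
        + - Bt_l1 * exp (- Bt_l1 * s) * ?S s) (at s)"
      unfolding f_def by (auto intro!: derivative_eq_intros comp)
    have "(\<Sum>i\<in>UNIV. - phi c B \<mu> (v s \<theta>) $ i) \<le> Bt_l1 * ?S s"
      using s by (intro sum_minus_phi_le v_orthant th) auto
    then have "exp (- Bt_l1 * s) * (\<Sum>i\<in>UNIV. - phi c B \<mu> (v s \<theta>) $ i) \<le> exp (- Bt_l1 * s) * (Bt_l1 * ?S s)"
      by (intro mult_left_mono) auto
    with D show "\<exists>y. (f has_real_derivative y) (at s) \<and> y \<le> 0"
      by (intro exI conjI) (assumption, simp add: mult_ac)
  qed
  then have "exp (- Bt_l1 * t) * ?S t \<le> (\<Sum>i\<in>UNIV. \<theta> $ i)"
    by (simp add: f_def v_0 th)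
  then have "exp (Bt_l1 * t) * (exp (- Bt_l1 * t) * ?S t) \<le> exp (Bt_l1 * t) * (\<Sum>i\<in>UNIV. \<theta> $ i)"
    by (intro mult_left_mono) auto
  moreover have "exp (Bt_l1 * t) * exp (- Bt_l1 * t) = 1"
    by (simp flip: exp_add)
  ultimately show ?thesis
    by (simp only: mult.assoc[symmetric] mult_1_left)
qed

lemma flow_norm_bound:
  assumes "\<theta> \<in> orthant" "0 \<le> t" "t \<le> T"
  shows "norm (v t \<theta>) \<le> exp (Bt_l1 * T) * (\<Sum>i\<in>UNIV. \<theta> $ i)"
proof -
  have "norm (v t \<theta>) \<le> exp (Bt_l1 * t) * (\<Sum>i\<in>UNIV. \<theta> $ i)"
    using norm_le_sum_orthant[OF v_orthant] flow_sum_bound assms by (meson order_trans)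
  also have "\<dots> \<le> exp (Bt_l1 * T) * (\<Sum>i\<in>UNIV. \<theta> $ i)"
    using assms Bt_l1_nonneg by (intro mult_right_mono) (auto simp: orthant_def intro!: sum_nonneg mult_left_mono)
  finally show ?thesis .
qed

definition Psi_int :: "real \<Rightarrow> real ^ 'd \<Rightarrow> real" where
  "Psi_int h \<theta> = (LINT s:{0..h}|lborel. psi \<beta> \<nu> (v s \<theta>))"

lemma cont_psi_v:
  assumes "\<theta> \<in> orthant"
  shows "continuous_on {0..} (\<lambda>s. psi \<beta> \<nu> (v s \<theta>))"
proof -
  have "Lpsi-lipschitz_on orthant (psi \<beta> \<nu>)"
    by (rule lipschitz_onI) (use psi_lipschitz Lpsi_nonneg in \<open>auto simp: dist_norm\<close>)
  then have "continuous_on orthant (psi \<beta> \<nu>)"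
    by (rule lipschitz_on_continuous_on)
  then show ?thesis
    by (rule continuous_on_compose2[OF _ cont_v[OF assms]]) (use v_orthant assms in auto)
qed

lemma int_psi_v:
  assumes "\<theta> \<in> orthant"
  shows "set_integrable lborel {0..h} (\<lambda>s. psi \<beta> \<nu> (v s \<theta>))"
  by (rule borel_integrable_atLeastAtMost') (rule continuous_on_subset[OF cont_psi_v[OF assms]], auto)

lemma Psi_int_nonneg:
  assumes "\<theta> \<in> orthant"
  shows "0 \<le> Psi_int h \<theta>"
  unfolding Psi_int_def set_lebesgue_integral_def
  by (rule Bochner_Integration.integral_nonneg) (auto simp: indicator_def psi_nonneg v_orthant assms)

lemma Psi_int_le:
  assumes "\<theta> \<in> orthant" "0 \<le> h"
  shows "Psi_int h \<theta> \<le> h * (Lpsi * (exp (Bt_l1 * h) * (\<Sum>i\<in>UNIV. \<theta> $ i)))"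
proof -
  have "\<bar>Psi_int h \<theta>\<bar> \<le> h * (Lpsi * (exp (Bt_l1 * h) * (\<Sum>i\<in>UNIV. \<theta> $ i)))"
    unfolding Psi_int_def
  proof (rule set_integral_abs_le[OF assms(2) int_psi_v[OF assms(1)]])
    fix s assume s: "s \<in> {0..h}"
    have "psi \<beta> \<nu> (v s \<theta>) \<le> Lpsi * norm (v s \<theta>)"
      using s assms by (intro psi_le v_orthant) auto
    also have "\<dots> \<le> Lpsi * (exp (Bt_l1 * h) * (\<Sum>i\<in>UNIV. \<theta> $ i))"
      using s assms by (intro mult_left_mono flow_norm_bound Lpsi_nonneg) auto
    finally show "\<bar>psi \<beta> \<nu> (v s \<theta>)\<bar> \<le> Lpsi * (exp (Bt_l1 * h) * (\<Sum>i\<in>UNIV. \<theta> $ i))"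
      using psi_nonneg[OF v_orthant, of \<theta> s] s assms by auto
  qed
  then show ?thesis by simp
qed

text \<open>First-order expansion in time with remainder of order \<open>h\<^sup>2\<close>,
  uniformly in \<open>\<theta>\<close> on bounded sets. Uniformity matters because Dynkin's formula
  evaluates the flow at a starting point that moves with \<open>h\<close>.\<close>

lemma flow_approx:
  assumes T: "0 \<le> T" and r: "0 \<le> r"
  shows "\<exists>K\<ge>0. \<forall>\<theta>\<in>orthant. \<forall>h\<in>{0..T}. norm \<theta> \<le> r \<longrightarrow>
    norm (v h \<theta> - \<theta>) \<le> K * h \<and> norm (v h \<theta> - \<theta> + h *\<^sub>R phi c B \<mu> \<theta>) \<le> K * h\<^sup>2 \<and>
    Psi_int h \<theta> \<le> K * h \<and> \<bar>Psi_int h \<theta> - h * psi \<beta> \<nu> \<theta>\<bar> \<le> K * h\<^sup>2 \<and> norm (phi c B \<mu> \<theta>) \<le> K \<and> psi \<beta> \<nu> \<theta> \<le> K"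
proof -
  \<comment> \<open>Bounds the flow up to time \<open>T\<close> from every starting point of norm at
    most \<open>r\<close>. The dimension enters through the comparison of coordinate sum and norm;
    the summand \<open>r\<close> covers the starting points themselves.\<close>
  define R where "R = exp (Bt_l1 * T) * (real CARD('d) * r) + r"
  have R: "0 \<le> R" "r \<le> R"
    using r by (auto simp: R_def)
  obtain L where L: "0 \<le> L" "\<And>\<theta> \<theta>'. \<theta> \<in> orthant \<Longrightarrow> \<theta>' \<in> orthant \<Longrightarrow> norm \<theta> \<le> R \<Longrightarrow> norm \<theta>' \<le> R \<Longrightarrow>
    norm (phi c B \<mu> \<theta> - phi c B \<mu> \<theta>') \<le> L * norm (\<theta> - \<theta>')"
    using phi_lipschitz[of R] by blast
  have phiR: "norm (phi c B \<mu> \<theta>) \<le> L * R" if "\<theta> \<in> orthant" "norm \<theta> \<le> R" for \<theta>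
    using L(2)[OF that(1) zero_orthant that(2)] R(1) mult_left_mono[OF that(2) L(1)] by simp
  define K where "K = L * R + L * (L * R) + Lpsi * R + Lpsi * (L * R)"
  have K: "L * R \<le> K" "L * (L * R) \<le> K" "Lpsi * R \<le> K" "Lpsi * (L * R) \<le> K" "0 \<le> K"
    using L(1) R Lpsi_nonneg by (auto simp: K_def intro!: add_increasing2 add_nonneg_nonneg mult_nonneg_nonneg)
  show ?thesis
  proof (intro exI[of _ K] conjI ballI impI K(5))
    fix \<theta> :: "real ^ 'd" and h assume th: "\<theta> \<in> orthant" and h: "h \<in> {0..T}" and n: "norm \<theta> \<le> r"
    have vR: "norm (v s \<theta>) \<le> R" if "s \<in> {0..h}" for s
    proof -
      have "norm (v s \<theta>) \<le> exp (Bt_l1 * T) * (\<Sum>i\<in>UNIV. \<theta> $ i)"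
        using that h th by (intro flow_norm_bound) auto
      also have "\<dots> \<le> exp (Bt_l1 * T) * (real CARD('d) * r)"
        using sum_le_card_norm[of \<theta>] n
        by (intro mult_left_mono order_trans[OF sum_le_card_norm]) (auto intro!: mult_left_mono)
      finally show ?thesis using r by (simp add: R_def)
    qed
    have vo: "v s \<theta> \<in> orthant" if "s \<in> {0..h}" for s
      using that th by (auto intro: v_orthant)
    have der: "((\<lambda>s. v s \<theta>) has_vector_derivative - phi c B \<mu> (v s \<theta>)) (at s within {0..u})"
      if "s \<in> {0..u}" for s u
      using that by (intro has_vector_derivative_within_subset[OF v_deriv[OF th]]) auto
    have first: "norm (v s \<theta> - \<theta>) \<le> L * R * s" if s: "s \<in> {0..h}" for s
    proof -
      have "norm (v s \<theta> - v 0 \<theta>) \<le> (L * R) * norm (s - 0)"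
      proof (rule differentiable_bound[of "{0..s}"])
        show "((\<lambda>s. v s \<theta>) has_derivative (\<lambda>x. x *\<^sub>R - phi c B \<mu> (v u \<theta>))) (at u within {0..s})"
          if "u \<in> {0..s}" for u
          using der[OF that] by (simp add: has_vector_derivative_def)
        show "onorm (\<lambda>x. x *\<^sub>R - phi c B \<mu> (v u \<theta>)) \<le> L * R" if "u \<in> {0..s}" for u
          using phiR[OF vo vR, of u] that s by (intro onorm_bound) (auto simp: L(1) R(1) mult.commute intro!: mult_left_mono)
      qed (use s in auto)
      then show ?thesis using s by (simp add: v_0 th)
    qed
    have LRK: "L * R * h \<le> K * h" using K h by (intro mult_right_mono) auto
    show "norm (v h \<theta> - \<theta>) \<le> K * h"
      using first[of h] h LRK by simp
    \<comment> \<open>Over \<open>[0,h]\<close> the flow moves by at most \<open>L * R * h\<close>,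
      hence its velocity changes by at most \<open>L\<close> times this; linearisation at time
      \<open>0\<close> then has a quadratic error.\<close>
    have "norm (v h \<theta> - v 0 \<theta> - (h - 0) *\<^sub>R (- phi c B \<mu> (v 0 \<theta>))) \<le> norm (h - 0) * (L * (L * R * h))"
    proof (rule vector_differentiable_bound_linearization[where S = "{0..h}"])
      show "norm (- phi c B \<mu> (v s \<theta>) - - phi c B \<mu> (v 0 \<theta>)) \<le> L * (L * R * h)" if s: "s \<in> {0..h}" for s
      proof -
        have "norm (- phi c B \<mu> (v s \<theta>) - - phi c B \<mu> (v 0 \<theta>)) = norm (phi c B \<mu> (v s \<theta>) - phi c B \<mu> \<theta>)"
          by (simp add: v_0 th norm_minus_commute)
        also have "\<dots> \<le> L * norm (v s \<theta> - \<theta>)"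
          using L(2) vo vR s th n R by auto
        also have "\<dots> \<le> L * (L * R * h)"
          using first[OF s] s L(1) R(1) mult_left_mono[of s h "L * R"] by (intro mult_left_mono) auto
        finally show ?thesis .
      qed
    qed (use h der closed_segment_subset in \<open>auto simp: closed_segment_eq_real_ivl\<close>)
    then have "norm (v h \<theta> - \<theta> + h *\<^sub>R phi c B \<mu> \<theta>) \<le> (L * (L * R)) * h\<^sup>2"
      using h by (simp add: v_0 th power2_eq_square mult_ac)
    also have "\<dots> \<le> K * h\<^sup>2"
      using K by (intro mult_right_mono) auto
    finally show "norm (v h \<theta> - \<theta> + h *\<^sub>R phi c B \<mu> \<theta>) \<le> K * h\<^sup>2" .
    have psiR: "psi \<beta> \<nu> x \<le> Lpsi * R" "0 \<le> psi \<beta> \<nu> x" if "x \<in> orthant" "norm x \<le> R" for x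
      using psi_le[OF that(1)] mult_left_mono[OF that(2) Lpsi_nonneg] psi_nonneg[OF that(1)] by auto
    have "\<bar>Psi_int h \<theta>\<bar> \<le> h * (Lpsi * R)"
      unfolding Psi_int_def
      by (rule set_integral_abs_le[OF _ int_psi_v[OF th]]) (use h psiR vo vR in auto)
    also have "\<dots> = (Lpsi * R) * h" by simp
    also have "\<dots> \<le> K * h"
      using K h by (intro mult_right_mono) auto
    finally show "Psi_int h \<theta> \<le> K * h" by simp
    have "\<bar>LINT s:{0..h}|lborel. (psi \<beta> \<nu> (v s \<theta>) - psi \<beta> \<nu> \<theta>)\<bar> \<le> h * (Lpsi * (L * R * h))"
    proof (rule set_integral_abs_le)
      show "set_integrable lborel {0..h} (\<lambda>s. psi \<beta> \<nu> (v s \<theta>) - psi \<beta> \<nu> \<theta>)"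
        by (intro set_integral_diff int_psi_v th borel_integrable_atLeastAtMost' continuous_intros)
      fix s assume s: "s \<in> {0..h}"
      have "\<bar>psi \<beta> \<nu> (v s \<theta>) - psi \<beta> \<nu> \<theta>\<bar> \<le> Lpsi * norm (v s \<theta> - \<theta>)"
        by (rule psi_lipschitz[OF vo[OF s] th])
      also have "\<dots> \<le> Lpsi * (L * R * h)"
        using first[OF s] s L(1) R(1) mult_left_mono[of s h "L * R"] Lpsi_nonneg by (intro mult_left_mono) auto
      finally show "\<bar>psi \<beta> \<nu> (v s \<theta>) - psi \<beta> \<nu> \<theta>\<bar> \<le> Lpsi * (L * R * h)" .
    qed (use h in auto)
    moreover have "(LINT s:{0..h}|lborel. (psi \<beta> \<nu> (v s \<theta>) - psi \<beta> \<nu> \<theta>)) = Psi_int h \<theta> - h * psi \<beta> \<nu> \<theta>"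
      unfolding Psi_int_def using h
      by (subst set_integral_diff(2)[OF int_psi_v[OF th]])
        (auto intro!: borel_integrable_atLeastAtMost' continuous_intros simp: set_integral_const)
    ultimately have "\<bar>Psi_int h \<theta> - h * psi \<beta> \<nu> \<theta>\<bar> \<le> (Lpsi * (L * R)) * h\<^sup>2"
      by (simp add: power2_eq_square mult_ac)
    also have "\<dots> \<le> K * h\<^sup>2"
      using K by (intro mult_right_mono) auto
    finally show "\<bar>Psi_int h \<theta> - h * psi \<beta> \<nu> \<theta>\<bar> \<le> K * h\<^sup>2" .
    show "norm (phi c B \<mu> \<theta>) \<le> K" "psi \<beta> \<nu> \<theta> \<le> K"
      using phiR[OF th] psiR[OF th] n R K by auto
  qed
qed

text \<open>Gronwall's argument for the squared distance of two solutions, with the Lipschitz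
  constant of \<open>phi\<close> on a ball that contains both. It makes the Laplace transforms, and
  with them the polynomials, independent of the semigroup at hand.\<close>

lemma flow_unique:
  assumes w: "cbi_flow c B \<mu> w" and th: "\<theta> \<in> orthant" and t: "0 \<le> t"
  shows "w t \<theta> = v t \<theta>"
proof -
  interpret w: cbi_flow_param c \<beta> B \<nu> \<mu> q w
    by unfold_locales (rule w)
  define R where "R = exp (Bt_l1 * t) * (\<Sum>i\<in>UNIV. \<theta> $ i)"
  obtain L where L: "0 \<le> L" "\<And>\<theta> \<theta>'. \<theta> \<in> orthant \<Longrightarrow> \<theta>' \<in> orthant \<Longrightarrow> norm \<theta> \<le> R \<Longrightarrow> norm \<theta>' \<le> R \<Longrightarrow>
    norm (phi c B \<mu> \<theta> - phi c B \<mu> \<theta>') \<le> L * norm (\<theta> - \<theta>')"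
    using phi_lipschitz[of R] by blast
  define d where "d s = v s \<theta> - w s \<theta>" for s
  define f where "f s = exp (- (2 * L) * s) * (d s \<bullet> d s)" for s
  have "f t \<le> f 0"
  proof (rule DERIV_nonpos_imp_decreasing_open[OF t])
    show "continuous_on {0..t} f"
      unfolding f_def d_def using continuous_on_subset[OF cont_v[OF th], of "{0..t}"]
        continuous_on_subset[OF w.cont_v[OF th], of "{0..t}"]
      by (auto intro!: continuous_intros)
    fix s assume s: "0 < s" "s < t"
    define d' where "d' = - phi c B \<mu> (v s \<theta>) - - phi c B \<mu> (w s \<theta>)"
    have "(d has_vector_derivative d') (at s)"
      unfolding d_def d'_def by (intro has_vector_derivative_diff v_deriv_at w.v_deriv_at th s)
    then have "((\<lambda>s. d s \<bullet> d s) has_real_derivative (d s \<bullet> d' + d' \<bullet> d s)) (at s)"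
      using bounded_bilinear.has_vector_derivative[OF bounded_bilinear_inner, of d d' s UNIV d d']
      by (simp add: has_real_derivative_iff_has_vector_derivative)
    then have D: "(f has_real_derivative exp (- (2 * L) * s) * (d s \<bullet> d' + d' \<bullet> d s)
        + - (2 * L) * exp (- (2 * L) * s) * (d s \<bullet> d s)) (at s)"
      unfolding f_def by (auto intro!: derivative_eq_intros)
    have "norm d' \<le> L * norm (d s)"
      unfolding d'_def d_def using L(2)[of "v s \<theta>" "w s \<theta>"] flow_norm_bound[OF th, of s t]
        w.flow_norm_bound[OF th, of s t] v_orthant[OF th] w.v_orthant[OF th] s
      by (simp add: R_def Bt_l1_def w.Bt_l1_def norm_minus_commute)
    then have "d s \<bullet> d' \<le> norm (d s) * (L * norm (d s))"
      by (intro order_trans[OF norm_cauchy_schwarz] mult_left_mono) auto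
    also have "\<dots> = L * (d s \<bullet> d s)"
      by (simp add: dot_square_norm power2_eq_square)
    finally have "d s \<bullet> d' + d' \<bullet> d s \<le> 2 * L * (d s \<bullet> d s)"
      by (simp add: inner_commute)
    then have "exp (- (2 * L) * s) * (d s \<bullet> d' + d' \<bullet> d s) \<le> exp (- (2 * L) * s) * (2 * L * (d s \<bullet> d s))"
      by (intro mult_left_mono) auto
    with D show "\<exists>y. (f has_real_derivative y) (at s) \<and> y \<le> 0"
      by (intro exI conjI) (assumption, simp add: mult_ac)
  qed
  then have "f t \<le> 0"
    by (simp add: f_def d_def v_0 w.v_0 th)
  then have "d t \<bullet> d t = 0"
    using inner_ge_zero[of "d t"] by (simp add: f_def mult_le_0_iff)
  then show ?thesis
    by (simp add: d_def)
qed

end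


section \<open>Dynkin's formula for exponentials\<close>

text \<open>Turns bounds on approximants that are uniform in \<open>n\<close> into the existence of
  a moment, together with the same bound.\<close>

lemma fatou_integrable:
  fixes f :: "nat \<Rightarrow> 'a \<Rightarrow> real"
  assumes f: "\<And>n. integrable M (f n)" "\<And>n. AE x in M. 0 \<le> f n x" "AE x in M. (\<lambda>n. f n x) \<longlonglongrightarrow> g x"
    and [measurable]: "g \<in> borel_measurable M" and K: "\<And>n. (\<integral>x. f n x \<partial>M) \<le> K"
  shows "integrable M g" "(\<integral>x. g x \<partial>M) \<le> K"
proof -
  have [measurable]: "f n \<in> borel_measurable M" for n using f(1) by simp
  have g0: "AE x in M. 0 \<le> g x"
  proof -
    have "AE x in M. \<forall>n. 0 \<le> f n x" using f(2) by (simp add: AE_all_countable)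
    with f(3) show ?thesis
      by eventually_elim (rule LIMSEQ_le_const, auto)
  qed
  have K0: "0 \<le> K"
    using integral_nonneg_AE[OF f(2)[of 0]] K[of 0] by linarith
  have "(\<integral>\<^sup>+x. ennreal (g x) \<partial>M) = (\<integral>\<^sup>+x. liminf (\<lambda>n. ennreal (f n x)) \<partial>M)"
    using f(3) by (intro nn_integral_cong_AE, eventually_elim)
      (rule lim_imp_Liminf[symmetric], auto intro!: tendsto_ennrealI)
  also have "\<dots> \<le> liminf (\<lambda>n. \<integral>\<^sup>+x. ennreal (f n x) \<partial>M)"
    by (rule nn_integral_liminf) simp
  also have "\<dots> \<le> ennreal K"
  proof (rule order_trans[OF Liminf_le_Limsup Limsup_bounded], simp, rule always_eventually, rule allI)
    show "(\<integral>\<^sup>+x. ennreal (f n x) \<partial>M) \<le> ennreal K" for n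
      using nn_integral_eq_integral[OF f(1) f(2)] K by (simp add: ennreal_leI)
  qed
  finally have le: "(\<integral>\<^sup>+x. ennreal (g x) \<partial>M) \<le> ennreal K" .
  have "(\<integral>\<^sup>+x. ennreal (norm (g x)) \<partial>M) = (\<integral>\<^sup>+x. ennreal (g x) \<partial>M)"
    using g0 by (intro nn_integral_cong_AE, eventually_elim) auto
  also have "\<dots> < \<infinity>" using le by (simp add: le_less_trans)
  finally show int: "integrable M g"
    by (intro integrableI_bounded) auto
  then show "(\<integral>x. g x \<partial>M) \<le> K"
    using le nn_integral_eq_integral[OF int g0] K0 by simp
qed

lemma exp_diff_le:
  fixes a b r :: real
  assumes "a \<le> r" "b \<le> r"
  shows "\<bar>exp a - exp b\<bar> \<le> exp r * \<bar>a - b\<bar>"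
proof -
  have "exp a - exp b = exp r * (exp (- (r - a)) - exp (- (r - b)))"
    by (simp add: right_diff_distrib flip: exp_add)
  then show ?thesis
    using exp_diff_bound[of "r - a" "r - b"] assms by (simp add: abs_mult abs_minus_commute)
qed

lemma exp_right_quotient:
  fixes a :: "real \<Rightarrow> real"
  assumes "((\<lambda>h. (a h - a0) / h) \<longlongrightarrow> A) (at_right 0)"
  shows "((\<lambda>h. (exp (a h) - exp a0) / h) \<longlongrightarrow> A * exp a0) (at_right 0)"
proof -
  \<comment> \<open>\<open>a\<close> need not take the value \<open>a0\<close> at \<open>0\<close>.
    Overwriting it there makes the expression a genuine difference quotient, to which the chain rule
    applies.\<close>
  define b where "b h = (if h = 0 then a0 else a h)" for h
  have "((\<lambda>h. (b h - b 0) / (h - 0)) \<longlongrightarrow> A) (at 0 within {0<..})"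
    by (rule Lim_transform_eventually[OF assms]) (auto simp: b_def eventually_at_filter)
  then have "(b has_field_derivative A) (at 0 within {0<..})"
    by (simp add: has_field_derivative_iff)
  then have "((\<lambda>h. exp (b h)) has_field_derivative exp (b 0) * A) (at 0 within {0<..})"
    by (rule DERIV_chain2[OF DERIV_exp])
  then have "((\<lambda>h. (exp (b h) - exp (b 0)) / (h - 0)) \<longlongrightarrow> exp (b 0) * A) (at 0 within {0<..})"
    by (simp add: has_field_derivative_iff)
  then have "((\<lambda>h. (exp (b h) - exp (b 0)) / (h - 0)) \<longlongrightarrow> A * exp a0) (at_right 0)"
    by (simp add: b_def mult.commute)
  then show ?thesis
    by (rule Lim_transform_eventually) (auto simp: b_def eventually_at_filter)
qed

lemma tendsto_one_minus_exp: "(\<lambda>n. real (Suc n) * (1 - exp (- (u / real (Suc n))))) \<longlonglongrightarrow> u"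
proof -
  have D: "((\<lambda>h. (exp (- (u * h)) - 1) / h) \<longlongrightarrow> - u) (at 0)"
  proof -
    have "((\<lambda>h. exp (- (u * h))) has_real_derivative - u) (at 0)"
      by (auto intro!: derivative_eq_intros)
    then show ?thesis by (simp add: DERIV_def)
  qed
  have "filterlim (\<lambda>n. 1 / real (Suc n)) (at 0) sequentially"
    unfolding filterlim_at using LIMSEQ_inverse_real_of_nat[unfolded inverse_eq_divide]
    by (auto simp del: of_nat_Suc intro!: always_eventually)
  from filterlim_compose[OF D this]
  have "(\<lambda>n. - ((exp (- (u * (1 / real (Suc n)))) - 1) / (1 / real (Suc n)))) \<longlonglongrightarrow> - (- u)"
    by (rule tendsto_minus)
  then show ?thesis by (simp add: algebra_simps del: of_nat_Suc)
qed

lemma orthant_borel [measurable]: "(orthant :: (real ^ 'd) set) \<in> sets borel"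
proof -
  have "closed (orthant :: (real ^ 'd) set)"
    unfolding orthant_def by (intro closed_Collect_all closed_Collect_le continuous_intros)
  then show ?thesis by simp
qed

text \<open>Only the marginal laws and the Laplace identity between any two of them are recorded.
  Both the marginals of a process and the kernels started at a fixed point form such a family. The
  laws live on the whole space and are carried by the orthant, which spares restricted
  sigma-algebras.\<close>

locale cbi_laws = cbi_flow_param c \<beta> B \<nu> \<mu> q v
  for c \<beta> :: "real ^ 'd" and B :: "real ^ 'd ^ 'd"
    and \<nu> :: "(real ^ 'd) measure" and \<mu> :: "'d \<Rightarrow> (real ^ 'd) measure" and q :: nat and v +
  fixes N :: "real \<Rightarrow> (real ^ 'd) measure"
  assumes prob_N: "\<And>s. 0 \<le> s \<Longrightarrow> prob_space (N s)"
    and sets_N [measurable_cong, simp]: "\<And>s. sets (N s) = sets borel"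
    and N_orthant: "\<And>s. 0 \<le> s \<Longrightarrow> AE x in N s. x \<in> orthant"
    and laplace: "\<And>s h \<theta>. 0 \<le> s \<Longrightarrow> 0 \<le> h \<Longrightarrow> \<theta> \<in> orthant \<Longrightarrow>
      (\<integral>x. exp (- (\<theta> \<bullet> x)) \<partial>N (s + h)) = (\<integral>x. exp (- (x \<bullet> v h \<theta>) - Psi_int h \<theta>) \<partial>N s)"
    and N0: "integrable (N 0) (\<lambda>x. norm x ^ q)"
begin

lemma integrable_exp:
  assumes "0 \<le> s" "\<theta> \<in> orthant"
  shows "integrable (N s) (\<lambda>x. exp (- (\<theta> \<bullet> x) + k))"
proof -
  interpret prob_space "N s" using prob_N assms by simp
  show ?thesis
  proof (rule integrable_const_bound[where B = "exp k"])
    show "AE x in N s. norm (exp (- (\<theta> \<bullet> x) + k)) \<le> exp k"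
      using N_orthant[OF assms(1)] by eventually_elim (simp add: orthant_inner_nonneg assms)
  qed measurable
qed

lemma integrable_power_le:
  assumes "0 \<le> s" "integrable (N s) (\<lambda>x. norm x ^ k)" "m \<le> k"
  shows "integrable (N s) (\<lambda>x. norm x ^ m)"
proof -
  interpret prob_space "N s" using prob_N assms by simp
  show ?thesis
  proof (rule Bochner_Integration.integrable_bound[OF Bochner_Integration.integrable_add[OF integrable_const[of 1] assms(2)]])
    show "AE x in N s. norm (norm x ^ m) \<le> norm (1 + norm x ^ k)"
    proof (rule AE_I2)
      fix x :: "real ^ 'd"
      show "norm (norm x ^ m) \<le> norm (1 + norm x ^ k)"
      proof (cases "1 \<le> norm x")
        case True
        then have "norm x ^ m \<le> norm x ^ k" using assms by (intro power_increasing) auto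
        then show ?thesis by simp
      next
        case False
        then have "norm x ^ m \<le> 1" by (intro power_le_one) auto
        then show ?thesis by (simp add: add_increasing2)
      qed
    qed
  qed measurable
qed

text \<open>For \<open>\<theta> = (1,...,1) / (n + 1)\<close> the functions
  \<open>(n + 1) * (1 - exp (- (\<theta> \<bullet> x)))\<close> tend to the coordinate sum. Their
  integrals are bounded uniformly in \<open>n\<close> by the Laplace identity, the inequality
  \<open>1 - exp (- u) \<le> u\<close> and the linear bounds on the flow and on
  \<open>Psi_int\<close>; Fatou's lemma concludes. Dynkin's formula uses this moment for
  domination.\<close>

lemma first_moment:
  assumes T: "0 \<le> T"
  shows "\<exists>M\<ge>0. \<forall>t\<in>{0..T}. integrable (N t) norm \<and> (\<integral>x. norm x \<partial>N t) \<le> M"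
proof -
  define K where "K = exp (Bt_l1 * T) * real CARD('d) * ((\<integral>x. norm x \<partial>N 0) + T * Lpsi)"
  have i0: "integrable (N 0) norm"
    using integrable_power_le[OF _ N0, of 1] q by simp
  have K0: "0 \<le> K"
    unfolding K_def using T Lpsi_nonneg by (intro mult_nonneg_nonneg add_nonneg_nonneg) auto
  have "integrable (N t) norm \<and> (\<integral>x. norm x \<partial>N t) \<le> K" if t: "t \<in> {0..T}" for t
  proof -
    have t0: "0 \<le> t" using t by simp
    interpret t: prob_space "N t" using prob_N t by simp
    interpret z: prob_space "N 0" using prob_N by simp
    define S where "S x = (\<Sum>i\<in>UNIV. x $ i)" for x :: "real ^ 'd"
    have [measurable]: "S \<in> borel_measurable borel" unfolding S_def by measurable
    define th :: "nat \<Rightarrow> real ^ 'd" where "th n = (\<chi> i. 1 / real (Suc n))" for n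
    have th: "th n \<in> orthant" for n by (simp add: th_def orthant_def)
    have thS: "th n \<bullet> x = S x / real (Suc n)" for n x
      by (simp add: th_def inner_vec_def S_def sum_divide_distrib)
    have sth: "(\<Sum>i\<in>UNIV. th n $ i) = real CARD('d) / real (Suc n)" for n
      by (simp add: th_def)
    define f where "f n x = real (Suc n) * (1 - exp (- (S x / real (Suc n))))" for n x
    have fint: "integrable (N t) (f n)" for n
      unfolding f_def thS[symmetric] using integrable_exp[OF t0 th, of n 0] by auto
    have bound: "(\<integral>x. f n x \<partial>N t) \<le> K" for n
    proof -
      have "(\<integral>x. f n x \<partial>N t) = real (Suc n) * (1 - (\<integral>x. exp (- (th n \<bullet> x)) \<partial>N (0 + t)))"
        unfolding f_def thS[symmetric] using integrable_exp[OF t0 th, of n 0] t.prob_space by simp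
      also have "\<dots> = real (Suc n) * (1 - (\<integral>x. exp (- (x \<bullet> v t (th n)) - Psi_int t (th n)) \<partial>N 0))"
        by (subst laplace) (use t0 th in auto)
      also have "1 - (\<integral>x. exp (- (x \<bullet> v t (th n)) - Psi_int t (th n)) \<partial>N 0)
          = (\<integral>x. 1 - exp (- (x \<bullet> v t (th n)) - Psi_int t (th n)) \<partial>N 0)"
        using integrable_exp[OF _ v_orthant[OF th t0], of 0 n "- Psi_int t (th n)"] z.prob_space
        by (simp add: inner_commute)
      also have "\<dots> \<le> (\<integral>x. norm x * norm (v t (th n)) + Psi_int t (th n) \<partial>N 0)"
      proof (rule integral_mono_AE)
        show "AE x in N 0. 1 - exp (- (x \<bullet> v t (th n)) - Psi_int t (th n)) \<le> norm x * norm (v t (th n)) + Psi_int t (th n)"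
        proof (rule AE_I2)
          fix x
          show "1 - exp (- (x \<bullet> v t (th n)) - Psi_int t (th n)) \<le> norm x * norm (v t (th n)) + Psi_int t (th n)"
            using exp_ge_add_one_self[of "- (x \<bullet> v t (th n)) - Psi_int t (th n)"] norm_cauchy_schwarz[of x "v t (th n)"]
            by linarith
        qed
      qed (use integrable_exp[OF _ v_orthant[OF th t0], of 0 n "- Psi_int t (th n)"] i0 in \<open>simp_all add: inner_commute\<close>)
      also have "\<dots> = (\<integral>x. norm x \<partial>N 0) * norm (v t (th n)) + Psi_int t (th n)"
        using i0 z.prob_space by simp
      also have "\<dots> \<le> (\<integral>x. norm x \<partial>N 0) * (exp (Bt_l1 * T) * (real CARD('d) / real (Suc n)))
          + T * (Lpsi * (exp (Bt_l1 * T) * (real CARD('d) / real (Suc n))))"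
      proof (intro add_mono mult_left_mono)
        show "norm (v t (th n)) \<le> exp (Bt_l1 * T) * (real CARD('d) / real (Suc n))"
          using flow_norm_bound[OF th t0, of T n] t by (simp only: sth) auto
        have "Psi_int t (th n) \<le> t * (Lpsi * (exp (Bt_l1 * t) * (real CARD('d) / real (Suc n))))"
          using Psi_int_le[OF th t0, of n] by (simp only: sth)
        also have "\<dots> \<le> T * (Lpsi * (exp (Bt_l1 * T) * (real CARD('d) / real (Suc n))))"
          using t T Lpsi_nonneg Bt_l1_nonneg by (intro mult_mono) (auto intro: mult_left_mono)
        finally show "Psi_int t (th n) \<le> T * (Lpsi * (exp (Bt_l1 * T) * (real CARD('d) / real (Suc n))))" .
      qed simp
      finally have "(\<integral>x. f n x \<partial>N t) \<le> real (Suc n) * ((\<integral>x. norm x \<partial>N 0) * (exp (Bt_l1 * T) * (real CARD('d) / real (Suc n)))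
          + T * (Lpsi * (exp (Bt_l1 * T) * (real CARD('d) / real (Suc n)))))"
        by (simp add: mult_left_mono del: of_nat_Suc)
      also have "\<dots> = K"
        by (simp add: K_def field_simps del: of_nat_Suc)
      finally show ?thesis .
    qed
    have f0: "AE x in N t. 0 \<le> f n x" for n
      using N_orthant[OF t0]
      by eventually_elim (auto simp: f_def S_def orthant_def intro!: mult_nonneg_nonneg divide_nonneg_nonneg sum_nonneg)
    have lim: "AE x in N t. (\<lambda>n. f n x) \<longlonglongrightarrow> S x"
      unfolding f_def by (intro AE_I2 tendsto_one_minus_exp)
    note fat = fatou_integrable[OF fint f0 lim _ bound]
    have nS: "AE x in N t. norm x \<le> S x"
      using N_orthant[OF t0] by eventually_elim (auto simp: S_def intro: norm_le_sum_orthant)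
    have iN: "integrable (N t) norm"
      by (rule Bochner_Integration.integrable_bound[OF fat(1)]) (use nS in \<open>auto elim: eventually_mono\<close>)
    moreover have "(\<integral>x. norm x \<partial>N t) \<le> (\<integral>x. S x \<partial>N t)"
      by (rule integral_mono_AE[OF iN fat(1) nS]) simp
    ultimately show ?thesis using fat(2) by simp
  qed
  then show ?thesis using K0 by blast
qed

text \<open>The Laplace identity writes the expectation at time \<open>s + h\<close> as an integral
  against the law at time \<open>s\<close>. The difference quotient can then be taken inside one
  integral; it is dominated by a multiple of \<open>norm x + 1\<close>, and its limit is the
  integrand of \<open>D\<close>. The same domination makes \<open>G\<close> Lipschitz, so
  \<open>FTC_right_derivative\<close> applies.\<close>

lemma dynkin_exp:
  fixes lam lam' :: "real \<Rightarrow> real ^ 'd" and eta eta' :: "real \<Rightarrow> real"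
  assumes T: "0 \<le> T" and r: "0 \<le> r"
    and lo: "\<And>s. s \<in> {0..T} \<Longrightarrow> lam s \<in> orthant" "\<And>s. s \<in> {0..T} \<Longrightarrow> norm (lam s) \<le> r"
      "\<And>s. s \<in> {0..T} \<Longrightarrow> \<bar>eta s\<bar> \<le> r"
    and lip: "\<And>s u. s \<in> {0..T} \<Longrightarrow> u \<in> {0..T} \<Longrightarrow> norm (lam s - lam u) \<le> r * \<bar>s - u\<bar>"
      "\<And>s u. s \<in> {0..T} \<Longrightarrow> u \<in> {0..T} \<Longrightarrow> \<bar>eta s - eta u\<bar> \<le> r * \<bar>s - u\<bar>"
    and der: "\<And>s. 0 \<le> s \<Longrightarrow> s < T \<Longrightarrow> ((\<lambda>h. (1 / h) *\<^sub>R (lam (s + h) - lam s)) \<longlongrightarrow> lam' s) (at_right 0)"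
      "\<And>s. 0 \<le> s \<Longrightarrow> s < T \<Longrightarrow> ((\<lambda>h. (eta (s + h) - eta s) / h) \<longlongrightarrow> eta' s) (at_right 0)"
  defines "G \<equiv> \<lambda>s. \<integral>x. exp (- (lam s \<bullet> x) + eta s) \<partial>N s"
    and "D \<equiv> \<lambda>s. \<integral>x. (x \<bullet> (phi c B \<mu> (lam s) - lam' s) - psi \<beta> \<nu> (lam s) + eta' s) * exp (- (lam s \<bullet> x) + eta s) \<partial>N s"
  shows "set_integrable lborel {0..T} D" "(LINT s:{0..T}|lborel. D s) = G T - G 0" "continuous_on {0..T} G"
proof -
  obtain K where K: "0 \<le> K" and approx: "\<And>\<theta> h. \<theta> \<in> orthant \<Longrightarrow> h \<in> {0..T} \<Longrightarrow> norm \<theta> \<le> r \<Longrightarrow>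
    norm (v h \<theta> - \<theta>) \<le> K * h \<and> norm (v h \<theta> - \<theta> + h *\<^sub>R phi c B \<mu> \<theta>) \<le> K * h\<^sup>2 \<and>
    Psi_int h \<theta> \<le> K * h \<and> \<bar>Psi_int h \<theta> - h * psi \<beta> \<nu> \<theta>\<bar> \<le> K * h\<^sup>2"
    using flow_approx[OF T r] by blast
  obtain M where M: "0 \<le> M" "\<And>t. t \<in> {0..T} \<Longrightarrow> integrable (N t) norm"
    "\<And>t. t \<in> {0..T} \<Longrightarrow> (\<integral>x. norm x \<partial>N t) \<le> M"
    using first_moment[OF T] by blast
  obtain Lp where Lp: "\<And>\<theta> \<theta>'. \<theta> \<in> orthant \<Longrightarrow> \<theta>' \<in> orthant \<Longrightarrow> norm \<theta> \<le> r \<Longrightarrow> norm \<theta>' \<le> r \<Longrightarrow>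
    norm (phi c B \<mu> \<theta> - phi c B \<mu> \<theta>') \<le> Lp * norm (\<theta> - \<theta>')" and Lp0: "0 \<le> Lp"
    using phi_lipschitz[of r] by blast
  \<comment> \<open>\<open>La\<close> and \<open>Jv\<close> are the exponent and the additive
    constant at time \<open>s + h\<close>, carried back to time \<open>s\<close> by the
    flow.\<close>
  define La where "La s h = v h (lam (s + h))" for s h
  define Jv where "Jv s h = eta (s + h) - Psi_int h (lam (s + h))" for s h
  define a where "a s x h = - (x \<bullet> La s h) + Jv s h" for s x h
  define a0 where "a0 s x = - (lam s \<bullet> x) + eta s" for s x
  have Gh: "G (s + h) = (\<integral>x. exp (a s x h) \<partial>N s)" and Gint: "integrable (N s) (\<lambda>x. exp (a s x h))"
    if "0 \<le> s" "0 \<le> h" "s + h \<le> T" for s h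
  proof -
    have l: "lam (s + h) \<in> orthant" using lo(1) that by simp
    have "G (s + h) = exp (eta (s + h)) * (\<integral>x. exp (- (lam (s + h) \<bullet> x)) \<partial>N (s + h))"
      unfolding G_def exp_add by (simp add: mult.commute)
    also have "\<dots> = exp (eta (s + h)) * (\<integral>x. exp (- (x \<bullet> v h (lam (s + h))) - Psi_int h (lam (s + h))) \<partial>N s)"
      using laplace[OF that(1,2) l] by simp
    also have "\<dots> = (\<integral>x. exp (a s x h) \<partial>N s)"
    proof -
      have "exp (a s x h) = exp (eta (s + h)) * exp (- (x \<bullet> v h (lam (s + h))) - Psi_int h (lam (s + h)))" for x
        unfolding a_def La_def Jv_def exp_add[symmetric] by simp
      then show ?thesis by simp
    qed
    finally show "G (s + h) = (\<integral>x. exp (a s x h) \<partial>N s)" .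
    show "integrable (N s) (\<lambda>x. exp (a s x h))"
      unfolding a_def La_def inner_commute[of _ "v h (lam (s + h))"]
      by (intro integrable_exp v_orthant l that)
  qed
  have G0: "G s = (\<integral>x. exp (a0 s x) \<partial>N s)" for s
    by (simp add: G_def a0_def)
  have G0int: "integrable (N s) (\<lambda>x. exp (a0 s x))" if "s \<in> {0..T}" for s
    unfolding a0_def by (intro integrable_exp lo) (use that in auto)
  have diff: "\<bar>exp (a s x h) - exp (a0 s x)\<bar> \<le> exp r * (K + r) * (norm x + 1) * h"
    if s: "0 \<le> s" "0 \<le> h" "s + h \<le> T" and x: "x \<in> orthant" for s h x
  proof -
    have l: "lam (s + h) \<in> orthant" "norm (lam (s + h)) \<le> r" "h \<in> {0..T}" and sT: "s \<in> {0..T}" "s + h \<in> {0..T}"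
      using lo s by auto
    note ap = approx[OF l(1,3,2)]
    have r1: "a s x h \<le> r" "a0 s x \<le> r"
      using lo(3)[OF sT(1)] lo(3)[OF sT(2)] Psi_int_nonneg[OF l(1), of h] orthant_inner_nonneg[OF x v_orthant[OF l(1) s(2)]]
        orthant_inner_nonneg[OF lo(1)[OF sT(1)] x]
      by (auto simp: a_def a0_def La_def Jv_def)
    have "norm (La s h - lam s) \<le> norm (v h (lam (s + h)) - lam (s + h)) + norm (lam (s + h) - lam s)"
      unfolding La_def using norm_triangle_ineq[of "v h (lam (s + h)) - lam (s + h)" "lam (s + h) - lam s"] by simp
    also have "\<dots> \<le> (K + r) * h"
      using ap lip(1)[OF sT(2,1)] s by (simp add: distrib_right)
    finally have "\<bar>x \<bullet> (La s h - lam s)\<bar> \<le> norm x * ((K + r) * h)"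
      using Cauchy_Schwarz_ineq2[of x "La s h - lam s"] mult_left_mono[of _ _ "norm x"] by (meson norm_ge_zero order_trans)
    moreover have "\<bar>Jv s h - eta s\<bar> \<le> (K + r) * h"
    proof -
      have "\<bar>eta (s + h) - eta s\<bar> \<le> r * h" "Psi_int h (lam (s + h)) \<le> K * h"
        using ap lip(2)[OF sT(2,1)] s by auto
      then show ?thesis
        using Psi_int_nonneg[OF l(1), of h] unfolding Jv_def distrib_right abs_le_iff by linarith
    qed
    ultimately have "\<bar>a s x h - a0 s x\<bar> \<le> (K + r) * (norm x + 1) * h"
      by (simp add: a_def a0_def inner_diff_right inner_commute[of x] algebra_simps)
    then have "exp r * \<bar>a s x h - a0 s x\<bar> \<le> exp r * ((K + r) * (norm x + 1) * h)"
      by (intro mult_left_mono) auto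
    from order_trans[OF exp_diff_le[OF r1] this] show ?thesis by (simp only: mult_ac)
  qed
  define L where "L = exp r * (K + r) * (M + 1)"
  have step: "\<bar>G (s + h) - G s\<bar> \<le> L * h" if s: "0 \<le> s" "0 \<le> h" "s + h \<le> T" for s h
  proof -
    interpret prob_space "N s" using prob_N s by simp
    have sT: "s \<in> {0..T}" using s by simp
    have "G (s + h) - G s = (\<integral>x. exp (a s x h) - exp (a0 s x) \<partial>N s)"
      using Gh[OF s] Gint[OF s] G0 G0int[OF sT] by simp
    also have "\<bar>\<dots>\<bar> \<le> (\<integral>x. \<bar>exp (a s x h) - exp (a0 s x)\<bar> \<partial>N s)"
      by (rule integral_abs_bound)
    also have "\<dots> \<le> (\<integral>x. exp r * (K + r) * h * (norm x + 1) \<partial>N s)"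
    proof (rule integral_mono_AE)
      show "AE x in N s. \<bar>exp (a s x h) - exp (a0 s x)\<bar> \<le> exp r * (K + r) * h * (norm x + 1)"
        using N_orthant[OF s(1)] by eventually_elim (use diff[OF s] in \<open>simp add: mult_ac\<close>)
    qed (use Gint[OF s] G0int[OF sT] M(2)[OF sT] in auto)
    also have "\<dots> = exp r * (K + r) * h * ((\<integral>x. norm x \<partial>N s) + 1)"
      using M(2)[OF sT] prob_space by simp
    also have "\<dots> \<le> exp r * (K + r) * h * (M + 1)"
      using M(3)[OF sT] K r s by (intro mult_left_mono) auto
    finally show ?thesis by (simp add: L_def mult_ac)
  qed
  have L0: "0 \<le> L" using K r M by (simp add: L_def)
  have Glip: "\<bar>G x - G y\<bar> \<le> L * \<bar>x - y\<bar>" if "x \<in> {0..T}" "y \<in> {0..T}" for x y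
    using step[of x "y - x"] step[of y "x - y"] that by (cases "x \<le> y") (auto simp: abs_minus_commute)
  have "L-lipschitz_on {0..T} G"
    by (rule lipschitz_onI) (use Glip L0 in \<open>auto simp: dist_real_def\<close>)
  then show "continuous_on {0..T} G"
    by (rule lipschitz_on_continuous_on)
  have Glim: "((\<lambda>h. (G (s + h) - G s) / h) \<longlongrightarrow> D s) (at_right 0)" if s: "0 \<le> s" "s < T" for s
  proof -
    interpret prob_space "N s" using prob_N s by simp
    have sT: "s \<in> {0..T}" using s by simp
    have ev: "\<forall>\<^sub>F h in at_right 0. 0 < h \<and> s + h \<le> T"
      using s by (intro eventually_at_rightI[of 0 "T - s"]) auto
    have h0: "((\<lambda>h::real. K * h) \<longlongrightarrow> 0) (at_right 0)" "((\<lambda>h::real. r * h) \<longlongrightarrow> 0) (at_right 0)"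
      by (auto intro!: tendsto_eq_intros)
    have lim_lam: "((\<lambda>h. lam (s + h)) \<longlongrightarrow> lam s) (at_right 0)"
    proof (rule LIM_zero_cancel, rule Lim_null_comparison[OF _ h0(2)])
      show "\<forall>\<^sub>F h in at_right 0. norm (lam (s + h) - lam s) \<le> r * h"
        using ev
      proof eventually_elim
        case (elim h)
        then show ?case using lip(1)[of "s + h" s] s by simp
      qed
    qed
    have lim_phi: "((\<lambda>h. phi c B \<mu> (lam (s + h))) \<longlongrightarrow> phi c B \<mu> (lam s)) (at_right 0)"
    proof (rule LIM_zero_cancel, rule Lim_null_comparison)
      show "\<forall>\<^sub>F h in at_right 0. norm (phi c B \<mu> (lam (s + h)) - phi c B \<mu> (lam s)) \<le> Lp * norm (lam (s + h) - lam s)"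
        using ev by eventually_elim (use Lp lo sT s in auto)
      show "((\<lambda>h. Lp * norm (lam (s + h) - lam s)) \<longlongrightarrow> 0) (at_right 0)"
        using tendsto_mult_left[OF tendsto_norm_zero[OF LIM_zero[OF lim_lam]], of Lp] by simp
    qed
    have lim_psi: "((\<lambda>h. psi \<beta> \<nu> (lam (s + h))) \<longlongrightarrow> psi \<beta> \<nu> (lam s)) (at_right 0)"
    proof (rule LIM_zero_cancel, rule Lim_null_comparison)
      show "\<forall>\<^sub>F h in at_right 0. norm (psi \<beta> \<nu> (lam (s + h)) - psi \<beta> \<nu> (lam s)) \<le> Lpsi * norm (lam (s + h) - lam s)"
        using ev by eventually_elim (use psi_lipschitz lo sT s in auto)
      show "((\<lambda>h. Lpsi * norm (lam (s + h) - lam s)) \<longlongrightarrow> 0) (at_right 0)"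
        using tendsto_mult_left[OF tendsto_norm_zero[OF LIM_zero[OF lim_lam]], of Lpsi] by simp
    qed
    have rem1: "((\<lambda>h. (1 / h) *\<^sub>R (v h (lam (s + h)) - lam (s + h) + h *\<^sub>R phi c B \<mu> (lam (s + h)))) \<longlongrightarrow> 0) (at_right 0)"
    proof (rule Lim_null_comparison[OF _ h0(1)])
      show "\<forall>\<^sub>F h in at_right 0. norm ((1 / h) *\<^sub>R (v h (lam (s + h)) - lam (s + h) + h *\<^sub>R phi c B \<mu> (lam (s + h)))) \<le> K * h"
        using ev
      proof eventually_elim
        case (elim h)
        then have "norm (v h (lam (s + h)) - lam (s + h) + h *\<^sub>R phi c B \<mu> (lam (s + h))) \<le> K * h\<^sup>2"
          using approx[of "lam (s + h)" h] lo s by auto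
        then have "norm (v h (lam (s + h)) - lam (s + h) + h *\<^sub>R phi c B \<mu> (lam (s + h))) / h \<le> K * h\<^sup>2 / h"
          using elim by (intro divide_right_mono) auto
        then show ?case using elim by (simp add: power2_eq_square)
      qed
    qed
    have rem2: "((\<lambda>h. (Psi_int h (lam (s + h)) - h * psi \<beta> \<nu> (lam (s + h))) / h) \<longlongrightarrow> 0) (at_right 0)"
    proof (rule Lim_null_comparison[OF _ h0(1)])
      show "\<forall>\<^sub>F h in at_right 0. norm ((Psi_int h (lam (s + h)) - h * psi \<beta> \<nu> (lam (s + h))) / h) \<le> K * h"
        using ev
      proof eventually_elim
        case (elim h)
        then have "\<bar>Psi_int h (lam (s + h)) - h * psi \<beta> \<nu> (lam (s + h))\<bar> \<le> K * h\<^sup>2"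
          using approx[of "lam (s + h)" h] lo s by auto
        then have "\<bar>Psi_int h (lam (s + h)) - h * psi \<beta> \<nu> (lam (s + h))\<bar> / h \<le> K * h\<^sup>2 / h"
          using elim by (intro divide_right_mono) auto
        then show ?case using elim by (simp add: power2_eq_square)
      qed
    qed
    \<comment> \<open>The increment splits into the remainder of the flow expansion,
      \<open>- phi\<close> at the moving point, and the increment of \<open>lam\<close>
      itself.\<close>
    have La: "((\<lambda>h. (1 / h) *\<^sub>R (La s h - lam s)) \<longlongrightarrow> 0 - phi c B \<mu> (lam s) + lam' s) (at_right 0)"
    proof (rule Lim_transform_eventually[OF tendsto_add[OF tendsto_diff[OF rem1 lim_phi] der(1)[OF s]]])
      show "\<forall>\<^sub>F h in at_right 0. (1 / h) *\<^sub>R (v h (lam (s + h)) - lam (s + h) + h *\<^sub>R phi c B \<mu> (lam (s + h)))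
          - phi c B \<mu> (lam (s + h)) + (1 / h) *\<^sub>R (lam (s + h) - lam s) = (1 / h) *\<^sub>R (La s h - lam s)"
        using ev by eventually_elim (simp add: La_def scaleR_diff_right scaleR_add_right)
    qed
    have Jv: "((\<lambda>h. (Jv s h - eta s) / h) \<longlongrightarrow> eta' s - (0 + psi \<beta> \<nu> (lam s))) (at_right 0)"
    proof (rule Lim_transform_eventually[OF tendsto_diff[OF der(2)[OF s] tendsto_add[OF rem2 lim_psi]]])
      show "\<forall>\<^sub>F h in at_right 0. (eta (s + h) - eta s) / h - ((Psi_int h (lam (s + h)) - h * psi \<beta> \<nu> (lam (s + h))) / h
          + psi \<beta> \<nu> (lam (s + h))) = (Jv s h - eta s) / h"
        using ev by eventually_elim (simp add: Jv_def diff_divide_distrib)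
    qed
    have alim: "((\<lambda>h. (a s x h - a0 s x) / h) \<longlongrightarrow> x \<bullet> (phi c B \<mu> (lam s) - lam' s) - psi \<beta> \<nu> (lam s) + eta' s) (at_right 0)" for x
    proof -
      have "((\<lambda>h. - (x \<bullet> ((1 / h) *\<^sub>R (La s h - lam s))) + (Jv s h - eta s) / h)
          \<longlongrightarrow> - (x \<bullet> (0 - phi c B \<mu> (lam s) + lam' s)) + (eta' s - (0 + psi \<beta> \<nu> (lam s)))) (at_right 0)"
        by (intro tendsto_intros La Jv)
      moreover have "- (x \<bullet> ((1 / h) *\<^sub>R (La s h - lam s))) + (Jv s h - eta s) / h = (a s x h - a0 s x) / h" for h
        by (simp add: a_def a0_def inner_diff_right inner_commute[of x] diff_divide_distrib add_divide_distrib)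
      ultimately show ?thesis by (simp add: inner_diff_right inner_add_right algebra_simps)
    qed
    define Q where "Q h x = (exp (a s x h) - exp (a0 s x)) / h" for h x
    have Qlim: "((\<lambda>h. Q h x) \<longlongrightarrow> (x \<bullet> (phi c B \<mu> (lam s) - lam' s) - psi \<beta> \<nu> (lam s) + eta' s) * exp (a0 s x)) (at_right 0)" for x
      unfolding Q_def by (rule exp_right_quotient[OF alim])
    have [measurable]: "Q h \<in> borel_measurable borel" for h
      unfolding Q_def a_def a0_def by measurable
    \<comment> \<open>Dominated convergence is applied along \<open>t = 1 / h\<close> tending to
      infinity, in place of \<open>h\<close> tending to \<open>0\<close> from the right.\<close>
    have "((\<lambda>t. \<integral>x. Q (inverse t) x \<partial>N s) \<longlongrightarrow> (\<integral>x. (x \<bullet> (phi c B \<mu> (lam s) - lam' s) - psi \<beta> \<nu> (lam s) + eta' s) * exp (a0 s x) \<partial>N s)) at_top"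
    proof (rule integral_dominated_convergence_at_top)
      show "integrable (N s) (\<lambda>x. exp r * (K + r) * (norm x + 1))"
        using M(2)[OF sT] by simp
      show "AE x in N s. ((\<lambda>t. Q (inverse t) x) \<longlongrightarrow> (x \<bullet> (phi c B \<mu> (lam s) - lam' s) - psi \<beta> \<nu> (lam s) + eta' s) * exp (a0 s x)) at_top"
        using Qlim by (intro AE_I2) (simp add: filterlim_at_right_to_top)
      show "\<forall>\<^sub>F t in at_top. AE x in N s. norm (Q (inverse t) x) \<le> exp r * (K + r) * (norm x + 1)"
        using ev unfolding eventually_at_right_to_top
      proof eventually_elim
        case (elim t)
        show ?case
          using N_orthant[OF s(1)]
        proof eventually_elim
          fix x :: "real ^ 'd" assume "x \<in> orthant"
          from diff[OF s(1) _ _ this, of "inverse t"] elim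
          show "norm (Q (inverse t) x) \<le> exp r * (K + r) * (norm x + 1)"
            by (simp add: Q_def divide_le_eq)
        qed
      qed
    qed (simp_all add: a0_def)
    then have "((\<lambda>h. \<integral>x. Q h x \<partial>N s) \<longlongrightarrow> D s) (at_right 0)"
      by (simp add: filterlim_at_right_to_top D_def a0_def)
    then show ?thesis
    proof (rule Lim_transform_eventually)
      show "\<forall>\<^sub>F h in at_right 0. (\<integral>x. Q h x \<partial>N s) = (G (s + h) - G s) / h"
        using ev
      proof eventually_elim
        case (elim h)
        have "(\<integral>x. Q h x \<partial>N s) = (\<integral>x. exp (a s x h) - exp (a0 s x) \<partial>N s) / h"
          unfolding Q_def by simp
        also have "\<dots> = (G (s + h) - G s) / h"
          using Gh[of s h] Gint[of s h] G0 G0int[OF sT] elim s by simp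
        finally show ?case .
      qed
    qed
  qed
  show "set_integrable lborel {0..T} D" "(LINT s:{0..T}|lborel. D s) = G T - G 0"
    by (rule FTC_right_derivative[OF T Glip Glim]; assumption)+
qed

end


section \<open>Functions of polynomial growth\<close>

text \<open>\<open>f1\<close> and \<open>f2\<close> are the first two derivatives, each losing one
  power of growth; truncated subtraction asks for a bounded \<open>f2\<close> when
  \<open>k = 1\<close>. The bounds concern a half-line only, since
  \<open>exp (- (u / (n + 1)))\<close> is not controlled as \<open>u\<close> tends to minus
  infinity.\<close>

definition power_growth :: "real \<Rightarrow> real \<Rightarrow> nat \<Rightarrow> (real \<Rightarrow> real) \<Rightarrow> (real \<Rightarrow> real) \<Rightarrow> (real \<Rightarrow> real) \<Rightarrow> bool" where
  "power_growth K A k f f1 f2 \<longleftrightarrow>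
     (\<forall>u. (f has_real_derivative f1 u) (at u)) \<and> (\<forall>u. (f1 has_real_derivative f2 u) (at u)) \<and>
     f2 \<in> borel_measurable borel \<and>
     (\<forall>u\<ge>-A. \<bar>f u\<bar> \<le> K * (1 + \<bar>u\<bar>) ^ k \<and> \<bar>f1 u\<bar> \<le> K * (1 + \<bar>u\<bar>) ^ (k - 1) \<and>
        \<bar>f2 u\<bar> \<le> K * (1 + \<bar>u\<bar>) ^ (k - 2))"

lemma power_growth_measurable:
  assumes "power_growth K A k f f1 f2"
  shows "f \<in> borel_measurable borel" "f1 \<in> borel_measurable borel" "f2 \<in> borel_measurable borel"
proof -
  have "continuous_on UNIV f" "continuous_on UNIV f1"
    using assms unfolding power_growth_def by (auto intro!: continuous_at_imp_continuous_on intro: DERIV_isCont)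
  then show "f \<in> borel_measurable borel" "f1 \<in> borel_measurable borel" "f2 \<in> borel_measurable borel"
    using assms by (auto simp: power_growth_def intro: borel_measurable_continuous_onI)
qed

lemma power_growth_increment:
  assumes n: "power_growth K A k f f1 f2" and K: "0 \<le> K" and u: "- A \<le> u" and y: "0 \<le> y"
  shows "\<bar>f (u + y) - f u\<bar> \<le> y * (K * (1 + \<bar>u\<bar> + y) ^ (k - 1))"
    "\<bar>f1 (u + y) - f1 u\<bar> \<le> y * (K * (1 + \<bar>u\<bar> + y) ^ (k - 2))"
    "\<bar>f (u + y) - f u - y * f1 u\<bar> \<le> y * (y * (K * (1 + \<bar>u\<bar> + y) ^ (k - 2)))"
proof -
  have mono: "K * (1 + \<bar>x\<bar>) ^ m \<le> K * (1 + \<bar>u\<bar> + y) ^ m" if "x \<in> {u..u+y}" for x m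
    using that K by (intro mult_left_mono power_mono) auto
  have D: "(f has_field_derivative f1 x) (at x within S)" "(f1 has_field_derivative f2 x) (at x within S)" for x S
    using n by (auto simp: power_growth_def intro: has_field_derivative_at_within)
  have bd: "norm (f1 x) \<le> K * (1 + \<bar>u\<bar> + y) ^ (k - 1)" "norm (f2 x) \<le> K * (1 + \<bar>u\<bar> + y) ^ (k - 2)"
    if "x \<in> {u..u+y}" for x
  proof -
    have "- A \<le> x" using that u by simp
    then have "\<bar>f1 x\<bar> \<le> K * (1 + \<bar>x\<bar>) ^ (k - 1)" "\<bar>f2 x\<bar> \<le> K * (1 + \<bar>x\<bar>) ^ (k - 2)"
      using n by (auto simp: power_growth_def)
    then show "norm (f1 x) \<le> K * (1 + \<bar>u\<bar> + y) ^ (k - 1)" "norm (f2 x) \<le> K * (1 + \<bar>u\<bar> + y) ^ (k - 2)"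
      using mono[OF that] by (auto intro: order_trans)
  qed
  have "norm (f (u + y) - f u) \<le> (K * (1 + \<bar>u\<bar> + y) ^ (k - 1)) * norm (u + y - u)"
    by (rule field_differentiable_bound[of "{u..u+y}" f f1, OF _ D(1) bd(1)]) (use y in auto)
  then show "\<bar>f (u + y) - f u\<bar> \<le> y * (K * (1 + \<bar>u\<bar> + y) ^ (k - 1))"
    using y by (simp add: mult.commute)
  have f1: "norm (f1 x - f1 u) \<le> (K * (1 + \<bar>u\<bar> + y) ^ (k - 2)) * norm (x - u)" if "x \<in> {u..u+y}" for x
    by (rule field_differentiable_bound[of "{u..u+y}" f1 f2, OF _ D(2) bd(2)]) (use y that in auto)
  from f1[of "u + y"] show "\<bar>f1 (u + y) - f1 u\<bar> \<le> y * (K * (1 + \<bar>u\<bar> + y) ^ (k - 2))"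
    using y by (simp add: mult.commute)
  have "norm (f (u + y) - f u - (u + y - u) *\<^sub>R f1 u) \<le> norm (u + y - u) * (y * (K * (1 + \<bar>u\<bar> + y) ^ (k - 2)))"
  proof (rule vector_differentiable_bound_linearization[where S = "{u..u+y}" and f' = f1 and ?x0.0 = u])
    show "(f has_vector_derivative f1 x) (at x within {u..u+y})" if "x \<in> {u..u+y}" for x
      using D(1) by (simp add: has_real_derivative_iff_has_vector_derivative)
    show "norm (f1 x - f1 u) \<le> y * (K * (1 + \<bar>u\<bar> + y) ^ (k - 2))" if "x \<in> {u..u+y}" for x
    proof -
      have "norm (f1 x - f1 u) \<le> (K * (1 + \<bar>u\<bar> + y) ^ (k - 2)) * norm (x - u)"
        by (rule f1[OF that])
      also have "\<dots> \<le> (K * (1 + \<bar>u\<bar> + y) ^ (k - 2)) * y"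
        using that K y by (intro mult_left_mono) auto
      finally show ?thesis by (simp add: mult.commute)
    qed
  qed (use y in \<open>auto simp: closed_segment_eq_real_ivl\<close>)
  then show "\<bar>f (u + y) - f u - y * f1 u\<bar> \<le> y * (y * (K * (1 + \<bar>u\<bar> + y) ^ (k - 2)))"
    using y by simp
qed

text \<open>The factor \<open>1 + \<bar>u\<bar> + y\<close> is at most
  \<open>(1 + \<bar>u\<bar>) * (1 + y)\<close>, which separates the state from the jump. What
  remains of the jump is integrable against \<open>\<nu>\<close> or, after compensation, against
  \<open>\<mu> i\<close>.\<close>

lemma power_growth_jump_bound:
  assumes n: "power_growth K A k f f1 f2" and K: "0 \<le> K" and u: "- A \<le> u" and y: "0 \<le> y" and k: "1 \<le> k"
  shows "\<bar>f (u + y) - f u\<bar> \<le> K * (1 + \<bar>u\<bar>) ^ (k - 1) * (y * (1 + y) ^ (k - 1))"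
    "\<bar>f (u + y) - f u - y * f1 u\<bar> \<le> 2 ^ k * K * (1 + \<bar>u\<bar>) ^ (k - 2) * jump_weight k y"
proof -
  have prod: "(1 + \<bar>u\<bar> + y) ^ m \<le> (1 + \<bar>u\<bar>) ^ m * (1 + y) ^ m" for m
    using y by (simp add: algebra_simps power_mono flip: power_mult_distrib)
  have "y * (K * (1 + \<bar>u\<bar> + y) ^ (k - 1)) \<le> y * (K * ((1 + \<bar>u\<bar>) ^ (k - 1) * (1 + y) ^ (k - 1)))"
    using y K prod by (intro mult_left_mono) auto
  with power_growth_increment(1)[OF n K u y]
  show "\<bar>f (u + y) - f u\<bar> \<le> K * (1 + \<bar>u\<bar>) ^ (k - 1) * (y * (1 + y) ^ (k - 1))"
    by (simp add: mult_ac)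
  show "\<bar>f (u + y) - f u - y * f1 u\<bar> \<le> 2 ^ k * K * (1 + \<bar>u\<bar>) ^ (k - 2) * jump_weight k y"
  proof (cases "y \<le> 1 \<or> 2 \<le> k")
    case True
    have "y * (y * (1 + y) ^ (k - 2)) \<le> 2 ^ k * jump_weight k y"
    proof (cases "y \<le> 1")
      case y1: True
      have "(1 + y) ^ (k - 2) \<le> 2 ^ (k - 2)" using y y1 by (intro power_mono) auto
      also have "\<dots> \<le> (2 :: real) ^ k" by (intro power_increasing) auto
      finally have "(y * y) * (1 + y) ^ (k - 2) \<le> (y * y) * 2 ^ k" by (intro mult_left_mono) auto
      then show ?thesis using y1 by (simp add: jump_weight_def power2_eq_square mult_ac)
    next
      case False
      have k2: "2 \<le> k" using True False by simp
      have "(1 + y) ^ (k - 2) \<le> (2 * y) ^ (k - 2)" using y False by (intro power_mono) auto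
      also have "\<dots> \<le> 2 ^ k * y ^ (k - 2)"
        unfolding power_mult_distrib using y by (intro mult_right_mono power_increasing) auto
      finally have "(y * y) * (1 + y) ^ (k - 2) \<le> (y * y) * (2 ^ k * y ^ (k - 2))" by (intro mult_left_mono) auto
      also have "\<dots> = 2 ^ k * y ^ (2 + (k - 2))"
        unfolding power_add by (simp add: power2_eq_square)
      also have "2 + (k - 2) = k" using k2 by simp
      finally show ?thesis using False by (simp only: jump_weight_def if_False mult.assoc)
    qed
    then have "K * (1 + \<bar>u\<bar>) ^ (k - 2) * (y * (y * (1 + y) ^ (k - 2))) \<le> K * (1 + \<bar>u\<bar>) ^ (k - 2) * (2 ^ k * jump_weight k y)"
      using K by (intro mult_left_mono) auto
    moreover have "y * (y * (K * (1 + \<bar>u\<bar> + y) ^ (k - 2))) \<le> y * (y * (K * ((1 + \<bar>u\<bar>) ^ (k - 2) * (1 + y) ^ (k - 2))))"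
      using y K prod by (intro mult_left_mono) auto
    ultimately show ?thesis
      using power_growth_increment(3)[OF n K u y] by (simp add: mult_ac)
  next
    case False
    \<comment> \<open>For a large jump and \<open>k = 1\<close> the second-order estimate is
      quadratic in \<open>y\<close>, too much for \<open>jump_weight 1\<close>. Increment and
      compensator are bounded separately, each by \<open>y * K\<close>.\<close>
    then have k1: "k = 1" and y1: "1 < y" using k by auto
    have "\<bar>f (u + y) - f u\<bar> \<le> y * K" "\<bar>f1 u\<bar> \<le> K"
      using power_growth_increment(1)[OF n K u y] n u k1 by (auto simp: power_growth_def)
    moreover from this(2) have "\<bar>y * f1 u\<bar> \<le> y * K"
      using y by (simp add: abs_mult mult_left_mono)
    ultimately have "\<bar>f (u + y) - f u - y * f1 u\<bar> \<le> y * K + y * K"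
      by linarith
    then show ?thesis using k1 y1 by (simp add: jump_weight_def mult_ac)
  qed
qed

text \<open>\<open>pow_approx0\<close> approximates the \<open>k\<close>-th power by finite linear combinations of exponentials, the
  functions whose expectations are known; \<open>pow_approx1\<close> and \<open>pow_approx2\<close> are its derivatives.\<close>

definition exp_chord :: "nat \<Rightarrow> real \<Rightarrow> real" where
  "exp_chord n u = real (Suc n) * (1 - exp (- (u / real (Suc n))))"

definition pow_approx0 :: "nat \<Rightarrow> nat \<Rightarrow> real \<Rightarrow> real" where "pow_approx0 k n u = exp_chord n u ^ k"

definition pow_approx1 :: "nat \<Rightarrow> nat \<Rightarrow> real \<Rightarrow> real" where
  "pow_approx1 k n u = real k * exp_chord n u ^ (k - 1) * exp (- (u / real (Suc n)))"

definition pow_approx2 :: "nat \<Rightarrow> nat \<Rightarrow> real \<Rightarrow> real" where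
  "pow_approx2 k n u = real k * (real (k - 1) * exp_chord n u ^ (k - 2) * exp (- (u / real (Suc n)))) * exp (- (u / real (Suc n)))
     - real k * exp_chord n u ^ (k - 1) * (1 / real (Suc n)) * exp (- (u / real (Suc n)))"

lemma pow_approx_derivs:
  "(exp_chord n has_real_derivative exp (- (u / real (Suc n)))) (at u)"
  "(pow_approx0 k n has_real_derivative pow_approx1 k n u) (at u)" "(pow_approx1 k n has_real_derivative pow_approx2 k n u) (at u)"
proof -
  show g: "(exp_chord n has_real_derivative exp (- (u / real (Suc n)))) (at u)" for u
    unfolding exp_chord_def[abs_def] by (auto intro!: derivative_eq_intros simp del: of_nat_Suc)
  show "(pow_approx0 k n has_real_derivative pow_approx1 k n u) (at u)"
    unfolding pow_approx0_def[abs_def] pow_approx1_def by (auto intro!: derivative_eq_intros g simp del: of_nat_Suc)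
  have p: "((\<lambda>u. exp_chord n u ^ (k - 1)) has_real_derivative real (k - 1) * exp_chord n u ^ (k - 2) * exp (- (u / real (Suc n)))) (at u)"
    by (auto intro!: derivative_eq_intros g simp del: of_nat_Suc simp: numeral_2_eq_2)
  have e: "((\<lambda>u. exp (- (u / real (Suc n)))) has_real_derivative - (1 / real (Suc n)) * exp (- (u / real (Suc n)))) (at u)"
    by (auto intro!: derivative_eq_intros simp del: of_nat_Suc)
  show "(pow_approx1 k n has_real_derivative pow_approx2 k n u) (at u)"
    unfolding pow_approx1_def[abs_def]
    by (rule DERIV_cong[OF DERIV_mult[OF DERIV_cmult[OF p] e]]) (simp add: pow_approx2_def algebra_simps del: of_nat_Suc)
qed

lemma pow_approx_tendsto:
  "(\<lambda>n. pow_approx0 k n u) \<longlonglongrightarrow> u ^ k" "(\<lambda>n. pow_approx1 k n u) \<longlonglongrightarrow> real k * u ^ (k - 1)"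
  "(\<lambda>n. pow_approx2 k n u) \<longlonglongrightarrow> real k * (real (k - 1) * u ^ (k - 2))"
proof -
  have g: "(\<lambda>n. exp_chord n u) \<longlonglongrightarrow> u"
    unfolding exp_chord_def by (rule tendsto_one_minus_exp)
  have i: "(\<lambda>n. 1 / real (Suc n)) \<longlonglongrightarrow> 0"
    using LIMSEQ_inverse_real_of_nat by (simp add: inverse_eq_divide)
  have "(\<lambda>n. exp (- (u * (1 / real (Suc n))))) \<longlonglongrightarrow> exp (- (u * 0))"
    by (intro tendsto_intros i)
  then have e: "(\<lambda>n. exp (- (u / real (Suc n)))) \<longlonglongrightarrow> 1" by simp
  show "(\<lambda>n. pow_approx0 k n u) \<longlonglongrightarrow> u ^ k"
    unfolding pow_approx0_def by (intro tendsto_intros g)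
  have "(\<lambda>n. pow_approx1 k n u) \<longlonglongrightarrow> real k * u ^ (k - 1) * 1"
    unfolding pow_approx1_def by (intro tendsto_intros g e)
  then show "(\<lambda>n. pow_approx1 k n u) \<longlonglongrightarrow> real k * u ^ (k - 1)" by simp
  have "(\<lambda>n. pow_approx2 k n u) \<longlonglongrightarrow> real k * (real (k - 1) * u ^ (k - 2) * 1) * 1 - real k * u ^ (k - 1) * 0 * 1"
    unfolding pow_approx2_def by (intro tendsto_intros g e i)
  then show "(\<lambda>n. pow_approx2 k n u) \<longlonglongrightarrow> real k * (real (k - 1) * u ^ (k - 2))" by simp
qed

text \<open>\<open>1 + exp A\<close> bounds the exponential factors and the growth rate of
  \<open>exp_chord\<close> on \<open>[-A, \<infinity>)\<close> uniformly in \<open>n\<close>; the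
  square of \<open>k\<close> comes from differentiating twice.\<close>

definition pow_approx_bound :: "real \<Rightarrow> nat \<Rightarrow> real" where "pow_approx_bound A k = (real k)\<^sup>2 * (1 + exp A) ^ (k + 1)"

lemma pow_approx_bound_ge:
  assumes "1 \<le> k"
  shows "(1 + exp A) ^ (k + 1) \<le> pow_approx_bound A k" "1 \<le> pow_approx_bound A k" "real k * (1 + exp A) ^ k \<le> pow_approx_bound A k"
    "real k * real k * (1 + exp A) ^ k \<le> pow_approx_bound A k"
proof -
  have k: "1 \<le> real k" using assms by simp
  then have k2: "1 \<le> real k * real k" "real k \<le> real k * real k"
    using mult_mono[of 1 "real k" 1 "real k"] mult_mono[of 1 "real k" "real k" "real k"] by auto
  have e: "1 \<le> (1 + exp A) ^ (k + 1)" "(1 + exp A) ^ k \<le> (1 + exp A) ^ (k + 1)"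
    by (auto intro!: one_le_power power_increasing simp del: power_Suc)
  show 1: "(1 + exp A) ^ (k + 1) \<le> pow_approx_bound A k"
    unfolding pow_approx_bound_def power2_eq_square using k2 e by (simp add: mult_le_cancel_right1)
  show "1 \<le> pow_approx_bound A k" using 1 e by linarith
  show "real k * (1 + exp A) ^ k \<le> pow_approx_bound A k" "real k * real k * (1 + exp A) ^ k \<le> pow_approx_bound A k"
    unfolding pow_approx_bound_def power2_eq_square using k2 e by (auto intro!: mult_mono)
qed

text \<open>For \<open>u \<ge> - A\<close> the factor \<open>exp (- (u / (n + 1)))\<close> stays
  below \<open>exp A\<close> for every \<open>n\<close>, so \<open>exp_chord\<close> grows at most
  linearly. The second derivative contains a term with one power of \<open>exp_chord\<close> too
  many. Its prefactor \<open>1 / (n + 1)\<close> pays for this, because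
  \<open>exp_chord n u / (n + 1) = 1 - exp (- (u / (n + 1)))\<close> is bounded.\<close>

lemma power_growth_pow_approx:
  assumes A: "0 \<le> A" and k: "1 \<le> k"
  shows "power_growth (pow_approx_bound A k) A k (pow_approx0 k n) (pow_approx1 k n) (pow_approx2 k n)"
  unfolding power_growth_def
proof (intro conjI allI impI pow_approx_derivs)
  show "pow_approx2 k n \<in> borel_measurable borel"
    unfolding pow_approx2_def[abs_def] exp_chord_def by measurable
  fix u assume u: "- A \<le> u"
  let ?C = "exp A" and ?e = "exp (- (u / real (Suc n)))" and ?U = "1 + \<bar>u\<bar>"
  have "- (u / real (Suc n)) \<le> A / real (Suc n)"
    unfolding minus_divide_left using u by (intro divide_right_mono) auto
  also have "\<dots> \<le> A / 1" using A by (intro divide_left_mono) auto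
  finally have uA: "- (u / real (Suc n)) \<le> A" by simp
  have e: "\<bar>?e\<bar> \<le> 1 + ?C" "0 \<le> ?e" using uA by auto (smt (verit) exp_le_cancel_iff)
  have C: "1 \<le> 1 + ?C" by simp
  have d: "\<bar>1 - ?e\<bar> \<le> 1 + ?C" using e by (simp add: abs_le_iff) (smt (verit) exp_ge_zero)
  have "\<bar>exp 0 - ?e\<bar> \<le> ?C * \<bar>0 - - (u / real (Suc n))\<bar>"
    using uA A by (intro exp_diff_le)
  then have "real (Suc n) * \<bar>1 - ?e\<bar> \<le> real (Suc n) * (?C * \<bar>u / real (Suc n)\<bar>)"
    by (intro mult_left_mono) auto
  then have "\<bar>exp_chord n u\<bar> \<le> ?C * \<bar>u\<bar>"
    by (simp add: exp_chord_def abs_mult del: of_nat_Suc)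
  also have "\<dots> \<le> (1 + ?C) * ?U" by (intro mult_mono) auto
  finally have g: "\<bar>exp_chord n u\<bar> \<le> (1 + ?C) * ?U" .
  have gp: "\<bar>exp_chord n u\<bar> ^ m \<le> (1 + ?C) ^ m * ?U ^ m" for m
    using power_mono[OF g, of m] by (simp add: power_mult_distrib)
  note Kg = pow_approx_bound_ge[OF k, of A]
  have "\<bar>pow_approx0 k n u\<bar> \<le> (1 + ?C) ^ k * ?U ^ k"
    unfolding pow_approx0_def power_abs by (rule gp)
  also have "\<dots> \<le> pow_approx_bound A k * ?U ^ k"
    using Kg(1) C by (intro mult_right_mono order_trans[OF power_increasing Kg(1)]) auto
  finally show "\<bar>pow_approx0 k n u\<bar> \<le> pow_approx_bound A k * ?U ^ k" .
  have c1: "(1 + ?C) ^ (k - 1) * (1 + ?C) = (1 + ?C) ^ k"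
    using k by (metis Suc_diff_1 less_eq_Suc_le One_nat_def power_Suc2)
  have "\<bar>pow_approx1 k n u\<bar> = real k * \<bar>exp_chord n u\<bar> ^ (k - 1) * \<bar>?e\<bar>"
    by (simp add: pow_approx1_def abs_mult power_abs del: of_nat_Suc)
  also have "\<dots> \<le> real k * ((1 + ?C) ^ (k - 1) * ?U ^ (k - 1)) * (1 + ?C)"
    using gp e by (intro mult_mono mult_left_mono) auto
  also have "\<dots> = real k * (1 + ?C) ^ k * ?U ^ (k - 1)"
    by (simp flip: c1)
  also have "\<dots> \<le> pow_approx_bound A k * ?U ^ (k - 1)"
    using Kg(3) by (intro mult_right_mono) auto
  finally show "\<bar>pow_approx1 k n u\<bar> \<le> pow_approx_bound A k * ?U ^ (k - 1)" .
  have one: "real k * (real (k - 1) * \<bar>exp_chord n u\<bar> ^ (k - 2) * \<bar>?e\<bar>) * \<bar>?e\<bar> \<le> real k * (real (k - 1) * (1 + ?C) ^ k) * ?U ^ (k - 2)"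
  proof (cases "k = 1")
    case False
    then have k2: "(1 + ?C) ^ (k - 2) * (1 + ?C) * (1 + ?C) = (1 + ?C) ^ k"
      using k by (metis (no_types, lifting) Suc_diff_le Suc_1 One_nat_def diff_Suc_Suc le_neq_implies_less less_eq_Suc_le power_Suc2 diff_Suc_1 Suc_diff_Suc)
    have "real k * (real (k - 1) * \<bar>exp_chord n u\<bar> ^ (k - 2) * \<bar>?e\<bar>) * \<bar>?e\<bar>
        \<le> real k * (real (k - 1) * ((1 + ?C) ^ (k - 2) * ?U ^ (k - 2)) * (1 + ?C)) * (1 + ?C)"
      using gp e by (intro mult_mono mult_left_mono) auto
    also have "\<dots> = real k * (real (k - 1) * (1 + ?C) ^ k) * ?U ^ (k - 2)"
      by (simp flip: k2)
    finally show ?thesis .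
  qed simp
  have two: "real k * (\<bar>exp_chord n u\<bar> ^ (k - 1) * (1 / real (Suc n))) * \<bar>?e\<bar> \<le> real k * (1 + ?C) ^ k * ?U ^ (k - 2)"
  proof -
    have "\<bar>exp_chord n u\<bar> ^ (k - 1) * (1 / real (Suc n)) \<le> (1 + ?C) ^ (k - 1) * ?U ^ (k - 2)"
    proof (cases "k = 1")
      case True
      then show ?thesis by simp
    next
      case False
      then have k2: "k - 1 = Suc (k - 2)" using k by simp
      have "\<bar>exp_chord n u\<bar> * (1 / real (Suc n)) = \<bar>1 - ?e\<bar>"
        by (simp add: exp_chord_def abs_mult del: of_nat_Suc)
      moreover have "\<bar>exp_chord n u\<bar> ^ (k - 1) * (1 / real (Suc n)) = \<bar>exp_chord n u\<bar> ^ (k - 2) * (\<bar>exp_chord n u\<bar> * (1 / real (Suc n)))"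
        unfolding k2 power_Suc by (simp only: mult_ac)
      ultimately have "\<bar>exp_chord n u\<bar> ^ (k - 1) * (1 / real (Suc n)) = \<bar>exp_chord n u\<bar> ^ (k - 2) * \<bar>1 - ?e\<bar>"
        by simp
      also have "\<dots> \<le> ((1 + ?C) ^ (k - 2) * ?U ^ (k - 2)) * (1 + ?C)"
        using gp d by (intro mult_mono) auto
      also have "\<dots> = (1 + ?C) ^ (k - 1) * ?U ^ (k - 2)"
        unfolding k2 power_Suc by (simp only: mult_ac)
      finally show ?thesis .
    qed
    then have "real k * (\<bar>exp_chord n u\<bar> ^ (k - 1) * (1 / real (Suc n))) * \<bar>?e\<bar> \<le> real k * ((1 + ?C) ^ (k - 1) * ?U ^ (k - 2)) * (1 + ?C)"
      using e by (intro mult_mono[OF mult_left_mono]) auto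
    also have "\<dots> = real k * (1 + ?C) ^ k * ?U ^ (k - 2)"
      by (simp flip: c1)
    finally show ?thesis .
  qed
  have "\<bar>pow_approx2 k n u\<bar> \<le> real k * (real (k - 1) * \<bar>exp_chord n u\<bar> ^ (k - 2) * \<bar>?e\<bar>) * \<bar>?e\<bar>
      + real k * (\<bar>exp_chord n u\<bar> ^ (k - 1) * (1 / real (Suc n))) * \<bar>?e\<bar>"
    unfolding pow_approx2_def by (rule order_trans[OF abs_triangle_ineq4]) (simp add: abs_mult power_abs mult_ac del: of_nat_Suc)
  also have "\<dots> \<le> real k * (real (k - 1) * (1 + ?C) ^ k) * ?U ^ (k - 2) + real k * (1 + ?C) ^ k * ?U ^ (k - 2)"
    by (rule add_mono[OF one two])
  also have "\<dots> = real k * real k * (1 + ?C) ^ k * ?U ^ (k - 2)"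
    using k by (simp add: of_nat_diff algebra_simps)
  also have "\<dots> \<le> pow_approx_bound A k * ?U ^ (k - 2)"
    using Kg(4) by (intro mult_right_mono) auto
  finally show "\<bar>pow_approx2 k n u\<bar> \<le> pow_approx_bound A k * ?U ^ (k - 2)" .
qed

section \<open>The generator on functions of a linear form of the state\<close>

context cbi_param
begin

text \<open>The generator of the process plus the time derivative, applied to
  \<open>f (w s \<bullet> x - a s)\<close>, with \<open>a1\<close> standing for the derivative of
  \<open>a\<close>. Along the adjoint equation the derivative of \<open>w\<close> cancels the linear
  drift, so the jumps of \<open>\<mu> i\<close> appear compensated by the full
  \<open>w \<bullet> z\<close>.\<close>

definition generator :: "(real \<Rightarrow> real) \<Rightarrow> (real \<Rightarrow> real) \<Rightarrow> (real \<Rightarrow> real) \<Rightarrow> real ^ 'd \<Rightarrow> real \<Rightarrow> real \<Rightarrow> real ^ 'd \<Rightarrow> real"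
  where "generator f f1 f2 w a a1 x =
    (\<Sum>i\<in>UNIV. x $ i * (c $ i * (w $ i)\<^sup>2 * f2 (w \<bullet> x - a)
        + (\<integral>z. f (w \<bullet> x - a + w \<bullet> z) - f (w \<bullet> x - a) - (w \<bullet> z) * f1 (w \<bullet> x - a) \<partial>\<mu> i)))
    + (\<beta> \<bullet> w - a1) * f1 (w \<bullet> x - a) + (\<integral>z. f (w \<bullet> x - a + w \<bullet> z) - f (w \<bullet> x - a) \<partial>\<nu>)"

lemma int_nu_growth:
  assumes "1 \<le> k" "k \<le> q"
  shows "integrable \<nu> (\<lambda>z. norm z * (1 + norm z) ^ (k - 1))"
proof (rule Bochner_Integration.integrable_bound)
  show "integrable \<nu> (\<lambda>z. 2 ^ k * (norm z + norm z ^ k))"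
    using int_nu_norm int_nu_power[OF assms] by simp
  show "AE z in \<nu>. norm (norm z * (1 + norm z) ^ (k - 1)) \<le> norm (2 ^ k * (norm z + norm z ^ k))"
  proof (rule AE_I2)
    fix z :: "real ^ 'd"
    let ?n = "norm z"
    have two: "(2::real) ^ (k - 1) \<le> 2 ^ k" by (intro power_increasing) auto
    have "?n * (1 + ?n) ^ (k - 1) \<le> 2 ^ k * (?n + ?n ^ k)"
    proof (cases "?n \<le> 1")
      case True
      then have "(1 + ?n) ^ (k - 1) \<le> 2 ^ (k - 1)" by (intro power_mono) auto
      then have "?n * (1 + ?n) ^ (k - 1) \<le> ?n * 2 ^ k" using two by (intro mult_left_mono order_trans[OF _ two]) auto
      also have "\<dots> \<le> 2 ^ k * (?n + ?n ^ k)" by (simp add: algebra_simps)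
      finally show ?thesis .
    next
      case False
      then have "(1 + ?n) ^ (k - 1) \<le> (2 * ?n) ^ (k - 1)" by (intro power_mono) auto
      also have "\<dots> \<le> 2 ^ k * ?n ^ (k - 1)"
        unfolding power_mult_distrib using two by (intro mult_right_mono) auto
      finally have "?n * (1 + ?n) ^ (k - 1) \<le> ?n * (2 ^ k * ?n ^ (k - 1))" by (intro mult_left_mono) auto
      also have "\<dots> = 2 ^ k * ?n ^ Suc (k - 1)" by simp
      also have "\<dots> \<le> 2 ^ k * (?n + ?n ^ k)" using assms by simp
      finally show ?thesis .
    qed
    then show "norm (?n * (1 + ?n) ^ (k - 1)) \<le> norm (2 ^ k * (?n + ?n ^ k))" by simp
  qed
qed (auto intro!: meas_jump)

text \<open>The weight vector is absorbed into powers of \<open>W\<close>. Besides the integrals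
  themselves, the pointwise bounds are stated, since they serve as majorants when the functions vary
  with \<open>n\<close>.\<close>

lemma jump_integrals:
  assumes n: "power_growth K A k f f1 f2" and K: "0 \<le> K" and k: "1 \<le> k" "k \<le> q"
    and w: "w \<in> orthant" "norm w \<le> W" "1 \<le> W" and u: "- A \<le> u"
  shows "integrable (\<mu> i) (\<lambda>z. f (u + w \<bullet> z) - f u - (w \<bullet> z) * f1 u)"
    "\<bar>\<integral>z. f (u + w \<bullet> z) - f u - (w \<bullet> z) * f1 u \<partial>\<mu> i\<bar>
      \<le> 2 ^ k * K * (1 + \<bar>u\<bar>) ^ (k - 2) * (W ^ (k + 1) * (\<integral>z. jump_weight k (norm z) \<partial>\<mu> i))"
    "\<And>z. z \<in> orthant \<Longrightarrow> \<bar>f (u + w \<bullet> z) - f u - (w \<bullet> z) * f1 u\<bar>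
      \<le> 2 ^ k * K * (1 + \<bar>u\<bar>) ^ (k - 2) * (W ^ (k + 1) * jump_weight k (norm z))"
    "integrable \<nu> (\<lambda>z. f (u + w \<bullet> z) - f u)"
    "\<bar>\<integral>z. f (u + w \<bullet> z) - f u \<partial>\<nu>\<bar>
      \<le> K * (1 + \<bar>u\<bar>) ^ (k - 1) * (W ^ k * (\<integral>z. norm z * (1 + norm z) ^ (k - 1) \<partial>\<nu>))"
    "\<And>z. z \<in> orthant \<Longrightarrow> \<bar>f (u + w \<bullet> z) - f u\<bar>
      \<le> K * (1 + \<bar>u\<bar>) ^ (k - 1) * (W ^ k * (norm z * (1 + norm z) ^ (k - 1)))"
proof -
  note [measurable] = power_growth_measurable[OF n]
  have wz: "0 \<le> w \<bullet> z" "w \<bullet> z \<le> W * norm z" if "z \<in> orthant" for z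
  proof -
    show "0 \<le> w \<bullet> z" using orthant_inner_bounds[OF w(1) that] by simp
    show "w \<bullet> z \<le> W * norm z"
      using orthant_inner_bounds(2)[OF w(1) that] mult_right_mono[OF w(2), of "norm z"] by simp
  qed
  show b1: "\<bar>f (u + w \<bullet> z) - f u - (w \<bullet> z) * f1 u\<bar>
      \<le> 2 ^ k * K * (1 + \<bar>u\<bar>) ^ (k - 2) * (W ^ (k + 1) * jump_weight k (norm z))" if z: "z \<in> orthant" for z
  proof -
    have "jump_weight k (w \<bullet> z) \<le> W ^ (k + 1) * jump_weight k (norm z)"
      using wz[OF z] w k by (intro jump_weight_scale_le) auto
    then have "2 ^ k * K * (1 + \<bar>u\<bar>) ^ (k - 2) * jump_weight k (w \<bullet> z) \<le> 2 ^ k * K * (1 + \<bar>u\<bar>) ^ (k - 2) * (W ^ (k + 1) * jump_weight k (norm z))"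
      using K by (intro mult_left_mono) auto
    with power_growth_jump_bound(2)[OF n K u wz(1)[OF z] k(1)] show ?thesis by linarith
  qed
  show b2: "\<bar>f (u + w \<bullet> z) - f u\<bar>
      \<le> K * (1 + \<bar>u\<bar>) ^ (k - 1) * (W ^ k * (norm z * (1 + norm z) ^ (k - 1)))" if z: "z \<in> orthant" for z
  proof -
    have "1 + w \<bullet> z \<le> W * (1 + norm z)"
      using wz(2)[OF z] w(3) by (simp add: distrib_left)
    then have "(1 + w \<bullet> z) ^ (k - 1) \<le> W ^ (k - 1) * (1 + norm z) ^ (k - 1)"
      using power_mono[of "1 + w \<bullet> z" "W * (1 + norm z)" "k - 1"] wz(1)[OF z] by (simp add: power_mult_distrib)
    then have "(w \<bullet> z) * (1 + w \<bullet> z) ^ (k - 1) \<le> (W * norm z) * (W ^ (k - 1) * (1 + norm z) ^ (k - 1))"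
      using wz[OF z] w by (intro mult_mono) auto
    also have "\<dots> = W ^ Suc (k - 1) * (norm z * (1 + norm z) ^ (k - 1))" by simp
    also have "Suc (k - 1) = k" using k by simp
    finally have "K * (1 + \<bar>u\<bar>) ^ (k - 1) * ((w \<bullet> z) * (1 + w \<bullet> z) ^ (k - 1))
        \<le> K * (1 + \<bar>u\<bar>) ^ (k - 1) * (W ^ k * (norm z * (1 + norm z) ^ (k - 1)))"
      using K by (intro mult_left_mono) auto
    with power_growth_jump_bound(1)[OF n K u wz(1)[OF z] k(1)] show ?thesis by linarith
  qed
  have i1: "integrable (\<mu> i) (\<lambda>z. 2 ^ k * K * (1 + \<bar>u\<bar>) ^ (k - 2) * (W ^ (k + 1) * jump_weight k (norm z)))"
    using int_mu_J[OF k] by simp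
  have i2: "integrable \<nu> (\<lambda>z. K * (1 + \<bar>u\<bar>) ^ (k - 1) * (W ^ k * (norm z * (1 + norm z) ^ (k - 1))))"
    using int_nu_growth[OF k] by simp
  show j1: "integrable (\<mu> i) (\<lambda>z. f (u + w \<bullet> z) - f u - (w \<bullet> z) * f1 u)"
    by (rule Bochner_Integration.integrable_bound[OF i1])
      (auto intro!: meas_jump AE_I2 order_trans[OF b1] simp: space_jump)
  show j2: "integrable \<nu> (\<lambda>z. f (u + w \<bullet> z) - f u)"
    by (rule Bochner_Integration.integrable_bound[OF i2])
      (auto intro!: meas_jump AE_I2 order_trans[OF b2] simp: space_jump)
  show "\<bar>\<integral>z. f (u + w \<bullet> z) - f u - (w \<bullet> z) * f1 u \<partial>\<mu> i\<bar>
      \<le> 2 ^ k * K * (1 + \<bar>u\<bar>) ^ (k - 2) * (W ^ (k + 1) * (\<integral>z. jump_weight k (norm z) \<partial>\<mu> i))"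
    using abs_integral_le[OF j1 i1] b1 by (simp add: space_jump)
  show "\<bar>\<integral>z. f (u + w \<bullet> z) - f u \<partial>\<nu>\<bar>
      \<le> K * (1 + \<bar>u\<bar>) ^ (k - 1) * (W ^ k * (\<integral>z. norm z * (1 + norm z) ^ (k - 1) \<partial>\<nu>))"
    using abs_integral_le[OF j2 i2] b2 by (simp add: space_jump)
qed

lemma Z_bounds:
  assumes "w \<in> orthant" "norm w \<le> W" "1 \<le> W" "\<bar>a\<bar> \<le> W" "x \<in> orthant"
  shows "- W \<le> w \<bullet> x - a" "1 + \<bar>w \<bullet> x - a\<bar> \<le> 2 * W * (1 + norm x)"
proof -
  have "0 \<le> w \<bullet> x" "w \<bullet> x \<le> W * norm x"
    using orthant_inner_bounds[OF assms(1,5)] mult_right_mono[OF assms(2), of "norm x"] by auto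
  moreover have "0 \<le> W * norm x" using assms by simp
  ultimately show "- W \<le> w \<bullet> x - a" "1 + \<bar>w \<bullet> x - a\<bar> \<le> 2 * W * (1 + norm x)"
    using assms(3,4) by (auto simp: distrib_left abs_le_iff)
qed

text \<open>The state enters as \<open>x $ i\<close> times something of growth \<open>k - 2\<close>,
  while drift and immigration have growth \<open>k - 1\<close>. So a moment of order
  \<open>k - 1\<close> is needed for \<open>2 \<le> k\<close>, and of order \<open>1\<close> for
  \<open>k = 1\<close>; the exponent \<open>Suc (k - 2)\<close> covers both. This gain of one order
  drives the induction on moments.\<close>

lemma generator_bound:
  assumes K: "0 \<le> K" and k: "1 \<le> k" "k \<le> q" and W: "1 \<le> W"
  shows "\<exists>L\<ge>0. \<forall>f f1 f2 w a a1 x. power_growth K W k f f1 f2 \<longrightarrow> w \<in> orthant \<longrightarrow> norm w \<le> W \<longrightarrow> \<bar>a\<bar> \<le> W \<longrightarrow>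
    \<bar>a1\<bar> \<le> W \<longrightarrow> x \<in> orthant \<longrightarrow> \<bar>generator f f1 f2 w a a1 x\<bar> \<le> L * (1 + norm x) ^ Suc (k - 2)"
proof -
  define Ci where "Ci i = (c $ i * W\<^sup>2 * K + 2 ^ k * K * (W ^ (k + 1) * (\<integral>z. jump_weight k (norm z) \<partial>\<mu> i))) * (2 * W) ^ (k - 2)" for i
  define C2 where "C2 = ((norm \<beta> * W + W) * K + K * (W ^ k * (\<integral>z. norm z * (1 + norm z) ^ (k - 1) \<partial>\<nu>))) * (2 * W) ^ (k - 1)"
  have Jn: "0 \<le> (\<integral>z. jump_weight k (norm z) \<partial>\<mu> i)" for i
    by (rule Bochner_Integration.integral_nonneg) (simp add: jump_weight_nonneg)
  have nn: "0 \<le> (\<integral>z. norm z * (1 + norm z) ^ (k - 1) \<partial>\<nu>)"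
    by (rule Bochner_Integration.integral_nonneg) simp
  have Ci0: "0 \<le> Ci i" for i
    unfolding Ci_def using c_nonneg[of i] K W Jn[of i] by (intro mult_nonneg_nonneg add_nonneg_nonneg) auto
  have C20: "0 \<le> C2"
    unfolding C2_def using K W nn by (intro mult_nonneg_nonneg add_nonneg_nonneg) auto
  show ?thesis
  proof (intro exI[of _ "(\<Sum>i\<in>UNIV. Ci i) + C2"] conjI allI impI)
    show "0 \<le> (\<Sum>i\<in>UNIV. Ci i) + C2" using Ci0 C20 by (simp add: sum_nonneg)
    fix f f1 f2 :: "real \<Rightarrow> real" and w x :: "real ^ 'd" and a a1 :: real
    assume n: "power_growth K W k f f1 f2" and w: "w \<in> orthant" "norm w \<le> W" and a: "\<bar>a\<bar> \<le> W" "\<bar>a1\<bar> \<le> W"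
      and x: "x \<in> orthant"
    let ?u = "w \<bullet> x - a" and ?X = "1 + norm x"
    note Zb = Z_bounds[OF w W a(1) x]
    have up: "(1 + \<bar>?u\<bar>) ^ m \<le> (2 * W) ^ m * ?X ^ m" for m
      using power_mono[OF Zb(2), of m] by (simp only: power_mult_distrib)
    have fb: "\<bar>f1 ?u\<bar> \<le> K * (1 + \<bar>?u\<bar>) ^ (k - 1)" "\<bar>f2 ?u\<bar> \<le> K * (1 + \<bar>?u\<bar>) ^ (k - 2)"
      using n Zb(1) by (auto simp: power_growth_def)
    note ji = jump_integrals[OF n K k w W Zb(1)]
    have term1: "\<bar>x $ i * (c $ i * (w $ i)\<^sup>2 * f2 ?u + (\<integral>z. f (?u + w \<bullet> z) - f ?u - (w \<bullet> z) * f1 ?u \<partial>\<mu> i))\<bar>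
        \<le> Ci i * ?X ^ Suc (k - 2)" for i
    proof -
      have wi: "(w $ i)\<^sup>2 \<le> W\<^sup>2"
        using component_le_norm_cart[of w i] w by (metis abs_ge_zero order_trans power2_abs power_mono)
      have "\<bar>c $ i * (w $ i)\<^sup>2 * f2 ?u\<bar> \<le> c $ i * W\<^sup>2 * (K * (1 + \<bar>?u\<bar>) ^ (k - 2))"
        using fb(2) wi c_nonneg[of i] unfolding abs_mult by (intro mult_mono) auto
      then have "\<bar>c $ i * (w $ i)\<^sup>2 * f2 ?u + (\<integral>z. f (?u + w \<bullet> z) - f ?u - (w \<bullet> z) * f1 ?u \<partial>\<mu> i)\<bar>
          \<le> c $ i * W\<^sup>2 * (K * (1 + \<bar>?u\<bar>) ^ (k - 2)) + 2 ^ k * K * (1 + \<bar>?u\<bar>) ^ (k - 2) * (W ^ (k + 1) * (\<integral>z. jump_weight k (norm z) \<partial>\<mu> i))"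
        using ji(2)[of i] by linarith
      also have "\<dots> = (c $ i * W\<^sup>2 * K + 2 ^ k * K * (W ^ (k + 1) * (\<integral>z. jump_weight k (norm z) \<partial>\<mu> i))) * (1 + \<bar>?u\<bar>) ^ (k - 2)"
        by (simp add: algebra_simps)
      also have "\<dots> \<le> (c $ i * W\<^sup>2 * K + 2 ^ k * K * (W ^ (k + 1) * (\<integral>z. jump_weight k (norm z) \<partial>\<mu> i))) * ((2 * W) ^ (k - 2) * ?X ^ (k - 2))"
        using c_nonneg[of i] K W Jn[of i] by (intro mult_left_mono up add_nonneg_nonneg mult_nonneg_nonneg) auto
      also have "\<dots> = Ci i * ?X ^ (k - 2)" by (simp only: Ci_def mult.assoc)
      finally have "\<bar>x $ i\<bar> * \<bar>c $ i * (w $ i)\<^sup>2 * f2 ?u + (\<integral>z. f (?u + w \<bullet> z) - f ?u - (w \<bullet> z) * f1 ?u \<partial>\<mu> i)\<bar>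
          \<le> ?X * (Ci i * ?X ^ (k - 2))"
        using component_le_norm_cart[of x i] by (intro mult_mono) auto
      then show ?thesis by (simp add: abs_mult mult_ac)
    qed
    have "\<bar>\<beta> \<bullet> w - a1\<bar> \<le> norm \<beta> * W + W"
      using Cauchy_Schwarz_ineq2[of \<beta> w] mult_left_mono[OF w(2), of "norm \<beta>"] a by (simp add: abs_le_iff)
    then have "\<bar>(\<beta> \<bullet> w - a1) * f1 ?u\<bar> \<le> (norm \<beta> * W + W) * (K * (1 + \<bar>?u\<bar>) ^ (k - 1))"
      unfolding abs_mult using fb(1) W by (intro mult_mono) auto
    then have "\<bar>(\<beta> \<bullet> w - a1) * f1 ?u + (\<integral>z. f (?u + w \<bullet> z) - f ?u \<partial>\<nu>)\<bar>
        \<le> (norm \<beta> * W + W) * (K * (1 + \<bar>?u\<bar>) ^ (k - 1))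
          + K * (1 + \<bar>?u\<bar>) ^ (k - 1) * (W ^ k * (\<integral>z. norm z * (1 + norm z) ^ (k - 1) \<partial>\<nu>))"
      using ji(5) by linarith
    also have "\<dots> = ((norm \<beta> * W + W) * K + K * (W ^ k * (\<integral>z. norm z * (1 + norm z) ^ (k - 1) \<partial>\<nu>))) * (1 + \<bar>?u\<bar>) ^ (k - 1)"
      by (simp add: algebra_simps)
    also have "\<dots> \<le> ((norm \<beta> * W + W) * K + K * (W ^ k * (\<integral>z. norm z * (1 + norm z) ^ (k - 1) \<partial>\<nu>))) * ((2 * W) ^ (k - 1) * ?X ^ (k - 1))"
      using K W nn by (intro mult_left_mono up add_nonneg_nonneg mult_nonneg_nonneg) auto
    also have "\<dots> = C2 * ?X ^ (k - 1)" by (simp only: C2_def mult.assoc)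
    also have "\<dots> \<le> C2 * ?X ^ Suc (k - 2)"
      using C20 by (intro mult_left_mono power_increasing) auto
    finally have term2: "\<bar>(\<beta> \<bullet> w - a1) * f1 ?u + (\<integral>z. f (?u + w \<bullet> z) - f ?u \<partial>\<nu>)\<bar> \<le> C2 * ?X ^ Suc (k - 2)" .
    have "\<bar>\<Sum>i\<in>UNIV. x $ i * (c $ i * (w $ i)\<^sup>2 * f2 ?u + (\<integral>z. f (?u + w \<bullet> z) - f ?u - (w \<bullet> z) * f1 ?u \<partial>\<mu> i))\<bar>
        \<le> (\<Sum>i\<in>UNIV. Ci i * ?X ^ Suc (k - 2))"
      by (rule order_trans[OF sum_abs sum_mono[OF term1]])
    with term2 show "\<bar>generator f f1 f2 w a a1 x\<bar> \<le> ((\<Sum>i\<in>UNIV. Ci i) + C2) * ?X ^ Suc (k - 2)"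
      unfolding generator_def distrib_right sum_distrib_right by linarith
  qed
qed

lemma generator_tendsto:
  fixes f f1 f2 :: "nat \<Rightarrow> real \<Rightarrow> real"
  assumes n: "\<And>n. power_growth K W k (f n) (f1 n) (f2 n)" and K: "0 \<le> K" and k: "1 \<le> k" "k \<le> q" and W: "1 \<le> W"
    and w: "w \<in> orthant" "norm w \<le> W" "\<bar>a\<bar> \<le> W" "x \<in> orthant"
    and lim: "\<And>u. (\<lambda>n. f n u) \<longlonglongrightarrow> g u" "\<And>u. (\<lambda>n. f1 n u) \<longlonglongrightarrow> g1 u" "\<And>u. (\<lambda>n. f2 n u) \<longlonglongrightarrow> g2 u"
  shows "(\<lambda>n. generator (f n) (f1 n) (f2 n) w a a1 x) \<longlonglongrightarrow> generator g g1 g2 w a a1 x"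
proof -
  let ?u = "w \<bullet> x - a"
  note Zb = Z_bounds[OF w(1,2) W w(3,4)]
  note ji = jump_integrals[OF n K k w(1,2) W Zb(1)]
  have [measurable]: "f n \<in> borel_measurable borel" for n using power_growth_measurable[OF n] by auto
  have [measurable]: "g \<in> borel_measurable borel"
    by (rule borel_measurable_LIMSEQ_real[OF lim(1)]) simp_all
  have 1: "(\<lambda>n. \<integral>z. f n (?u + w \<bullet> z) - f n ?u - (w \<bullet> z) * f1 n ?u \<partial>\<mu> i)
      \<longlonglongrightarrow> (\<integral>z. g (?u + w \<bullet> z) - g ?u - (w \<bullet> z) * g1 ?u \<partial>\<mu> i)" for i
  proof (rule integral_dominated_convergence[where w = "\<lambda>z. 2 ^ k * K * (1 + \<bar>?u\<bar>) ^ (k - 2) * (W ^ (k + 1) * jump_weight k (norm z))"])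
    show "AE z in \<mu> i. (\<lambda>n. f n (?u + w \<bullet> z) - f n ?u - (w \<bullet> z) * f1 n ?u)
        \<longlonglongrightarrow> g (?u + w \<bullet> z) - g ?u - (w \<bullet> z) * g1 ?u"
      by (intro AE_I2 tendsto_intros lim)
    show "AE z in \<mu> i. norm (f n (?u + w \<bullet> z) - f n ?u - (w \<bullet> z) * f1 n ?u)
        \<le> 2 ^ k * K * (1 + \<bar>?u\<bar>) ^ (k - 2) * (W ^ (k + 1) * jump_weight k (norm z))" for n
      using ji(3)[of _ n] by (intro AE_I2) (auto simp: space_jump)
    show "integrable (\<mu> i) (\<lambda>z. 2 ^ k * K * (1 + \<bar>?u\<bar>) ^ (k - 2) * (W ^ (k + 1) * jump_weight k (norm z)))"
      using int_mu_J[OF k] by simp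
  qed (auto intro!: meas_jump)
  have 2: "(\<lambda>n. \<integral>z. f n (?u + w \<bullet> z) - f n ?u \<partial>\<nu>) \<longlonglongrightarrow> (\<integral>z. g (?u + w \<bullet> z) - g ?u \<partial>\<nu>)"
  proof (rule integral_dominated_convergence[where w = "\<lambda>z. K * (1 + \<bar>?u\<bar>) ^ (k - 1) * (W ^ k * (norm z * (1 + norm z) ^ (k - 1)))"])
    show "AE z in \<nu>. (\<lambda>n. f n (?u + w \<bullet> z) - f n ?u) \<longlonglongrightarrow> g (?u + w \<bullet> z) - g ?u"
      by (intro AE_I2 tendsto_intros lim)
    show "AE z in \<nu>. norm (f n (?u + w \<bullet> z) - f n ?u)
        \<le> K * (1 + \<bar>?u\<bar>) ^ (k - 1) * (W ^ k * (norm z * (1 + norm z) ^ (k - 1)))" for n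
      using ji(6)[of _ n] by (intro AE_I2) (auto simp: space_jump)
    show "integrable \<nu> (\<lambda>z. K * (1 + \<bar>?u\<bar>) ^ (k - 1) * (W ^ k * (norm z * (1 + norm z) ^ (k - 1))))"
      using int_nu_growth[OF k] by simp
  qed (auto intro!: meas_jump)
  show ?thesis
    unfolding generator_def by (intro tendsto_intros lim 1 2)
qed

end


context cbi_param
begin

lemma borel_measurable_jump_integral:
  fixes h :: "'x::topological_space \<Rightarrow> real ^ 'd \<Rightarrow> real"
  assumes h: "case_prod h \<in> borel_measurable (borel \<Otimes>\<^sub>M borel)"
  shows "(\<lambda>x. \<integral>z. h x z \<partial>\<mu> i) \<in> borel_measurable borel" "(\<lambda>x. \<integral>z. h x z \<partial>\<nu>) \<in> borel_measurable borel"
proof -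
  interpret m: sigma_finite_measure "\<mu> i" by (rule sigma_finite_jump)
  interpret n: sigma_finite_measure \<nu> by (rule sigma_finite_jump)
  have "(\<lambda>p. (fst p, snd p)) \<in> borel \<Otimes>\<^sub>M \<mu> i \<rightarrow>\<^sub>M borel \<Otimes>\<^sub>M borel"
    by (intro measurable_Pair measurable_fst measurable_compose[OF measurable_snd id_jump(2)])
  from measurable_compose[OF this h] have 1: "case_prod h \<in> borel_measurable (borel \<Otimes>\<^sub>M \<mu> i)"
    by (simp add: case_prod_beta')
  have "(\<lambda>p. (fst p, snd p)) \<in> borel \<Otimes>\<^sub>M \<nu> \<rightarrow>\<^sub>M borel \<Otimes>\<^sub>M borel"
    by (intro measurable_Pair measurable_fst measurable_compose[OF measurable_snd id_jump(1)])
  from measurable_compose[OF this h] have 2: "case_prod h \<in> borel_measurable (borel \<Otimes>\<^sub>M \<nu>)"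
    by (simp add: case_prod_beta')
  show "(\<lambda>x. \<integral>z. h x z \<partial>\<mu> i) \<in> borel_measurable borel"
    using 1 by (rule m.borel_measurable_lebesgue_integral)
  show "(\<lambda>x. \<integral>z. h x z \<partial>\<nu>) \<in> borel_measurable borel"
    using 2 by (rule n.borel_measurable_lebesgue_integral)
qed

lemma generator_measurable:
  assumes [measurable]: "f \<in> borel_measurable borel" "f1 \<in> borel_measurable borel" "f2 \<in> borel_measurable borel"
  shows "generator f f1 f2 w a a1 \<in> borel_measurable borel"
proof -
  have [measurable]: "(\<lambda>x. \<integral>z. f (w \<bullet> x - a + w \<bullet> z) - f (w \<bullet> x - a) - (w \<bullet> z) * f1 (w \<bullet> x - a) \<partial>\<mu> i) \<in> borel_measurable borel" for i
    by (rule borel_measurable_jump_integral) measurable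
  have [measurable]: "(\<lambda>x. \<integral>z. f (w \<bullet> x - a + w \<bullet> z) - f (w \<bullet> x - a) \<partial>\<nu>) \<in> borel_measurable borel"
    by (rule borel_measurable_jump_integral) measurable
  show ?thesis
    unfolding generator_def[abs_def] by measurable
qed

text \<open>On exponentials the generator is an expression in \<open>phi\<close> and
  \<open>psi\<close> times the exponential, the very integrand of \<open>dynkin_exp\<close> for
  \<open>lam = th *\<^sub>R w\<close>. The summand with \<open>Bt\<close> removes the linear part of
  \<open>phi\<close>; along the adjoint equation it is minus the derivative of
  \<open>lam\<close>.\<close>

lemma generator_at_exp:
  assumes w: "w \<in> orthant" and th: "0 \<le> th"
  shows "generator (\<lambda>u. exp (- (th * u))) (\<lambda>u. - th * exp (- (th * u))) (\<lambda>u. th\<^sup>2 * exp (- (th * u))) w a a1 x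
    = (x \<bullet> (phi c B \<mu> (th *\<^sub>R w) + th *\<^sub>R (\<chi> i. (Bt *v axis i 1) \<bullet> w)) - psi \<beta> \<nu> (th *\<^sub>R w) + th * a1)
      * exp (- ((th *\<^sub>R w) \<bullet> x) + th * a)"
    "integrable (\<mu> i) (\<lambda>z. exp (- (th * (u + w \<bullet> z))) - exp (- (th * u)) - (w \<bullet> z) * (- th * exp (- (th * u))))"
    "integrable \<nu> (\<lambda>z. exp (- (th * (u + w \<bullet> z))) - exp (- (th * u)))"
proof -
  let ?f = "\<lambda>u. exp (- (th * u))" and ?f1 = "\<lambda>u. - th * exp (- (th * u))" and ?f2 = "\<lambda>u. th\<^sup>2 * exp (- (th * u))"
  have tw: "th *\<^sub>R w \<in> orthant" using w th by (auto simp: orthant_def)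
  have f: "?f (u + y) - ?f u - y * ?f1 u = exp (- (th * u)) * exp_rem2 (th * y)" "?f (u + y) - ?f u = exp (- (th * u)) * (exp (- (th * y)) - 1)"
    for u y
  proof -
    have "exp (- (th * (u + y))) = exp (- (th * u)) * exp (- (th * y))"
      by (simp add: distrib_left flip: exp_add)
    then show "?f (u + y) - ?f u - y * ?f1 u = exp (- (th * u)) * exp_rem2 (th * y)"
      "?f (u + y) - ?f u = exp (- (th * u)) * (exp (- (th * y)) - 1)"
      by (simp_all add: exp_rem2_def algebra_simps)
  qed
  show "integrable (\<mu> i) (\<lambda>z. ?f (u + w \<bullet> z) - ?f u - (w \<bullet> z) * ?f1 u)"
    unfolding f(1) using int_r2[OF tw, of i] by simp
  show "integrable \<nu> (\<lambda>z. ?f (u + w \<bullet> z) - ?f u)"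
    unfolding f(2) using int_nu_exp[OF tw] by simp
  let ?u = "w \<bullet> x - a"
  have e: "exp (- (th * ?u)) = exp (- ((th *\<^sub>R w) \<bullet> x) + th * a)"
    by (simp add: right_diff_distrib)
  have 1: "(\<integral>z. ?f (?u + w \<bullet> z) - ?f ?u - (w \<bullet> z) * ?f1 ?u \<partial>\<mu> i) = exp (- (th * ?u)) * (\<integral>z. exp_rem2 ((th *\<^sub>R w) \<bullet> z) \<partial>\<mu> i)" for i
    unfolding f(1) by simp
  have 2: "(\<integral>z. ?f (?u + w \<bullet> z) - ?f ?u \<partial>\<nu>) = exp (- (th * ?u)) * (\<integral>z. exp (- ((th *\<^sub>R w) \<bullet> z)) - 1 \<partial>\<nu>)"
    unfolding f(2) by simp
  have ph: "(phi c B \<mu> (th *\<^sub>R w) + th *\<^sub>R (\<chi> i. (Bt *v axis i 1) \<bullet> w)) $ i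
      = c $ i * (w $ i)\<^sup>2 * th\<^sup>2 + (\<integral>z. exp_rem2 ((th *\<^sub>R w) \<bullet> z) \<partial>\<mu> i)" for i
    by (simp add: phi_eq[OF tw] power_mult_distrib)
  have "generator ?f ?f1 ?f2 w a a1 x = (\<Sum>i\<in>UNIV. x $ i * (phi c B \<mu> (th *\<^sub>R w) + th *\<^sub>R (\<chi> i. (Bt *v axis i 1) \<bullet> w)) $ i * exp (- (th * ?u)))
      + (\<beta> \<bullet> w - a1) * (- th * exp (- (th * ?u))) + exp (- (th * ?u)) * (\<integral>z. exp (- ((th *\<^sub>R w) \<bullet> z)) - 1 \<partial>\<nu>)"
    unfolding generator_def 1 2 ph by (simp add: algebra_simps)
  also have "\<dots> = (x \<bullet> (phi c B \<mu> (th *\<^sub>R w) + th *\<^sub>R (\<chi> i. (Bt *v axis i 1) \<bullet> w)) - psi \<beta> \<nu> (th *\<^sub>R w) + th * a1) * exp (- (th * ?u))"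
    unfolding psi_def inner_vec_def[of x] sum_distrib_right[symmetric] by (simp add: algebra_simps)
  finally show "generator ?f ?f1 ?f2 w a a1 x
    = (x \<bullet> (phi c B \<mu> (th *\<^sub>R w) + th *\<^sub>R (\<chi> i. (Bt *v axis i 1) \<bullet> w)) - psi \<beta> \<nu> (th *\<^sub>R w) + th * a1)
      * exp (- ((th *\<^sub>R w) \<bullet> x) + th * a)"
    by (simp only: e)
qed

lemma generator_sum:
  fixes f f1 f2 :: "nat \<Rightarrow> real \<Rightarrow> real"
  assumes "\<And>m i u. m \<in> S \<Longrightarrow> integrable (\<mu> i) (\<lambda>z. f m (u + w \<bullet> z) - f m u - (w \<bullet> z) * f1 m u)"
    "\<And>m u. m \<in> S \<Longrightarrow> integrable \<nu> (\<lambda>z. f m (u + w \<bullet> z) - f m u)"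
  shows "generator (\<lambda>u. \<Sum>m\<in>S. k m * f m u) (\<lambda>u. \<Sum>m\<in>S. k m * f1 m u) (\<lambda>u. \<Sum>m\<in>S. k m * f2 m u) w a a1 x
    = (\<Sum>m\<in>S. k m * generator (f m) (f1 m) (f2 m) w a a1 x)"
proof -
  let ?u = "w \<bullet> x - a"
  have 1: "(\<integral>z. (\<Sum>m\<in>S. k m * f m (?u + w \<bullet> z)) - (\<Sum>m\<in>S. k m * f m ?u) - (w \<bullet> z) * (\<Sum>m\<in>S. k m * f1 m ?u) \<partial>\<mu> i)
      = (\<Sum>m\<in>S. k m * (\<integral>z. f m (?u + w \<bullet> z) - f m ?u - (w \<bullet> z) * f1 m ?u \<partial>\<mu> i))" for i
  proof -
    have "(\<Sum>m\<in>S. k m * f m (?u + w \<bullet> z)) - (\<Sum>m\<in>S. k m * f m ?u) - (w \<bullet> z) * (\<Sum>m\<in>S. k m * f1 m ?u)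
        = (\<Sum>m\<in>S. k m * (f m (?u + w \<bullet> z) - f m ?u - (w \<bullet> z) * f1 m ?u))" for z
      by (simp add: sum_subtractf sum_distrib_left right_diff_distrib mult_ac)
    then show ?thesis
      using assms(1) by (simp add: Bochner_Integration.integral_sum)
  qed
  have 2: "(\<integral>z. (\<Sum>m\<in>S. k m * f m (?u + w \<bullet> z)) - (\<Sum>m\<in>S. k m * f m ?u) \<partial>\<nu>)
      = (\<Sum>m\<in>S. k m * (\<integral>z. f m (?u + w \<bullet> z) - f m ?u \<partial>\<nu>))"
  proof -
    have "(\<Sum>m\<in>S. k m * f m (?u + w \<bullet> z)) - (\<Sum>m\<in>S. k m * f m ?u) = (\<Sum>m\<in>S. k m * (f m (?u + w \<bullet> z) - f m ?u))" for z
      by (simp add: sum_subtractf right_diff_distrib)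
    then show ?thesis
      using assms(2) by (simp add: Bochner_Integration.integral_sum)
  qed
  have "(\<Sum>i\<in>UNIV. x $ i * (c $ i * (w $ i)\<^sup>2 * (\<Sum>m\<in>S. k m * f2 m ?u)
        + (\<Sum>m\<in>S. k m * (\<integral>z. f m (?u + w \<bullet> z) - f m ?u - (w \<bullet> z) * f1 m ?u \<partial>\<mu> i))))
      = (\<Sum>i\<in>UNIV. \<Sum>m\<in>S. k m * (x $ i * (c $ i * (w $ i)\<^sup>2 * f2 m ?u
        + (\<integral>z. f m (?u + w \<bullet> z) - f m ?u - (w \<bullet> z) * f1 m ?u \<partial>\<mu> i))))"
    by (intro sum.cong refl) (simp add: sum_distrib_left sum.distrib[symmetric] algebra_simps)
  also have "\<dots> = (\<Sum>m\<in>S. k m * (\<Sum>i\<in>UNIV. x $ i * (c $ i * (w $ i)\<^sup>2 * f2 m ?u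
        + (\<integral>z. f m (?u + w \<bullet> z) - f m ?u - (w \<bullet> z) * f1 m ?u \<partial>\<mu> i))))"
    unfolding sum_distrib_left by (rule sum.swap)
  finally show ?thesis
    unfolding generator_def 1 2 by (simp add: sum_distrib_left sum.distrib[symmetric] algebra_simps)
qed

end

text \<open>Coefficients of the binomial expansion of \<open>((n + 1) * (1 - e)) ^ k\<close> in
  powers of \<open>e = exp (- (u / (n + 1)))\<close>.\<close>

definition pow_approx_coeff :: "nat \<Rightarrow> nat \<Rightarrow> nat \<Rightarrow> real" where
  "pow_approx_coeff k n m = real (Suc n) ^ k * (real (k choose m) * (- 1) ^ m)"

text \<open>Only the function itself is expanded. The other two identities follow by differentiating
  the sum, since derivatives are unique.\<close>

lemma pow_approx_expansion:
  "pow_approx0 k n u = (\<Sum>m\<le>k. pow_approx_coeff k n m * exp (- (real m / real (Suc n) * u)))"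
  "pow_approx1 k n u = (\<Sum>m\<le>k. pow_approx_coeff k n m * (- (real m / real (Suc n)) * exp (- (real m / real (Suc n) * u))))"
  "pow_approx2 k n u = (\<Sum>m\<le>k. pow_approx_coeff k n m * ((real m / real (Suc n))\<^sup>2 * exp (- (real m / real (Suc n) * u))))"
proof -
  let ?t = "\<lambda>m. real m / real (Suc n)"
  show 0: "pow_approx0 k n u = (\<Sum>m\<le>k. pow_approx_coeff k n m * exp (- (?t m * u)))" for u
  proof -
    have e: "exp (- (u / real (Suc n))) ^ m = exp (- (?t m * u))" for m
      by (simp add: exp_of_nat_mult[symmetric] del: of_nat_Suc)
    have "pow_approx0 k n u = real (Suc n) ^ k * ((- exp (- (u / real (Suc n)))) + 1) ^ k"
      by (simp add: pow_approx0_def exp_chord_def power_mult_distrib del: of_nat_Suc)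
    also have "\<dots> = (\<Sum>m\<le>k. pow_approx_coeff k n m * exp (- (?t m * u)))"
      unfolding binomial_ring sum_distrib_left
      by (intro sum.cong refl) (simp add: pow_approx_coeff_def power_minus[of "exp _"] e mult_ac del: of_nat_Suc)
    finally show ?thesis .
  qed
  have D0: "((\<lambda>u. \<Sum>m\<le>k. pow_approx_coeff k n m * exp (- (?t m * u))) has_real_derivative
      (\<Sum>m\<le>k. pow_approx_coeff k n m * (- ?t m * exp (- (?t m * u))))) (at u)" for u
    by (auto intro!: derivative_eq_intros sum.cong)
  show 1: "pow_approx1 k n u = (\<Sum>m\<le>k. pow_approx_coeff k n m * (- ?t m * exp (- (?t m * u))))" for u
    using DERIV_unique[OF pow_approx_derivs(2)[of k n u] D0[of u, folded 0]] .
  have D1: "((\<lambda>u. \<Sum>m\<le>k. pow_approx_coeff k n m * (- ?t m * exp (- (?t m * u)))) has_real_derivative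
      (\<Sum>m\<le>k. pow_approx_coeff k n m * ((?t m)\<^sup>2 * exp (- (?t m * u))))) (at u)" for u
    by (auto intro!: derivative_eq_intros sum.cong simp: power2_eq_square)
  show "pow_approx2 k n u = (\<Sum>m\<le>k. pow_approx_coeff k n m * ((?t m)\<^sup>2 * exp (- (?t m * u))))"
    using DERIV_unique[OF pow_approx_derivs(3)[of k n u] D1[of u, folded 1]] .
qed

text \<open>\<open>w\<close> solves the adjoint linear equation and \<open>a\<close> is a free
  centring. Two choices occur: \<open>a = 0\<close>, which keeps
  \<open>w s \<bullet> x - a s\<close> non-negative and serves to bound moments and to find the
  mean, and \<open>a\<close> equal to the mean of \<open>w s \<bullet> x\<close>, which yields the
  centred recursion.\<close>

locale cbi_path = cbi_laws c \<beta> B \<nu> \<mu> q v N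
  for c \<beta> :: "real ^ 'd" and B :: "real ^ 'd ^ 'd"
    and \<nu> :: "(real ^ 'd) measure" and \<mu> :: "'d \<Rightarrow> (real ^ 'd) measure" and q :: nat and v N +
  fixes w :: "real \<Rightarrow> real ^ 'd" and a a' :: "real \<Rightarrow> real" and T W :: real
  assumes T: "0 \<le> T" and W: "1 \<le> W"
    and w_o: "\<And>s. s \<in> {0..T} \<Longrightarrow> w s \<in> orthant" and w_n: "\<And>s. s \<in> {0..T} \<Longrightarrow> norm (w s) \<le> W"
    and a_n: "\<And>s. s \<in> {0..T} \<Longrightarrow> \<bar>a s\<bar> \<le> W" and a'_n: "\<And>s. s \<in> {0..T} \<Longrightarrow> \<bar>a' s\<bar> \<le> W"
    and w_d: "\<And>s i. s \<in> {0..T} \<Longrightarrow> ((\<lambda>s. w s $ i) has_real_derivative - ((Bt *v axis i 1) \<bullet> w s)) (at s)"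
    and a_d: "\<And>s. s \<in> {0..T} \<Longrightarrow> (a has_real_derivative a' s) (at s)"
begin

lemma w_lipschitz: "\<exists>L\<ge>0. \<forall>s\<in>{0..T}. \<forall>u\<in>{0..T}. norm (w s - w u) \<le> L * \<bar>s - u\<bar>"
proof -
  have comp: "\<bar>w s $ i - w u $ i\<bar> \<le> (norm (Bt *v axis i 1) * W) * \<bar>s - u\<bar>" if "s \<in> {0..T}" "u \<in> {0..T}" for s u i
  proof -
    have "norm (w s $ i - w u $ i) \<le> (norm (Bt *v axis i 1) * W) * norm (s - u)"
    proof (rule field_differentiable_bound[of "{0..T}"])
      show "((\<lambda>s. w s $ i) has_field_derivative - ((Bt *v axis i 1) \<bullet> w z)) (at z within {0..T})" if "z \<in> {0..T}" for z
        using w_d[OF that] by (rule has_field_derivative_at_within)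
      show "norm (- ((Bt *v axis i 1) \<bullet> w z)) \<le> norm (Bt *v axis i 1) * W" if "z \<in> {0..T}" for z
        using Cauchy_Schwarz_ineq2[of "Bt *v axis i 1" "w z"] mult_left_mono[OF w_n[OF that], of "norm (Bt *v axis i 1)"]
        by simp
    qed (use that in auto)
    then show ?thesis by simp
  qed
  show ?thesis
  proof (intro exI[of _ "\<Sum>i\<in>UNIV. norm (Bt *v axis i 1) * W"] conjI ballI)
    show "0 \<le> (\<Sum>i\<in>UNIV. norm (Bt *v axis i 1) * W)" using W by (intro sum_nonneg) auto
    fix s u assume su: "s \<in> {0..T}" "u \<in> {0..T}"
    show "norm (w s - w u) \<le> (\<Sum>i\<in>UNIV. norm (Bt *v axis i 1) * W) * \<bar>s - u\<bar>"
      unfolding sum_distrib_right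
      by (rule order_trans[OF norm_le_l1_cart sum_mono]) (use comp[OF su] in simp)
  qed
qed

lemma a_lipschitz: "s \<in> {0..T} \<Longrightarrow> u \<in> {0..T} \<Longrightarrow> \<bar>a s - a u\<bar> \<le> W * \<bar>s - u\<bar>"
  using field_differentiable_bound[of "{0..T}" a a' W s u] a_d a'_n
  by (auto intro: has_field_derivative_at_within)

text \<open>\<open>e\<close> is a constant shift of the exponent. The generator is treated with
  \<open>e = 0\<close>; a small multiple of a unit vector produces, by differencing, a coordinate
  factor in mixed moments, for which the continuity in time is what counts.\<close>

lemma path_exp:
  fixes th :: real
  assumes th: "0 \<le> th" and e: "e \<in> orthant" and t: "t \<in> {0..T}"
  defines "lam \<equiv> \<lambda>s. th *\<^sub>R w s + e"
    and "D \<equiv> \<lambda>s. \<integral>x. (x \<bullet> (phi c B \<mu> (th *\<^sub>R w s + e) + th *\<^sub>R (\<chi> i. (Bt *v axis i 1) \<bullet> w s))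
        - psi \<beta> \<nu> (th *\<^sub>R w s + e) + th * a' s) * exp (- ((th *\<^sub>R w s + e) \<bullet> x) + th * a s) \<partial>N s"
    and "G \<equiv> \<lambda>s. \<integral>x. exp (- ((th *\<^sub>R w s + e) \<bullet> x) + th * a s) \<partial>N s"
  shows "set_integrable lborel {0..t} D" "(LINT s:{0..t}|lborel. D s) = G t - G 0" "continuous_on {0..t} G"
proof -
  obtain Lw where Lw: "0 \<le> Lw" "\<And>s u. s \<in> {0..T} \<Longrightarrow> u \<in> {0..T} \<Longrightarrow> norm (w s - w u) \<le> Lw * \<bar>s - u\<bar>"
    using w_lipschitz by blast
  define r where "r = th * W + th * Lw + norm e"
  have r0: "th * W \<le> r" "th * Lw \<le> r" "th * W + norm e \<le> r" "0 \<le> r"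
    using th W Lw(1) by (auto simp: r_def)
  define lam' where "lam' s = th *\<^sub>R (\<chi> i. - ((Bt *v axis i 1) \<bullet> w s))" for s
  have quot: "((\<lambda>h. (f (s + h) - f s) / h) \<longlongrightarrow> d) (at_right 0)" if "(f has_real_derivative d) (at s)" for f d and s :: real
    using that unfolding DERIV_def by (rule filterlim_mono) (auto simp: at_le)
  have sT: "s \<in> {0..t} \<Longrightarrow> s \<in> {0..T}" for s using t by auto
  have D_eq: "D = (\<lambda>s. \<integral>x. (x \<bullet> (phi c B \<mu> (lam s) - lam' s) - psi \<beta> \<nu> (lam s) + th * a' s) * exp (- (lam s \<bullet> x) + th * a s) \<partial>N s)"
  proof -
    have "phi c B \<mu> (lam s) + th *\<^sub>R (\<chi> i. (Bt *v axis i 1) \<bullet> w s) = phi c B \<mu> (lam s) - lam' s" for s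
      by (simp add: lam'_def vec_eq_iff)
    then show ?thesis by (simp add: D_def lam_def)
  qed
  have G_eq: "G = (\<lambda>s. \<integral>x. exp (- (lam s \<bullet> x) + th * a s) \<partial>N s)"
    by (simp add: G_def lam_def)
  note main = dynkin_exp[where T = t and r = r and lam = lam and lam' = lam' and eta = "\<lambda>s. th * a s" and eta' = "\<lambda>s. th * a' s", folded D_eq G_eq]
  have 1: "lam s \<in> orthant" "norm (lam s) \<le> r" "\<bar>th * a s\<bar> \<le> r" if "s \<in> {0..t}" for s
  proof -
    show "lam s \<in> orthant"
      using w_o[OF sT[OF that]] e th by (auto simp: lam_def orthant_def)
    have "norm (lam s) \<le> th * norm (w s) + norm e"
      unfolding lam_def using norm_triangle_ineq[of "th *\<^sub>R w s" e] th by simp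
    also have "\<dots> \<le> th * W + norm e"
      using w_n[OF sT[OF that]] th by (simp add: mult_left_mono)
    finally show "norm (lam s) \<le> r" using r0 by simp
    have "th * \<bar>a s\<bar> \<le> th * W"
      using a_n[OF sT[OF that]] th by (simp add: mult_left_mono)
    then show "\<bar>th * a s\<bar> \<le> r" using r0 th by (simp add: abs_mult)
  qed
  have 2: "norm (lam s - lam u) \<le> r * \<bar>s - u\<bar>" "\<bar>th * a s - th * a u\<bar> \<le> r * \<bar>s - u\<bar>" if su: "s \<in> {0..t}" "u \<in> {0..t}" for s u
  proof -
    have "norm (lam s - lam u) = th * norm (w s - w u)"
      using th by (simp add: lam_def flip: scaleR_diff_right)
    also have "\<dots> \<le> th * (Lw * \<bar>s - u\<bar>)"
      using Lw(2) sT su th by (intro mult_left_mono) auto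
    also have "\<dots> \<le> r * \<bar>s - u\<bar>"
      using r0 by (simp add: mult_right_mono flip: mult.assoc)
    finally show "norm (lam s - lam u) \<le> r * \<bar>s - u\<bar>" .
    have "\<bar>th * a s - th * a u\<bar> = th * \<bar>a s - a u\<bar>"
      using th by (simp add: abs_mult flip: right_diff_distrib)
    also have "\<dots> \<le> th * (W * \<bar>s - u\<bar>)"
      using a_lipschitz sT su th by (intro mult_left_mono) auto
    also have "\<dots> \<le> r * \<bar>s - u\<bar>"
      using r0 by (simp add: mult_right_mono flip: mult.assoc)
    finally show "\<bar>th * a s - th * a u\<bar> \<le> r * \<bar>s - u\<bar>" .
  qed
  have 3: "((\<lambda>h. (1 / h) *\<^sub>R (lam (s + h) - lam s)) \<longlongrightarrow> lam' s) (at_right 0)"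
    "((\<lambda>h. (th * a (s + h) - th * a s) / h) \<longlongrightarrow> th * a' s) (at_right 0)" if "0 \<le> s" "s < t" for s
  proof -
    have s: "s \<in> {0..T}" using that t by simp
    show "((\<lambda>h. (1 / h) *\<^sub>R (lam (s + h) - lam s)) \<longlongrightarrow> lam' s) (at_right 0)"
    proof (rule vec_tendstoI)
      fix i
      have "((\<lambda>h. th * ((w (s + h) $ i - w s $ i) / h)) \<longlongrightarrow> th * - ((Bt *v axis i 1) \<bullet> w s)) (at_right 0)"
        by (intro tendsto_intros quot w_d s)
      then show "((\<lambda>h. ((1 / h) *\<^sub>R (lam (s + h) - lam s)) $ i) \<longlongrightarrow> lam' s $ i) (at_right 0)"
        by (simp add: lam_def lam'_def algebra_simps diff_divide_distrib)
    qed
    have "((\<lambda>h. th * ((a (s + h) - a s) / h)) \<longlongrightarrow> th * a' s) (at_right 0)"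
      by (intro tendsto_intros quot a_d s)
    then show "((\<lambda>h. (th * a (s + h) - th * a s) / h) \<longlongrightarrow> th * a' s) (at_right 0)"
      by (simp add: right_diff_distrib)
  qed
  have t0: "0 \<le> t" using t by simp
  note res = main[OF t0 r0(4) 1 2 3]
  show "set_integrable lborel {0..t} D" "(LINT s:{0..t}|lborel. D s) = G t - G 0" "continuous_on {0..t} G"
    using res by (auto simp: G_eq)
qed

end


lemma set_integral_lin_comb:
  fixes f :: "'b \<Rightarrow> 'a \<Rightarrow> real"
  assumes "\<And>m. m \<in> S \<Longrightarrow> set_integrable M A (f m)"
  shows "set_integrable M A (\<lambda>s. \<Sum>m\<in>S. k m * f m s)"
    "(LINT s:A|M. \<Sum>m\<in>S. k m * f m s) = (\<Sum>m\<in>S. k m * (LINT s:A|M. f m s))"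
proof -
  have e: "indicator A s *\<^sub>R (\<Sum>m\<in>S. k m * f m s) = (\<Sum>m\<in>S. k m * (indicator A s *\<^sub>R f m s))" for s
    by (simp add: sum_distrib_left mult_ac)
  show "set_integrable M A (\<lambda>s. \<Sum>m\<in>S. k m * f m s)"
    using assms unfolding set_integrable_def e by (intro Bochner_Integration.integrable_sum integrable_mult_right) auto
  show "(LINT s:A|M. \<Sum>m\<in>S. k m * f m s) = (\<Sum>m\<in>S. k m * (LINT s:A|M. f m s))"
    using assms unfolding set_lebesgue_integral_def set_integrable_def e
    by (subst Bochner_Integration.integral_sum) auto
qed

section \<open>Moments\<close>

lemma one_plus_power_le: "0 \<le> (n::real) \<Longrightarrow> (1 + n) ^ k \<le> 2 ^ k * (1 + n ^ k)"
proof -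
  assume n: "0 \<le> n"
  have "(1 + n) ^ k \<le> (2 * max 1 n) ^ k" using n by (intro power_mono) auto
  also have "\<dots> = 2 ^ k * max 1 n ^ k" by (rule power_mult_distrib)
  also have "\<dots> \<le> 2 ^ k * (1 + n ^ k)"
    using n by (intro mult_left_mono) (auto simp: max_def)
  finally show ?thesis .
qed

context cbi_laws
begin

lemma integrable_one_plus:
  assumes "0 \<le> s" "integrable (N s) (\<lambda>x. norm x ^ k)"
  shows "integrable (N s) (\<lambda>x. (1 + norm x) ^ k)"
proof -
  interpret prob_space "N s" using prob_N assms by simp
  have "integrable (N s) (\<lambda>x. 2 ^ k * (1 + norm x ^ k))" using assms(2) by simp
  then show ?thesis
    by (rule Bochner_Integration.integrable_bound) (auto simp: one_plus_power_le)
qed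

end

context cbi_path
begin

lemma integrable_lin_exp:
  assumes s: "s \<in> {0..T}" and th: "0 \<le> th"
  shows "integrable (N s) (\<lambda>x. (x \<bullet> p + k) * exp (- ((th *\<^sub>R w s) \<bullet> x) + th * a s))"
proof -
  have s0: "0 \<le> s" using s by simp
  interpret prob_space "N s" using prob_N s0 by simp
  have "integrable (N s) norm" using first_moment[OF T] s by auto
  then have "integrable (N s) (\<lambda>x. (norm x * norm p + \<bar>k\<bar>) * exp (th * W))" by simp
  then show ?thesis
  proof (rule Bochner_Integration.integrable_bound)
    show "AE x in N s. norm ((x \<bullet> p + k) * exp (- ((th *\<^sub>R w s) \<bullet> x) + th * a s)) \<le> norm ((norm x * norm p + \<bar>k\<bar>) * exp (th * W))"
      using N_orthant[OF s0]
    proof eventually_elim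
      case (elim x)
      have "0 \<le> th * (w s \<bullet> x)" using th orthant_inner_nonneg[OF w_o[OF s] elim] by simp
      moreover have "th * a s \<le> th * W" using a_n[OF s] th by (intro mult_left_mono) auto
      ultimately have "exp (- ((th *\<^sub>R w s) \<bullet> x) + th * a s) \<le> exp (th * W)" by simp
      moreover have "\<bar>x \<bullet> p + k\<bar> \<le> norm x * norm p + \<bar>k\<bar>"
        using Cauchy_Schwarz_ineq2[of x p] by linarith
      ultimately have "\<bar>x \<bullet> p + k\<bar> * exp (- ((th *\<^sub>R w s) \<bullet> x) + th * a s) \<le> (norm x * norm p + \<bar>k\<bar>) * exp (th * W)"
        by (intro mult_mono) auto
      then show ?case by (simp add: abs_mult)
    qed
  qed measurable
qed

definition generator_exp :: "real \<Rightarrow> real \<Rightarrow> real ^ 'd \<Rightarrow> real" where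
  "generator_exp th s = generator (\<lambda>u. exp (- (th * u))) (\<lambda>u. - th * exp (- (th * u))) (\<lambda>u. th\<^sup>2 * exp (- (th * u))) (w s) (a s) (a' s)"

lemma dyn_exp:
  assumes th: "0 \<le> th" and t: "t \<in> {0..T}"
  shows "set_integrable lborel {0..t} (\<lambda>s. \<integral>x. generator_exp th s x \<partial>N s)"
    "(LINT s:{0..t}|lborel. \<integral>x. generator_exp th s x \<partial>N s) = (\<integral>x. exp (- (th * (w t \<bullet> x - a t))) \<partial>N t) - (\<integral>x. exp (- (th * (w 0 \<bullet> x - a 0))) \<partial>N 0)"
    "integrable (N t) (generator_exp th t)" "integrable (N t) (\<lambda>x. exp (- (th * (w t \<bullet> x - a t))))"
proof -
  have t0: "0 \<le> t" using t by simp
  have ge: "generator_exp th s x = (x \<bullet> (phi c B \<mu> (th *\<^sub>R w s + 0) + th *\<^sub>R (\<chi> i. (Bt *v axis i 1) \<bullet> w s)) - psi \<beta> \<nu> (th *\<^sub>R w s + 0) + th * a' s)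
      * exp (- ((th *\<^sub>R w s + 0) \<bullet> x) + th * a s)" if "s \<in> {0..T}" for s x
    unfolding generator_exp_def generator_at_exp(1)[OF w_o[OF that] th] by simp
  have e: "exp (- (th * (w s \<bullet> x - a s))) = exp (- ((th *\<^sub>R w s + 0) \<bullet> x) + th * a s)" for s x
    by (simp add: right_diff_distrib)
  note pe = path_exp[OF th zero_orthant t]
  have cong: "(\<integral>x. generator_exp th s x \<partial>N s) = (\<integral>x. (x \<bullet> (phi c B \<mu> (th *\<^sub>R w s + 0) + th *\<^sub>R (\<chi> i. (Bt *v axis i 1) \<bullet> w s)) - psi \<beta> \<nu> (th *\<^sub>R w s + 0) + th * a' s)
      * exp (- ((th *\<^sub>R w s + 0) \<bullet> x) + th * a s) \<partial>N s)" if "s \<in> {0..t}" for s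
    using ge[of s] that t by simp
  have "set_integrable lborel {0..t} (\<lambda>s. \<integral>x. generator_exp th s x \<partial>N s) \<longleftrightarrow>
    set_integrable lborel {0..t} (\<lambda>s. \<integral>x. (x \<bullet> (phi c B \<mu> (th *\<^sub>R w s + 0) + th *\<^sub>R (\<chi> i. (Bt *v axis i 1) \<bullet> w s)) - psi \<beta> \<nu> (th *\<^sub>R w s + 0) + th * a' s)
      * exp (- ((th *\<^sub>R w s + 0) \<bullet> x) + th * a s) \<partial>N s)"
    by (rule set_integrable_cong[OF refl refl cong])
  with pe(1) show "set_integrable lborel {0..t} (\<lambda>s. \<integral>x. generator_exp th s x \<partial>N s)" by blast
  have "(LINT s:{0..t}|lborel. \<integral>x. generator_exp th s x \<partial>N s) =
    (LINT s:{0..t}|lborel. \<integral>x. (x \<bullet> (phi c B \<mu> (th *\<^sub>R w s + 0) + th *\<^sub>R (\<chi> i. (Bt *v axis i 1) \<bullet> w s)) - psi \<beta> \<nu> (th *\<^sub>R w s + 0) + th * a' s)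
      * exp (- ((th *\<^sub>R w s + 0) \<bullet> x) + th * a s) \<partial>N s)"
    by (rule set_lebesgue_integral_cong) (use cong in auto)
  with pe(2) show "(LINT s:{0..t}|lborel. \<integral>x. generator_exp th s x \<partial>N s) = (\<integral>x. exp (- (th * (w t \<bullet> x - a t))) \<partial>N t) - (\<integral>x. exp (- (th * (w 0 \<bullet> x - a 0))) \<partial>N 0)"
    by (simp only: e)
  have "generator_exp th t = (\<lambda>x. (x \<bullet> (phi c B \<mu> (th *\<^sub>R w t) + th *\<^sub>R (\<chi> i. (Bt *v axis i 1) \<bullet> w t)) + (th * a' t - psi \<beta> \<nu> (th *\<^sub>R w t)))
      * exp (- ((th *\<^sub>R w t) \<bullet> x) + th * a t))"
    using ge[OF t] by (auto simp: algebra_simps)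
  then show "integrable (N t) (generator_exp th t)"
    using integrable_lin_exp[OF t th] by simp
  show "integrable (N t) (\<lambda>x. exp (- (th * (w t \<bullet> x - a t))))"
    using integrable_lin_exp[OF t th, of 0 1] by (simp add: right_diff_distrib)
qed

definition generator_approx :: "nat \<Rightarrow> nat \<Rightarrow> real \<Rightarrow> real ^ 'd \<Rightarrow> real" where
  "generator_approx k n s = generator (pow_approx0 k n) (pow_approx1 k n) (pow_approx2 k n) (w s) (a s) (a' s)"

text \<open>By linearity from the exponentials: the approximants are finite combinations of them, so
  Dynkin's formula holds without a moment of order \<open>k\<close>.\<close>

lemma dyn_pow_approx:
  assumes t: "t \<in> {0..T}"
  shows "set_integrable lborel {0..t} (\<lambda>s. \<integral>x. generator_approx k n s x \<partial>N s)"
    "(LINT s:{0..t}|lborel. \<integral>x. generator_approx k n s x \<partial>N s) = (\<integral>x. pow_approx0 k n (w t \<bullet> x - a t) \<partial>N t) - (\<integral>x. pow_approx0 k n (w 0 \<bullet> x - a 0) \<partial>N 0)"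
    "integrable (N t) (\<lambda>x. pow_approx0 k n (w t \<bullet> x - a t))"
proof -
  define th where "th m = real m / real (Suc n)" for m
  have th: "0 \<le> th m" for m by (simp add: th_def)
  have z: "0 \<in> {0..T}" using T by simp
  have A: "generator_approx k n s x = (\<Sum>m\<le>k. pow_approx_coeff k n m * generator_exp (th m) s x)" if "s \<in> {0..T}" for s x
    unfolding generator_approx_def generator_exp_def pow_approx_expansion[abs_def] th_def[symmetric]
    by (rule generator_sum) (intro generator_at_exp(2,3) w_o that th)+
  have int: "(\<integral>x. generator_approx k n s x \<partial>N s) = (\<Sum>m\<le>k. pow_approx_coeff k n m * (\<integral>x. generator_exp (th m) s x \<partial>N s))" if "s \<in> {0..T}" for s
    unfolding A[OF that] using dyn_exp(3)[OF th that] by (simp add: Bochner_Integration.integral_sum)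
  have sT: "s \<in> {0..t} \<Longrightarrow> s \<in> {0..T}" for s using t by auto
  have si: "set_integrable lborel {0..t} (\<lambda>s. \<Sum>m\<le>k. pow_approx_coeff k n m * (\<integral>x. generator_exp (th m) s x \<partial>N s))"
    by (intro set_integral_lin_comb(1) dyn_exp th t)
  have "set_integrable lborel {0..t} (\<lambda>s. \<integral>x. generator_approx k n s x \<partial>N s) \<longleftrightarrow>
    set_integrable lborel {0..t} (\<lambda>s. \<Sum>m\<le>k. pow_approx_coeff k n m * (\<integral>x. generator_exp (th m) s x \<partial>N s))"
    by (rule set_integrable_cong[OF refl refl int[OF sT]])
  with si show "set_integrable lborel {0..t} (\<lambda>s. \<integral>x. generator_approx k n s x \<partial>N s)" by blast
  have ap: "(\<integral>x. pow_approx0 k n (w s \<bullet> x - a s) \<partial>N s) = (\<Sum>m\<le>k. pow_approx_coeff k n m * (\<integral>x. exp (- (th m * (w s \<bullet> x - a s))) \<partial>N s))"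
    if "s \<in> {0..T}" for s
    unfolding pow_approx_expansion th_def[symmetric] using dyn_exp(4)[OF th that] by (simp add: Bochner_Integration.integral_sum)
  have "(LINT s:{0..t}|lborel. \<integral>x. generator_approx k n s x \<partial>N s) = (LINT s:{0..t}|lborel. \<Sum>m\<le>k. pow_approx_coeff k n m * (\<integral>x. generator_exp (th m) s x \<partial>N s))"
    by (rule set_lebesgue_integral_cong) (use int sT in auto)
  also have "\<dots> = (\<Sum>m\<le>k. pow_approx_coeff k n m * (LINT s:{0..t}|lborel. \<integral>x. generator_exp (th m) s x \<partial>N s))"
    by (intro set_integral_lin_comb(2) dyn_exp th t)
  also have "\<dots> = (\<integral>x. pow_approx0 k n (w t \<bullet> x - a t) \<partial>N t) - (\<integral>x. pow_approx0 k n (w 0 \<bullet> x - a 0) \<partial>N 0)"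
    unfolding ap[OF t] ap[OF z] dyn_exp(2)[OF th t] by (simp add: right_diff_distrib sum_subtractf)
  finally show "(LINT s:{0..t}|lborel. \<integral>x. generator_approx k n s x \<partial>N s) = (\<integral>x. pow_approx0 k n (w t \<bullet> x - a t) \<partial>N t) - (\<integral>x. pow_approx0 k n (w 0 \<bullet> x - a 0) \<partial>N 0)" .
  show "integrable (N t) (\<lambda>x. pow_approx0 k n (w t \<bullet> x - a t))"
    unfolding pow_approx_expansion th_def[symmetric] using dyn_exp(4)[OF th t] by simp
qed

definition generator_power :: "nat \<Rightarrow> real \<Rightarrow> real ^ 'd \<Rightarrow> real" where
  "generator_power k s = generator (\<lambda>u. u ^ k) (\<lambda>u. real k * u ^ (k - 1)) (\<lambda>u. real k * (real (k - 1) * u ^ (k - 2))) (w s) (a s) (a' s)"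

lemma generator_power_measurable: "generator_power k s \<in> borel_measurable borel"
  unfolding generator_power_def by (rule generator_measurable; measurable)

lemma pow_approx0_bound:
  assumes k: "1 \<le> k" and s: "s \<in> {0..T}" and x: "x \<in> orthant"
  shows "\<bar>pow_approx0 k n (w s \<bullet> x - a s)\<bar> \<le> pow_approx_bound W k * (2 * W) ^ k * (1 + norm x) ^ k"
proof -
  note Zb = Z_bounds[OF w_o[OF s] w_n[OF s] W a_n[OF s] x]
  have "\<bar>pow_approx0 k n (w s \<bullet> x - a s)\<bar> \<le> pow_approx_bound W k * (1 + \<bar>w s \<bullet> x - a s\<bar>) ^ k"
    using power_growth_pow_approx[of W k n] W k Zb(1) by (auto simp: power_growth_def)
  also have "\<dots> \<le> pow_approx_bound W k * (2 * W * (1 + norm x)) ^ k"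
    using Zb(2) pow_approx_bound_ge(2)[OF k, of W] by (intro mult_left_mono power_mono) auto
  finally show ?thesis by (simp only: power_mult_distrib mult.assoc)
qed

section \<open>From the approximants to the power itself, given the moments that the generator
  needs\<close>

context
  fixes k :: nat and L Mb :: real
  assumes k: "1 \<le> k" "k \<le> q"
    and GB: "0 \<le> L" "\<And>f f1 f2 w a a1 x. power_growth (pow_approx_bound W k) W k f f1 f2 \<Longrightarrow> w \<in> orthant \<Longrightarrow> norm w \<le> W \<Longrightarrow> \<bar>a\<bar> \<le> W \<Longrightarrow>
    \<bar>a1\<bar> \<le> W \<Longrightarrow> x \<in> orthant \<Longrightarrow> \<bar>generator f f1 f2 w a a1 x\<bar> \<le> L * (1 + norm x) ^ Suc (k - 2)"
    and Mb: "\<And>s. s \<in> {0..T} \<Longrightarrow> integrable (N s) (\<lambda>x. (1 + norm x) ^ Suc (k - 2))"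
      "\<And>s. s \<in> {0..T} \<Longrightarrow> (\<integral>x. (1 + norm x) ^ Suc (k - 2) \<partial>N s) \<le> Mb"
begin

lemma generator_approx_measurable: "generator_approx k n s \<in> borel_measurable borel"
  unfolding generator_approx_def
  by (intro generator_measurable power_growth_measurable[OF power_growth_pow_approx[of W]]) (use W k in auto)

lemma generator_approx_bound:
  assumes s: "s \<in> {0..T}"
  shows "AE x in N s. norm (generator_approx k n s x) \<le> L * (1 + norm x) ^ Suc (k - 2)"
proof -
  have "AE x in N s. x \<in> orthant" using N_orthant s by simp
  then show ?thesis
    by eventually_elim (use GB(2)[OF power_growth_pow_approx[of W k n] w_o[OF s] w_n[OF s] a_n[OF s] a'_n[OF s]] W k in \<open>simp add: generator_approx_def\<close>)
qed

lemma generator_approx_integral_bound: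
  assumes s: "s \<in> {0..T}"
  shows "\<bar>\<integral>x. generator_approx k n s x \<partial>N s\<bar> \<le> L * Mb"
proof -
  have i: "integrable (N s) (\<lambda>x. L * (1 + norm x) ^ Suc (k - 2))" using Mb(1)[OF s] by simp
  have "\<bar>\<integral>x. generator_approx k n s x \<partial>N s\<bar> \<le> (\<integral>x. \<bar>generator_approx k n s x\<bar> \<partial>N s)" by (rule integral_abs_bound)
  also have "\<dots> \<le> (\<integral>x. L * (1 + norm x) ^ Suc (k - 2) \<partial>N s)"
  proof (rule integral_mono_AE[OF _ i])
    show "integrable (N s) (\<lambda>x. \<bar>generator_approx k n s x\<bar>)"
      by (rule integrable_abs, rule Bochner_Integration.integrable_bound[OF i])
        (use generator_approx_bound[OF s, of n] generator_approx_measurable in \<open>auto elim!: eventually_mono\<close>)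
    show "AE x in N s. \<bar>generator_approx k n s x\<bar> \<le> L * (1 + norm x) ^ Suc (k - 2)"
      using generator_approx_bound[OF s, of n] by simp
  qed
  also have "\<dots> \<le> L * Mb" using Mb(2)[OF s] GB(1) by (simp add: mult_left_mono)
  finally show ?thesis .
qed

lemma generator_power_limit:
  assumes s: "s \<in> {0..T}"
  shows "(\<lambda>n. \<integral>x. generator_approx k n s x \<partial>N s) \<longlonglongrightarrow> (\<integral>x. generator_power k s x \<partial>N s)" "integrable (N s) (generator_power k s)"
proof -
  have i: "integrable (N s) (\<lambda>x. L * (1 + norm x) ^ Suc (k - 2))" using Mb(1)[OF s] by simp
  have gp: "generator_power k s \<in> borel_measurable (N s)"
    using generator_power_measurable by simp
  have ga: "generator_approx k n s \<in> borel_measurable (N s)" for n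
    using generator_approx_measurable by simp
  have lim: "AE x in N s. (\<lambda>n. generator_approx k n s x) \<longlonglongrightarrow> generator_power k s x"
  proof -
    have "AE x in N s. x \<in> orthant" using N_orthant s by simp
    then show ?thesis
    proof eventually_elim
      case (elim x)
      have "0 \<le> pow_approx_bound W k" using pow_approx_bound_ge(2)[OF k(1), of W] by simp
      then show ?case
        unfolding generator_approx_def generator_power_def
        by (intro generator_tendsto[OF power_growth_pow_approx[of W] _ k W w_o[OF s] w_n[OF s] a_n[OF s] elim] pow_approx_tendsto)
          (use W k in auto)
    qed
  qed
  show "(\<lambda>n. \<integral>x. generator_approx k n s x \<partial>N s) \<longlonglongrightarrow> (\<integral>x. generator_power k s x \<partial>N s)"
    by (rule integral_dominated_convergence[OF gp ga i lim generator_approx_bound[OF s]])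
  show "integrable (N s) (generator_power k s)"
    by (rule integrable_dominated_convergence[OF gp ga i lim generator_approx_bound[OF s]])
qed

text \<open>No moment of order \<open>k\<close> at time \<open>t\<close> is assumed here. The last
  bound, which is uniform in \<open>n\<close>, is what will produce it.\<close>

lemma dyn_power_limit:
  assumes t: "t \<in> {0..T}"
  shows "set_integrable lborel {0..t} (\<lambda>s. \<integral>x. generator_power k s x \<partial>N s)"
    "(\<lambda>n. (\<integral>x. pow_approx0 k n (w t \<bullet> x - a t) \<partial>N t) - (\<integral>x. pow_approx0 k n (w 0 \<bullet> x - a 0) \<partial>N 0))
      \<longlonglongrightarrow> (LINT s:{0..t}|lborel. \<integral>x. generator_power k s x \<partial>N s)"
    "\<And>n. \<bar>(\<integral>x. pow_approx0 k n (w t \<bullet> x - a t) \<partial>N t) - (\<integral>x. pow_approx0 k n (w 0 \<bullet> x - a 0) \<partial>N 0)\<bar> \<le> t * (L * Mb)"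
proof -
  have sT: "s \<in> {0..t} \<Longrightarrow> s \<in> {0..T}" for s using t by auto
  let ?P = "\<lambda>s. indicator {0..t} s *\<^sub>R (\<integral>x. generator_power k s x \<partial>N s)"
  let ?A = "\<lambda>n s. indicator {0..t} s *\<^sub>R (\<integral>x. generator_approx k n s x \<partial>N s)"
  have A: "?A n \<in> borel_measurable lborel" for n
    using dyn_pow_approx(1)[OF t, of k n] unfolding set_integrable_def by (rule borel_measurable_integrable)
  have lim: "(\<lambda>n. ?A n s) \<longlonglongrightarrow> ?P s" for s
    using generator_power_limit(1)[OF sT, of s] by (cases "s \<in> {0..t}") auto
  have P: "?P \<in> borel_measurable lborel"
    by (rule borel_measurable_LIMSEQ_real[OF lim A])
  have b: "AE s in lborel. norm (?A n s) \<le> indicator {0..t} s * (L * Mb)" for n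
    using generator_approx_integral_bound[OF sT, of _ n] by (intro AE_I2) (auto split: split_indicator)
  have i: "integrable lborel (\<lambda>s. indicator {0..t} s * (L * Mb))"
    using t by (intro integrable_mult_left integrable_real_indicator) (auto simp: emeasure_lborel_Icc_eq)
  show "set_integrable lborel {0..t} (\<lambda>s. \<integral>x. generator_power k s x \<partial>N s)"
    unfolding set_integrable_def
    by (rule integrable_dominated_convergence[where s = ?A, OF P A i AE_I2[OF lim] b])
  have "(\<lambda>n. \<integral>s. ?A n s \<partial>lborel) \<longlonglongrightarrow> (\<integral>s. ?P s \<partial>lborel)"
    by (rule integral_dominated_convergence[where s = ?A, OF P A i AE_I2[OF lim] b])
  then show "(\<lambda>n. (\<integral>x. pow_approx0 k n (w t \<bullet> x - a t) \<partial>N t) - (\<integral>x. pow_approx0 k n (w 0 \<bullet> x - a 0) \<partial>N 0))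
      \<longlonglongrightarrow> (LINT s:{0..t}|lborel. \<integral>x. generator_power k s x \<partial>N s)"
    unfolding dyn_pow_approx(2)[OF t, symmetric] set_lebesgue_integral_def .
  show "\<bar>(\<integral>x. pow_approx0 k n (w t \<bullet> x - a t) \<partial>N t) - (\<integral>x. pow_approx0 k n (w 0 \<bullet> x - a 0) \<partial>N 0)\<bar> \<le> t * (L * Mb)" for n
    unfolding dyn_pow_approx(2)[OF t, symmetric]
    by (rule set_integral_abs_le[OF _ dyn_pow_approx(1)[OF t]]) (use t generator_approx_integral_bound sT in auto)
qed

lemma pow_approx0_limit:
  assumes s: "s \<in> {0..T}" and i: "integrable (N s) (\<lambda>x. norm x ^ k)"
  shows "(\<lambda>n. \<integral>x. pow_approx0 k n (w s \<bullet> x - a s) \<partial>N s) \<longlonglongrightarrow> (\<integral>x. (w s \<bullet> x - a s) ^ k \<partial>N s)"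
    "integrable (N s) (\<lambda>x. (w s \<bullet> x - a s) ^ k)"
    "\<bar>\<integral>x. pow_approx0 k n (w s \<bullet> x - a s) \<partial>N s\<bar> \<le> pow_approx_bound W k * (2 * W) ^ k * (\<integral>x. (1 + norm x) ^ k \<partial>N s)"
proof -
  have s0: "0 \<le> s" using s by simp
  have i1: "integrable (N s) (\<lambda>x. pow_approx_bound W k * (2 * W) ^ k * (1 + norm x) ^ k)"
    using integrable_one_plus[OF s0 i] by simp
  have b: "AE x in N s. norm (pow_approx0 k n (w s \<bullet> x - a s)) \<le> pow_approx_bound W k * (2 * W) ^ k * (1 + norm x) ^ k" for n
    using N_orthant[OF s0] by eventually_elim (use pow_approx0_bound[OF k(1) s] in simp)
  have m: "(\<lambda>x. pow_approx0 k n (w s \<bullet> x - a s)) \<in> borel_measurable (N s)" for n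
    using dyn_pow_approx(3)[OF s] by (rule borel_measurable_integrable)
  show "(\<lambda>n. \<integral>x. pow_approx0 k n (w s \<bullet> x - a s) \<partial>N s) \<longlonglongrightarrow> (\<integral>x. (w s \<bullet> x - a s) ^ k \<partial>N s)"
    by (rule integral_dominated_convergence[OF _ m i1 _ b]) (auto intro: pow_approx_tendsto)
  show "integrable (N s) (\<lambda>x. (w s \<bullet> x - a s) ^ k)"
    by (rule integrable_dominated_convergence[OF _ m i1 _ b]) (auto intro: pow_approx_tendsto)
  have "\<bar>\<integral>x. pow_approx0 k n (w s \<bullet> x - a s) \<partial>N s\<bar> \<le> (\<integral>x. \<bar>pow_approx0 k n (w s \<bullet> x - a s)\<bar> \<partial>N s)"
    by (rule integral_abs_bound)
  also have "\<dots> \<le> (\<integral>x. pow_approx_bound W k * (2 * W) ^ k * (1 + norm x) ^ k \<partial>N s)"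
    by (rule integral_mono_AE) (use b[of n] i1 dyn_pow_approx(3)[OF s] in auto)
  finally show "\<bar>\<integral>x. pow_approx0 k n (w s \<bullet> x - a s) \<partial>N s\<bar> \<le> pow_approx_bound W k * (2 * W) ^ k * (\<integral>x. (1 + norm x) ^ k \<partial>N s)"
    by simp
qed

lemma dyn_power:
  assumes t: "t \<in> {0..T}" and i: "integrable (N t) (\<lambda>x. norm x ^ k)"
  shows "(\<integral>x. (w t \<bullet> x - a t) ^ k \<partial>N t) - (\<integral>x. (w 0 \<bullet> x - a 0) ^ k \<partial>N 0) = (LINT s:{0..t}|lborel. \<integral>x. generator_power k s x \<partial>N s)"
proof (rule LIMSEQ_unique)
  have z: "0 \<in> {0..T}" using T by simp
  show "(\<lambda>n. (\<integral>x. pow_approx0 k n (w t \<bullet> x - a t) \<partial>N t) - (\<integral>x. pow_approx0 k n (w 0 \<bullet> x - a 0) \<partial>N 0))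
      \<longlonglongrightarrow> (LINT s:{0..t}|lborel. \<integral>x. generator_power k s x \<partial>N s)"
    by (rule dyn_power_limit[OF t])
  show "(\<lambda>n. (\<integral>x. pow_approx0 k n (w t \<bullet> x - a t) \<partial>N t) - (\<integral>x. pow_approx0 k n (w 0 \<bullet> x - a 0) \<partial>N 0))
      \<longlonglongrightarrow> (\<integral>x. (w t \<bullet> x - a t) ^ k \<partial>N t) - (\<integral>x. (w 0 \<bullet> x - a 0) ^ k \<partial>N 0)"
    by (intro tendsto_diff pow_approx0_limit(1) t z i integrable_power_le[OF _ N0] k) simp
qed

text \<open>With \<open>a = 0\<close> the form \<open>w t \<bullet> x\<close>, and with it the
  approximant, is non-negative, as Fatou's lemma requires. The integral at time \<open>t\<close>
  differs from that at time \<open>0\<close> by at most \<open>t * (L * Mb)\<close>, and the latter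
  is bounded through the initial moment of order \<open>k\<close>.\<close>

lemma moment_bound:
  assumes a0: "\<And>s. a s = 0" and t: "t \<in> {0..T}"
  shows "integrable (N t) (\<lambda>x. (w t \<bullet> x) ^ k)"
    "(\<integral>x. (w t \<bullet> x) ^ k \<partial>N t) \<le> pow_approx_bound W k * (2 * W) ^ k * (\<integral>x. (1 + norm x) ^ k \<partial>N 0) + T * (L * Mb)"
proof -
  have z: "0 \<in> {0..T}" and t0: "0 \<le> t" using T t by auto
  have i0: "integrable (N 0) (\<lambda>x. norm x ^ k)" by (rule integrable_power_le[OF _ N0 k(2)]) simp
  have f: "integrable (N t) (\<lambda>x. pow_approx0 k n (w t \<bullet> x))" for n
    using dyn_pow_approx(3)[OF t, of k n] by (simp add: a0)
  have p: "AE x in N t. 0 \<le> pow_approx0 k n (w t \<bullet> x)" for n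
    using N_orthant[OF t0]
    by eventually_elim (auto simp: pow_approx0_def exp_chord_def orthant_inner_nonneg w_o[OF t] intro!: zero_le_power mult_nonneg_nonneg)
  have l: "AE x in N t. (\<lambda>n. pow_approx0 k n (w t \<bullet> x)) \<longlonglongrightarrow> (w t \<bullet> x) ^ k"
    by (intro AE_I2 pow_approx_tendsto)
  have LMb: "0 \<le> L * Mb"
    using generator_approx_integral_bound[OF z, of 0] abs_ge_zero order_trans by blast
  have b: "(\<integral>x. pow_approx0 k n (w t \<bullet> x) \<partial>N t) \<le> pow_approx_bound W k * (2 * W) ^ k * (\<integral>x. (1 + norm x) ^ k \<partial>N 0) + T * (L * Mb)" for n
    using dyn_power_limit(3)[OF t, of n] pow_approx0_limit(3)[OF z i0, of n] mult_right_mono[OF _ LMb, of t T] t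
    by (simp add: a0)
  note fat = fatou_integrable[OF f p l _ b]
  show "integrable (N t) (\<lambda>x. (w t \<bullet> x) ^ k)"
    "(\<integral>x. (w t \<bullet> x) ^ k \<partial>N t) \<le> pow_approx_bound W k * (2 * W) ^ k * (\<integral>x. (1 + norm x) ^ k \<partial>N 0) + T * (L * Mb)"
    using fat by auto
qed

end

end


section \<open>The adjoint flow of \<open>B_tilde\<close> and the mean drift\<close>

context cbi_param
begin

text \<open>Row \<open>j\<close> of \<open>exp(r Bt)\<close> as a vector, that is, the transposed
  exponential applied to the unit vector \<open>e_j\<close>.\<close>

definition dual_flow :: "'d \<Rightarrow> real \<Rightarrow> real ^ 'd" where
  "dual_flow j r = (\<chi> i. entry Bt r j (axis i 1))"

lemma entry_wv: "entry Bt r j x = dual_flow j r \<bullet> x"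
  unfolding dual_flow_def by (rule entry_eq_inner)

lemma dual_flow_0: "dual_flow j 0 = axis j 1"
  by (auto simp: vec_eq_iff dual_flow_def entry_0 axis_def)

text \<open>The off-diagonal entries of \<open>Bt\<close> are non-negative, so its exponential has
  non-negative entries. Multiples of the weights are thus admissible arguments of the Laplace
  transform.\<close>

lemma dual_flow_orthant:
  assumes "0 \<le> r"
  shows "dual_flow j r \<in> orthant"
proof -
  have "0 \<le> entry Bt r j (axis i 1)" for i
    by (rule entry_nonneg[OF Bt_offdiag _ assms]) (auto simp: orthant_def axis_def)
  then show ?thesis by (simp add: dual_flow_def orthant_def)
qed

text \<open>Read backwards from \<open>t\<close>, the rows solve the adjoint equation demanded by
  \<open>cbi_path\<close>, and they arrive at \<open>e_j\<close> when \<open>s = t\<close>.\<close>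

lemma dual_flow_deriv:
  "((\<lambda>s. dual_flow j (t - s) $ i) has_real_derivative - ((Bt *v axis i 1) \<bullet> dual_flow j (t - s))) (at s)"
proof -
  have "((\<lambda>s. entry Bt (t - s) j (axis i 1)) has_real_derivative entry Bt (t - s) j (Bt *v axis i 1) * (0 - 1)) (at s)"
    by (rule DERIV_chain2[OF has_real_derivative_entry]) (auto intro!: derivative_eq_intros)
  then show ?thesis
    by (simp add: entry_wv[of _ j "Bt *v axis i 1"] inner_commute) (simp add: dual_flow_def)
qed

lemma dual_flow_continuous: "continuous_on S (dual_flow j)"
proof -
  have "isCont (\<lambda>r. entry Bt r j (axis i 1)) r" for i r
    using has_real_derivative_entry by (rule DERIV_isCont)
  then have "continuous_on S (\<lambda>r. entry Bt r j (axis i 1))" for i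
    by (intro continuous_at_imp_continuous_on) auto
  then show ?thesis
    unfolding dual_flow_def[abs_def] by (intro continuous_on_vec_lambda)
qed

lemma dual_flow_bounded: "\<exists>W\<ge>1. \<forall>r\<in>{0..T}. \<forall>j. norm (dual_flow j r) \<le> W"
proof -
  have "\<exists>K. \<forall>r\<in>{0..T}. norm (dual_flow j r) \<le> K" for j
  proof -
    have "bounded (dual_flow j ` {0..T})"
      by (intro compact_imp_bounded compact_continuous_image dual_flow_continuous) simp
    then show ?thesis by (auto simp: bounded_iff)
  qed
  then obtain K where K: "\<And>j r. r \<in> {0..T} \<Longrightarrow> norm (dual_flow j r) \<le> K j" by metis
  have "norm (dual_flow j r) \<le> 1 + (\<Sum>j\<in>UNIV. \<bar>K j\<bar>)" if "r \<in> {0..T}" for j r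
  proof -
    have "\<bar>K j\<bar> \<le> (\<Sum>j\<in>UNIV. \<bar>K j\<bar>)" by (rule member_le_sum) auto
    with K[OF that, of j] show ?thesis by linarith
  qed
  then show ?thesis
    by (intro exI[of _ "1 + (\<Sum>j\<in>UNIV. \<bar>K j\<bar>)"]) (auto simp: sum_nonneg)
qed

text \<open>The expected immigration per unit of time, with the jumps of \<open>\<nu>\<close>
  included.\<close>

definition mean_drift :: "real ^ 'd" where "mean_drift = \<beta> + (\<chi> i. \<integral>z. z $ i \<partial>\<nu>)"

lemma mean_drift_inner: "mean_drift \<bullet> w = \<beta> \<bullet> w + (\<integral>z. w \<bullet> z \<partial>\<nu>)"
proof -
  have "integrable \<nu> (\<lambda>z. z $ i)" for i
    by (rule Bochner_Integration.integrable_bound[OF int_nu_norm])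
      (auto intro!: meas_jump simp: component_le_norm_cart)
  then have "(\<integral>z. w \<bullet> z \<partial>\<nu>) = (\<Sum>i\<in>UNIV. w $ i * (\<integral>z. z $ i \<partial>\<nu>))"
    unfolding inner_vec_def by (simp add: Bochner_Integration.integral_sum)
  then show ?thesis
    by (simp add: mean_drift_def inner_add_left) (simp add: inner_vec_def mult.commute)
qed

end

section \<open>Bounds for moments up to order \<open>q\<close>, locally uniform in time\<close>

context cbi_laws
begin

text \<open>For \<open>2 \<le> k\<close> the generator needs order \<open>k - 1\<close> only, which
  the induction hypothesis supplies. Order \<open>1\<close> stands apart, since there the generator
  already needs order \<open>1\<close>; it comes from the Laplace transform directly.\<close>

lemma moments:
  assumes "k \<le> q" and T: "0 \<le> T"
  shows "\<exists>M. \<forall>t\<in>{0..T}. integrable (N t) (\<lambda>x. (1 + norm x) ^ k) \<and> (\<integral>x. (1 + norm x) ^ k \<partial>N t) \<le> M"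
  using assms(1)
proof (induction k rule: less_induct)
  case (less k)
  consider "k = 0" | "k = 1" | "2 \<le> k" by linarith
  then show ?case
  proof cases
    case 1
    have "integrable (N t) (\<lambda>x. (1 + norm x) ^ k) \<and> (\<integral>x. (1 + norm x) ^ k \<partial>N t) \<le> 1" if "t \<in> {0..T}" for t
    proof -
      interpret prob_space "N t" using prob_N that by simp
      show ?thesis using 1 prob_space by simp
    qed
    then show ?thesis by blast
  next
    case 2
    obtain M where M: "\<And>t. t \<in> {0..T} \<Longrightarrow> integrable (N t) norm" "\<And>t. t \<in> {0..T} \<Longrightarrow> (\<integral>x. norm x \<partial>N t) \<le> M"
      using first_moment[OF T] by blast
    have "integrable (N t) (\<lambda>x. (1 + norm x) ^ k) \<and> (\<integral>x. (1 + norm x) ^ k \<partial>N t) \<le> 1 + M" if "t \<in> {0..T}" for t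
    proof -
      interpret prob_space "N t" using prob_N that by simp
      show ?thesis using 2 M[OF that] prob_space by simp
    qed
    then show ?thesis by blast
  next
    case 3
    then have k: "1 \<le> k" "k \<le> q" "Suc (k - 2) = k - 1" using less.prems by auto
    have "k - 1 < k" "k - 1 \<le> q" using k by auto
    from less.IH[OF this] obtain Mb where Mb: "\<And>t. t \<in> {0..T} \<Longrightarrow> integrable (N t) (\<lambda>x. (1 + norm x) ^ Suc (k - 2))"
      "\<And>t. t \<in> {0..T} \<Longrightarrow> (\<integral>x. (1 + norm x) ^ Suc (k - 2) \<partial>N t) \<le> Mb"
      unfolding k(3) by blast
    obtain W where W: "1 \<le> W" "\<And>r j. r \<in> {0..T} \<Longrightarrow> norm (dual_flow j r) \<le> W"
      using dual_flow_bounded[of T] by blast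
    have K0: "0 \<le> pow_approx_bound W k" using pow_approx_bound_ge(2)[OF k(1), of W] by simp
    obtain L where L: "0 \<le> L" "\<And>f f1 f2 w a a1 x. power_growth (pow_approx_bound W k) W k f f1 f2 \<Longrightarrow> w \<in> orthant \<Longrightarrow> norm w \<le> W \<Longrightarrow> \<bar>a\<bar> \<le> W \<Longrightarrow>
      \<bar>a1\<bar> \<le> W \<Longrightarrow> x \<in> orthant \<Longrightarrow> \<bar>generator f f1 f2 w a a1 x\<bar> \<le> L * (1 + norm x) ^ Suc (k - 2)"
      using generator_bound[OF K0 k(1,2) W(1)] by blast
    define R where "R = \<bar>pow_approx_bound W k * (2 * W) ^ k * (\<integral>x. (1 + norm x) ^ k \<partial>N 0)\<bar> + T * \<bar>L * Mb\<bar>"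
    have coord: "integrable (N t) (\<lambda>x. x $ j ^ k)" "(\<integral>x. x $ j ^ k \<partial>N t) \<le> R" if t: "t \<in> {0..T}" for t j
    proof -
      \<comment> \<open>Every \<open>t\<close> has a path of its own, run backwards from
        \<open>t\<close>. Its weight at time \<open>t\<close> is \<open>e_j\<close>, so
        \<open>moment_bound\<close> controls the \<open>k\<close>-th moment of coordinate
        \<open>j\<close>.\<close>
      interpret p: cbi_path c \<beta> B \<nu> \<mu> q v N "\<lambda>s. dual_flow j (t - s)" "\<lambda>_. 0" "\<lambda>_. 0" t W
      proof
        show "dual_flow j (t - s) \<in> orthant" "norm (dual_flow j (t - s)) \<le> W" if "s \<in> {0..t}" for s
          using that t W by (auto intro!: dual_flow_orthant)
      qed (use t W in \<open>auto intro!: dual_flow_deriv\<close>)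
      have tt: "t \<in> {0..t}" using t by simp
      have pm: "integrable (N t) (\<lambda>x. (dual_flow j (t - t) \<bullet> x) ^ k)"
        "(\<integral>x. (dual_flow j (t - t) \<bullet> x) ^ k \<partial>N t) \<le> pow_approx_bound W k * (2 * W) ^ k * (\<integral>x. (1 + norm x) ^ k \<partial>N 0) + t * (L * Mb)"
        by (rule p.moment_bound[OF k(1,2) L(1), where Mb = Mb]; use L(2) Mb t in \<open>auto simp del: power_Suc\<close>)+
      have e: "dual_flow j (t - t) \<bullet> x = x $ j" for x by (simp add: dual_flow_0 inner_axis')
      show "integrable (N t) (\<lambda>x. x $ j ^ k)" using pm(1) unfolding e .
      have "t * (L * Mb) \<le> T * \<bar>L * Mb\<bar>"
        using t by (intro order_trans[OF mult_left_mono[OF abs_ge_self] mult_right_mono]) auto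
      then show "(\<integral>x. x $ j ^ k \<partial>N t) \<le> R"
        using pm(2) unfolding e R_def by linarith
    qed
    \<comment> \<open>The norm is at most the dimension times the largest coordinate, and the
      \<open>k\<close>-th power of that coordinate is one of the summands.\<close>
    have nb: "(1 + norm x) ^ k \<le> 2 ^ k * (1 + real CARD('d) ^ k * (\<Sum>j\<in>UNIV. x $ j ^ k))" if x: "x \<in> orthant" for x :: "real ^ 'd"
    proof -
      have "\<exists>j. \<forall>i. x $ i \<le> x $ j"
      proof -
        have "Max (range (($) x)) \<in> range (($) x)" by (intro Max_in) auto
        then obtain j where j: "Max (range (($) x)) = x $ j" by (rule rangeE)
        have "x $ i \<le> Max (range (($) x))" for i by (intro Max_ge) auto
        then show ?thesis unfolding j by blast
      qed
      then obtain j where j: "\<And>i. x $ i \<le> x $ j" by blast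
      have pos: "0 \<le> x $ i" for i using x by (simp add: orthant_def)
      have "norm x \<le> (\<Sum>i\<in>UNIV. x $ i)" by (rule norm_le_sum_orthant[OF x])
      also have "\<dots> \<le> (\<Sum>i\<in>(UNIV :: 'd set). x $ j)" using j by (intro sum_mono)
      also have "\<dots> = real CARD('d) * x $ j" by simp
      finally have "norm x ^ k \<le> (real CARD('d) * x $ j) ^ k" by (intro power_mono) auto
      also have "\<dots> = real CARD('d) ^ k * x $ j ^ k" by (rule power_mult_distrib)
      also have "\<dots> \<le> real CARD('d) ^ k * (\<Sum>j\<in>UNIV. x $ j ^ k)"
        using pos by (intro mult_left_mono member_le_sum) auto
      finally have "2 ^ k * (1 + norm x ^ k) \<le> 2 ^ k * (1 + real CARD('d) ^ k * (\<Sum>j\<in>UNIV. x $ j ^ k))"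
        by (intro mult_left_mono add_left_mono) auto
      with one_plus_power_le[OF norm_ge_zero, of x k] show ?thesis by linarith
    qed
    have "integrable (N t) (\<lambda>x. (1 + norm x) ^ k) \<and>
      (\<integral>x. (1 + norm x) ^ k \<partial>N t) \<le> 2 ^ k * (1 + real CARD('d) ^ k * (real CARD('d) * R))" if t: "t \<in> {0..T}" for t
    proof -
      have t0: "0 \<le> t" using t by simp
      interpret prob_space "N t" using prob_N t0 by simp
      have i: "integrable (N t) (\<lambda>x. 2 ^ k * (1 + real CARD('d) ^ k * (\<Sum>j\<in>UNIV. x $ j ^ k)))"
        using coord(1)[OF t] by simp
      have ae: "AE x in N t. (1 + norm x) ^ k \<le> 2 ^ k * (1 + real CARD('d) ^ k * (\<Sum>j\<in>UNIV. x $ j ^ k))"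
        using N_orthant[OF t0] by eventually_elim (rule nb)
      have i2: "integrable (N t) (\<lambda>x. (1 + norm x) ^ k)"
        by (rule Bochner_Integration.integrable_bound[OF i]) (use ae in \<open>auto elim!: eventually_mono\<close>)
      have "(\<integral>x. (1 + norm x) ^ k \<partial>N t) \<le> (\<integral>x. 2 ^ k * (1 + real CARD('d) ^ k * (\<Sum>j\<in>UNIV. x $ j ^ k)) \<partial>N t)"
        by (rule integral_mono_AE[OF i2 i ae])
      also have "\<dots> = 2 ^ k * (1 + real CARD('d) ^ k * (\<Sum>j\<in>UNIV. \<integral>x. x $ j ^ k \<partial>N t))"
        using coord(1)[OF t] prob_space by (simp add: Bochner_Integration.integral_sum)
      also have "\<dots> \<le> 2 ^ k * (1 + real CARD('d) ^ k * (\<Sum>j\<in>(UNIV :: 'd set). R))"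
        using coord(2)[OF t] by (intro mult_left_mono add_left_mono sum_mono) auto
      finally show ?thesis using i2 by simp
    qed
    then show ?thesis by blast
  qed
qed

lemma integrable_norm_power:
  assumes "k \<le> q" "0 \<le> t"
  shows "integrable (N t) (\<lambda>x. norm x ^ k)" "integrable (N t) (\<lambda>x. (1 + norm x) ^ k)"
proof -
  show i: "integrable (N t) (\<lambda>x. (1 + norm x) ^ k)"
    using moments[OF assms] assms(2) by auto
  show "integrable (N t) (\<lambda>x. norm x ^ k)"
    by (rule Bochner_Integration.integrable_bound[OF i]) (auto intro!: power_mono)
qed

end

text \<open>The integrand is bounded by \<open>W ^ p * C * norm z ^ p\<close>, which is integrable
  for the product of a finite measure in time with \<open>m\<close>. Measurability of
  \<open>\<phi>\<close> is asked for after cutting off at \<open>[0,T]\<close>, because the moments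
  to be inserted are controlled only there.\<close>

lemma jump_product:
  fixes w :: "real \<Rightarrow> real ^ 'd" and \<phi> :: "real \<Rightarrow> real"
  assumes m: "sigma_finite_measure m" "(\<lambda>z. z) \<in> m \<rightarrow>\<^sub>M borel" "integrable m (\<lambda>z. norm z ^ p)"
    and w: "w \<in> borel_measurable borel" "\<And>s. s \<in> {0..T} \<Longrightarrow> norm (w s) \<le> W"
    and \<phi>: "(\<lambda>s. indicator {0..T} s * \<phi> s) \<in> borel_measurable borel" "\<And>s. s \<in> {0..T} \<Longrightarrow> \<bar>\<phi> s\<bar> \<le> C"
    and T: "0 \<le> T"
  shows "integrable (restrict_space lborel {0..T} \<Otimes>\<^sub>M m) (\<lambda>(s, z). (w s \<bullet> z) ^ p * \<phi> s)"
    "set_integrable lborel {0..T} (\<lambda>s. \<integral>z. (w s \<bullet> z) ^ p * \<phi> s \<partial>m)"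
proof -
  let ?R = "restrict_space lborel {0..T}"
  have fin: "finite_measure ?R"
    by (rule finite_measureI) (simp add: emeasure_restrict_space space_restrict_space emeasure_lborel_Icc_eq T)
  interpret R: finite_measure ?R by (rule fin)
  interpret m: sigma_finite_measure m by (rule m)
  interpret pair_sigma_finite ?R m ..
  have \<phi>m: "\<phi> \<in> borel_measurable ?R"
    using \<phi>(1) by (simp add: borel_measurable_restrict_space_iff)
  have [measurable]: "(\<lambda>p. \<phi> (fst p)) \<in> borel_measurable (?R \<Otimes>\<^sub>M m)"
    by (rule measurable_compose[OF measurable_fst \<phi>m])
  have "w \<in> borel_measurable ?R"
    using w(1) by (intro measurable_restrict_space1) simp
  then have [measurable]: "(\<lambda>p. w (fst p)) \<in> borel_measurable (?R \<Otimes>\<^sub>M m)"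
    by (rule measurable_compose[OF measurable_fst])
  have [measurable]: "(\<lambda>p. snd p) \<in> borel_measurable (?R \<Otimes>\<^sub>M m)"
    by (rule measurable_compose[OF measurable_snd m(2)])
  have [measurable]: "(\<lambda>z. z) \<in> borel_measurable m" by (rule m(2))
  have meas: "(\<lambda>(s, z). (w s \<bullet> z) ^ p * \<phi> s) \<in> borel_measurable (?R \<Otimes>\<^sub>M m)"
    unfolding case_prod_beta' by measurable
  have bd: "norm ((w s \<bullet> z) ^ p * \<phi> s) \<le> W ^ p * C * norm z ^ p" if "s \<in> {0..T}" for s z
  proof -
    have "\<bar>w s \<bullet> z\<bar> \<le> W * norm z"
      using Cauchy_Schwarz_ineq2[of "w s" z] mult_right_mono[OF w(2)[OF that], of "norm z"] by simp
    then have "\<bar>w s \<bullet> z\<bar> ^ p \<le> (W * norm z) ^ p" by (intro power_mono) auto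
    then have "\<bar>w s \<bullet> z\<bar> ^ p * \<bar>\<phi> s\<bar> \<le> (W * norm z) ^ p * C"
      using \<phi>(2)[OF that] by (intro mult_mono') auto
    then show ?thesis by (simp add: abs_mult power_abs power_mult_distrib mult_ac)
  qed
  have iz: "integrable m (\<lambda>z. (w s \<bullet> z) ^ p * \<phi> s)" if "s \<in> {0..T}" for s
  proof (rule Bochner_Integration.integrable_bound)
    show "integrable m (\<lambda>z. W ^ p * C * norm z ^ p)" using m(3) by simp
    show "AE z in m. norm ((w s \<bullet> z) ^ p * \<phi> s) \<le> norm (W ^ p * C * norm z ^ p)"
      by (intro AE_I2) (rule order_trans[OF bd[OF that]], simp only: real_norm_def abs_ge_self)
  qed measurable
  have int: "integrable ?R (\<lambda>s. \<integral>z. norm ((w s \<bullet> z) ^ p * \<phi> s) \<partial>m)"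
  proof (rule R.integrable_const_bound[where B = "\<integral>z. W ^ p * C * norm z ^ p \<partial>m"])
    show "AE s in ?R. norm (\<integral>z. norm ((w s \<bullet> z) ^ p * \<phi> s) \<partial>m) \<le> (\<integral>z. W ^ p * C * norm z ^ p \<partial>m)"
    proof (rule AE_I2)
      fix s assume "s \<in> space ?R"
      then have s: "s \<in> {0..T}" by (simp add: space_restrict_space)
      have "(\<integral>z. norm ((w s \<bullet> z) ^ p * \<phi> s) \<partial>m) \<le> (\<integral>z. W ^ p * C * norm z ^ p \<partial>m)"
        by (rule integral_mono[OF integrable_norm[OF iz[OF s]] _ bd[OF s]]) (use m(3) in simp)
      then show "norm (\<integral>z. norm ((w s \<bullet> z) ^ p * \<phi> s) \<partial>m) \<le> (\<integral>z. W ^ p * C * norm z ^ p \<partial>m)"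
        by (simp add: Bochner_Integration.integral_nonneg)
    qed
    show "(\<lambda>s. \<integral>z. norm ((w s \<bullet> z) ^ p * \<phi> s) \<partial>m) \<in> borel_measurable ?R"
      by (rule m.borel_measurable_lebesgue_integral) (use meas in \<open>simp add: case_prod_beta'\<close>)
  qed
  show i: "integrable (?R \<Otimes>\<^sub>M m) (\<lambda>(s, z). (w s \<bullet> z) ^ p * \<phi> s)"
  proof (rule Fubini_integrable[OF meas])
    show "integrable ?R (\<lambda>s. \<integral>z. norm (case (s, z) of (s, z) \<Rightarrow> (w s \<bullet> z) ^ p * \<phi> s) \<partial>m)"
      using int by (simp only: prod.case)
    show "AE s in ?R. integrable m (\<lambda>z. case (s, z) of (s, z) \<Rightarrow> (w s \<bullet> z) ^ p * \<phi> s)"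
      unfolding prod.case by (intro AE_I2 iz) (simp add: space_restrict_space)
  qed
  have "integrable ?R (\<lambda>s. \<integral>z. (w s \<bullet> z) ^ p * \<phi> s \<partial>m)"
    using integrable_fst[OF i] by simp
  then show "set_integrable lborel {0..T} (\<lambda>s. \<integral>z. (w s \<bullet> z) ^ p * \<phi> s \<partial>m)"
    by (simp add: integrable_restrict_space set_integrable_def)
qed

lemma set_integrable_bounded:
  fixes \<phi> :: "real \<Rightarrow> real"
  assumes "0 \<le> T" "(\<lambda>s. indicator {0..T} s * \<phi> s) \<in> borel_measurable borel" "\<And>s. s \<in> {0..T} \<Longrightarrow> \<bar>\<phi> s\<bar> \<le> C"
  shows "set_integrable lborel {0..T} \<phi>"
  unfolding set_integrable_def
proof (rule Bochner_Integration.integrable_bound)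
  show "integrable lborel (\<lambda>s. indicator {0..T} s * C)"
    using assms(1) by (intro integrable_mult_left integrable_real_indicator) (auto simp: emeasure_lborel_Icc_eq)
  show "AE s in lborel. norm (indicator {0..T} s *\<^sub>R \<phi> s) \<le> norm (indicator {0..T} s * C)"
    using assms(3) by (intro AE_I2) (fastforce split: split_indicator)
qed (use assms(2) in simp)

section \<open>Centred and weighted moments as functions of time\<close>

context cbi_path
begin

definition centred_moment :: "nat \<Rightarrow> real \<Rightarrow> real" where "centred_moment l s = (\<integral>x. (w s \<bullet> x - a s) ^ l \<partial>N s)"

definition weighted_moment :: "nat \<Rightarrow> 'd \<Rightarrow> real \<Rightarrow> real" where
  "weighted_moment l i s = (\<integral>x. (w s \<bullet> x - a s) ^ l * x $ i \<partial>N s)"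

text \<open>\<open>pow_approx_bound W 0\<close> is zero, hence the separate value for
  \<open>l = 0\<close>.\<close>

definition approx_bound :: "nat \<Rightarrow> real" where "approx_bound l = (if l = 0 then 1 else pow_approx_bound W l) * (2 * W) ^ l"

lemma power_bounds:
  assumes s: "s \<in> {0..T}" and x: "x \<in> orthant"
  shows "\<bar>pow_approx0 l n (w s \<bullet> x - a s)\<bar> \<le> approx_bound l * (1 + norm x) ^ l"
    "\<bar>(w s \<bullet> x - a s) ^ l\<bar> \<le> (2 * W) ^ l * (1 + norm x) ^ l"
    "\<bar>exp_chord n (x $ i)\<bar> \<le> 1 + norm x"
proof -
  show "\<bar>pow_approx0 l n (w s \<bullet> x - a s)\<bar> \<le> approx_bound l * (1 + norm x) ^ l"
    using pow_approx0_bound[OF _ s x, of l n] by (cases "l = 0") (auto simp: approx_bound_def pow_approx0_def)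
  note Zb = Z_bounds[OF w_o[OF s] w_n[OF s] W a_n[OF s] x]
  have "\<bar>w s \<bullet> x - a s\<bar> ^ l \<le> (2 * W * (1 + norm x)) ^ l"
    using Zb(2) by (intro power_mono) auto
  then show "\<bar>(w s \<bullet> x - a s) ^ l\<bar> \<le> (2 * W) ^ l * (1 + norm x) ^ l"
    by (simp only: power_abs power_mult_distrib)
  have xi: "0 \<le> x $ i" "x $ i \<le> norm x"
    using x component_le_norm_cart[of x i] by (auto simp: orthant_def)
  have "1 - exp (- (x $ i / real (Suc n))) \<le> x $ i / real (Suc n)"
    using exp_ge_add_one_self[of "- (x $ i / real (Suc n))"] by linarith
  then have "exp_chord n (x $ i) \<le> real (Suc n) * (x $ i / real (Suc n))"
    unfolding exp_chord_def by (intro mult_left_mono) auto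
  moreover have "0 \<le> exp_chord n (x $ i)"
    unfolding exp_chord_def using xi by (intro mult_nonneg_nonneg) auto
  ultimately show "\<bar>exp_chord n (x $ i)\<bar> \<le> 1 + norm x" using xi by simp
qed

lemma
  assumes s: "s \<in> {0..T}"
  shows integrable_mom: "l \<le> q \<Longrightarrow> integrable (N s) (\<lambda>x. (w s \<bullet> x - a s) ^ l)"
    and integrable_momx: "Suc l \<le> q \<Longrightarrow> integrable (N s) (\<lambda>x. (w s \<bullet> x - a s) ^ l * x $ i)"
    and centred_moment_le: "l \<le> q \<Longrightarrow> \<bar>centred_moment l s\<bar> \<le> (2 * W) ^ l * (\<integral>x. (1 + norm x) ^ l \<partial>N s)"
    and weighted_moment_le: "Suc l \<le> q \<Longrightarrow> \<bar>weighted_moment l i s\<bar> \<le> (2 * W) ^ l * (\<integral>x. (1 + norm x) ^ Suc l \<partial>N s)"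
proof -
  have s0: "0 \<le> s" using s by simp
  have b: "AE x in N s. \<bar>(w s \<bullet> x - a s) ^ l\<bar> \<le> (2 * W) ^ l * (1 + norm x) ^ l"
    using N_orthant[OF s0] by eventually_elim (rule power_bounds(2)[OF s])
  have bx: "AE x in N s. \<bar>(w s \<bullet> x - a s) ^ l * x $ i\<bar> \<le> (2 * W) ^ l * (1 + norm x) ^ Suc l"
    using N_orthant[OF s0]
  proof eventually_elim
    case (elim x)
    have "\<bar>(w s \<bullet> x - a s) ^ l\<bar> * \<bar>x $ i\<bar> \<le> ((2 * W) ^ l * (1 + norm x) ^ l) * (1 + norm x)"
      using power_bounds(2)[OF s elim, of l] component_le_norm_cart[of x i] by (intro mult_mono') auto
    then show ?case by (simp add: abs_mult mult_ac)
  qed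
  show i1: "integrable (N s) (\<lambda>x. (w s \<bullet> x - a s) ^ l)" if "l \<le> q"
  proof (rule Bochner_Integration.integrable_bound)
    show "integrable (N s) (\<lambda>x. (2 * W) ^ l * (1 + norm x) ^ l)"
      using integrable_norm_power(2)[OF that s0] by simp
    show "AE x in N s. norm ((w s \<bullet> x - a s) ^ l) \<le> norm ((2 * W) ^ l * (1 + norm x) ^ l)"
      using b by eventually_elim auto
  qed measurable
  show i2: "integrable (N s) (\<lambda>x. (w s \<bullet> x - a s) ^ l * x $ i)" if "Suc l \<le> q"
  proof (rule Bochner_Integration.integrable_bound)
    show "integrable (N s) (\<lambda>x. (2 * W) ^ l * (1 + norm x) ^ Suc l)"
      using integrable_norm_power(2)[OF that s0] by simp
    show "AE x in N s. norm ((w s \<bullet> x - a s) ^ l * x $ i) \<le> norm ((2 * W) ^ l * (1 + norm x) ^ Suc l)"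
      using bx by eventually_elim auto
  qed measurable
  show "\<bar>centred_moment l s\<bar> \<le> (2 * W) ^ l * (\<integral>x. (1 + norm x) ^ l \<partial>N s)" if "l \<le> q"
  proof -
    have "\<bar>centred_moment l s\<bar> \<le> (\<integral>x. \<bar>(w s \<bullet> x - a s) ^ l\<bar> \<partial>N s)"
      unfolding centred_moment_def by (rule integral_abs_bound)
    also have "\<dots> \<le> (\<integral>x. (2 * W) ^ l * (1 + norm x) ^ l \<partial>N s)"
      by (rule integral_mono_AE[OF _ _ b]) (use i1[OF that] integrable_norm_power(2)[OF that s0] in auto)
    finally show ?thesis by simp
  qed
  show "\<bar>weighted_moment l i s\<bar> \<le> (2 * W) ^ l * (\<integral>x. (1 + norm x) ^ Suc l \<partial>N s)" if "Suc l \<le> q"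
  proof -
    have "\<bar>weighted_moment l i s\<bar> \<le> (\<integral>x. \<bar>(w s \<bullet> x - a s) ^ l * x $ i\<bar> \<partial>N s)"
      unfolding weighted_moment_def by (rule integral_abs_bound)
    also have "\<dots> \<le> (\<integral>x. (2 * W) ^ l * (1 + norm x) ^ Suc l \<partial>N s)"
      by (rule integral_mono_AE[OF _ _ bx]) (use i2[OF that] integrable_norm_power(2)[OF that s0] in auto)
    finally show ?thesis by simp
  qed
qed

lemma centred_moment_bounded:
  shows "l \<le> q \<Longrightarrow> \<exists>C. \<forall>s\<in>{0..T}. \<bar>centred_moment l s\<bar> \<le> C"
    and "Suc l \<le> q \<Longrightarrow> \<exists>C. \<forall>s\<in>{0..T}. \<bar>weighted_moment l i s\<bar> \<le> C"
proof -
  assume l: "l \<le> q"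
  obtain M where M: "\<And>s. s \<in> {0..T} \<Longrightarrow> (\<integral>x. (1 + norm x) ^ l \<partial>N s) \<le> M"
    using moments[OF l T] by blast
  have "\<bar>centred_moment l s\<bar> \<le> (2 * W) ^ l * M" if "s \<in> {0..T}" for s
    using centred_moment_le[OF that l] M[OF that] W by (meson mult_left_mono order_trans zero_le_power zero_le_mult_iff zero_le_numeral zero_le_one)
  then show "\<exists>C. \<forall>s\<in>{0..T}. \<bar>centred_moment l s\<bar> \<le> C" by blast
next
  assume l: "Suc l \<le> q"
  obtain M where M: "\<And>s. s \<in> {0..T} \<Longrightarrow> (\<integral>x. (1 + norm x) ^ Suc l \<partial>N s) \<le> M"
    using moments[OF l T] by blast
  have "\<bar>weighted_moment l i s\<bar> \<le> (2 * W) ^ l * M" if "s \<in> {0..T}" for s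
    using weighted_moment_le[OF that l] M[OF that] W by (meson mult_left_mono order_trans zero_le_power zero_le_mult_iff zero_le_numeral zero_le_one)
  then show "\<exists>C. \<forall>s\<in>{0..T}. \<bar>weighted_moment l i s\<bar> \<le> C" by blast
qed

text \<open>The moments are pointwise limits of finite combinations of expectations of exponentials,
  and those are continuous in time by \<open>path_exp\<close>. Dominated convergence uses the moment
  of order \<open>l\<close> or \<open>Suc l\<close>.\<close>

lemma centred_moment_measurable:
  shows "l \<le> q \<Longrightarrow> (\<lambda>s. indicator {0..T} s * centred_moment l s) \<in> borel_measurable borel"
    and "Suc l \<le> q \<Longrightarrow> (\<lambda>s. indicator {0..T} s * weighted_moment l i s) \<in> borel_measurable borel"
proof -
  define th where "th n m = real m / real (Suc n)" for n m :: nat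
  have th: "0 \<le> th n m" for n m by (simp add: th_def)
  define E where "E u e s = (\<integral>x. exp (- ((u *\<^sub>R w s + e) \<bullet> x) + u * a s) \<partial>N s)" for u e s
  have TT: "T \<in> {0..T}" using T by simp
  have cE: "continuous_on {0..T} (E u e)" if "0 \<le> u" "e \<in> orthant" for u e
    unfolding E_def[abs_def] by (rule path_exp(3)[OF that TT])
  have ax: "(1 / real (Suc n)) *\<^sub>R axis i 1 \<in> orthant" for n by (auto simp: orthant_def axis_def)
  have iE: "integrable (N s) (\<lambda>x. exp (- ((th n m *\<^sub>R w s + e) \<bullet> x) + th n m * a s))"
    if s: "s \<in> {0..T}" and e: "e \<in> orthant" for s n m and e :: "real ^ 'd"
  proof (rule integrable_exp)
    show "th n m *\<^sub>R w s + e \<in> orthant"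
      using w_o[OF s] e th[of n m] by (auto simp: orthant_def)
  qed (use s in simp)
  show "(\<lambda>s. indicator {0..T} s * centred_moment l s) \<in> borel_measurable borel" if l: "l \<le> q"
  proof (rule borel_measurable_LIMSEQ_real)
    fix n
    have F: "(\<integral>x. pow_approx0 l n (w s \<bullet> x - a s) \<partial>N s) = (\<Sum>m\<le>l. pow_approx_coeff l n m * E (th n m) 0 s)" if s: "s \<in> {0..T}" for s
    proof -
      have "pow_approx0 l n (w s \<bullet> x - a s) = (\<Sum>m\<le>l. pow_approx_coeff l n m * exp (- ((th n m *\<^sub>R w s + 0) \<bullet> x) + th n m * a s))" for x
        unfolding pow_approx_expansion th_def[symmetric] by (simp add: right_diff_distrib)
      then show ?thesis unfolding E_def using iE[OF s zero_orthant] by (simp add: Bochner_Integration.integral_sum)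
    qed
    have "continuous_on {0..T} (\<lambda>s. \<Sum>m\<le>l. pow_approx_coeff l n m * E (th n m) 0 s)"
      by (intro continuous_intros cE th zero_orthant)
    then have "(\<lambda>s. indicator {0..T} s *\<^sub>R (\<Sum>m\<le>l. pow_approx_coeff l n m * E (th n m) 0 s)) \<in> borel_measurable borel"
      by (intro borel_measurable_continuous_on_indicator) auto
    then show "(\<lambda>s. indicator {0..T} s * (\<integral>x. pow_approx0 l n (w s \<bullet> x - a s) \<partial>N s)) \<in> borel_measurable borel"
      by (rule measurable_cong[THEN iffD1, rotated]) (auto simp: F split: split_indicator)
  next
    fix s
    show "(\<lambda>n. indicator {0..T} s * (\<integral>x. pow_approx0 l n (w s \<bullet> x - a s) \<partial>N s)) \<longlonglongrightarrow> indicator {0..T} s * centred_moment l s"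
    proof (cases "s \<in> {0..T}")
      case s: True
      then have s0: "0 \<le> s" by simp
      have "(\<lambda>n. \<integral>x. pow_approx0 l n (w s \<bullet> x - a s) \<partial>N s) \<longlonglongrightarrow> centred_moment l s"
        unfolding centred_moment_def
      proof (rule integral_dominated_convergence[where w = "\<lambda>x. approx_bound l * (1 + norm x) ^ l"])
        show "integrable (N s) (\<lambda>x. approx_bound l * (1 + norm x) ^ l)" using integrable_norm_power(2)[OF l s0] by simp
        show "AE x in N s. norm (pow_approx0 l n (w s \<bullet> x - a s)) \<le> approx_bound l * (1 + norm x) ^ l" for n
          using N_orthant[OF s0] by eventually_elim (simp add: power_bounds(1)[OF s])
        show "AE x in N s. (\<lambda>n. pow_approx0 l n (w s \<bullet> x - a s)) \<longlonglongrightarrow> (w s \<bullet> x - a s) ^ l"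
          by (intro AE_I2 pow_approx_tendsto)
      qed (auto simp: pow_approx0_def exp_chord_def)
      then show ?thesis by (intro tendsto_intros)
    qed simp
  qed
  show "(\<lambda>s. indicator {0..T} s * weighted_moment l i s) \<in> borel_measurable borel" if l: "Suc l \<le> q"
  proof (rule borel_measurable_LIMSEQ_real)
    fix n
    \<comment> \<open>With this shift the factor \<open>exp_chord n (x $ i)\<close>, which stands in
      for \<open>x $ i\<close>, turns into a difference of two exponentials.\<close>
    let ?e = "(1 / real (Suc n)) *\<^sub>R axis i 1 :: real ^ 'd"
    have F: "(\<integral>x. pow_approx0 l n (w s \<bullet> x - a s) * exp_chord n (x $ i) \<partial>N s)
        = (\<Sum>m\<le>l. pow_approx_coeff l n m * (real (Suc n) * (E (th n m) 0 s - E (th n m) ?e s)))" if s: "s \<in> {0..T}" for s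
    proof -
      have g: "exp (- ((th n m *\<^sub>R w s + 0) \<bullet> x) + th n m * a s) * exp_chord n (x $ i)
          = real (Suc n) * (exp (- ((th n m *\<^sub>R w s + 0) \<bullet> x) + th n m * a s) - exp (- ((th n m *\<^sub>R w s + ?e) \<bullet> x) + th n m * a s))" for m x
      proof -
        have "exp (- ((th n m *\<^sub>R w s + ?e) \<bullet> x) + th n m * a s)
            = exp (- ((th n m *\<^sub>R w s + 0) \<bullet> x) + th n m * a s) * exp (- (x $ i / real (Suc n)))"
          by (simp add: inner_add_left inner_axis' flip: exp_add del: of_nat_Suc)
        then show ?thesis by (simp add: exp_chord_def algebra_simps del: of_nat_Suc)
      qed
      have "pow_approx0 l n (w s \<bullet> x - a s) * exp_chord n (x $ i)
          = (\<Sum>m\<le>l. pow_approx_coeff l n m * (exp (- ((th n m *\<^sub>R w s + 0) \<bullet> x) + th n m * a s) * exp_chord n (x $ i)))" for x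
        unfolding pow_approx_expansion th_def[symmetric] sum_distrib_right
        by (intro sum.cong refl) (simp add: right_diff_distrib)
      then show ?thesis
        unfolding E_def g using iE[OF s zero_orthant] iE[OF s ax] by (simp add: Bochner_Integration.integral_sum del: of_nat_Suc)
    qed
    have "continuous_on {0..T} (\<lambda>s. \<Sum>m\<le>l. pow_approx_coeff l n m * (real (Suc n) * (E (th n m) 0 s - E (th n m) ?e s)))"
      by (intro continuous_intros cE th zero_orthant ax)
    then have "(\<lambda>s. indicator {0..T} s *\<^sub>R (\<Sum>m\<le>l. pow_approx_coeff l n m * (real (Suc n) * (E (th n m) 0 s - E (th n m) ?e s)))) \<in> borel_measurable borel"
      by (intro borel_measurable_continuous_on_indicator) auto
    then show "(\<lambda>s. indicator {0..T} s * (\<integral>x. pow_approx0 l n (w s \<bullet> x - a s) * exp_chord n (x $ i) \<partial>N s)) \<in> borel_measurable borel"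
      by (rule measurable_cong[THEN iffD1, rotated]) (auto simp: F split: split_indicator)
  next
    fix s
    show "(\<lambda>n. indicator {0..T} s * (\<integral>x. pow_approx0 l n (w s \<bullet> x - a s) * exp_chord n (x $ i) \<partial>N s)) \<longlonglongrightarrow> indicator {0..T} s * weighted_moment l i s"
    proof (cases "s \<in> {0..T}")
      case s: True
      then have s0: "0 \<le> s" by simp
      have "(\<lambda>n. \<integral>x. pow_approx0 l n (w s \<bullet> x - a s) * exp_chord n (x $ i) \<partial>N s) \<longlonglongrightarrow> weighted_moment l i s"
        unfolding weighted_moment_def
      proof (rule integral_dominated_convergence[where w = "\<lambda>x. approx_bound l * (1 + norm x) ^ Suc l"])
        show "integrable (N s) (\<lambda>x. approx_bound l * (1 + norm x) ^ Suc l)" using integrable_norm_power(2)[OF l s0] by simp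
        show "AE x in N s. norm (pow_approx0 l n (w s \<bullet> x - a s) * exp_chord n (x $ i)) \<le> approx_bound l * (1 + norm x) ^ Suc l" for n
          using N_orthant[OF s0]
        proof eventually_elim
          case (elim x)
          have "\<bar>pow_approx0 l n (w s \<bullet> x - a s)\<bar> * \<bar>exp_chord n (x $ i)\<bar> \<le> (approx_bound l * (1 + norm x) ^ l) * (1 + norm x)"
            using power_bounds(1,3)[OF s elim] by (intro mult_mono') auto
          then show ?case by (simp add: abs_mult mult_ac)
        qed
        show "AE x in N s. (\<lambda>n. pow_approx0 l n (w s \<bullet> x - a s) * exp_chord n (x $ i)) \<longlonglongrightarrow> (w s \<bullet> x - a s) ^ l * x $ i"
        proof (rule AE_I2)
          fix x
          show "(\<lambda>n. pow_approx0 l n (w s \<bullet> x - a s) * exp_chord n (x $ i)) \<longlonglongrightarrow> (w s \<bullet> x - a s) ^ l * x $ i"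
            unfolding exp_chord_def by (intro tendsto_mult pow_approx_tendsto tendsto_one_minus_exp)
        qed
      qed (auto simp: pow_approx0_def exp_chord_def)
      then show ?thesis by (intro tendsto_intros)
    qed simp
  qed
qed

end


section \<open>The recursion for centred moments\<close>

text \<open>The binomial theorem without its top power of \<open>u\<close>. In the second identity
  the compensator is exactly the term \<open>l = k - 1\<close>, so the sum stops at
  \<open>k - 2\<close>.\<close>

lemma power_increment:
  fixes u y :: real
  shows "(u + y) ^ k - u ^ k = (\<Sum>l<k. real (k choose l) * (u ^ l * y ^ (k - l)))"
    "1 \<le> k \<Longrightarrow> (u + y) ^ k - u ^ k - y * (real k * u ^ (k - 1)) = (\<Sum>l<k - 1. real (k choose l) * (u ^ l * y ^ (k - l)))"
proof -
  show 1: "(u + y) ^ k - u ^ k = (\<Sum>l<k. real (k choose l) * (u ^ l * y ^ (k - l)))"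
    unfolding binomial_ring by (simp add: lessThan_Suc_atMost[symmetric] mult_ac)
  assume "1 \<le> k"
  then obtain m where k: "k = Suc m" by (cases k) auto
  show "(u + y) ^ k - u ^ k - y * (real k * u ^ (k - 1)) = (\<Sum>l<k - 1. real (k choose l) * (u ^ l * y ^ (k - l)))"
    unfolding 1 unfolding k by simp
qed

context cbi_path
begin

lemma power_formula:
  assumes k: "1 \<le> k" "k \<le> q" and t: "t \<in> {0..T}"
  shows "(\<integral>x. (w t \<bullet> x - a t) ^ k \<partial>N t) - (\<integral>x. (w 0 \<bullet> x - a 0) ^ k \<partial>N 0) = (LINT s:{0..t}|lborel. \<integral>x. generator_power k s x \<partial>N s)"
proof -
  have K0: "0 \<le> pow_approx_bound W k" using pow_approx_bound_ge(2)[OF k(1), of W] by simp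
  obtain L where L: "0 \<le> L" "\<And>f f1 f2 w a a1 x. power_growth (pow_approx_bound W k) W k f f1 f2 \<Longrightarrow> w \<in> orthant \<Longrightarrow> norm w \<le> W \<Longrightarrow> \<bar>a\<bar> \<le> W \<Longrightarrow>
    \<bar>a1\<bar> \<le> W \<Longrightarrow> x \<in> orthant \<Longrightarrow> \<bar>generator f f1 f2 w a a1 x\<bar> \<le> L * (1 + norm x) ^ Suc (k - 2)"
    using generator_bound[OF K0 k W] by blast
  have "Suc (k - 2) \<le> q" using k by simp
  from moments[OF this T] obtain Mb where Mb: "\<And>s. s \<in> {0..T} \<Longrightarrow> integrable (N s) (\<lambda>x. (1 + norm x) ^ Suc (k - 2))"
    "\<And>s. s \<in> {0..T} \<Longrightarrow> (\<integral>x. (1 + norm x) ^ Suc (k - 2) \<partial>N s) \<le> Mb" by blast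
  have i: "integrable (N t) (\<lambda>x. norm x ^ k)" using integrable_norm_power(1)[OF k(2)] t by simp
  show ?thesis
    by (rule dyn_power[OF k L(1), where Mb = Mb]; use L(2) Mb t i in \<open>auto simp del: power_Suc\<close>)
qed

end

lemma set_integral_add3:
  fixes f g h :: "'a \<Rightarrow> real"
  assumes "set_integrable M A f" "set_integrable M A g" "set_integrable M A h"
  shows "(LINT s:A|M. f s + g s + h s) = (LINT s:A|M. f s) + (LINT s:A|M. g s) + (LINT s:A|M. h s)"
  using assms by (simp add: set_integral_add)

text \<open>Fixes the derivative of the centring so that the term of order \<open>k - 1\<close>,
  which would otherwise survive in the immigration part, is cancelled. The constant of integration
  in \<open>a\<close> is still free.\<close>

locale cbi_mean_path = cbi_path c \<beta> B \<nu> \<mu> q v N w a a' T W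
  for c \<beta> :: "real ^ 'd" and B :: "real ^ 'd ^ 'd"
    and \<nu> :: "(real ^ 'd) measure" and \<mu> :: "'d \<Rightarrow> (real ^ 'd) measure" and q :: nat and v N w a a' T W +
  assumes w_meas: "w \<in> borel_measurable borel" and a'_mean: "\<And>s. s \<in> {0..T} \<Longrightarrow> a' s = mean_drift \<bullet> w s"
begin

text \<open>The jump increments are expanded binomially and integrated termwise. For
  \<open>\<nu>\<close> the term \<open>l = k - 1\<close> survives the expansion: it is
  \<open>k * u ^ (k - 1)\<close> times the mean of \<open>w s \<bullet> z\<close>, and it meets its
  negative in the drift term
  \<open>(\<beta> \<bullet> w s - a' s) * k * u ^ (k - 1)\<close>.\<close>

lemma generator_power_expectation:
  assumes k: "1 \<le> k" "k \<le> q" and s: "s \<in> {0..T}"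
  shows "(\<integral>x. generator_power k s x \<partial>N s) = (\<Sum>i\<in>UNIV. (real (k * (k - 1)) * c $ i) * ((w s $ i)\<^sup>2 * weighted_moment (k - 2) i s))
    + (\<Sum>l<k - 1. real (k choose l) * (\<Sum>i\<in>UNIV. \<integral>z. (w s \<bullet> z) ^ (k - l) * weighted_moment l i s \<partial>\<mu> i))
    + (\<Sum>l<k - 1. real (k choose l) * (\<integral>z. (w s \<bullet> z) ^ (k - l) * centred_moment l s \<partial>\<nu>))"
proof -
  have s0: "0 \<le> s" using s by simp
  define jm where "jm p i = (\<integral>z. (w s \<bullet> z) ^ p \<partial>\<mu> i)" for p i
  define jn where "jn p = (\<integral>z. (w s \<bullet> z) ^ p \<partial>\<nu>)" for p
  have bd: "\<bar>(w s \<bullet> z) ^ p\<bar> \<le> W ^ p * norm z ^ p" for z p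
  proof -
    have "\<bar>w s \<bullet> z\<bar> \<le> W * norm z"
      using Cauchy_Schwarz_ineq2[of "w s" z] mult_right_mono[OF w_n[OF s], of "norm z"] by simp
    then have "\<bar>w s \<bullet> z\<bar> ^ p \<le> (W * norm z) ^ p" by (intro power_mono) auto
    then show ?thesis by (simp add: power_abs power_mult_distrib)
  qed
  have im: "integrable (\<mu> i) (\<lambda>z. (w s \<bullet> z) ^ p)" if "2 \<le> p" "p \<le> q" for p i
  proof (rule Bochner_Integration.integrable_bound)
    show "integrable (\<mu> i) (\<lambda>z. W ^ p * norm z ^ p)" using int_mu_power[OF that] by simp
    show "AE z in \<mu> i. norm ((w s \<bullet> z) ^ p) \<le> norm (W ^ p * norm z ^ p)"
      using bd W by (intro AE_I2) simp
  qed (auto intro!: meas_jump)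
  have ino: "integrable \<nu> (\<lambda>z. (w s \<bullet> z) ^ p)" if "1 \<le> p" "p \<le> q" for p
  proof (rule Bochner_Integration.integrable_bound)
    show "integrable \<nu> (\<lambda>z. W ^ p * norm z ^ p)" using int_nu_power[OF that] by simp
    show "AE z in \<nu>. norm ((w s \<bullet> z) ^ p) \<le> norm (W ^ p * norm z ^ p)"
      using bd W by (intro AE_I2) simp
  qed (auto intro!: meas_jump)
  have 1: "(\<integral>z. (u + w s \<bullet> z) ^ k - u ^ k - (w s \<bullet> z) * (real k * u ^ (k - 1)) \<partial>\<mu> i)
      = (\<Sum>l<k - 1. real (k choose l) * (u ^ l * jm (k - l) i))" for u i
    unfolding power_increment(2)[OF k(1)] jm_def using im k
    by (subst Bochner_Integration.integral_sum) auto
  have 2: "(\<integral>z. (u + w s \<bullet> z) ^ k - u ^ k \<partial>\<nu>)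
      = (\<Sum>l<k - 1. real (k choose l) * (u ^ l * jn (k - l))) + real k * u ^ (k - 1) * jn 1" for u
  proof -
    have "(\<integral>z. (u + w s \<bullet> z) ^ k - u ^ k \<partial>\<nu>) = (\<Sum>l<k. real (k choose l) * (u ^ l * jn (k - l)))"
      unfolding power_increment(1) jn_def using ino k
      by (subst Bochner_Integration.integral_sum) auto
    also have "\<dots> = (\<Sum>l<Suc (k - 1). real (k choose l) * (u ^ l * jn (k - l)))"
      using k by simp
    also have "\<dots> = (\<Sum>l<k - 1. real (k choose l) * (u ^ l * jn (k - l))) + real (k choose (k - 1)) * (u ^ (k - 1) * jn (k - (k - 1)))"
      by (rule sum.lessThan_Suc)
    also have "k - (k - 1) = 1" using k by simp
    also have "k choose (k - 1) = k" using k binomial_symmetric[of "k - 1" k] by simp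
    finally show ?thesis by (simp add: mult_ac)
  qed
  let ?Z = "\<lambda>x. w s \<bullet> x - a s"
  have a': "a' s = \<beta> \<bullet> w s + jn 1" unfolding a'_mean[OF s] mean_drift_inner jn_def by simp
  have G_eq: "generator_power k s x = (\<Sum>i\<in>UNIV. (real (k * (k - 1)) * c $ i) * ((w s $ i)\<^sup>2 * (?Z x ^ (k - 2) * x $ i)))
      + (\<Sum>l<k - 1. real (k choose l) * (\<Sum>i\<in>UNIV. jm (k - l) i * (?Z x ^ l * x $ i)))
      + (\<Sum>l<k - 1. real (k choose l) * (jn (k - l) * ?Z x ^ l))" for x
  proof -
    have "(\<Sum>i\<in>UNIV. x $ i * (c $ i * (w s $ i)\<^sup>2 * (real k * (real (k - 1) * ?Z x ^ (k - 2)))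
          + (\<Sum>l<k - 1. real (k choose l) * (?Z x ^ l * jm (k - l) i))))
        = (\<Sum>i\<in>UNIV. (real (k * (k - 1)) * c $ i) * ((w s $ i)\<^sup>2 * (?Z x ^ (k - 2) * x $ i)))
          + (\<Sum>i\<in>UNIV. \<Sum>l<k - 1. real (k choose l) * (jm (k - l) i * (?Z x ^ l * x $ i)))"
      unfolding sum.distrib[symmetric] by (intro sum.cong refl) (simp add: distrib_left sum_distrib_left mult_ac)
    also have "(\<Sum>i\<in>UNIV. \<Sum>l<k - 1. real (k choose l) * (jm (k - l) i * (?Z x ^ l * x $ i)))
        = (\<Sum>l<k - 1. real (k choose l) * (\<Sum>i\<in>UNIV. jm (k - l) i * (?Z x ^ l * x $ i)))"
      unfolding sum_distrib_left by (rule sum.swap)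
    finally show ?thesis
      unfolding generator_power_def generator_def 1 2 a' by (simp add: algebra_simps)
  qed
  have ix: "integrable (N s) (\<lambda>x. ?Z x ^ l * x $ i)" if "l < k - 1" for l i
    using integrable_momx[OF s, of l i] that k by simp
  have ik: "integrable (N s) (\<lambda>x. real (k * (k - 1)) * c $ i * ((w s $ i)\<^sup>2 * (?Z x ^ (k - 2) * x $ i)))" for i
  \<comment> \<open>For \<open>k = 1\<close> the exponent \<open>k - 2\<close> is truncated to
    \<open>0\<close>, but the factor \<open>k - 1\<close> makes the whole function zero.\<close>
  proof (cases "k = 1")
    case False
    then have "Suc (k - 2) \<le> q" using k by simp
    then show ?thesis using integrable_momx[OF s] by simp
  qed simp
  have im0: "integrable (N s) (\<lambda>x. ?Z x ^ l)" if "l < k - 1" for l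
    using integrable_mom[OF s, of l] that k by simp
  have "(\<integral>x. generator_power k s x \<partial>N s) = (\<Sum>i\<in>UNIV. (real (k * (k - 1)) * c $ i) * ((w s $ i)\<^sup>2 * weighted_moment (k - 2) i s))
      + (\<Sum>l<k - 1. real (k choose l) * (\<Sum>i\<in>UNIV. jm (k - l) i * weighted_moment l i s))
      + (\<Sum>l<k - 1. real (k choose l) * (jn (k - l) * centred_moment l s))"
  proof -
    let ?F = "\<lambda>x. \<Sum>i\<in>UNIV. (real (k * (k - 1)) * c $ i) * ((w s $ i)\<^sup>2 * (?Z x ^ (k - 2) * x $ i))"
    let ?G = "\<lambda>x. \<Sum>l<k - 1. real (k choose l) * (\<Sum>i\<in>UNIV. jm (k - l) i * (?Z x ^ l * x $ i))"
    let ?H = "\<lambda>x. \<Sum>l<k - 1. real (k choose l) * (jn (k - l) * ?Z x ^ l)"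
    have F: "integrable (N s) ?F" "(\<integral>x. ?F x \<partial>N s) = (\<Sum>i\<in>UNIV. (real (k * (k - 1)) * c $ i) * ((w s $ i)\<^sup>2 * weighted_moment (k - 2) i s))"
      using ik by (intro Bochner_Integration.integrable_sum, blast)
        (subst Bochner_Integration.integral_sum[OF ik], simp only: integral_mult_right_zero weighted_moment_def)
    have Gi: "integrable (N s) (\<lambda>x. real (k choose l) * (\<Sum>i\<in>UNIV. jm (k - l) i * (?Z x ^ l * x $ i)))"
      "(\<integral>x. real (k choose l) * (\<Sum>i\<in>UNIV. jm (k - l) i * (?Z x ^ l * x $ i)) \<partial>N s)
        = real (k choose l) * (\<Sum>i\<in>UNIV. jm (k - l) i * weighted_moment l i s)" if "l \<in> {..<k - 1}" for l
      using ix that by (auto simp: weighted_moment_def Bochner_Integration.integral_sum)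
    have G: "integrable (N s) ?G" "(\<integral>x. ?G x \<partial>N s) = (\<Sum>l<k - 1. real (k choose l) * (\<Sum>i\<in>UNIV. jm (k - l) i * weighted_moment l i s))"
      by (rule Bochner_Integration.integrable_sum[OF Gi(1)], assumption)
        (subst Bochner_Integration.integral_sum[OF Gi(1)], assumption, rule sum.cong[OF refl Gi(2)])
    have Hi: "integrable (N s) (\<lambda>x. real (k choose l) * (jn (k - l) * ?Z x ^ l))"
      "(\<integral>x. real (k choose l) * (jn (k - l) * ?Z x ^ l) \<partial>N s) = real (k choose l) * (jn (k - l) * centred_moment l s)" if "l \<in> {..<k - 1}" for l
      using im0 that by (auto simp: centred_moment_def)
    have H: "integrable (N s) ?H" "(\<integral>x. ?H x \<partial>N s) = (\<Sum>l<k - 1. real (k choose l) * (jn (k - l) * centred_moment l s))"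
      by (rule Bochner_Integration.integrable_sum[OF Hi(1)], assumption)
        (subst Bochner_Integration.integral_sum[OF Hi(1)], assumption, rule sum.cong[OF refl Hi(2)])
    have "(\<integral>x. generator_power k s x \<partial>N s) = (\<integral>x. ?F x + ?G x + ?H x \<partial>N s)"
      by (simp only: G_eq)
    also have "\<dots> = (\<integral>x. ?F x \<partial>N s) + (\<integral>x. ?G x \<partial>N s) + (\<integral>x. ?H x \<partial>N s)"
      by (subst Bochner_Integration.integral_add[OF Bochner_Integration.integrable_add[OF F(1) G(1)] H(1)],
          subst Bochner_Integration.integral_add[OF F(1) G(1)]) (rule refl)
    finally show ?thesis unfolding F(2) G(2) H(2) .
  qed
  then show ?thesis
    unfolding jm_def jn_def by simp
qed

lemma main_formula:
  assumes k: "1 \<le> k" "k \<le> q"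
  shows "2 \<le> k \<Longrightarrow> set_integrable lborel {0..T} (\<lambda>s. (w s $ i)\<^sup>2 * weighted_moment (k - 2) i s)"
    "l < k - 1 \<Longrightarrow> integrable (restrict_space lborel {0..T} \<Otimes>\<^sub>M \<mu> i) (\<lambda>(s, z). (w s \<bullet> z) ^ (k - l) * weighted_moment l i s)"
    "l < k - 1 \<Longrightarrow> integrable (restrict_space lborel {0..T} \<Otimes>\<^sub>M \<nu>) (\<lambda>(s, z). (w s \<bullet> z) ^ (k - l) * centred_moment l s)"
    "(\<integral>x. (w T \<bullet> x - a T) ^ k \<partial>N T) = (\<integral>x. (w 0 \<bullet> x - a 0) ^ k \<partial>N 0) +
      (real (k * (k - 1)) * (\<Sum>i\<in>UNIV. c $ i * (LINT s:{0..T}|lborel. (w s $ i)\<^sup>2 * weighted_moment (k - 2) i s))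
      + (\<Sum>l<k - 1. real (k choose l) * (\<Sum>i\<in>UNIV. LINT s:{0..T}|lborel. \<integral>z. (w s \<bullet> z) ^ (k - l) * weighted_moment l i s \<partial>\<mu> i))
      + (\<Sum>l<k - 1. real (k choose l) * (LINT s:{0..T}|lborel. \<integral>z. (w s \<bullet> z) ^ (k - l) * centred_moment l s \<partial>\<nu>)))"
proof -
  have TT: "T \<in> {0..T}" using T by simp
  have f: "set_integrable lborel {0..T} (\<lambda>s. (w s $ i)\<^sup>2 * weighted_moment (k - 2) i s)" if "2 \<le> k" for i
  proof -
    have kq: "Suc (k - 2) \<le> q" using k that by simp
    obtain C where C: "\<And>s. s \<in> {0..T} \<Longrightarrow> \<bar>weighted_moment (k - 2) i s\<bar> \<le> C" using centred_moment_bounded(2)[OF kq] by blast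
    show ?thesis
    proof (rule set_integrable_bounded[OF T])
      have "(\<lambda>s. w s $ i) \<in> borel_measurable borel"
        by (rule measurable_compose[OF w_meas]) measurable
      then have "(\<lambda>s. (w s $ i)\<^sup>2 * (indicator {0..T} s * weighted_moment (k - 2) i s)) \<in> borel_measurable borel"
        by (intro borel_measurable_times borel_measurable_power centred_moment_measurable(2)[OF kq])
      then show "(\<lambda>s. indicator {0..T} s * ((w s $ i)\<^sup>2 * weighted_moment (k - 2) i s)) \<in> borel_measurable borel"
        by (simp add: mult_ac)
      show "\<bar>(w s $ i)\<^sup>2 * weighted_moment (k - 2) i s\<bar> \<le> W\<^sup>2 * C" if s: "s \<in> {0..T}" for s
      proof -
        have "(w s $ i)\<^sup>2 \<le> W\<^sup>2"
          using component_le_norm_cart[of "w s" i] w_n[OF s] by (metis abs_ge_zero order_trans power2_abs power_mono)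
        then show ?thesis
          using C[OF s] unfolding abs_mult by (intro mult_mono') auto
      qed
    qed
  qed
  have g: "integrable (restrict_space lborel {0..T} \<Otimes>\<^sub>M \<mu> i) (\<lambda>(s, z). (w s \<bullet> z) ^ (k - l) * weighted_moment l i s)"
    "set_integrable lborel {0..T} (\<lambda>s. \<integral>z. (w s \<bullet> z) ^ (k - l) * weighted_moment l i s \<partial>\<mu> i)" if l: "l < k - 1" for l i
  proof -
    have lq: "Suc l \<le> q" "2 \<le> k - l" "k - l \<le> q" using k l by auto
    obtain C where C: "\<And>s. s \<in> {0..T} \<Longrightarrow> \<bar>weighted_moment l i s\<bar> \<le> C" using centred_moment_bounded(2)[OF lq(1)] by blast
    note jp = jump_product[OF sigma_finite_jump(2) id_jump(2) int_mu_power[OF lq(2,3)] w_meas w_n centred_moment_measurable(2)[OF lq(1)] C T]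
    show "integrable (restrict_space lborel {0..T} \<Otimes>\<^sub>M \<mu> i) (\<lambda>(s, z). (w s \<bullet> z) ^ (k - l) * weighted_moment l i s)"
      "set_integrable lborel {0..T} (\<lambda>s. \<integral>z. (w s \<bullet> z) ^ (k - l) * weighted_moment l i s \<partial>\<mu> i)"
      by (rule jp; assumption)+
  qed
  have h: "integrable (restrict_space lborel {0..T} \<Otimes>\<^sub>M \<nu>) (\<lambda>(s, z). (w s \<bullet> z) ^ (k - l) * centred_moment l s)"
    "set_integrable lborel {0..T} (\<lambda>s. \<integral>z. (w s \<bullet> z) ^ (k - l) * centred_moment l s \<partial>\<nu>)" if l: "l < k - 1" for l
  proof -
    have lq: "l \<le> q" "1 \<le> k - l" "k - l \<le> q" using k l by auto
    obtain C where C: "\<And>s. s \<in> {0..T} \<Longrightarrow> \<bar>centred_moment l s\<bar> \<le> C" using centred_moment_bounded(1)[OF lq(1)] by blast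
    note jp = jump_product[OF sigma_finite_jump(1) id_jump(1) int_nu_power[OF lq(2,3)] w_meas w_n centred_moment_measurable(1)[OF lq(1)] C T]
    show "integrable (restrict_space lborel {0..T} \<Otimes>\<^sub>M \<nu>) (\<lambda>(s, z). (w s \<bullet> z) ^ (k - l) * centred_moment l s)"
      "set_integrable lborel {0..T} (\<lambda>s. \<integral>z. (w s \<bullet> z) ^ (k - l) * centred_moment l s \<partial>\<nu>)"
      by (rule jp; assumption)+
  qed
  show "2 \<le> k \<Longrightarrow> set_integrable lborel {0..T} (\<lambda>s. (w s $ i)\<^sup>2 * weighted_moment (k - 2) i s)" by (rule f)
  show "l < k - 1 \<Longrightarrow> integrable (restrict_space lborel {0..T} \<Otimes>\<^sub>M \<mu> i) (\<lambda>(s, z). (w s \<bullet> z) ^ (k - l) * weighted_moment l i s)" by (rule g)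
  show "l < k - 1 \<Longrightarrow> integrable (restrict_space lborel {0..T} \<Otimes>\<^sub>M \<nu>) (\<lambda>(s, z). (w s \<bullet> z) ^ (k - l) * centred_moment l s)" by (rule h)
  have "(\<integral>x. (w T \<bullet> x - a T) ^ k \<partial>N T) - (\<integral>x. (w 0 \<bullet> x - a 0) ^ k \<partial>N 0) = (LINT s:{0..T}|lborel. \<integral>x. generator_power k s x \<partial>N s)"
    by (rule power_formula[OF k TT])
  \<comment> \<open>The factor \<open>1 *\<close> brings the inner sums into the shape of
    \<open>set_integral_lin_comb\<close>; it is simplified away at the end.\<close>
  also have "\<dots> = (LINT s:{0..T}|lborel. (\<Sum>i\<in>UNIV. (real (k * (k - 1)) * c $ i) * ((w s $ i)\<^sup>2 * weighted_moment (k - 2) i s))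
    + (\<Sum>l<k - 1. real (k choose l) * (\<Sum>i\<in>UNIV. 1 * (\<integral>z. (w s \<bullet> z) ^ (k - l) * weighted_moment l i s \<partial>\<mu> i)))
    + (\<Sum>l<k - 1. real (k choose l) * (\<integral>z. (w s \<bullet> z) ^ (k - l) * centred_moment l s \<partial>\<nu>)))"
    by (rule set_lebesgue_integral_cong) (auto simp: generator_power_expectation[OF k] simp del: of_nat_mult)
  also have "\<dots> = (\<Sum>i\<in>UNIV. (real (k * (k - 1)) * c $ i) * (LINT s:{0..T}|lborel. (w s $ i)\<^sup>2 * weighted_moment (k - 2) i s))
      + (\<Sum>l<k - 1. real (k choose l) * (\<Sum>i\<in>UNIV. 1 * (LINT s:{0..T}|lborel. \<integral>z. (w s \<bullet> z) ^ (k - l) * weighted_moment l i s \<partial>\<mu> i)))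
      + (\<Sum>l<k - 1. real (k choose l) * (LINT s:{0..T}|lborel. \<integral>z. (w s \<bullet> z) ^ (k - l) * centred_moment l s \<partial>\<nu>))"
  proof -
    have F: "set_integrable lborel {0..T} (\<lambda>s. \<Sum>i\<in>UNIV. (real (k * (k - 1)) * c $ i) * ((w s $ i)\<^sup>2 * weighted_moment (k - 2) i s))
        \<and> (LINT s:{0..T}|lborel. \<Sum>i\<in>UNIV. (real (k * (k - 1)) * c $ i) * ((w s $ i)\<^sup>2 * weighted_moment (k - 2) i s))
          = (\<Sum>i\<in>UNIV. (real (k * (k - 1)) * c $ i) * (LINT s:{0..T}|lborel. (w s $ i)\<^sup>2 * weighted_moment (k - 2) i s))"
    proof (cases "2 \<le> k")
      case True
      then show ?thesis by (intro conjI set_integral_lin_comb f)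
    next
      case False
      then have "k = 1" using k by simp
      then show ?thesis by (simp add: set_integrable_def set_lebesgue_integral_def)
    qed
    have G: "set_integrable lborel {0..T} (\<lambda>s. \<Sum>i\<in>UNIV. 1 * (\<integral>z. (w s \<bullet> z) ^ (k - l) * weighted_moment l i s \<partial>\<mu> i))"
      "(LINT s:{0..T}|lborel. \<Sum>i\<in>UNIV. 1 * (\<integral>z. (w s \<bullet> z) ^ (k - l) * weighted_moment l i s \<partial>\<mu> i))
        = (\<Sum>i\<in>UNIV. 1 * (LINT s:{0..T}|lborel. \<integral>z. (w s \<bullet> z) ^ (k - l) * weighted_moment l i s \<partial>\<mu> i))" if "l \<in> {..<k - 1}" for l
      by (rule set_integral_lin_comb; use g that in simp)+
    note G2 = set_integral_lin_comb[of "{..<k - 1}", OF G(1)]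
    have H: "set_integrable lborel {0..T} (\<lambda>s. \<integral>z. (w s \<bullet> z) ^ (k - l) * centred_moment l s \<partial>\<nu>)" if "l \<in> {..<k - 1}" for l
      using h that by simp
    note H2 = set_integral_lin_comb[of "{..<k - 1}", OF H]
    have G3: "(LINT s:{0..T}|lborel. \<Sum>l<k - 1. real (k choose l) * (\<Sum>i\<in>UNIV. 1 * (\<integral>z. (w s \<bullet> z) ^ (k - l) * weighted_moment l i s \<partial>\<mu> i)))
        = (\<Sum>l<k - 1. real (k choose l) * (\<Sum>i\<in>UNIV. 1 * (LINT s:{0..T}|lborel. \<integral>z. (w s \<bullet> z) ^ (k - l) * weighted_moment l i s \<partial>\<mu> i)))"
      by (rule trans[OF G2(2)], assumption, rule sum.cong[OF refl], simp only: G(2))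
    show ?thesis
      by (rule trans[OF set_integral_add3[OF conjunct1[OF F] G2(1) H2(1)]]; (assumption)?)
        (simp only: conjunct2[OF F] G3 H2(2))
  qed
  finally show "(\<integral>x. (w T \<bullet> x - a T) ^ k \<partial>N T) = (\<integral>x. (w 0 \<bullet> x - a 0) ^ k \<partial>N 0) +
      (real (k * (k - 1)) * (\<Sum>i\<in>UNIV. c $ i * (LINT s:{0..T}|lborel. (w s $ i)\<^sup>2 * weighted_moment (k - 2) i s))
      + (\<Sum>l<k - 1. real (k choose l) * (\<Sum>i\<in>UNIV. LINT s:{0..T}|lborel. \<integral>z. (w s \<bullet> z) ^ (k - l) * weighted_moment l i s \<partial>\<mu> i))
      + (\<Sum>l<k - 1. real (k choose l) * (LINT s:{0..T}|lborel. \<integral>z. (w s \<bullet> z) ^ (k - l) * centred_moment l s \<partial>\<nu>)))"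
    by (simp add: sum_distrib_left mult.assoc del: of_nat_mult)
qed

end


section \<open>Central moments and cumulants\<close>

text \<open>Differentiation under the integral. As \<open>Z\<close> is bounded below by
  \<open>- A\<close>, the exponential is at most \<open>exp (R' * A)\<close> for parameters in
  \<open>[0, R']\<close>, and a Lipschitz estimate leaves \<open>\<bar>Z\<bar> ^ Suc r\<close> as a
  majorant. \<open>Z\<close> may be unbounded above, so the parameter stays non-negative and the
  derivative at \<open>0\<close> is one-sided.\<close>

lemma exp_moment_derivative:
  fixes Z :: "'a \<Rightarrow> real"
  assumes Zm: "Z \<in> borel_measurable M" and A: "AE x in M. - A \<le> Z x" "0 \<le> A"
    and i: "integrable M (\<lambda>x. Z x ^ r)" "integrable M (\<lambda>x. Z x ^ Suc r)" and th: "0 \<le> th"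
  shows "((\<lambda>th. \<integral>x. (- Z x) ^ r * exp (- (th * Z x)) \<partial>M) has_real_derivative
      (\<integral>x. (- Z x) ^ Suc r * exp (- (th * Z x)) \<partial>M)) (at th within {0..})"
proof -
  note [measurable] = Zm
  have int: "integrable M (\<lambda>x. (- Z x) ^ r * exp (- (u * Z x)))" if u: "0 \<le> u" for u
  proof (rule Bochner_Integration.integrable_bound)
    show "integrable M (\<lambda>x. \<bar>Z x ^ r\<bar> * exp (u * A))" using i by (intro integrable_mult_left integrable_abs)
    show "AE x in M. norm ((- Z x) ^ r * exp (- (u * Z x))) \<le> norm (\<bar>Z x ^ r\<bar> * exp (u * A))"
      using A(1)
    proof eventually_elim
      case (elim x)
      have "u * - A \<le> u * Z x" using elim u by (rule mult_left_mono)
      then have "exp (- (u * Z x)) \<le> exp (u * A)" by simp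
      then show ?case by (simp add: abs_mult power_abs mult_left_mono)
    qed
  qed measurable
  show ?thesis
    unfolding has_field_derivative_iff tendsto_at_iff_sequentially
  proof (intro allI impI)
    fix Y :: "nat \<Rightarrow> real"
    assume Y: "\<forall>n. Y n \<in> {0..} - {th}" and lim: "Y \<longlonglongrightarrow> th"
    \<comment> \<open>A convergent sequence is bounded, which confines all parameters to one
      interval.\<close>
    obtain R where R: "\<And>n. Y n \<le> R"
    proof -
      obtain K where "\<And>n. \<bar>Y n\<bar> \<le> K" using convergent_imp_Bseq[OF convergentI[OF lim]] unfolding Bseq_def by auto
      then show ?thesis using that[of K] by (meson abs_ge_self order_trans)
    qed
    define R' where "R' = max R th"
    have YR: "0 \<le> Y n" "Y n \<noteq> th" "Y n \<le> R'" for n using Y R by (auto simp: R'_def intro: le_max_iff_disj[THEN iffD2])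
    let ?q = "\<lambda>n x. (- Z x) ^ r * ((exp (- (Y n * Z x)) - exp (- (th * Z x))) / (Y n - th))"
    have "(\<lambda>n. \<integral>x. ?q n x \<partial>M) \<longlonglongrightarrow> (\<integral>x. (- Z x) ^ Suc r * exp (- (th * Z x)) \<partial>M)"
    proof (rule integral_dominated_convergence[where w = "\<lambda>x. \<bar>Z x ^ Suc r\<bar> * exp (R' * A)"])
      show "integrable M (\<lambda>x. \<bar>Z x ^ Suc r\<bar> * exp (R' * A))" by (intro integrable_mult_left integrable_abs i(2))
      show "AE x in M. (\<lambda>n. ?q n x) \<longlonglongrightarrow> (- Z x) ^ Suc r * exp (- (th * Z x))"
      proof (rule AE_I2)
        fix x
        have D: "((\<lambda>u. exp (- (u * Z x))) has_real_derivative - Z x * exp (- (th * Z x))) (at th within {0..})"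
          by (auto intro!: derivative_eq_intros)
        have "(\<lambda>n. (exp (- (Y n * Z x)) - exp (- (th * Z x))) / (Y n - th)) \<longlonglongrightarrow> - Z x * exp (- (th * Z x))"
          using D[unfolded has_field_derivative_iff tendsto_at_iff_sequentially] Y lim by (auto simp: comp_def)
        then have "(\<lambda>n. ?q n x) \<longlonglongrightarrow> (- Z x) ^ r * (- Z x * exp (- (th * Z x)))"
          by (intro tendsto_intros)
        then show "(\<lambda>n. ?q n x) \<longlonglongrightarrow> (- Z x) ^ Suc r * exp (- (th * Z x))" by (simp add: mult_ac)
      qed
      show "AE x in M. norm (?q n x) \<le> \<bar>Z x ^ Suc r\<bar> * exp (R' * A)" for n
        using A(1)
      proof eventually_elim
        case (elim x)
        have b: "- (u * Z x) \<le> R' * A" if "0 \<le> u" "u \<le> R'" for u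
        proof -
          have "u * - A \<le> u * Z x" using elim that(1) by (rule mult_left_mono)
          moreover have "u * A \<le> R' * A" using that A by (intro mult_right_mono)
          ultimately show ?thesis by simp
        qed
        have "\<bar>exp (- (Y n * Z x)) - exp (- (th * Z x))\<bar> \<le> exp (R' * A) * \<bar>- (Y n * Z x) - - (th * Z x)\<bar>"
          by (intro exp_diff_le b) (use YR[of n] th in \<open>auto simp: R'_def\<close>)
        also have "\<bar>- (Y n * Z x) - - (th * Z x)\<bar> = \<bar>Y n - th\<bar> * \<bar>Z x\<bar>"
          by (subst abs_mult[symmetric]) (simp add: left_diff_distrib abs_minus_commute)
        finally have "\<bar>exp (- (Y n * Z x)) - exp (- (th * Z x))\<bar> / \<bar>Y n - th\<bar> \<le> exp (R' * A) * \<bar>Z x\<bar>"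
          using YR(2)[of n] by (simp add: divide_le_eq mult_ac)
        then have "\<bar>Z x\<bar> ^ r * (\<bar>exp (- (Y n * Z x)) - exp (- (th * Z x))\<bar> / \<bar>Y n - th\<bar>) \<le> \<bar>Z x\<bar> ^ r * (exp (R' * A) * \<bar>Z x\<bar>)"
          by (intro mult_left_mono) auto
        then show ?case by (simp add: abs_mult power_abs mult_ac)
      qed
    qed measurable
    moreover have q_eq: "(\<integral>x. ?q n x \<partial>M) = ((\<integral>x. (- Z x) ^ r * exp (- (Y n * Z x)) \<partial>M) - (\<integral>x. (- Z x) ^ r * exp (- (th * Z x)) \<partial>M)) / (Y n - th)" for n
    proof -
      have "?q n x = ((- Z x) ^ r * exp (- (Y n * Z x)) - (- Z x) ^ r * exp (- (th * Z x))) / (Y n - th)" for x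
        by (simp add: right_diff_distrib)
      then have "(\<integral>x. ?q n x \<partial>M) = (\<integral>x. ((- Z x) ^ r * exp (- (Y n * Z x)) - (- Z x) ^ r * exp (- (th * Z x))) / (Y n - th) \<partial>M)"
        by (rule Bochner_Integration.integral_cong[OF refl])
      also have "\<dots> = ((\<integral>x. (- Z x) ^ r * exp (- (Y n * Z x)) \<partial>M) - (\<integral>x. (- Z x) ^ r * exp (- (th * Z x)) \<partial>M)) / (Y n - th)"
        by (simp only: integral_divide_zero Bochner_Integration.integral_diff[OF int[OF YR(1)] int[OF th]])
      finally show ?thesis .
    qed
    ultimately show "((\<lambda>y. ((\<integral>x. (- Z x) ^ r * exp (- (y * Z x)) \<partial>M) - (\<integral>x. (- Z x) ^ r * exp (- (th * Z x)) \<partial>M)) / (y - th)) \<circ> Y)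
        \<longlonglongrightarrow> (\<integral>x. (- Z x) ^ Suc r * exp (- (th * Z x)) \<partial>M)"
      by (simp only: comp_def q_eq)
  qed
qed

text \<open>\<open>n\<close>-fold differentiability on \<open>[0, \<infinity>)\<close>, one-sided at
  \<open>0\<close>. The derivatives are hidden behind an existential, so that closure under sums,
  products and quotients needs no formula for higher derivatives.\<close>

fun times_diff :: "nat \<Rightarrow> (real \<Rightarrow> real) \<Rightarrow> bool" where
  "times_diff 0 f = True"
| "times_diff (Suc n) f = (\<exists>f'. (\<forall>x\<ge>0. (f has_real_derivative f' x) (at x within {0..})) \<and> times_diff n f')"

lemma times_diff_Suc_imp: "times_diff (Suc n) f \<Longrightarrow> times_diff n f"
  by (induction n arbitrary: f) auto

lemma times_diff_add: "times_diff n f \<Longrightarrow> times_diff n g \<Longrightarrow> times_diff n (\<lambda>x. f x + g x)"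
proof (induction n arbitrary: f g)
  case (Suc n)
  then obtain f' g' where "\<forall>x\<ge>0. (f has_real_derivative f' x) (at x within {0..})" "times_diff n f'"
    "\<forall>x\<ge>0. (g has_real_derivative g' x) (at x within {0..})" "times_diff n g'" by auto
  then show ?case using Suc.IH[of f' g'] by (auto intro!: exI[of _ "\<lambda>x. f' x + g' x"] derivative_eq_intros)
qed simp

lemma times_diff_minus: "times_diff n f \<Longrightarrow> times_diff n (\<lambda>x. - f x)"
proof (induction n arbitrary: f)
  case (Suc n)
  then obtain f' where "\<forall>x\<ge>0. (f has_real_derivative f' x) (at x within {0..})" "times_diff n f'" by auto
  then show ?case using Suc.IH[of f'] by (auto intro!: exI[of _ "\<lambda>x. - f' x"] derivative_eq_intros)
qed simp

lemma times_diff_diff: "times_diff n f \<Longrightarrow> times_diff n g \<Longrightarrow> times_diff n (\<lambda>x. f x - g x)"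
  using times_diff_add[OF _ times_diff_minus] by simp

lemma times_diff_mult: "times_diff n f \<Longrightarrow> times_diff n g \<Longrightarrow> times_diff n (\<lambda>x. f x * g x)"
proof (induction n arbitrary: f g)
  case (Suc n)
  then obtain f' g' where d: "\<forall>x\<ge>0. (f has_real_derivative f' x) (at x within {0..})" "times_diff n f'"
    "\<forall>x\<ge>0. (g has_real_derivative g' x) (at x within {0..})" "times_diff n g'" by auto
  have "times_diff n (\<lambda>x. f' x * g x + f x * g' x)"
    using times_diff_Suc_imp[OF Suc.prems(1)] times_diff_Suc_imp[OF Suc.prems(2)] d
    by (intro times_diff_add Suc.IH)
  then show ?case using d
    by (intro times_diff.simps(2)[THEN iffD2] exI[of _ "\<lambda>x. f' x * g x + f x * g' x"])
      (auto intro!: derivative_eq_intros)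
qed simp

text \<open>The quotient rule yields another quotient, of functions with one derivative less and
  with denominator \<open>g * g\<close>, again without zeros; hence the induction ranges over both
  functions.\<close>

lemma times_diff_divide:
  assumes "times_diff n f" "times_diff n g" "\<And>x. 0 \<le> x \<Longrightarrow> g x \<noteq> 0"
  shows "times_diff n (\<lambda>x. f x / g x)"
  using assms
proof (induction n arbitrary: f g)
  case (Suc n)
  then obtain f' g' where d: "\<forall>x\<ge>0. (f has_real_derivative f' x) (at x within {0..})" "times_diff n f'"
    "\<forall>x\<ge>0. (g has_real_derivative g' x) (at x within {0..})" "times_diff n g'" by auto
  have "times_diff n (\<lambda>x. (f' x * g x - f x * g' x) / (g x * g x))"
    using times_diff_Suc_imp[OF Suc.prems(1)] times_diff_Suc_imp[OF Suc.prems(2)] d Suc.prems(3)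
    by (intro Suc.IH times_diff_diff times_diff_mult) auto
  then show ?case using d Suc.prems(3)
    by (auto intro!: exI[of _ "\<lambda>x. (f' x * g x - f x * g' x) / (g x * g x)"] derivative_eq_intros)
qed simp

lemma times_diff_sequence:
  assumes "times_diff n f"
  shows "\<exists>F. F 0 = f \<and> (\<forall>r<n. \<forall>x\<ge>0. (F r has_real_derivative F (Suc r) x) (at x within {0..}))"
  using assms
proof (induction n arbitrary: f)
  case (Suc n)
  then obtain f' where d: "\<forall>x\<ge>0. (f has_real_derivative f' x) (at x within {0..})" "times_diff n f'" by auto
  obtain F where F: "F 0 = f'" "\<forall>r<n. \<forall>x\<ge>0. (F r has_real_derivative F (Suc r) x) (at x within {0..})"
    using Suc.IH[OF d(2)] by blast
  show ?case
    by (rule exI[of _ "\<lambda>r. case r of 0 \<Rightarrow> f | Suc r \<Rightarrow> F r"]) (use d F in \<open>auto split: nat.split\<close>)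
qed auto

lemma times_diff_of_sequence:
  assumes "\<And>r x. r < n \<Longrightarrow> 0 \<le> x \<Longrightarrow> (F r has_real_derivative F (Suc r) x) (at x within {0..})"
  shows "times_diff n (F 0)"
  using assms
proof (induction n arbitrary: F)
  case (Suc n)
  have "times_diff n (F (Suc 0))"
    using Suc.IH[of "\<lambda>r. F (Suc r)"] Suc.prems by simp
  then show ?case using Suc.prems by (auto intro!: exI[of _ "F (Suc 0)"])
qed simp

lemma deriv_unique_half_line:
  fixes f :: "real \<Rightarrow> real"
  assumes "(f has_real_derivative D) (at x within {0..})" "(f has_real_derivative E) (at x within {0..})" "0 \<le> x"
  shows "D = E"
proof -
  have "x islimpt {x<..<x+1}" by (rule islimpt_greaterThanLessThan1) simp
  then have "x islimpt {0..}" by (rule islimpt_subset) (use assms in auto)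
  then have "at x within {0..} \<noteq> bot" by (simp add: trivial_limit_within)
  then show ?thesis
    using assms unfolding has_field_derivative_iff by (blast intro: tendsto_unique)
qed

text \<open>Pascal's rule. Differentiating termwise the Leibniz formula for \<open>K' = E' K\<close>
  at one order gives the left side; the right side is the formula at the next order.\<close>

lemma leibniz_step:
  fixes a b :: "nat \<Rightarrow> real"
  shows "(\<Sum>m\<le>n. real (n choose m) * (a (Suc (Suc n) - m) * b m + a (Suc n - m) * b (Suc m)))
    = (\<Sum>m\<le>Suc n. real (Suc n choose m) * (a (Suc (Suc n) - m) * b m))"
proof -
  have "(\<Sum>m\<le>Suc n. real (Suc n choose m) * (a (Suc (Suc n) - m) * b m))
      = a (Suc (Suc n)) * b 0 + (\<Sum>m\<le>n. real (Suc n choose Suc m) * (a (Suc n - m) * b (Suc m)))"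
    by (subst sum.atMost_Suc_shift) simp
  also have "\<dots> = (a (Suc (Suc n)) * b 0 + (\<Sum>m\<le>n. real (n choose Suc m) * (a (Suc n - m) * b (Suc m))))
      + (\<Sum>m\<le>n. real (n choose m) * (a (Suc n - m) * b (Suc m)))"
    by (simp add: sum.distrib[symmetric] distrib_right add_ac)
  also have "a (Suc (Suc n)) * b 0 + (\<Sum>m\<le>n. real (n choose Suc m) * (a (Suc n - m) * b (Suc m)))
      = (\<Sum>m\<le>Suc n. real (n choose m) * (a (Suc (Suc n) - m) * b m))"
    by (subst sum.atMost_Suc_shift) simp
  also have "\<dots> = (\<Sum>m\<le>n. real (n choose m) * (a (Suc (Suc n) - m) * b m))"
    by simp
  finally show ?thesis
    by (simp add: sum.distrib[symmetric] distrib_left)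
qed

text \<open>The logarithm \<open>H\<close> of the moment generating function is affine in \<open>x\<close>, hence so are its
  derivatives (the cumulants); \<open>K' = H' K\<close> and the vanishing of the first cumulant then lower the
  degree of the central moments to one half of their order.\<close>

lemma central_moment_polynomial:
  fixes K :: "nat \<Rightarrow> real ^ 'd \<Rightarrow> real \<Rightarrow> real"
  assumes D: "\<And>x r th. x \<in> orthant \<Longrightarrow> r < q \<Longrightarrow> 0 \<le> th \<Longrightarrow> (K r x has_real_derivative K (Suc r) x th) (at th within {0..})"
    and K0: "\<And>x th. x \<in> orthant \<Longrightarrow> 0 \<le> th \<Longrightarrow> K 0 x th = exp (H0 th + (\<Sum>i\<in>UNIV. x $ i * H i th))"
    and K1: "\<And>x. x \<in> orthant \<Longrightarrow> K 0 x 0 = 1" "\<And>x. x \<in> orthant \<Longrightarrow> K 1 x 0 = 0"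
    and q: "1 \<le> q" and k: "k \<le> q"
  shows "\<exists>p. polynomial_deg_le (k div 2) p \<and> (\<forall>x\<in>orthant. K k x 0 = p x)"
proof -
  obtain q' where q': "q = Suc q'" using q by (cases q) auto
  \<comment> \<open>The logarithm inherits its regularity from \<open>K 0 x\<close>: its derivative
    is \<open>K 1 x / K 0 x\<close>, a quotient of functions that are \<open>q - 1\<close> times
    differentiable. Off the half-line, where nothing is known, the value is set to
    \<open>0\<close>.\<close>
  have ln: "times_diff q (\<lambda>th. if 0 \<le> th then H0 th + (\<Sum>i\<in>UNIV. x $ i * H i th) else 0)" if x: "x \<in> orthant" for x
  proof -
    have pos: "K 0 x th > 0" if "0 \<le> th" for th using K0[OF x that] by simp
    have t0: "times_diff q' (K 0 x)" by (rule times_diff_of_sequence) (use D[OF x] q' in auto)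
    have t1: "times_diff q' (K (Suc 0) x)"
      by (rule times_diff_of_sequence[where F = "\<lambda>r. K (Suc r) x"]) (use D[OF x] q' in auto)
    have t: "times_diff q' (\<lambda>th. K (Suc 0) x th / K 0 x th)"
      by (rule times_diff_divide[OF t1 t0]) (use pos in force)
    have "((\<lambda>th. if 0 \<le> th then H0 th + (\<Sum>i\<in>UNIV. x $ i * H i th) else 0) has_real_derivative K (Suc 0) x th / K 0 x th) (at th within {0..})"
      if th: "0 \<le> th" for th
    proof (rule has_field_derivative_transform_within[where d = 1])
      show "((\<lambda>th. ln (K 0 x th)) has_real_derivative K (Suc 0) x th / K 0 x th) (at th within {0..})"
        using D[OF x _ th, of 0] q pos[OF th] by (auto intro!: derivative_eq_intros)
    qed (use th K0[OF x] in auto)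
    then show ?thesis
      unfolding q' times_diff.simps
      by (intro exI[of _ "\<lambda>th. K (Suc 0) x th / K 0 x th"] conjI allI impI t)
  qed
  \<comment> \<open>No regularity of \<open>H0\<close> and the \<open>H i\<close> is given. The
    starting points \<open>0\<close> and \<open>axis i 1\<close> isolate them, so that each is seen
    to be \<open>q\<close> times differentiable on the half-line.\<close>
  define L0 where "L0 th = (if 0 \<le> th then H0 th else 0)" for th
  define Li where "Li i th = (if 0 \<le> th then H i th else 0)" for i th
  have ax: "axis i 1 \<in> orthant" for i :: 'd by (auto simp: orthant_def axis_def)
  have d0: "times_diff q L0"
  proof -
    have "(0 :: real ^ 'd) \<in> orthant" by (simp add: orthant_def)
    from ln[OF this] show ?thesis by (simp add: L0_def[abs_def] cong: if_cong)
  qed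
  have di: "times_diff q (Li i)" for i
  proof -
    have ax_sum: "(\<Sum>k\<in>UNIV. axis i 1 $ k * H k th) = H i th" for th
      by (simp add: axis_def if_distrib[of "\<lambda>u. u * _"] cong: if_cong)
    have "times_diff q (\<lambda>th. (if 0 \<le> th then H0 th + H i th else 0) - L0 th)"
      using times_diff_diff[OF ln[OF ax[of i]] d0] by (simp only: ax_sum)
    moreover have "(\<lambda>th. (if 0 \<le> th then H0 th + H i th else 0) - L0 th) = Li i"
      by (auto simp: L0_def Li_def)
    ultimately show ?thesis by simp
  qed
  from times_diff_sequence[OF d0] obtain F0 where F0': "F0 0 = L0 \<and>
      (\<forall>r<q. \<forall>x\<ge>0. (F0 r has_real_derivative F0 (Suc r) x) (at x within {0..}))" ..
  then have F0: "F0 0 = L0" "\<And>r th. r < q \<Longrightarrow> 0 \<le> th \<Longrightarrow> (F0 r has_real_derivative F0 (Suc r) th) (at th within {0..})"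
    by simp_all
  have "\<forall>i. \<exists>F. F 0 = Li i \<and> (\<forall>r<q. \<forall>x\<ge>0. (F r has_real_derivative F (Suc r) x) (at x within {0..}))"
    by (rule allI, rule times_diff_sequence[OF di])
  from choice[OF this] obtain Fi where Fi': "\<forall>i. Fi i 0 = Li i \<and>
      (\<forall>r<q. \<forall>x\<ge>0. (Fi i r has_real_derivative Fi i (Suc r) x) (at x within {0..}))" ..
  then have Fi: "\<And>i. Fi i 0 = Li i"
    "\<And>i r th. r < q \<Longrightarrow> 0 \<le> th \<Longrightarrow> (Fi i r has_real_derivative Fi i (Suc r) th) (at th within {0..})"
    by simp_all
  \<comment> \<open>The \<open>r\<close>-th derivative of the logarithm of \<open>K 0 x\<close>; the
    values at \<open>th = 0\<close> are the cumulants up to sign, visibly affine in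
    \<open>x\<close>.\<close>
  define E where "E r x th = F0 r th + (\<Sum>i\<in>UNIV. x $ i * Fi i r th)" for r x th
  have Ed: "(E r x has_real_derivative E (Suc r) x th) (at th within {0..})" if "r < q" "0 \<le> th" for r x th
    unfolding E_def by (rule DERIV_add[OF F0(2)[OF that]], rule DERIV_sum, rule DERIV_cmult[OF Fi(2)[OF that]])
  have rec: "K (Suc n) x th = (\<Sum>m\<le>n. real (n choose m) * (E (Suc n - m) x th * K m x th))"
    if x: "x \<in> orthant" and "n < q" "0 \<le> th" for n x th
    using that(2,3)
  proof (induction n arbitrary: th)
    case 0
    have Ke: "K 0 x u = exp (E 0 x u)" if "0 \<le> u" for u
      using K0[OF x that] that by (simp add: E_def F0(1) Fi(1) L0_def Li_def)
    have De: "((\<lambda>u. exp (E 0 x u)) has_real_derivative exp (E 0 x th) * E 1 x th) (at th within {0..})"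
      using DERIV_chain2[OF DERIV_exp Ed[of 0 th x]] 0 by simp
    have "(K 0 x has_real_derivative K 0 x th * E 1 x th) (at th within {0..})"
      unfolding Ke[OF 0(2)]
      by (rule has_field_derivative_transform_within[OF De, where d = 1]) (use 0 Ke in simp_all)
    from deriv_unique_half_line[OF D[OF x 0] this 0(2)] show ?case by simp
  next
    case (Suc n)
    have R: "((\<lambda>u. \<Sum>m\<le>n. real (n choose m) * (E (Suc n - m) x u * K m x u)) has_real_derivative
        (\<Sum>m\<le>n. real (n choose m) * (E (Suc (Suc n) - m) x th * K m x th + E (Suc n - m) x th * K (Suc m) x th))) (at th within {0..})"
    proof (intro DERIV_sum DERIV_cmult)
      fix m assume m: "m \<in> {..n}"
      have "((\<lambda>u. E (Suc n - m) x u * K m x u) has_real_derivative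
          E (Suc (Suc n - m)) x th * K m x th + K (Suc m) x th * E (Suc n - m) x th) (at th within {0..})"
        using Suc.prems m by (intro DERIV_mult Ed D x) auto
      then show "((\<lambda>u. E (Suc n - m) x u * K m x u) has_real_derivative
          E (Suc (Suc n) - m) x th * K m x th + E (Suc n - m) x th * K (Suc m) x th) (at th within {0..})"
        using m by (simp add: Suc_diff_le mult.commute)
    qed
    have "(K (Suc n) x has_real_derivative
        (\<Sum>m\<le>n. real (n choose m) * (E (Suc (Suc n) - m) x th * K m x th + E (Suc n - m) x th * K (Suc m) x th))) (at th within {0..})"
      by (rule has_field_derivative_transform_within[OF R, where d = 1]) (use Suc in auto)
    from deriv_unique_half_line[OF D[OF x Suc.prems] this Suc.prems(2)]
    show ?case
      by (rule trans[OF _ leibniz_step[where a = "\<lambda>r. E r x th" and b = "\<lambda>m. K m x th"]])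
  qed
  have E1: "E 1 x 0 = 0" if x: "x \<in> orthant" for x
    using rec[OF x, of 0 0] q K1[OF x] by simp
  show ?thesis
    using k
  proof (induction k rule: less_induct)
    case (less k)
    show ?case
    proof (cases k)
      case 0
      have "polynomial_deg_le 0 (\<lambda>x :: real ^ 'd. 1)"
        using polynomial_deg_le_monomial[of "\<lambda>_. 0" 0 1] by simp
      then show ?thesis using 0 K1(1) by (intro exI[of _ "\<lambda>_. 1"]) auto
    next
      case (Suc n)
      have "\<forall>m\<in>{..<n}. \<exists>p. polynomial_deg_le (m div 2) p \<and> (\<forall>x\<in>orthant. K m x 0 = p x)"
        using less Suc by auto
      then obtain p where p: "\<And>m. m < n \<Longrightarrow> polynomial_deg_le (m div 2) (p m)" "\<And>m x. m < n \<Longrightarrow> x \<in> orthant \<Longrightarrow> K m x 0 = p m x"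
        by (metis lessThan_iff)
      \<comment> \<open>The term \<open>m = n\<close> of the recursion carries the first cumulant
        and vanishes. The others satisfy \<open>m + 2 \<le> k\<close>, so an affine factor times a
        polynomial of degree \<open>m div 2\<close> stays within degree
        \<open>k div 2\<close>.\<close>
      let ?P = "\<lambda>x. \<Sum>m<n. real (n choose m) * ((F0 (Suc n - m) 0 + (\<Sum>i\<in>UNIV. x $ i * Fi i (Suc n - m) 0)) * p m x)"
      have "polynomial_deg_le (k div 2) ?P"
      proof (intro polynomial_deg_le_sum polynomial_deg_le_cmult)
        fix m assume "m \<in> {..<n}"
        then have m: "m < n" by simp
        show "polynomial_deg_le (k div 2) (\<lambda>x. (F0 (Suc n - m) 0 + (\<Sum>i\<in>UNIV. x $ i * Fi i (Suc n - m) 0)) * p m x)"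
          by (rule polynomial_deg_le_mono[OF polynomial_deg_le_mult_affine[OF p(1)[OF m]]]) (use m Suc in linarith)
      qed
      moreover have "K k x 0 = ?P x" if x: "x \<in> orthant" for x
      proof -
        have "K k x 0 = (\<Sum>m<Suc n. real (n choose m) * (E (Suc n - m) x 0 * K m x 0))"
          using rec[OF x, of n 0] less.prems Suc by (simp add: lessThan_Suc_atMost)
        also have "\<dots> = (\<Sum>m<n. real (n choose m) * (E (Suc n - m) x 0 * K m x 0))"
          using E1[OF x] by simp
        also have "\<dots> = ?P x"
          by (intro sum.cong refl) (simp add: E_def p(2)[OF _ x])
        finally show ?thesis .
      qed
      ultimately show ?thesis by blast
    qed
  qed
qed


section \<open>The mean as centring, and the recursion for a family of laws\<close>

context cbi_laws
begin

text \<open>The case \<open>k = 1\<close>, \<open>a = 0\<close> of the power formula: the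
  second-order terms vanish, and at each time the generator is constant in the state.\<close>

lemma first_moment_formula:
  assumes T: "0 \<le> T" and t: "t \<in> {0..T}"
  shows "(\<integral>x. dual_flow j (T - t) \<bullet> x \<partial>N t) = (\<integral>x. dual_flow j T \<bullet> x \<partial>N 0) + (LINT s:{0..t}|lborel. mean_drift \<bullet> dual_flow j (T - s))"
proof -
  obtain W where W: "1 \<le> W" "\<And>r j. r \<in> {0..T} \<Longrightarrow> norm (dual_flow j r) \<le> W"
    using dual_flow_bounded[of T] by blast
  interpret p: cbi_path c \<beta> B \<nu> \<mu> q v N "\<lambda>s. dual_flow j (T - s)" "\<lambda>_. 0" "\<lambda>_. 0" T W
  proof
    show "dual_flow j (T - s) \<in> orthant" "norm (dual_flow j (T - s)) \<le> W" if "s \<in> {0..T}" for s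
      using that W by (auto intro!: dual_flow_orthant)
  qed (use T W in \<open>auto intro!: dual_flow_deriv\<close>)
  have G: "p.generator_power 1 s x = mean_drift \<bullet> dual_flow j (T - s)" for s x
    by (simp add: p.generator_power_def generator_def mean_drift_inner)
  have "(LINT s:{0..t}|lborel. \<integral>x. p.generator_power 1 s x \<partial>N s) = (LINT s:{0..t}|lborel. mean_drift \<bullet> dual_flow j (T - s))"
  proof (rule set_lebesgue_integral_cong)
    show "\<forall>s. s \<in> {0..t} \<longrightarrow> (\<integral>x. p.generator_power 1 s x \<partial>N s) = mean_drift \<bullet> dual_flow j (T - s)"
    proof (intro allI impI)
      fix s assume "s \<in> {0..t}"
      then interpret prob_space "N s" by (intro prob_N) simp
      show "(\<integral>x. p.generator_power 1 s x \<partial>N s) = mean_drift \<bullet> dual_flow j (T - s)" unfolding G using prob_space by simp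
    qed
  qed simp
  with p.power_formula[of 1 t] q t show ?thesis by simp
qed

lemma integrable_component:
  assumes "0 \<le> s"
  shows "integrable (N s) (\<lambda>x. x)" "integrable (N s) (\<lambda>x. x $ i)"
proof -
  have n: "integrable (N s) norm" using integrable_norm_power(1)[of 1 s] q assms by simp
  show "integrable (N s) (\<lambda>x. x)"
    by (rule Bochner_Integration.integrable_bound[OF n]) auto
  show "integrable (N s) (\<lambda>x. x $ i)"
    by (rule Bochner_Integration.integrable_bound[OF n]) (auto simp: component_le_norm_cart)
qed

text \<open>The centring has to be differentiable at every point of \<open>[0,T]\<close>, from both
  sides even at the ends. It is therefore constructed as a primitive of the drift on a larger
  interval, with the initial mean as constant, and identified with the mean by
  \<open>first_moment_formula\<close>.\<close>

lemma mean_path: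
  assumes T: "0 \<le> T"
  shows "\<exists>a W. cbi_mean_path c \<beta> B \<nu> \<mu> q v N (\<lambda>s. dual_flow j (T - s)) a (\<lambda>s. mean_drift \<bullet> dual_flow j (T - s)) T W
    \<and> (\<forall>s\<in>{0..T}. a s = dual_flow j (T - s) \<bullet> (\<integral>x. x \<partial>N s))"
proof -
  define b where "b s = mean_drift \<bullet> dual_flow j (T - s)" for s
  have cw: "continuous_on UNIV (\<lambda>s. dual_flow j (T - s))"
    by (rule continuous_on_compose2[OF dual_flow_continuous[of UNIV]]) (auto intro!: continuous_intros)
  then have cb: "continuous_on S b" for S
    unfolding b_def by (intro continuous_intros continuous_on_subset[OF cw]) auto
  obtain A where A: "\<And>s. s \<in> {-1..T+1} \<Longrightarrow> (A has_vector_derivative b s) (at s within {-1..T+1})"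
    using antiderivative_continuous[OF cb[of "{-1..T+1}"]] by blast
  have DA: "DERIV A s :> b s" if "s \<in> {0..T}" for s
    using A[of s] that at_within_interior[of s "{-1..T+1}"]
    by (simp add: has_real_derivative_iff_has_vector_derivative)
  define a where "a s = A s - A 0 + (\<integral>x. dual_flow j T \<bullet> x \<partial>N 0)" for s
  have Da: "DERIV a s :> b s" if "s \<in> {0..T}" for s
    unfolding a_def by (auto intro!: derivative_eq_intros DA that)
  have mean: "a s = dual_flow j (T - s) \<bullet> (\<integral>x. x \<partial>N s)" if s: "s \<in> {0..T}" for s
  proof -
    have "(LINT u:{0..s}|lborel. b u) = A s - A 0"
      unfolding set_lebesgue_integral_def real_scaleR_def mult.commute[of "indicator _ _"]
    proof (rule integral_FTC_Icc_real)
      show "DERIV A u :> b u" if "0 \<le> u" "u \<le> s" for u using DA that s by simp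
      show "isCont b u" for u using cb[of UNIV] by (simp add: continuous_on_eq_continuous_at)
    qed (use s in simp)
    then have "a s = (\<integral>x. dual_flow j (T - s) \<bullet> x \<partial>N s)"
      using first_moment_formula[OF T s, of j] by (simp add: a_def b_def)
    then show ?thesis
      using integral_inner_right[of "dual_flow j (T - s)" "N s" "\<lambda>x. x"] integrable_component(1)[of s] s by simp
  qed
  obtain W0 where W0: "1 \<le> W0" "\<And>r j. r \<in> {0..T} \<Longrightarrow> norm (dual_flow j r) \<le> W0"
    using dual_flow_bounded[of T] by blast
  have "continuous_on {0..T} a"
    using Da by (intro continuous_at_imp_continuous_on ballI DERIV_isCont)
  then have "bounded (a ` {0..T})" "bounded (b ` {0..T})"
    using cb by (auto intro!: compact_imp_bounded compact_continuous_image)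
  then obtain W1 W2 where "\<forall>x\<in>a ` {0..T}. norm x \<le> W1" "\<forall>x\<in>b ` {0..T}. norm x \<le> W2"
    unfolding bounded_iff by blast
  then have W12: "\<bar>a s\<bar> \<le> W1" "\<bar>b s\<bar> \<le> W2" if "s \<in> {0..T}" for s
    using that by auto
  define W where "W = max W0 (max W1 W2)"
  have "cbi_mean_path c \<beta> B \<nu> \<mu> q v N (\<lambda>s. dual_flow j (T - s)) a b T W"
  proof
    show "0 \<le> T" by (rule T)
    show "1 \<le> W" using W0 by (simp add: W_def)
    show "(\<lambda>s. dual_flow j (T - s)) \<in> borel_measurable borel"
      by (rule borel_measurable_continuous_onI[OF cw])
    fix s assume s: "s \<in> {0..T}"
    show "dual_flow j (T - s) \<in> orthant" using s by (intro dual_flow_orthant) simp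
    have "norm (dual_flow j (T - s)) \<le> W0" using s by (intro W0) simp
    then show "norm (dual_flow j (T - s)) \<le> W" by (simp add: W_def)
    show "\<bar>a s\<bar> \<le> W" "\<bar>b s\<bar> \<le> W" using W12[OF s] by (auto simp: W_def)
    show "(a has_real_derivative b s) (at s)" by (rule Da[OF s])
    show "((\<lambda>s. dual_flow j (T - s) $ i) has_real_derivative - ((Bt *v axis i 1) \<bullet> dual_flow j (T - s))) (at s)" for i
      by (rule dual_flow_deriv)
    show "b s = mean_drift \<bullet> dual_flow j (T - s)" by (simp add: b_def)
  qed
  then show ?thesis using mean unfolding b_def by blast
qed

lemma laws_formula:
  fixes j :: 'd and T :: real
  defines "Y \<equiv> \<lambda>s x. entry Bt (T - s) j (x - (\<integral>x. x \<partial>N s))"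
  assumes T: "0 \<le> T" and k: "1 \<le> k" "k \<le> q"
  shows "2 \<le> k \<Longrightarrow> set_integrable lborel {0..T} (\<lambda>s. (entry Bt (T - s) j (axis i 1))\<^sup>2 * (\<integral>x. Y s x ^ (k - 2) * x $ i \<partial>N s))"
    "l < k - 1 \<Longrightarrow> integrable (restrict_space lborel {0..T} \<Otimes>\<^sub>M \<mu> i)
      (\<lambda>(s, z). entry Bt (T - s) j z ^ (k - l) * (\<integral>x. Y s x ^ l * x $ i \<partial>N s))"
    "l < k - 1 \<Longrightarrow> integrable (restrict_space lborel {0..T} \<Otimes>\<^sub>M \<nu>)
      (\<lambda>(s, z). entry Bt (T - s) j z ^ (k - l) * (\<integral>x. Y s x ^ l \<partial>N s))"
    "(\<integral>x. Y T x ^ k \<partial>N T) = (\<integral>x. Y 0 x ^ k \<partial>N 0) +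
      (real (k * (k - 1)) * (\<Sum>i\<in>UNIV. c $ i * (LINT s:{0..T}|lborel. (entry Bt (T - s) j (axis i 1))\<^sup>2 * (\<integral>x. Y s x ^ (k - 2) * x $ i \<partial>N s)))
      + (\<Sum>l<k - 1. real (k choose l) * (\<Sum>i\<in>UNIV. LINT s:{0..T}|lborel. \<integral>z. entry Bt (T - s) j z ^ (k - l) * (\<integral>x. Y s x ^ l * x $ i \<partial>N s) \<partial>\<mu> i))
      + (\<Sum>l<k - 1. real (k choose l) * (LINT s:{0..T}|lborel. \<integral>z. entry Bt (T - s) j z ^ (k - l) * (\<integral>x. Y s x ^ l \<partial>N s) \<partial>\<nu>)))"
proof -
  obtain a W where mp: "cbi_mean_path c \<beta> B \<nu> \<mu> q v N (\<lambda>s. dual_flow j (T - s)) a (\<lambda>s. mean_drift \<bullet> dual_flow j (T - s)) T W"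
    and a: "\<And>s. s \<in> {0..T} \<Longrightarrow> a s = dual_flow j (T - s) \<bullet> (\<integral>x. x \<partial>N s)"
    using mean_path[OF T] by blast
  interpret p: cbi_mean_path c \<beta> B \<nu> \<mu> q v N "\<lambda>s. dual_flow j (T - s)" a "\<lambda>s. mean_drift \<bullet> dual_flow j (T - s)" T W
    by (rule mp)
  have Y: "Y s x = dual_flow j (T - s) \<bullet> x - a s" if "s \<in> {0..T}" for s x
    by (simp add: Y_def a[OF that] entry_wv inner_diff_right)
  have mx: "(\<integral>x. Y s x ^ l * x $ i \<partial>N s) = p.weighted_moment l i s" if "s \<in> {0..T}" for l i s
    by (simp add: p.weighted_moment_def Y[OF that])
  have m0: "(\<integral>x. Y s x ^ l \<partial>N s) = p.centred_moment l s" if "s \<in> {0..T}" for l s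
    by (simp add: p.centred_moment_def Y[OF that])
  have en: "entry Bt r j (axis i 1) = dual_flow j r $ i" for r i by (simp add: dual_flow_def)
  note mf = p.main_formula[OF k]
  show "set_integrable lborel {0..T} (\<lambda>s. (entry Bt (T - s) j (axis i 1))\<^sup>2 * (\<integral>x. Y s x ^ (k - 2) * x $ i \<partial>N s))" if "2 \<le> k"
  proof -
    have "set_integrable lborel {0..T} (\<lambda>s. (entry Bt (T - s) j (axis i 1))\<^sup>2 * (\<integral>x. Y s x ^ (k - 2) * x $ i \<partial>N s)) \<longleftrightarrow>
      set_integrable lborel {0..T} (\<lambda>s. (dual_flow j (T - s) $ i)\<^sup>2 * p.weighted_moment (k - 2) i s)"
      by (rule set_integrable_cong) (auto simp: mx en)
    then show ?thesis using mf(1)[OF that] by blast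
  qed
  have sp: "p \<in> space (restrict_space lborel {0..T} \<Otimes>\<^sub>M m) \<Longrightarrow> fst p \<in> {0..T}" for p and m :: "(real ^ 'd) measure"
    by (auto simp: space_pair_measure space_restrict_space)
  show "integrable (restrict_space lborel {0..T} \<Otimes>\<^sub>M \<mu> i)
      (\<lambda>(s, z). entry Bt (T - s) j z ^ (k - l) * (\<integral>x. Y s x ^ l * x $ i \<partial>N s))" if "l < k - 1"
  proof -
    have "integrable (restrict_space lborel {0..T} \<Otimes>\<^sub>M \<mu> i) (\<lambda>(s, z). entry Bt (T - s) j z ^ (k - l) * (\<integral>x. Y s x ^ l * x $ i \<partial>N s)) \<longleftrightarrow>
      integrable (restrict_space lborel {0..T} \<Otimes>\<^sub>M \<mu> i) (\<lambda>(s, z). (dual_flow j (T - s) \<bullet> z) ^ (k - l) * p.weighted_moment l i s)"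
      by (rule Bochner_Integration.integrable_cong[OF refl]) (use sp mx in \<open>auto simp: case_prod_beta' entry_wv\<close>)
    then show ?thesis using mf(2)[OF that] by blast
  qed
  show "integrable (restrict_space lborel {0..T} \<Otimes>\<^sub>M \<nu>)
      (\<lambda>(s, z). entry Bt (T - s) j z ^ (k - l) * (\<integral>x. Y s x ^ l \<partial>N s))" if "l < k - 1"
  proof -
    have "integrable (restrict_space lborel {0..T} \<Otimes>\<^sub>M \<nu>) (\<lambda>(s, z). entry Bt (T - s) j z ^ (k - l) * (\<integral>x. Y s x ^ l \<partial>N s)) \<longleftrightarrow>
      integrable (restrict_space lborel {0..T} \<Otimes>\<^sub>M \<nu>) (\<lambda>(s, z). (dual_flow j (T - s) \<bullet> z) ^ (k - l) * p.centred_moment l s)"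
      by (rule Bochner_Integration.integrable_cong[OF refl]) (use sp m0 in \<open>auto simp: case_prod_beta' entry_wv\<close>)
    then show ?thesis using mf(3)[OF that] by blast
  qed
  have f: "(LINT s:{0..T}|lborel. (entry Bt (T - s) j (axis i 1))\<^sup>2 * (\<integral>x. Y s x ^ (k - 2) * x $ i \<partial>N s))
      = (LINT s:{0..T}|lborel. (dual_flow j (T - s) $ i)\<^sup>2 * p.weighted_moment (k - 2) i s)" for i
    by (rule set_lebesgue_integral_cong) (auto simp: mx en)
  have g: "(LINT s:{0..T}|lborel. \<integral>z. entry Bt (T - s) j z ^ (k - l) * (\<integral>x. Y s x ^ l * x $ i \<partial>N s) \<partial>\<mu> i)
      = (LINT s:{0..T}|lborel. \<integral>z. (dual_flow j (T - s) \<bullet> z) ^ (k - l) * p.weighted_moment l i s \<partial>\<mu> i)" for i l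
    by (rule set_lebesgue_integral_cong) (auto simp: mx entry_wv)
  have h: "(LINT s:{0..T}|lborel. \<integral>z. entry Bt (T - s) j z ^ (k - l) * (\<integral>x. Y s x ^ l \<partial>N s) \<partial>\<nu>)
      = (LINT s:{0..T}|lborel. \<integral>z. (dual_flow j (T - s) \<bullet> z) ^ (k - l) * p.centred_moment l s \<partial>\<nu>)" for l
    by (rule set_lebesgue_integral_cong) (auto simp: m0 entry_wv)
  have e: "(\<integral>x. Y s x ^ k \<partial>N s) = (\<integral>x. (dual_flow j (T - s) \<bullet> x - a s) ^ k \<partial>N s)" if "s \<in> {0..T}" for s
    by (simp add: Y[OF that])
  have T0: "0 \<in> {0..T}" "T \<in> {0..T}" using T by auto
  show "(\<integral>x. Y T x ^ k \<partial>N T) = (\<integral>x. Y 0 x ^ k \<partial>N 0) +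
      (real (k * (k - 1)) * (\<Sum>i\<in>UNIV. c $ i * (LINT s:{0..T}|lborel. (entry Bt (T - s) j (axis i 1))\<^sup>2 * (\<integral>x. Y s x ^ (k - 2) * x $ i \<partial>N s)))
      + (\<Sum>l<k - 1. real (k choose l) * (\<Sum>i\<in>UNIV. LINT s:{0..T}|lborel. \<integral>z. entry Bt (T - s) j z ^ (k - l) * (\<integral>x. Y s x ^ l * x $ i \<partial>N s) \<partial>\<mu> i))
      + (\<Sum>l<k - 1. real (k choose l) * (LINT s:{0..T}|lborel. \<integral>z. entry Bt (T - s) j z ^ (k - l) * (\<integral>x. Y s x ^ l \<partial>N s) \<partial>\<nu>)))"
    unfolding f g h e[OF T0(1)] e[OF T0(2)] by (rule mf(4))
qed

end


section \<open>The transition kernels\<close>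

lemma semigroup_sets:
  assumes P: "transition_semigroup P" and t: "0 \<le> t" and x: "x \<in> orthant"
  shows "prob_space (P t x)" "sets (P t x) = sets orthant_borel" "space (P t x) = orthant"
    "(\<lambda>y. y) \<in> P t x \<rightarrow>\<^sub>M borel"
proof -
  have "P t \<in> orthant_borel \<rightarrow>\<^sub>M prob_algebra orthant_borel"
    using P t by (simp add: transition_semigroup_def)
  then have "P t x \<in> space (prob_algebra orthant_borel)"
    by (rule measurable_space) (simp add: x space_restrict_space)
  then show "prob_space (P t x)" and s: "sets (P t x) = sets orthant_borel"
    by (auto simp: space_prob_algebra)
  show "space (P t x) = orthant"
    using sets_eq_imp_space_eq[OF s] by (simp add: space_restrict_space)
  show "(\<lambda>y. y) \<in> P t x \<rightarrow>\<^sub>M borel"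
    unfolding measurable_cong_sets[OF s refl] by (auto intro!: measurable_restrict_space1)
qed

lemma semigroup_start:
  assumes P: "transition_semigroup P" and x: "x \<in> orthant" and f: "f \<in> borel_measurable borel"
  shows "AE y in P 0 x. f y = (f x :: real)"
proof -
  have P0: "P 0 x = return orthant_borel x" using P x by (simp add: transition_semigroup_def)
  show ?thesis
    unfolding P0
  proof (subst AE_return)
    have [measurable]: "f \<in> borel_measurable orthant_borel" using f by (rule measurable_restrict_space1)
    show "Measurable.pred orthant_borel (\<lambda>y. f y = f x)" by measurable
  qed (use x in \<open>auto simp: space_restrict_space\<close>)
qed

lemma semigroup_integral:
  fixes f :: "real ^ 'd \<Rightarrow> real"
  assumes P: "transition_semigroup P" and t: "0 \<le> s" "0 \<le> h" and x: "x \<in> orthant"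
    and f: "f \<in> borel_measurable borel" and b: "\<And>y. y \<in> orthant \<Longrightarrow> \<bar>f y\<bar> \<le> K"
  shows "(\<integral>y. f y \<partial>P (s + h) x) = (\<integral>z. (\<integral>y. f y \<partial>P h z) \<partial>P s x)"
proof -
  interpret s: prob_space "P s x" by (rule semigroup_sets[OF P t(1) x])
  have "P (s + h) x = P s x \<bind> P h"
    using P t x by (simp add: transition_semigroup_def)
  moreover have "(\<integral>y. f y \<partial>(P s x \<bind> P h)) = (\<integral>z. (\<integral>y. f y \<partial>P h z) \<partial>P s x)"
  proof (rule integral_bind)
    show "f \<in> borel_measurable orthant_borel" using f by (rule measurable_restrict_space1)
    show "\<bar>f y\<bar> \<le> K" if "y \<in> space orthant_borel" for y using that b by (simp add: space_restrict_space)
    have "P h \<in> orthant_borel \<rightarrow>\<^sub>M prob_algebra orthant_borel"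
      using P t by (simp add: transition_semigroup_def)
    then show "P h \<in> P s x \<rightarrow>\<^sub>M subprob_algebra orthant_borel"
      unfolding measurable_cong_sets[OF semigroup_sets(2)[OF P t(1) x] refl] by (rule measurable_prob_algebraD)
    show "finite_measure (P s x)" by unfold_locales
    show "AE z in P s x. emeasure (P h z) (space (P h z)) \<le> ennreal 1"
      using prob_space.emeasure_space_1[OF semigroup_sets(1)[OF P t(2)]]
      by (intro AE_I2) (simp add: semigroup_sets(3)[OF P t(1) x])
  qed
  ultimately show ?thesis by simp
qed

section \<open>Moments and Laplace transforms of the kernels\<close>

context cbi_param
begin

text \<open>The Laplace identity is Chapman-Kolmogorov combined with the Laplace transform of
  \<open>P h\<close>. The kernels live on the orthant; pushing them forward along the identity moves
  them to the whole space, as \<open>cbi_laws\<close> requires.\<close>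

lemma semigroup_laws:
  assumes P: "transition_semigroup P" and v: "cbi_flow c B \<mu> v"
    and lap: "\<forall>x\<in>orthant. \<forall>\<theta>\<in>orthant. \<forall>t\<ge>0. (\<integral>y. exp (- (\<theta> \<bullet> y)) \<partial>P t x) =
             exp (- (x \<bullet> v t \<theta>) - (LINT s:{0..t}|lborel. psi \<beta> \<nu> (v s \<theta>)))"
    and x: "x \<in> orthant"
  shows "cbi_laws c \<beta> B \<nu> \<mu> q v (\<lambda>s. distr (P s x) borel (\<lambda>y. y))"
proof -
  interpret f: cbi_flow_param c \<beta> B \<nu> \<mu> q v by unfold_locales (rule v)
  note ss = semigroup_sets[OF P _ x]
  have id: "(\<integral>y. f y \<partial>distr (P s x) borel (\<lambda>y. y)) = (\<integral>y. f y \<partial>P s x)"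
    if "0 \<le> s" "f \<in> borel_measurable borel" for s and f :: "real ^ 'd \<Rightarrow> real"
    by (rule integral_distr[OF ss(4)[OF that(1)] that(2)])
  show ?thesis
  proof (intro cbi_laws.intro cbi_laws_axioms.intro)
    show "cbi_flow_param c \<beta> B \<nu> \<mu> q v" by unfold_locales
  next
    fix s :: real assume s: "0 \<le> s"
    show "prob_space (distr (P s x) borel (\<lambda>y. y))"
      by (rule prob_space.prob_space_distr[OF ss(1)[OF s] ss(4)[OF s]])
    show "AE y in distr (P s x) borel (\<lambda>y. y). y \<in> orthant"
      by (subst AE_distr_iff[OF ss(4)[OF s]]) (auto simp: ss(3)[OF s])
    fix h :: real and \<theta> :: "real ^ 'd" assume h: "0 \<le> h" and th: "\<theta> \<in> orthant"
    have "(\<integral>y. exp (- (\<theta> \<bullet> y)) \<partial>distr (P (s + h) x) borel (\<lambda>y. y)) = (\<integral>y. exp (- (\<theta> \<bullet> y)) \<partial>P (s + h) x)"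
      by (rule id) (use s h in auto)
    also have "\<dots> = (\<integral>z. (\<integral>y. exp (- (\<theta> \<bullet> y)) \<partial>P h z) \<partial>P s x)"
      by (rule semigroup_integral[OF P s h x, where K = 1]) (auto simp: orthant_inner_nonneg th)
    also have "\<dots> = (\<integral>z. exp (- (z \<bullet> v h \<theta>) - f.Psi_int h \<theta>) \<partial>P s x)"
      using lap th h by (intro Bochner_Integration.integral_cong refl) (simp add: ss(3)[OF s] f.Psi_int_def)
    also have "\<dots> = (\<integral>z. exp (- (z \<bullet> v h \<theta>) - f.Psi_int h \<theta>) \<partial>distr (P s x) borel (\<lambda>y. y))"
      by (rule id[symmetric, OF s]) measurable
    finally show "(\<integral>y. exp (- (\<theta> \<bullet> y)) \<partial>distr (P (s + h) x) borel (\<lambda>y. y))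
        = (\<integral>z. exp (- (z \<bullet> v h \<theta>) - f.Psi_int h \<theta>) \<partial>distr (P s x) borel (\<lambda>y. y))" .
  next
    have "AE y in P 0 x. norm y ^ q = norm x ^ q"
      by (rule semigroup_start[OF P x]) measurable
    moreover interpret z: prob_space "P 0 x" by (rule ss) simp
    have "(\<lambda>y. norm y ^ q) \<in> borel_measurable (P 0 x)"
      by (rule measurable_compose[OF ss(4)[of 0]]) auto
    ultimately have "integrable (P 0 x) (\<lambda>y. norm y ^ q)"
      by (intro z.integrable_const_bound[where B = "norm x ^ q"]) (auto elim!: eventually_mono)
    then show "integrable (distr (P 0 x) borel (\<lambda>y. y)) (\<lambda>y. norm y ^ q)"
      by (subst integrable_distr_eq[OF ss(4)[of 0]]) auto
  qed simp
qed

text \<open>The mean of coordinate \<open>j\<close> at time \<open>t\<close> for the start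
  \<open>x\<close>, written in the parameters alone, so that it can be mentioned before a semigroup
  is given.\<close>

definition kernel_mean_fun :: "real \<Rightarrow> 'd \<Rightarrow> real ^ 'd \<Rightarrow> real" where
  "kernel_mean_fun t j x = dual_flow j t \<bullet> x + (LINT s:{0..t}|lborel. mean_drift \<bullet> dual_flow j (t - s))"

lemma
  assumes P: "cbi_semigroup c \<beta> B \<nu> \<mu> P" and x: "x \<in> orthant" and t: "0 \<le> t"
  shows kernel_integrable: "k \<le> q \<Longrightarrow> integrable (P t x) (\<lambda>y. norm y ^ k)"
    and kernel_mean: "integrable (P t x) (\<lambda>y. y $ j)" "(\<integral>y. y $ j \<partial>P t x) = kernel_mean_fun t j x"
proof -
  from P obtain v where tP: "transition_semigroup P" and v: "cbi_flow c B \<mu> v"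
    and lap: "\<forall>x\<in>orthant. \<forall>\<theta>\<in>orthant. \<forall>t\<ge>0. (\<integral>y. exp (- (\<theta> \<bullet> y)) \<partial>P t x) =
             exp (- (x \<bullet> v t \<theta>) - (LINT s:{0..t}|lborel. psi \<beta> \<nu> (v s \<theta>)))"
    unfolding cbi_semigroup_def by blast
  interpret l: cbi_laws c \<beta> B \<nu> \<mu> q v "\<lambda>s. distr (P s x) borel (\<lambda>y. y)"
    by (rule semigroup_laws[OF tP v lap x])
  note ss = semigroup_sets[OF tP _ x]
  note int = integrable_distr_eq[OF ss(4)[OF t], symmetric]
  show "integrable (P t x) (\<lambda>y. norm y ^ k)" if "k \<le> q"
    using l.integrable_norm_power(1)[OF that t] by (subst int) auto
  show "integrable (P t x) (\<lambda>y. y $ j)"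
    using l.integrable_component(2)[OF t] by (subst int) auto
  have "AE y in P 0 x. dual_flow j t \<bullet> y = dual_flow j t \<bullet> x"
    by (rule semigroup_start[OF tP x]) measurable
  moreover interpret z: prob_space "P 0 x" by (rule ss) simp
  have "(\<lambda>y. dual_flow j t \<bullet> y) \<in> borel_measurable (P 0 x)"
    by (rule measurable_compose[OF ss(4)[of 0]]) auto
  ultimately have "(\<integral>y. dual_flow j t \<bullet> y \<partial>P 0 x) = (\<integral>y. dual_flow j t \<bullet> x \<partial>P 0 x)"
    by (intro integral_cong_AE) auto
  also have "\<dots> = dual_flow j t \<bullet> x" using z.prob_space by simp
  finally have z: "(\<integral>y. dual_flow j t \<bullet> y \<partial>distr (P 0 x) borel (\<lambda>y. y)) = dual_flow j t \<bullet> x"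
    by (subst integral_distr[OF ss(4)[of 0]]) auto
  have "(\<lambda>y. dual_flow j (t - t) \<bullet> y) = (\<lambda>y. y $ j)"
    by (auto simp: dual_flow_0 inner_axis')
  then have "(\<integral>y. y $ j \<partial>P t x) = (\<integral>y. dual_flow j (t - t) \<bullet> y \<partial>distr (P t x) borel (\<lambda>y. y))"
    by (subst integral_distr[OF ss(4)[OF t]]) auto
  then show "(\<integral>y. y $ j \<partial>P t x) = kernel_mean_fun t j x"
    using l.first_moment_formula[OF t, of t j] t z by (simp add: kernel_mean_fun_def)
qed

text \<open>The \<open>r\<close>-th derivative in \<open>th\<close> of the Laplace transform of the
  centred coordinate. With the sign inside the power, consecutive orders are derivatives of each
  other without a factor; at \<open>th = 0\<close> the value is the central moment up to the sign
  \<open>(-1) ^ r\<close>.\<close>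

definition centred_laplace :: "(real \<Rightarrow> real ^ 'd \<Rightarrow> (real ^ 'd) measure) \<Rightarrow> real \<Rightarrow> 'd \<Rightarrow> nat \<Rightarrow> real ^ 'd \<Rightarrow> real \<Rightarrow> real" where
  "centred_laplace P t j r x th = (\<integral>y. (- (y $ j - kernel_mean_fun t j x)) ^ r * exp (- (th * (y $ j - kernel_mean_fun t j x))) \<partial>P t x)"

lemma centred_laplace_derivative:
  assumes P: "cbi_semigroup c \<beta> B \<nu> \<mu> P" and x: "x \<in> orthant" and t: "0 \<le> t" and r: "r < q" and th: "0 \<le> th"
  shows "(centred_laplace P t j r x has_real_derivative centred_laplace P t j (Suc r) x th) (at th within {0..})"
proof -
  have tP: "transition_semigroup P" using P by (simp add: cbi_semigroup_def)
  note ss = semigroup_sets[OF tP t x]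
  interpret p: prob_space "P t x" by (rule ss)
  let ?m = "kernel_mean_fun t j x"
  have Zm: "(\<lambda>y. y $ j - ?m) \<in> borel_measurable (P t x)"
    by (rule measurable_compose[OF ss(4)]) auto
  have int: "integrable (P t x) (\<lambda>y. (y $ j - ?m) ^ k)" if "k \<le> q" for k
  proof (rule Bochner_Integration.integrable_bound)
    show "integrable (P t x) (\<lambda>y. (1 + \<bar>?m\<bar>) ^ k * (2 ^ k * (1 + norm y ^ k)))"
      using kernel_integrable[OF P x t that] by simp
    show "(\<lambda>y. (y $ j - ?m) ^ k) \<in> borel_measurable (P t x)" using Zm by (rule borel_measurable_power)
    show "AE y in P t x. norm ((y $ j - ?m) ^ k) \<le> norm ((1 + \<bar>?m\<bar>) ^ k * (2 ^ k * (1 + norm y ^ k)))"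
    proof (rule AE_I2)
      fix y :: "real ^ 'd"
      have "\<bar>y $ j - ?m\<bar> \<le> norm y + \<bar>?m\<bar>" using component_le_norm_cart[of y j] by linarith
      also have "\<dots> \<le> (1 + \<bar>?m\<bar>) * (1 + norm y)" by (simp add: algebra_simps)
      finally have "\<bar>y $ j - ?m\<bar> ^ k \<le> ((1 + \<bar>?m\<bar>) * (1 + norm y)) ^ k" by (intro power_mono) auto
      also have "\<dots> = (1 + \<bar>?m\<bar>) ^ k * (1 + norm y) ^ k" by (rule power_mult_distrib)
      also have "\<dots> \<le> (1 + \<bar>?m\<bar>) ^ k * (2 ^ k * (1 + norm y ^ k))"
        by (intro mult_left_mono one_plus_power_le) auto
      finally show "norm ((y $ j - ?m) ^ k) \<le> norm ((1 + \<bar>?m\<bar>) ^ k * (2 ^ k * (1 + norm y ^ k)))"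
        by (simp add: power_abs)
    qed
  qed
  have A: "AE y in P t x. - \<bar>?m\<bar> \<le> y $ j - ?m"
  proof (rule AE_I2)
    fix y assume "y \<in> space (P t x)"
    then have "0 \<le> y $ j" by (simp add: ss(3) orthant_def)
    then show "- \<bar>?m\<bar> \<le> y $ j - ?m" by linarith
  qed
  show ?thesis
    unfolding centred_laplace_def[abs_def] using r
    by (intro exp_moment_derivative[OF Zm A _ int int th]) auto
qed

text \<open>Kernel mean and Laplace exponent are both affine in \<open>x\<close>, hence so is the
  logarithm, as \<open>central_moment_polynomial\<close> demands. The flow that comes with
  \<open>P\<close> is replaced by the given \<open>v\<close> through \<open>flow_unique\<close>, so
  the right side does not depend on \<open>P\<close>.\<close>

lemma centred_laplace_0:
  assumes P: "cbi_semigroup c \<beta> B \<nu> \<mu> P" and v: "cbi_flow c B \<mu> v" and x: "x \<in> orthant" and t: "0 \<le> t" and th: "0 \<le> th"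
  shows "centred_laplace P t j 0 x th = exp ((th * (LINT s:{0..t}|lborel. mean_drift \<bullet> dual_flow j (t - s)) - (LINT s:{0..t}|lborel. psi \<beta> \<nu> (v s (th *\<^sub>R axis j 1))))
      + (\<Sum>i\<in>UNIV. x $ i * (th * dual_flow j t $ i - v t (th *\<^sub>R axis j 1) $ i)))"
proof -
  from P obtain u where u: "cbi_flow c B \<mu> u"
    and lap: "\<forall>x\<in>orthant. \<forall>\<theta>\<in>orthant. \<forall>t\<ge>0. (\<integral>y. exp (- (\<theta> \<bullet> y)) \<partial>P t x) =
             exp (- (x \<bullet> u t \<theta>) - (LINT s:{0..t}|lborel. psi \<beta> \<nu> (u s \<theta>)))"
    unfolding cbi_semigroup_def by blast
  interpret f: cbi_flow_param c \<beta> B \<nu> \<mu> q v by unfold_locales (rule v)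
  have to: "th *\<^sub>R axis j 1 \<in> orthant" using th by (auto simp: orthant_def axis_def)
  have uv: "u s (th *\<^sub>R axis j 1) = v s (th *\<^sub>R axis j 1)" if "0 \<le> s" for s
    by (rule f.flow_unique[OF u to that])
  have Psi_eq: "(LINT s:{0..t}|lborel. psi \<beta> \<nu> (u s (th *\<^sub>R axis j 1))) = (LINT s:{0..t}|lborel. psi \<beta> \<nu> (v s (th *\<^sub>R axis j 1)))"
    by (rule set_lebesgue_integral_cong) (auto simp: uv)
  have "centred_laplace P t j 0 x th = (\<integral>y. exp (th * kernel_mean_fun t j x) * exp (- ((th *\<^sub>R axis j 1) \<bullet> y)) \<partial>P t x)"
    unfolding centred_laplace_def
    by (intro Bochner_Integration.integral_cong refl) (simp add: inner_axis' right_diff_distrib flip: exp_add)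
  also have "\<dots> = exp (th * kernel_mean_fun t j x) * exp (- (x \<bullet> v t (th *\<^sub>R axis j 1)) - (LINT s:{0..t}|lborel. psi \<beta> \<nu> (v s (th *\<^sub>R axis j 1))))"
    by (simp only: integral_mult_right_zero lap[rule_format, OF x to t] uv[OF t] Psi_eq)
  finally show ?thesis
    unfolding exp_add[symmetric] kernel_mean_fun_def inner_vec_def
    by (simp add: right_diff_distrib sum_subtractf distrib_left sum_distrib_left mult_ac)
qed

text \<open>The polynomial is built from one semigroup and serves them all: any two share
  \<open>centred_laplace\<close> at order \<open>0\<close>, hence its derivatives on the half-line
  up to order \<open>q\<close>. If there is no semigroup the claim is vacuous, and the zero
  polynomial is taken.\<close>

lemma kernel_polynomial:
  assumes k: "k \<le> q" and t: "0 \<le> t"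
  shows "\<exists>p. polynomial_deg_le (k div 2) p \<and> (\<forall>P. cbi_semigroup c \<beta> B \<nu> \<mu> P \<longrightarrow>
    (\<forall>x\<in>orthant. (\<integral>y. (y $ j - kernel_mean_fun t j x) ^ k \<partial>P t x) = p x))"
proof (cases "\<exists>P. cbi_semigroup c \<beta> B \<nu> \<mu> P")
  case False
  then show ?thesis using polynomial_deg_le_0 by blast
next
  case True
  then obtain P where P: "cbi_semigroup c \<beta> B \<nu> \<mu> P" by blast
  then obtain v where v: "cbi_flow c B \<mu> v" unfolding cbi_semigroup_def by blast
  have m: "(\<integral>y. (y $ j - kernel_mean_fun t j x) ^ r \<partial>Q t x) = (- 1) ^ r * centred_laplace Q t j r x 0" for Q r x
  proof -
    have "(y $ j - kernel_mean_fun t j x) ^ r = (- 1) ^ r * (- (y $ j - kernel_mean_fun t j x)) ^ r" for y :: "real ^ 'd"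
      by (simp add: power_minus[of "y $ j - kernel_mean_fun t j x" r] flip: power_mult_distrib mult.assoc)
    then show ?thesis by (simp add: centred_laplace_def)
  qed
  have pr: "prob_space (P t x)" if "x \<in> orthant" for x
    using semigroup_sets(1)[OF _ t that] P by (auto simp: cbi_semigroup_def)
  have K1: "centred_laplace P t j 0 x 0 = 1" "centred_laplace P t j 1 x 0 = 0" if x: "x \<in> orthant" for x
  proof -
    interpret prob_space "P t x" by (rule pr[OF x])
    show "centred_laplace P t j 0 x 0 = 1" using prob_space by (simp add: centred_laplace_def)
    show "centred_laplace P t j 1 x 0 = 0"
      using kernel_mean[OF P x t, of j] prob_space by (simp add: centred_laplace_def)
  qed
  obtain p where p: "polynomial_deg_le (k div 2) p" "\<forall>x\<in>orthant. centred_laplace P t j k x 0 = p x"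
    using central_moment_polynomial[where K = "centred_laplace P t j" and q = q and k = k, OF centred_laplace_derivative[OF P _ t] centred_laplace_0[OF P v _ t] K1 q k]
    by blast
  have eq: "centred_laplace Q t j r x th = centred_laplace P t j r x th" if Q: "cbi_semigroup c \<beta> B \<nu> \<mu> Q" and x: "x \<in> orthant" and "r \<le> q" "0 \<le> th" for Q r x th
    using that(3,4)
  proof (induction r arbitrary: th)
    case 0
    then show ?case by (simp only: centred_laplace_0[OF Q v x t] centred_laplace_0[OF P v x t])
  next
    case (Suc r)
    have "(centred_laplace Q t j r x has_real_derivative centred_laplace P t j (Suc r) x th) (at th within {0..})"
      by (rule has_field_derivative_transform_within[OF centred_laplace_derivative[OF P x t _ Suc.prems(2), of r], where d = 1])
        (use Suc in auto)
    from deriv_unique_half_line[OF centred_laplace_derivative[OF Q x t _ Suc.prems(2), of r] this Suc.prems(2)] Suc.prems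
    show ?case by simp
  qed
  show ?thesis
  proof (intro exI[of _ "\<lambda>x. (- 1) ^ k * p x"] conjI allI impI ballI)
    show "polynomial_deg_le (k div 2) (\<lambda>x. (- 1) ^ k * p x)" by (rule polynomial_deg_le_cmult[OF p(1)])
    fix Q :: "real \<Rightarrow> real ^ 'd \<Rightarrow> (real ^ 'd) measure" and x :: "real ^ 'd"
    assume "cbi_semigroup c \<beta> B \<nu> \<mu> Q" "x \<in> orthant"
    then show "(\<integral>y. (y $ j - kernel_mean_fun t j x) ^ k \<partial>Q t x) = (- 1) ^ k * p x"
      unfolding m using eq k p(2) by simp
  qed
qed

end


section \<open>Markov processes\<close>

text \<open>For unbounded \<open>f\<close> the positive and negative parts are treated separately.
  Both have a finite total integral, so the inner integrals are finite for almost every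
  \<open>x\<close>, and there the inner integral of \<open>f\<close> is their difference.\<close>

lemma integral_bind_integrable:
  fixes f :: "'b \<Rightarrow> real"
  assumes N: "N \<in> M \<rightarrow>\<^sub>M subprob_algebra K" and f [measurable]: "f \<in> borel_measurable K"
    and int: "integrable (M \<bind> N) f" and ne: "space M \<noteq> {}"
  shows "integrable M (\<lambda>x. \<integral>y. f y \<partial>N x)" "(\<integral>y. f y \<partial>(M \<bind> N)) = (\<integral>x. (\<integral>y. f y \<partial>N x) \<partial>M)"
proof -
  have nnb: "(\<integral>\<^sup>+y. g y \<partial>(M \<bind> N)) = (\<integral>\<^sup>+x. (\<integral>\<^sup>+y. g y \<partial>N x) \<partial>M)" if "g \<in> borel_measurable K" for g
    by (rule nn_integral_bind[OF that N])
  have meas: "(\<lambda>x. \<integral>\<^sup>+y. g y \<partial>N x) \<in> borel_measurable M" if "g \<in> borel_measurable K" for g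
    by (rule measurable_compose[OF N nn_integral_measurable_subprob_algebra[OF that]])
  define p where "p x = (\<integral>\<^sup>+y. ennreal (f y) \<partial>N x)" for x
  define n where "n x = (\<integral>\<^sup>+y. ennreal (- f y) \<partial>N x)" for x
  have pm: "p \<in> borel_measurable M" "n \<in> borel_measurable M"
    unfolding p_def[abs_def] n_def[abs_def] by (rule meas; measurable)+
  have pn: "(\<integral>\<^sup>+x. p x \<partial>M) = (\<integral>\<^sup>+y. ennreal (f y) \<partial>(M \<bind> N))" "(\<integral>\<^sup>+x. n x \<partial>M) = (\<integral>\<^sup>+y. ennreal (- f y) \<partial>(M \<bind> N))"
    unfolding p_def n_def by (rule nnb[symmetric]; measurable)+
  have fin: "(\<integral>\<^sup>+x. p x \<partial>M) < \<infinity>" "(\<integral>\<^sup>+x. n x \<partial>M) < \<infinity>"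
    using int unfolding pn real_integrable_def by (auto simp: less_top)
  have AEfin: "AE x in M. p x \<noteq> \<infinity>" "AE x in M. n x \<noteq> \<infinity>"
    using nn_integral_PInf_AE[OF pm(1)] nn_integral_PInf_AE[OF pm(2)] fin by auto
  have eq: "AE x in M. (\<integral>y. f y \<partial>N x) = enn2real (p x) - enn2real (n x)"
    using AEfin AE_space
  proof eventually_elim
    case (elim x)
    have "f \<in> borel_measurable (N x)"
      using f subprob_measurableD(2)[OF N elim(3)] by (simp cong: measurable_cong_sets)
    then have "integrable (N x) f"
      unfolding real_integrable_def using elim by (simp add: p_def n_def)
    then show ?case by (simp add: real_lebesgue_integral_def p_def n_def)
  qed
  have part: "integrable M (\<lambda>x. enn2real (g x))" "(\<integral>x. enn2real (g x) \<partial>M) = enn2real (\<integral>\<^sup>+x. g x \<partial>M)"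
    if g: "g \<in> borel_measurable M" "(\<integral>\<^sup>+x. g x \<partial>M) < \<infinity>" "AE x in M. g x \<noteq> \<infinity>" for g
  proof -
    have e: "(\<integral>\<^sup>+x. ennreal (enn2real (g x)) \<partial>M) = (\<integral>\<^sup>+x. g x \<partial>M)"
      using g(3) by (intro nn_integral_cong_AE) (auto elim!: eventually_mono simp: less_top)
    show "integrable M (\<lambda>x. enn2real (g x))"
      by (rule integrableI_nonneg) (use g e in auto)
    show "(\<integral>x. enn2real (g x) \<partial>M) = enn2real (\<integral>\<^sup>+x. g x \<partial>M)"
      by (subst integral_eq_nn_integral) (use g e in auto)
  qed
  note P = part[OF pm(1) fin(1) AEfin(1)] and Q = part[OF pm(2) fin(2) AEfin(2)]
  have fm: "(\<lambda>x. \<integral>y. f y \<partial>N x) \<in> borel_measurable M"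
    by (rule measurable_compose[OF N integral_measurable_subprob_algebra]) measurable
  have i: "integrable M (\<lambda>x. enn2real (p x) - enn2real (n x))" using P(1) Q(1) by simp
  show "integrable M (\<lambda>x. \<integral>y. f y \<partial>N x)"
    by (rule integrable_cong_AE_imp[OF i fm]) (use eq in \<open>auto elim: eventually_mono\<close>)
  have "(\<integral>x. (\<integral>y. f y \<partial>N x) \<partial>M) = (\<integral>x. enn2real (p x) - enn2real (n x) \<partial>M)"
    by (rule integral_cong_AE[OF fm _ eq]) (use i in auto)
  also have "\<dots> = enn2real (\<integral>\<^sup>+x. p x \<partial>M) - enn2real (\<integral>\<^sup>+x. n x \<partial>M)"
    using P Q by simp
  also have "\<dots> = (\<integral>y. f y \<partial>(M \<bind> N))"
    unfolding pn by (rule real_lebesgue_integral_def[OF int, symmetric])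
  finally show "(\<integral>y. f y \<partial>(M \<bind> N)) = (\<integral>x. (\<integral>y. f y \<partial>N x) \<partial>M)" ..
qed

text \<open>The event \<open>X s \<in> A\<close> belongs to the natural filtration at time
  \<open>s\<close>, so the defining property of the conditional expectation can be integrated over
  it. Intersecting with the orthant puts \<open>D\<close> into the sigma-algebra of the
  kernels.\<close>

lemma markov_rectangle:
  fixes X :: "real \<Rightarrow> 'w \<Rightarrow> real ^ 'd"
  assumes P: "transition_semigroup P" and mp: "markov_process M P X" and st: "0 \<le> s" "s \<le> t"
    and A: "A \<in> sets borel" and D: "D \<in> sets borel"
  shows "measure M {\<omega> \<in> space M. X s \<omega> \<in> A \<and> X t \<omega> \<in> D} = (\<integral>\<omega>. indicator A (X s \<omega>) * measure (P (t - s) (X s \<omega>)) (D \<inter> orthant) \<partial>M)"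
proof -
  interpret prob_space M using mp by (simp add: markov_process_def)
  have Xm: "X u \<in> M \<rightarrow>\<^sub>M orthant_borel" if "0 \<le> u" for u using mp that by (simp add: markov_process_def)
  have Xb: "X u \<in> M \<rightarrow>\<^sub>M borel" if "0 \<le> u" for u
    using measurable_compose[OF Xm[OF that] measurable_restrict_space1[OF measurable_ident]] by simp
  let ?F = "natural_filtration M X s"
  have gen: "{X u -` A \<inter> space M | u A. 0 \<le> u \<and> u \<le> s \<and> A \<in> sets borel} \<subseteq> sets M"
    using Xb by (auto intro: measurable_sets)
  have F: "space ?F = space M" "sets ?F = sigma_sets (space M) {X u -` A \<inter> space M | u A. 0 \<le> u \<and> u \<le> s \<and> A \<in> sets borel}"
    unfolding natural_filtration_def by (auto intro!: space_measure_of sets_measure_of)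
  have "subalgebra M ?F"
    unfolding subalgebra_def F using sets.sigma_sets_subset[OF gen] by simp
  then interpret finite_measure_subalgebra M ?F
    by unfold_locales
  let ?S = "X s -` A \<inter> space M"
  have S: "?S \<in> sets ?F" unfolding F using st A by (intro sigma_sets.Basic) auto
  have SM: "?S \<in> sets M" by (rule measurable_sets[OF Xb[OF st(1)] A])
  have D': "D \<inter> orthant \<in> sets orthant_borel"
    using D by (auto simp: sets_restrict_space)
  have t0: "0 \<le> t" using st by simp
  have orth: "X u \<omega> \<in> orthant" if "0 \<le> u" "\<omega> \<in> space M" for u \<omega>
    using measurable_space[OF Xm[OF that(1)] that(2)] by (simp add: space_restrict_space)
  let ?Psi_int = "\<lambda>\<omega>. indicator (D \<inter> orthant) (X t \<omega>) :: real"
  have Im: "?Psi_int \<in> borel_measurable M"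
    using Xb[OF t0] D by (intro measurable_compose[OF Xb[OF t0]] borel_measurable_indicator) auto
  have Ii: "integrable M ?Psi_int" by (rule integrable_const_bound[where B = 1]) (use Im in auto)
  have ae: "AE \<omega> in M. real_cond_exp M ?F ?Psi_int \<omega> = measure (P (t - s) (X s \<omega>)) (D \<inter> orthant)"
    using mp st D' by (simp add: markov_process_def)
  have "P (t - s) \<in> orthant_borel \<rightarrow>\<^sub>M subprob_algebra orthant_borel"
    using P st by (auto simp: transition_semigroup_def intro: measurable_prob_algebraD)
  from measurable_compose[OF measurable_compose[OF Xm[OF st(1)] this] measurable_measure_subprob_algebra[OF D']]
  have mm: "(\<lambda>\<omega>. measure (P (t - s) (X s \<omega>)) (D \<inter> orthant)) \<in> borel_measurable M" .
  have SI: "(indicator ?S :: _ \<Rightarrow> real) \<in> borel_measurable M" using SM by simp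
  have "measure M {\<omega> \<in> space M. X s \<omega> \<in> A \<and> X t \<omega> \<in> D} = (\<integral>\<omega>\<in>?S. ?Psi_int \<omega> \<partial>M)"
  proof -
    have "{\<omega> \<in> space M. X s \<omega> \<in> A \<and> X t \<omega> \<in> D} = ?S \<inter> (X t -` D \<inter> space M)" by auto
    then have ms: "{\<omega> \<in> space M. X s \<omega> \<in> A \<and> X t \<omega> \<in> D} \<in> sets M"
      using SM measurable_sets[OF Xb[OF t0] D] by auto
    have "(\<integral>\<omega>\<in>?S. ?Psi_int \<omega> \<partial>M) = (\<integral>\<omega>. indicator {\<omega> \<in> space M. X s \<omega> \<in> A \<and> X t \<omega> \<in> D} \<omega> \<partial>M)"
      unfolding set_lebesgue_integral_def
      by (intro Bochner_Integration.integral_cong refl) (use orth[OF t0] in \<open>auto split: split_indicator\<close>)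
    then show ?thesis using ms by simp
  qed
  also have "\<dots> = (\<integral>\<omega>\<in>?S. real_cond_exp M ?F ?Psi_int \<omega> \<partial>M)"
    by (rule real_cond_exp_intA[OF Ii S])
  also have "\<dots> = (\<integral>\<omega>\<in>?S. measure (P (t - s) (X s \<omega>)) (D \<inter> orthant) \<partial>M)"
    unfolding set_lebesgue_integral_def
    unfolding real_scaleR_def
    by (rule integral_cong_AE[OF borel_measurable_times[OF SI borel_measurable_cond_exp2] borel_measurable_times[OF SI mm]])
      (use ae in \<open>auto elim!: eventually_mono\<close>)
  also have "\<dots> = (\<integral>\<omega>. indicator A (X s \<omega>) * measure (P (t - s) (X s \<omega>)) (D \<inter> orthant) \<partial>M)"
    unfolding set_lebesgue_integral_def
    by (intro Bochner_Integration.integral_cong refl) (auto split: split_indicator)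
  finally show ?thesis .
qed

text \<open>The joint law of \<open>(X s, X t)\<close> is the law of \<open>X s\<close> composed
  with the kernel that sends \<open>x\<close> to the law of \<open>(x, y)\<close>, where
  \<open>y\<close> is distributed by \<open>P (t - s) x\<close>. The two agree on rectangles, which
  generate the product sigma-algebra and are stable under intersection;
  \<open>integral_bind_integrable\<close> then covers unbounded integrands.\<close>

lemma markov_integral:
  fixes X :: "real \<Rightarrow> 'w \<Rightarrow> real ^ 'd" and f :: "(real ^ 'd) \<times> (real ^ 'd) \<Rightarrow> real"
  assumes P: "transition_semigroup P" and mp: "markov_process M P X" and st: "0 \<le> s" "s \<le> t"
    and f: "f \<in> borel_measurable (borel \<Otimes>\<^sub>M borel)" and int: "integrable M (\<lambda>\<omega>. f (X s \<omega>, X t \<omega>))"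
  shows "(\<integral>\<omega>. f (X s \<omega>, X t \<omega>) \<partial>M) = (\<integral>\<omega>. (\<integral>y. f (X s \<omega>, y) \<partial>P (t - s) (X s \<omega>)) \<partial>M)"
    "integrable M (\<lambda>\<omega>. \<integral>y. f (X s \<omega>, y) \<partial>P (t - s) (X s \<omega>))"
proof -
  interpret prob_space M using mp by (simp add: markov_process_def)
  have Xm: "X u \<in> M \<rightarrow>\<^sub>M orthant_borel" if "0 \<le> u" for u using mp that by (simp add: markov_process_def)
  have Xb: "X u \<in> M \<rightarrow>\<^sub>M borel" if "0 \<le> u" for u
    using measurable_compose[OF Xm[OF that] measurable_restrict_space1[OF measurable_ident]] by simp
  have t0: "0 \<le> t" and h0: "0 \<le> t - s" using st by auto
  have orth: "X u \<omega> \<in> orthant" if "0 \<le> u" "\<omega> \<in> space M" for u \<omega>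
    using measurable_space[OF Xm[OF that(1)] that(2)] by (simp add: space_restrict_space)
  define L where "L = (borel :: (real ^ 'd) measure) \<Otimes>\<^sub>M (borel :: (real ^ 'd) measure)"
  define \<kappa> where "\<kappa> x = distr (P (t - s) x) L (Pair x)" for x
  note ss = semigroup_sets[OF P h0]
  have pm: "Pair x \<in> P (t - s) x \<rightarrow>\<^sub>M L" if "x \<in> orthant" for x
    unfolding L_def using ss(4)[OF that] by (intro measurable_Pair) auto
  have Pk: "P (t - s) \<in> orthant_borel \<rightarrow>\<^sub>M subprob_algebra orthant_borel"
    using P h0 by (auto simp: transition_semigroup_def intro: measurable_prob_algebraD)
  have \<kappa>: "\<kappa> \<in> orthant_borel \<rightarrow>\<^sub>M subprob_algebra L"
    unfolding \<kappa>_def[abs_def]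
  proof (rule measurable_distr2[OF _ Pk])
    have "(\<lambda>p. (fst p, snd p)) \<in> orthant_borel \<Otimes>\<^sub>M orthant_borel \<rightarrow>\<^sub>M L"
      unfolding L_def
      by (intro measurable_Pair measurable_compose[OF measurable_fst] measurable_compose[OF measurable_snd] measurable_restrict_space1) auto
    then show "(\<lambda>(x, y). (x, y)) \<in> orthant_borel \<Otimes>\<^sub>M orthant_borel \<rightarrow>\<^sub>M L"
      by (simp add: case_prod_beta')
  qed
  define M' where "M' = distr M orthant_borel (X s)"
  have \<kappa>': "\<kappa> \<in> M' \<rightarrow>\<^sub>M subprob_algebra L" using \<kappa> by (simp add: M'_def)
  have M'_ne: "space M' \<noteq> {}"
    using orth[OF st(1)] not_empty by (auto simp: M'_def space_restrict_space)
  interpret M': prob_space M' unfolding M'_def by (rule prob_space_distr[OF Xm[OF st(1)]])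
  let ?D = "distr M L (\<lambda>\<omega>. (X s \<omega>, X t \<omega>))"
  have XX: "(\<lambda>\<omega>. (X s \<omega>, X t \<omega>)) \<in> M \<rightarrow>\<^sub>M L"
    unfolding L_def by (intro measurable_Pair Xb st t0)
  have law: "?D = M' \<bind> \<kappa>"
  proof (rule measure_eqI_generator_eq)
    let ?E = "{a \<times> b | a b. a \<in> sets (borel :: (real ^ 'd) measure) \<and> b \<in> sets (borel :: (real ^ 'd) measure)}"
    show "Int_stable ?E" by (rule Int_stable_pair_measure_generator)
    show "?E \<subseteq> Pow UNIV" by simp
    show "sets ?D = sigma_sets UNIV ?E" by (simp add: L_def sets_pair_measure)
    show "sets (M' \<bind> \<kappa>) = sigma_sets UNIV ?E"
      using sets_bind[OF subprob_measurableD(2)[OF \<kappa>'] M'_ne] by (simp add: L_def sets_pair_measure)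
    show "range (\<lambda>_::nat. UNIV \<times> UNIV) \<subseteq> ?E" by (auto simp del: UNIV_Times_UNIV intro!: exI[of _ UNIV])
    show "(\<Union>i::nat. UNIV \<times> UNIV) = (UNIV :: ((real ^ 'd) \<times> (real ^ 'd)) set)" by auto
    show "emeasure ?D (UNIV \<times> UNIV) \<noteq> \<infinity>" for i :: nat
      using prob_space.emeasure_le_1[OF prob_space_distr[OF XX], of "UNIV \<times> UNIV"] ennreal_one_less_top
      by (metis infinity_ennreal_def not_less)
    fix Z assume "Z \<in> ?E"
    then obtain A D where Z: "Z = A \<times> D" and AD: "A \<in> sets borel" "D \<in> sets borel" by auto
    have ZL: "Z \<in> sets L" unfolding L_def Z using AD by auto
    have k: "emeasure (\<kappa> x) Z = ennreal (indicator A x * measure (P (t - s) x) (D \<inter> orthant))" if x: "x \<in> orthant" for x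
    proof -
      interpret p: prob_space "P (t - s) x" by (rule ss(1)[OF x])
      have "emeasure (\<kappa> x) Z = emeasure (P (t - s) x) (Pair x -` Z \<inter> space (P (t - s) x))"
        unfolding \<kappa>_def by (rule emeasure_distr[OF pm[OF x] ZL])
      also have "Pair x -` Z \<inter> space (P (t - s) x) = (if x \<in> A then D \<inter> orthant else {})"
        using ss(3)[OF x] Z by auto
      finally show ?thesis by (auto simp: p.emeasure_eq_measure)
    qed
    have "emeasure (M' \<bind> \<kappa>) Z = (\<integral>\<^sup>+x. emeasure (\<kappa> x) Z \<partial>M')"
      by (rule emeasure_bind[OF M'_ne \<kappa>' ZL])
    also have "\<dots> = (\<integral>\<^sup>+\<omega>. emeasure (\<kappa> (X s \<omega>)) Z \<partial>M)"
      unfolding M'_def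
      by (rule nn_integral_distr[OF Xm[OF st(1)]]) (rule measurable_emeasure_kernel[OF \<kappa>'[unfolded M'_def] ZL])
    also have "\<dots> = (\<integral>\<^sup>+\<omega>. ennreal (indicator A (X s \<omega>) * measure (P (t - s) (X s \<omega>)) (D \<inter> orthant)) \<partial>M)"
      by (rule nn_integral_cong) (simp add: k orth st)
    also have "\<dots> = ennreal (\<integral>\<omega>. indicator A (X s \<omega>) * measure (P (t - s) (X s \<omega>)) (D \<inter> orthant) \<partial>M)"
    proof (rule nn_integral_eq_integral)
      have D': "D \<inter> orthant \<in> sets orthant_borel" using AD by (auto simp: sets_restrict_space)
      have m1: "(\<lambda>\<omega>. measure (P (t - s) (X s \<omega>)) (D \<inter> orthant)) \<in> borel_measurable M"
        by (rule measurable_compose[OF measurable_compose[OF Xm[OF st(1)] Pk] measurable_measure_subprob_algebra[OF D']])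
      have m2: "(\<lambda>\<omega>. indicator A (X s \<omega>) :: real) \<in> borel_measurable M"
        by (rule measurable_compose[OF Xb[OF st(1)] borel_measurable_indicator[OF AD(1)]])
      show "integrable M (\<lambda>\<omega>. indicator A (X s \<omega>) * measure (P (t - s) (X s \<omega>)) (D \<inter> orthant))"
      proof (rule integrable_const_bound[where B = 1])
        show "AE \<omega> in M. norm (indicator A (X s \<omega>) * measure (P (t - s) (X s \<omega>)) (D \<inter> orthant)) \<le> 1"
          using prob_space.prob_le_1[OF ss(1)[OF orth[OF st(1)]]]
          by (intro AE_I2) (auto split: split_indicator)
      qed (intro borel_measurable_times m1 m2)
    qed simp
    also have "\<dots> = ennreal (measure M {\<omega> \<in> space M. X s \<omega> \<in> A \<and> X t \<omega> \<in> D})"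
      by (simp only: markov_rectangle[OF P mp st AD])
    also have "\<dots> = emeasure ?D Z"
      by (subst emeasure_distr[OF XX ZL], subst emeasure_eq_measure) (auto simp: Z intro!: arg_cong[where f = "measure M"])
    finally show "emeasure ?D Z = emeasure (M' \<bind> \<kappa>) Z" ..
  qed
  have fL: "f \<in> borel_measurable L" using f by (simp add: L_def)
  have iD: "integrable (M' \<bind> \<kappa>) f"
    unfolding law[symmetric] by (subst integrable_distr_eq[OF XX fL]) (rule int)
  have kf: "(\<integral>p. f p \<partial>\<kappa> x) = (\<integral>y. f (x, y) \<partial>P (t - s) x)" if "x \<in> orthant" for x
    unfolding \<kappa>_def by (rule integral_distr[OF pm[OF that] fL])
  have km: "(\<lambda>x. \<integral>p. f p \<partial>\<kappa> x) \<in> borel_measurable orthant_borel"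
    by (rule measurable_compose[OF \<kappa> integral_measurable_subprob_algebra[OF fL]])
  note ib = integral_bind_integrable[OF \<kappa>' fL iD M'_ne]
  have "(\<integral>\<omega>. f (X s \<omega>, X t \<omega>) \<partial>M) = (\<integral>p. f p \<partial>?D)"
    by (rule integral_distr[OF XX fL, symmetric])
  also have "\<dots> = (\<integral>x. (\<integral>p. f p \<partial>\<kappa> x) \<partial>M')"
    unfolding law by (rule ib(2))
  also have "\<dots> = (\<integral>\<omega>. (\<integral>p. f p \<partial>\<kappa> (X s \<omega>)) \<partial>M)"
    unfolding M'_def by (rule integral_distr[OF Xm[OF st(1)] km])
  also have "\<dots> = (\<integral>\<omega>. (\<integral>y. f (X s \<omega>, y) \<partial>P (t - s) (X s \<omega>)) \<partial>M)"
    by (intro Bochner_Integration.integral_cong refl kf orth st)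
  finally show "(\<integral>\<omega>. f (X s \<omega>, X t \<omega>) \<partial>M) = (\<integral>\<omega>. (\<integral>y. f (X s \<omega>, y) \<partial>P (t - s) (X s \<omega>)) \<partial>M)" .
  have "integrable M (\<lambda>\<omega>. \<integral>p. f p \<partial>\<kappa> (X s \<omega>))"
    using ib(1) unfolding M'_def by (subst (asm) integrable_distr_eq[OF Xm[OF st(1)] km])
  moreover have "integrable M (\<lambda>\<omega>. \<integral>p. f p \<partial>\<kappa> (X s \<omega>)) \<longleftrightarrow> integrable M (\<lambda>\<omega>. \<integral>y. f (X s \<omega>, y) \<partial>P (t - s) (X s \<omega>))"
    by (intro Bochner_Integration.integrable_cong refl kf orth st)
  ultimately show "integrable M (\<lambda>\<omega>. \<integral>y. f (X s \<omega>, y) \<partial>P (t - s) (X s \<omega>))" by blast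
qed

section \<open>Marginal laws and conditional mean of a Markov process\<close>

context cbi_param
begin

text \<open>The Markov property between \<open>s\<close> and \<open>s + h\<close>, applied to a
  function of the later state only, followed by the Laplace transform of \<open>P h\<close>.\<close>

lemma process_laws:
  assumes P: "transition_semigroup P" and v: "cbi_flow c B \<mu> v"
    and lap: "\<forall>x\<in>orthant. \<forall>\<theta>\<in>orthant. \<forall>t\<ge>0. (\<integral>y. exp (- (\<theta> \<bullet> y)) \<partial>P t x) =
             exp (- (x \<bullet> v t \<theta>) - (LINT s:{0..t}|lborel. psi \<beta> \<nu> (v s \<theta>)))"
    and mp: "markov_process M P X" and X0: "integrable M (\<lambda>\<omega>. norm (X 0 \<omega>) ^ q)"
  shows "cbi_laws c \<beta> B \<nu> \<mu> q v (\<lambda>s. distr M borel (X s))"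
proof -
  interpret f: cbi_flow_param c \<beta> B \<nu> \<mu> q v by unfold_locales (rule v)
  interpret prob_space M using mp by (simp add: markov_process_def)
  have Xm: "X u \<in> M \<rightarrow>\<^sub>M orthant_borel" if "0 \<le> u" for u using mp that by (simp add: markov_process_def)
  have Xb: "X u \<in> M \<rightarrow>\<^sub>M borel" if "0 \<le> u" for u
    using measurable_compose[OF Xm[OF that] measurable_restrict_space1[OF measurable_ident]] by simp
  have orth: "X u \<omega> \<in> orthant" if "0 \<le> u" "\<omega> \<in> space M" for u \<omega>
    using measurable_space[OF Xm[OF that(1)] that(2)] by (simp add: space_restrict_space)
  show ?thesis
  proof (intro cbi_laws.intro cbi_laws_axioms.intro)
    show "cbi_flow_param c \<beta> B \<nu> \<mu> q v" by unfold_locales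
  next
    fix s :: real assume s: "0 \<le> s"
    show "prob_space (distr M borel (X s))" by (rule prob_space_distr[OF Xb[OF s]])
    show "AE y in distr M borel (X s). y \<in> orthant"
      by (subst AE_distr_iff[OF Xb[OF s]]) (auto simp: orth s)
    fix h :: real and \<theta> :: "real ^ 'd" assume h: "0 \<le> h" and th: "\<theta> \<in> orthant"
    have sh: "0 \<le> s + h" "s \<le> s + h" using s h by auto
    have fm: "(\<lambda>p. exp (- (\<theta> \<bullet> snd p))) \<in> borel_measurable (borel \<Otimes>\<^sub>M borel)" by measurable
    have "(\<lambda>\<omega>. exp (- (\<theta> \<bullet> X (s + h) \<omega>))) \<in> borel_measurable M"
      by (rule measurable_compose[OF Xb[OF sh(1)]]) measurable
    then have int: "integrable M (\<lambda>\<omega>. exp (- (\<theta> \<bullet> snd (X s \<omega>, X (s + h) \<omega>))))"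
      by (intro integrable_const_bound[where B = 1])
        (auto intro!: AE_I2 simp: orthant_inner_nonneg th orth sh)
    have "(\<integral>y. exp (- (\<theta> \<bullet> y)) \<partial>distr M borel (X (s + h))) = (\<integral>\<omega>. exp (- (\<theta> \<bullet> X (s + h) \<omega>)) \<partial>M)"
      by (rule integral_distr[OF Xb[OF sh(1)]]) measurable
    also have "\<dots> = (\<integral>\<omega>. (\<integral>y. exp (- (\<theta> \<bullet> y)) \<partial>P h (X s \<omega>)) \<partial>M)"
      using markov_integral(1)[OF P mp s sh(2) fm int] by simp
    also have "\<dots> = (\<integral>\<omega>. exp (- (X s \<omega> \<bullet> v h \<theta>) - f.Psi_int h \<theta>) \<partial>M)"
      using lap th h by (intro Bochner_Integration.integral_cong refl) (simp add: orth s f.Psi_int_def)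
    also have "\<dots> = (\<integral>z. exp (- (z \<bullet> v h \<theta>) - f.Psi_int h \<theta>) \<partial>distr M borel (X s))"
      by (rule integral_distr[symmetric, OF Xb[OF s]]) measurable
    finally show "(\<integral>y. exp (- (\<theta> \<bullet> y)) \<partial>distr M borel (X (s + h)))
        = (\<integral>z. exp (- (z \<bullet> v h \<theta>) - f.Psi_int h \<theta>) \<partial>distr M borel (X s))" .
  next
    show "integrable (distr M borel (X 0)) (\<lambda>y. norm y ^ q)"
      by (subst integrable_distr_eq[OF Xb]) (auto simp: X0)
  qed simp
qed

lemma kernel_mean_fun_bound: "\<exists>C\<ge>0. \<forall>x. \<bar>kernel_mean_fun t j x\<bar> \<le> C * (1 + norm x)"
proof -
  define L where "L = (LINT s:{0..t}|lborel. mean_drift \<bullet> dual_flow j (t - s))"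
  have "\<bar>kernel_mean_fun t j x\<bar> \<le> (norm (dual_flow j t) + \<bar>L\<bar>) * (1 + norm x)" for x
  proof -
    have "\<bar>dual_flow j t \<bullet> x\<bar> \<le> norm (dual_flow j t) * norm x" by (rule Cauchy_Schwarz_ineq2)
    then have "\<bar>kernel_mean_fun t j x\<bar> \<le> norm (dual_flow j t) * norm x + \<bar>L\<bar>"
      unfolding kernel_mean_fun_def L_def[symmetric] by linarith
    also have "\<dots> \<le> (norm (dual_flow j t) + \<bar>L\<bar>) * (1 + norm x)" by (simp add: algebra_simps)
    finally show ?thesis .
  qed
  then show ?thesis by (intro exI[of _ "norm (dual_flow j t) + \<bar>L\<bar>"]) auto
qed

lemma kernel_mean_fun_measurable: "kernel_mean_fun t j \<in> borel_measurable borel"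
  unfolding kernel_mean_fun_def[abs_def] by measurable

context
  fixes P :: "real \<Rightarrow> real ^ 'd \<Rightarrow> (real ^ 'd) measure" and M :: "'w measure" and X :: "real \<Rightarrow> 'w \<Rightarrow> real ^ 'd"
  assumes PS: "cbi_semigroup c \<beta> B \<nu> \<mu> P" and mp: "markov_process M P X"
    and X0: "integrable M (\<lambda>\<omega>. norm (X 0 \<omega>) ^ q)"
begin

lemma tP: "transition_semigroup P"
  using PS by (simp add: cbi_semigroup_def)

lemma prob_M: "prob_space M"
  using mp by (simp add: markov_process_def)

lemma X_measurable: "0 \<le> u \<Longrightarrow> X u \<in> M \<rightarrow>\<^sub>M borel"
proof -
  assume "0 \<le> u"
  then have "X u \<in> M \<rightarrow>\<^sub>M orthant_borel" using mp by (simp add: markov_process_def)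
  from measurable_compose[OF this measurable_restrict_space1[OF measurable_ident]] show ?thesis by simp
qed

lemma X_orthant: "0 \<le> u \<Longrightarrow> \<omega> \<in> space M \<Longrightarrow> X u \<omega> \<in> orthant"
proof -
  assume u: "0 \<le> u" "\<omega> \<in> space M"
  then have "X u \<in> M \<rightarrow>\<^sub>M orthant_borel" using mp by (simp add: markov_process_def)
  from measurable_space[OF this u(2)] show ?thesis by (simp add: space_restrict_space)
qed

lemma ex_laws: "\<exists>v. cbi_laws c \<beta> B \<nu> \<mu> q v (\<lambda>s. distr M borel (X s))"
proof -
  from PS obtain v where "cbi_flow c B \<mu> v"
    "\<forall>x\<in>orthant. \<forall>\<theta>\<in>orthant. \<forall>t\<ge>0. (\<integral>y. exp (- (\<theta> \<bullet> y)) \<partial>P t x) =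
             exp (- (x \<bullet> v t \<theta>) - (LINT s:{0..t}|lborel. psi \<beta> \<nu> (v s \<theta>)))"
    unfolding cbi_semigroup_def by blast
  from process_laws[OF tP this mp X0] show ?thesis by blast
qed

lemma X_moments:
  assumes t: "0 \<le> t"
  shows "k \<le> q \<Longrightarrow> integrable M (\<lambda>\<omega>. norm (X t \<omega>) ^ k)" "integrable M (\<lambda>\<omega>. X t \<omega>)" "integrable M (\<lambda>\<omega>. X t \<omega> $ j)"
proof -
  obtain v where "cbi_laws c \<beta> B \<nu> \<mu> q v (\<lambda>s. distr M borel (X s))" using ex_laws by blast
  then interpret l: cbi_laws c \<beta> B \<nu> \<mu> q v "\<lambda>s. distr M borel (X s)" .
  note e = integrable_distr_eq[OF X_measurable[OF t]]
  show "integrable M (\<lambda>\<omega>. norm (X t \<omega>) ^ k)" if "k \<le> q"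
    using l.integrable_norm_power(1)[OF that t] e[of "\<lambda>x. norm x ^ k"] by simp
  show "integrable M (\<lambda>\<omega>. X t \<omega>)"
    using l.integrable_component(1)[OF t] e[of "\<lambda>x. x"] by simp
  show "integrable M (\<lambda>\<omega>. X t \<omega> $ j)"
    using l.integrable_component(2)[OF t] e[of "\<lambda>x. x $ j"] by simp
qed

lemma X0_kmean_integrable: "integrable M (\<lambda>\<omega>. kernel_mean_fun t j (X 0 \<omega>))"
proof -
  interpret prob_space M by (rule prob_M)
  obtain C where C: "0 \<le> C" "\<And>x. \<bar>kernel_mean_fun t j x\<bar> \<le> C * (1 + norm x)" using kernel_mean_fun_bound by blast
  show ?thesis
  proof (rule Bochner_Integration.integrable_bound)
    show "integrable M (\<lambda>\<omega>. C * (1 + norm (X 0 \<omega>)))" using X_moments(1)[of 0 1] q by simp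
    show "AE \<omega> in M. norm (kernel_mean_fun t j (X 0 \<omega>)) \<le> norm (C * (1 + norm (X 0 \<omega>)))"
      using C by (intro AE_I2) (simp add: abs_mult)
    show "(\<lambda>\<omega>. kernel_mean_fun t j (X 0 \<omega>)) \<in> borel_measurable M"
      by (rule measurable_compose[OF X_measurable kernel_mean_fun_measurable]) simp
  qed
qed

text \<open>Sets of the sigma-algebra generated by \<open>X 0\<close> are of the form
  \<open>X 0 \<in> D\<close>; on these the Markov property at time \<open>0\<close> replaces
  \<open>X t $ j\<close> by the kernel mean.\<close>

lemma cond_exp_X:
  assumes t: "0 \<le> t"
  shows "AE \<omega> in M. real_cond_exp M (vimage_algebra (space M) (X 0) borel) (\<lambda>\<omega>. X t \<omega> $ j) \<omega> = kernel_mean_fun t j (X 0 \<omega>)"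
proof -
  interpret prob_space M by (rule prob_M)
  let ?F = "vimage_algebra (space M) (X 0) borel"
  have "subalgebra M ?F"
    unfolding subalgebra_def using X_measurable[of 0] by (auto simp: sets_vimage_algebra2 intro: measurable_sets)
  then interpret finite_measure_subalgebra M ?F by unfold_locales
  show ?thesis
  proof (rule real_cond_exp_charact[OF _ X_moments(3)[OF t] X0_kmean_integrable])
    show "(\<lambda>\<omega>. kernel_mean_fun t j (X 0 \<omega>)) \<in> borel_measurable ?F"
      by (rule measurable_compose[OF measurable_vimage_algebra1 kernel_mean_fun_measurable]) simp
    fix A assume "A \<in> sets ?F"
    then obtain D where D: "D \<in> sets borel" "A = X 0 -` D \<inter> space M"
      by (auto simp: sets_vimage_algebra2)
    let ?f = "\<lambda>p :: (real ^ 'd) \<times> (real ^ 'd). indicator D (fst p) * snd p $ j :: real"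
    have fm: "?f \<in> borel_measurable (borel \<Otimes>\<^sub>M borel)"
    proof (rule borel_measurable_times)
      show "(\<lambda>p. indicator D (fst p) :: real) \<in> borel_measurable (borel \<Otimes>\<^sub>M (borel :: (real ^ 'd) measure))"
        by (rule measurable_compose[OF measurable_fst borel_measurable_indicator[OF D(1)]])
      show "(\<lambda>p :: (real ^ 'd) \<times> (real ^ 'd). snd p $ j) \<in> borel_measurable (borel \<Otimes>\<^sub>M borel)"
        by (rule measurable_compose[OF measurable_snd borel_measurable_nth])
    qed
    have Am: "A \<in> sets M" unfolding D(2) by (rule measurable_sets[OF X_measurable D(1)]) simp
    have e: "indicator A \<omega> *\<^sub>R (X t \<omega> $ j) = ?f (X 0 \<omega>, X t \<omega>)" if "\<omega> \<in> space M" for \<omega>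
      using that by (auto simp: D(2) split: split_indicator)
    have "integrable M (\<lambda>\<omega>. indicator A \<omega> *\<^sub>R (X t \<omega> $ j))"
      by (rule integrable_mult_indicator[OF Am X_moments(3)[OF t]])
    moreover have "integrable M (\<lambda>\<omega>. indicator A \<omega> *\<^sub>R (X t \<omega> $ j)) \<longleftrightarrow> integrable M (\<lambda>\<omega>. ?f (X 0 \<omega>, X t \<omega>))"
      by (intro Bochner_Integration.integrable_cong refl e)
    ultimately have int: "integrable M (\<lambda>\<omega>. ?f (X 0 \<omega>, X t \<omega>))" by blast
    have "(\<integral>\<omega>\<in>A. X t \<omega> $ j \<partial>M) = (\<integral>\<omega>. ?f (X 0 \<omega>, X t \<omega>) \<partial>M)"
      unfolding set_lebesgue_integral_def by (intro Bochner_Integration.integral_cong refl e)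
    also have "\<dots> = (\<integral>\<omega>. (\<integral>y. ?f (X 0 \<omega>, y) \<partial>P (t - 0) (X 0 \<omega>)) \<partial>M)"
      by (rule markov_integral(1)[OF tP mp _ t fm int]) simp
    also have "\<dots> = (\<integral>\<omega>. indicator A \<omega> *\<^sub>R kernel_mean_fun t j (X 0 \<omega>) \<partial>M)"
      by (intro Bochner_Integration.integral_cong refl)
        (auto simp: D(2) kernel_mean[OF PS X_orthant t] split: split_indicator)
    finally show "(\<integral>\<omega>\<in>A. X t \<omega> $ j \<partial>M) = (\<integral>\<omega>\<in>A. kernel_mean_fun t j (X 0 \<omega>) \<partial>M)"
      unfolding set_lebesgue_integral_def .
  qed
qed

lemma mean_X:
  assumes t: "0 \<le> t"
  shows "(\<integral>\<omega>. X t \<omega> $ j \<partial>M) = (\<integral>\<omega>. kernel_mean_fun t j (X 0 \<omega>) \<partial>M)"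
proof -
  interpret prob_space M by (rule prob_M)
  have fm: "(\<lambda>p. snd p $ j) \<in> borel_measurable ((borel :: (real ^ 'd) measure) \<Otimes>\<^sub>M (borel :: (real ^ 'd) measure))"
    by (rule measurable_compose[OF measurable_snd]) measurable
  have "(\<integral>\<omega>. X t \<omega> $ j \<partial>M) = (\<integral>\<omega>. (\<integral>y. y $ j \<partial>P t (X 0 \<omega>)) \<partial>M)"
    using markov_integral(1)[OF tP mp _ t fm] X_moments(3)[OF t] t by simp
  also have "\<dots> = (\<integral>\<omega>. kernel_mean_fun t j (X 0 \<omega>) \<partial>M)"
    by (intro Bochner_Integration.integral_cong refl) (simp add: kernel_mean[OF PS X_orthant t])
  finally show ?thesis .
qed

text \<open>The centring is a function of the initial state, so it is frozen while integrating
  against the kernel, and the inner integral is the central moment of \<open>P t x\<close>. A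
  centring at the unconditional mean would not give this.\<close>

lemma conditional_moment:
  assumes t: "0 \<le> t" and k: "k \<le> q"
    and p: "\<forall>x\<in>orthant. (\<integral>y. (y $ j - kernel_mean_fun t j x) ^ k \<partial>P t x) = p x"
  shows "(\<integral>\<omega>. (X t \<omega> $ j - kernel_mean_fun t j (X 0 \<omega>)) ^ k \<partial>M) = (\<integral>\<omega>. p (X 0 \<omega>) \<partial>M)"
proof -
  interpret prob_space M by (rule prob_M)
  obtain C where C: "0 \<le> C" "\<And>x. \<bar>kernel_mean_fun t j x\<bar> \<le> C * (1 + norm x)" using kernel_mean_fun_bound by blast
  let ?f = "\<lambda>p. (snd p $ j - kernel_mean_fun t j (fst p)) ^ k"
  have fm: "?f \<in> borel_measurable (borel \<Otimes>\<^sub>M borel)"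
    by (intro borel_measurable_power borel_measurable_diff measurable_compose[OF measurable_fst kernel_mean_fun_measurable]
        measurable_compose[OF measurable_snd borel_measurable_nth])
  have XX: "(\<lambda>\<omega>. (X 0 \<omega>, X t \<omega>)) \<in> M \<rightarrow>\<^sub>M borel \<Otimes>\<^sub>M borel"
    by (intro measurable_Pair X_measurable t) simp
  have int: "integrable M (\<lambda>\<omega>. ?f (X 0 \<omega>, X t \<omega>))"
  proof (rule Bochner_Integration.integrable_bound)
    show "integrable M (\<lambda>\<omega>. 2 ^ k * (norm (X t \<omega>) ^ k + C ^ k * (2 ^ k * (1 + norm (X 0 \<omega>) ^ k))))"
      using X_moments(1)[OF t k] X_moments(1)[OF _ k, of 0] by simp
    show "(\<lambda>\<omega>. ?f (X 0 \<omega>, X t \<omega>)) \<in> borel_measurable M" by (rule measurable_compose[OF XX fm])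
    show "AE \<omega> in M. norm (?f (X 0 \<omega>, X t \<omega>)) \<le> norm (2 ^ k * (norm (X t \<omega>) ^ k + C ^ k * (2 ^ k * (1 + norm (X 0 \<omega>) ^ k))))"
    proof (rule AE_I2)
      fix \<omega>
      let ?u = "norm (X t \<omega>)" and ?v = "C * (1 + norm (X 0 \<omega>))"
      have v0: "0 \<le> ?v" using C by simp
      have "\<bar>X t \<omega> $ j - kernel_mean_fun t j (X 0 \<omega>)\<bar> \<le> ?u + ?v"
        using component_le_norm_cart[of "X t \<omega>" j] C(2)[of "X 0 \<omega>"] by linarith
      also have "\<dots> \<le> 2 * max ?u ?v" by simp
      finally have "\<bar>X t \<omega> $ j - kernel_mean_fun t j (X 0 \<omega>)\<bar> ^ k \<le> (2 * max ?u ?v) ^ k" by (intro power_mono) auto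
      also have "\<dots> = 2 ^ k * max ?u ?v ^ k" by (rule power_mult_distrib)
      also have "\<dots> \<le> 2 ^ k * (?u ^ k + ?v ^ k)"
        using v0 by (intro mult_left_mono) (auto simp: max_def)
      also have "?v ^ k \<le> C ^ k * (2 ^ k * (1 + norm (X 0 \<omega>) ^ k))"
        unfolding power_mult_distrib using C by (intro mult_left_mono one_plus_power_le) auto
      finally have "\<bar>X t \<omega> $ j - kernel_mean_fun t j (X 0 \<omega>)\<bar> ^ k \<le> 2 ^ k * (?u ^ k + C ^ k * (2 ^ k * (1 + norm (X 0 \<omega>) ^ k)))"
        by simp
      then show "norm (?f (X 0 \<omega>, X t \<omega>)) \<le> norm (2 ^ k * (norm (X t \<omega>) ^ k + C ^ k * (2 ^ k * (1 + norm (X 0 \<omega>) ^ k))))"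
        by (simp add: power_abs)
    qed
  qed
  have "(\<integral>\<omega>. ?f (X 0 \<omega>, X t \<omega>) \<partial>M) = (\<integral>\<omega>. (\<integral>y. ?f (X 0 \<omega>, y) \<partial>P (t - 0) (X 0 \<omega>)) \<partial>M)"
    by (rule markov_integral(1)[OF tP mp _ t fm int]) simp
  also have "\<dots> = (\<integral>\<omega>. p (X 0 \<omega>) \<partial>M)"
    using p by (intro Bochner_Integration.integral_cong refl) (simp add: X_orthant)
  finally show ?thesis by simp
qed

end

end


section \<open>The recursion and the polynomials for the process\<close>

context cbi_param
begin

context
  fixes P :: "real \<Rightarrow> real ^ 'd \<Rightarrow> (real ^ 'd) measure" and M :: "'w measure" and X :: "real \<Rightarrow> 'w \<Rightarrow> real ^ 'd"
  assumes PS: "cbi_semigroup c \<beta> B \<nu> \<mu> P" and mp: "markov_process M P X"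
    and X0: "integrable M (\<lambda>\<omega>. norm (X 0 \<omega>) ^ q)"
begin

lemma process_formula:
  fixes t :: real and j :: 'd
  defines "Y \<equiv> \<lambda>s \<omega>. centred M X Bt t j s \<omega>"
  assumes t: "0 \<le> t" and k: "1 \<le> k" "k \<le> q"
  shows "2 \<le> k \<Longrightarrow> set_integrable lborel {0..t} (\<lambda>s. (entry Bt (t - s) j (axis i 1))\<^sup>2 * (\<integral>\<omega>. Y s \<omega> ^ (k - 2) * X s \<omega> $ i \<partial>M))"
    "l < k - 1 \<Longrightarrow> integrable (restrict_space lborel {0..t} \<Otimes>\<^sub>M \<mu> i)
      (\<lambda>(s, z). entry Bt (t - s) j z ^ (k - l) * (\<integral>\<omega>. Y s \<omega> ^ l * X s \<omega> $ i \<partial>M))"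
    "l < k - 1 \<Longrightarrow> integrable (restrict_space lborel {0..t} \<Otimes>\<^sub>M \<nu>)
      (\<lambda>(s, z). entry Bt (t - s) j z ^ (k - l) * (\<integral>\<omega>. Y s \<omega> ^ l \<partial>M))"
    "(\<integral>\<omega>. (X t \<omega> $ j - (\<integral>\<omega>'. X t \<omega>' $ j \<partial>M)) ^ k \<partial>M) = (\<integral>\<omega>. Y 0 \<omega> ^ k \<partial>M) +
      (real (k * (k - 1)) * (\<Sum>i\<in>UNIV. c $ i * (LINT s:{0..t}|lborel. (entry Bt (t - s) j (axis i 1))\<^sup>2 * (\<integral>\<omega>. Y s \<omega> ^ (k - 2) * X s \<omega> $ i \<partial>M)))
      + (\<Sum>l<k - 1. real (k choose l) * (\<Sum>i\<in>UNIV. LINT s:{0..t}|lborel. \<integral>z. entry Bt (t - s) j z ^ (k - l) * (\<integral>\<omega>. Y s \<omega> ^ l * X s \<omega> $ i \<partial>M) \<partial>\<mu> i))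
      + (\<Sum>l<k - 1. real (k choose l) * (LINT s:{0..t}|lborel. \<integral>z. entry Bt (t - s) j z ^ (k - l) * (\<integral>\<omega>. Y s \<omega> ^ l \<partial>M) \<partial>\<nu>)))"
proof -
  note Xb = X_measurable[OF PS mp X0]
  obtain v where "cbi_laws c \<beta> B \<nu> \<mu> q v (\<lambda>s. distr M borel (X s))" using ex_laws[OF PS mp X0] by blast
  then interpret l: cbi_laws c \<beta> B \<nu> \<mu> q v "\<lambda>s. distr M borel (X s)" .
  define Z where "Z s x = entry Bt (t - s) j (x - (\<integral>x. x \<partial>distr M borel (X s)))" for s and x :: "real ^ 'd"
  have Zm: "Z s \<in> borel_measurable borel" for s
    unfolding Z_def[abs_def] entry_wv by measurable
  have ZY: "Z s (X s \<omega>) = Y s \<omega>" if "0 \<le> s" for s \<omega>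
    unfolding Z_def Y_def centred_def by (subst integral_distr[OF Xb[OF that]]) auto
  have mx: "(\<integral>x. Z s x ^ l * x $ i \<partial>distr M borel (X s)) = (\<integral>\<omega>. Y s \<omega> ^ l * X s \<omega> $ i \<partial>M)" if "0 \<le> s" for s l i
  proof -
    have "(\<lambda>x. Z s x ^ l * x $ i) \<in> borel_measurable borel"
      by (intro borel_measurable_times borel_measurable_power Zm borel_measurable_nth)
    from integral_distr[OF Xb[OF that] this] show ?thesis by (simp add: ZY[OF that])
  qed
  have m0: "(\<integral>x. Z s x ^ l \<partial>distr M borel (X s)) = (\<integral>\<omega>. Y s \<omega> ^ l \<partial>M)" if "0 \<le> s" for s l
  proof -
    have "(\<lambda>x. Z s x ^ l) \<in> borel_measurable borel"
      by (intro borel_measurable_power Zm)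
    from integral_distr[OF Xb[OF that] this] show ?thesis by (simp add: ZY[OF that])
  qed
  note lf = l.laws_formula[OF t k, where j = j, folded Z_def]
  show "set_integrable lborel {0..t} (\<lambda>s. (entry Bt (t - s) j (axis i 1))\<^sup>2 * (\<integral>\<omega>. Y s \<omega> ^ (k - 2) * X s \<omega> $ i \<partial>M))" if "2 \<le> k"
  proof -
    have "set_integrable lborel {0..t} (\<lambda>s. (entry Bt (t - s) j (axis i 1))\<^sup>2 * (\<integral>x. Z s x ^ (k - 2) * x $ i \<partial>distr M borel (X s))) \<longleftrightarrow>
      set_integrable lborel {0..t} (\<lambda>s. (entry Bt (t - s) j (axis i 1))\<^sup>2 * (\<integral>\<omega>. Y s \<omega> ^ (k - 2) * X s \<omega> $ i \<partial>M))"
      by (rule set_integrable_cong) (auto simp: mx)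
    then show ?thesis using lf(1)[OF that] by blast
  qed
  have sp: "p \<in> space (restrict_space lborel {0..t} \<Otimes>\<^sub>M m) \<Longrightarrow> 0 \<le> fst p" for p and m :: "(real ^ 'd) measure"
    by (auto simp: space_pair_measure space_restrict_space)
  show "integrable (restrict_space lborel {0..t} \<Otimes>\<^sub>M \<mu> i)
      (\<lambda>(s, z). entry Bt (t - s) j z ^ (k - l) * (\<integral>\<omega>. Y s \<omega> ^ l * X s \<omega> $ i \<partial>M))" if "l < k - 1"
  proof -
    have "integrable (restrict_space lborel {0..t} \<Otimes>\<^sub>M \<mu> i) (\<lambda>(s, z). entry Bt (t - s) j z ^ (k - l) * (\<integral>x. Z s x ^ l * x $ i \<partial>distr M borel (X s))) \<longleftrightarrow>
      integrable (restrict_space lborel {0..t} \<Otimes>\<^sub>M \<mu> i) (\<lambda>(s, z). entry Bt (t - s) j z ^ (k - l) * (\<integral>\<omega>. Y s \<omega> ^ l * X s \<omega> $ i \<partial>M))"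
      by (rule Bochner_Integration.integrable_cong[OF refl]) (use sp mx in \<open>auto simp: case_prod_beta'\<close>)
    then show ?thesis using lf(2)[OF that] by blast
  qed
  show "integrable (restrict_space lborel {0..t} \<Otimes>\<^sub>M \<nu>)
      (\<lambda>(s, z). entry Bt (t - s) j z ^ (k - l) * (\<integral>\<omega>. Y s \<omega> ^ l \<partial>M))" if "l < k - 1"
  proof -
    have "integrable (restrict_space lborel {0..t} \<Otimes>\<^sub>M \<nu>) (\<lambda>(s, z). entry Bt (t - s) j z ^ (k - l) * (\<integral>x. Z s x ^ l \<partial>distr M borel (X s))) \<longleftrightarrow>
      integrable (restrict_space lborel {0..t} \<Otimes>\<^sub>M \<nu>) (\<lambda>(s, z). entry Bt (t - s) j z ^ (k - l) * (\<integral>\<omega>. Y s \<omega> ^ l \<partial>M))"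
      by (rule Bochner_Integration.integrable_cong[OF refl]) (use sp m0 in \<open>auto simp: case_prod_beta'\<close>)
    then show ?thesis using lf(3)[OF that] by blast
  qed
  have f: "(LINT s:{0..t}|lborel. (entry Bt (t - s) j (axis i 1))\<^sup>2 * (\<integral>x. Z s x ^ (k - 2) * x $ i \<partial>distr M borel (X s)))
      = (LINT s:{0..t}|lborel. (entry Bt (t - s) j (axis i 1))\<^sup>2 * (\<integral>\<omega>. Y s \<omega> ^ (k - 2) * X s \<omega> $ i \<partial>M))" for i
    by (rule set_lebesgue_integral_cong) (auto simp: mx)
  have g: "(LINT s:{0..t}|lborel. \<integral>z. entry Bt (t - s) j z ^ (k - l) * (\<integral>x. Z s x ^ l * x $ i \<partial>distr M borel (X s)) \<partial>\<mu> i)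
      = (LINT s:{0..t}|lborel. \<integral>z. entry Bt (t - s) j z ^ (k - l) * (\<integral>\<omega>. Y s \<omega> ^ l * X s \<omega> $ i \<partial>M) \<partial>\<mu> i)" for i l
    by (rule set_lebesgue_integral_cong) (auto simp: mx)
  have h: "(LINT s:{0..t}|lborel. \<integral>z. entry Bt (t - s) j z ^ (k - l) * (\<integral>x. Z s x ^ l \<partial>distr M borel (X s)) \<partial>\<nu>)
      = (LINT s:{0..t}|lborel. \<integral>z. entry Bt (t - s) j z ^ (k - l) * (\<integral>\<omega>. Y s \<omega> ^ l \<partial>M) \<partial>\<nu>)" for l
    by (rule set_lebesgue_integral_cong) (auto simp: m0)
  \<comment> \<open>At \<open>s = t\<close> the matrix exponential is the identity, so
    \<open>Y t\<close> is the centred coordinate itself.\<close>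
  have "Y t \<omega> = X t \<omega> $ j - (\<integral>\<omega>'. X t \<omega>' $ j \<partial>M)" for \<omega>
    using integral_bounded_linear[OF bounded_linear_vec_nth X_moments(2)[OF PS mp X0 t], of j]
    by (simp add: Y_def centred_def entry_0)
  then have "(\<integral>\<omega>. (X t \<omega> $ j - (\<integral>\<omega>'. X t \<omega>' $ j \<partial>M)) ^ k \<partial>M) = (\<integral>x. Z t x ^ k \<partial>distr M borel (X t))"
    by (simp add: m0[OF t])
  then show "(\<integral>\<omega>. (X t \<omega> $ j - (\<integral>\<omega>'. X t \<omega>' $ j \<partial>M)) ^ k \<partial>M) = (\<integral>\<omega>. Y 0 \<omega> ^ k \<partial>M) +
      (real (k * (k - 1)) * (\<Sum>i\<in>UNIV. c $ i * (LINT s:{0..t}|lborel. (entry Bt (t - s) j (axis i 1))\<^sup>2 * (\<integral>\<omega>. Y s \<omega> ^ (k - 2) * X s \<omega> $ i \<partial>M)))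
      + (\<Sum>l<k - 1. real (k choose l) * (\<Sum>i\<in>UNIV. LINT s:{0..t}|lborel. \<integral>z. entry Bt (t - s) j z ^ (k - l) * (\<integral>\<omega>. Y s \<omega> ^ l * X s \<omega> $ i \<partial>M) \<partial>\<mu> i))
      + (\<Sum>l<k - 1. real (k choose l) * (LINT s:{0..t}|lborel. \<integral>z. entry Bt (t - s) j z ^ (k - l) * (\<integral>\<omega>. Y s \<omega> ^ l \<partial>M) \<partial>\<nu>)))"
    unfolding lf(4) f g h m0[OF order_refl] .
qed

text \<open>For \<open>k = 1\<close> this is the mean of a centred variable; for a deterministic
  start the centred variable is zero almost surely. With a random start and \<open>k \<ge> 2\<close>
  the term is in general present.\<close>

lemma initial_moment_zero:
  assumes t: "0 \<le> t" and k: "1 \<le> k" and det: "k = 1 \<or> (\<exists>x. AE \<omega> in M. X 0 \<omega> = x)"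
  shows "(\<integral>\<omega>. centred M X Bt t j 0 \<omega> ^ k \<partial>M) = 0"
proof -
  interpret prob_space M by (rule prob_M[OF PS mp X0])
  note X0i = X_moments(2)[OF PS mp X0 order_refl]
  have c: "centred M X Bt t j 0 \<omega> = dual_flow j t \<bullet> X 0 \<omega> - dual_flow j t \<bullet> (\<integral>\<omega>'. X 0 \<omega>' \<partial>M)" for \<omega>
    by (simp add: centred_def entry_wv inner_diff_right)
  from det show ?thesis
  proof
    assume "k = 1"
    then show ?thesis
      using X0i prob_space by (simp add: c)
  next
    assume "\<exists>x. AE \<omega> in M. X 0 \<omega> = x"
    then obtain x where x: "AE \<omega> in M. X 0 \<omega> = x" by blast
    have "(\<integral>\<omega>. X 0 \<omega> \<partial>M) = (\<integral>\<omega>. x \<partial>M)"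
      using X0i x by (intro integral_cong_AE) auto
    then have m: "(\<integral>\<omega>. X 0 \<omega> \<partial>M) = x" using prob_space by simp
    have "AE \<omega> in M. centred M X Bt t j 0 \<omega> ^ k = 0"
      using x by eventually_elim (use k in \<open>simp add: c m\<close>)
    then show ?thesis by (rule integral_eq_zero_AE)
  qed
qed

text \<open>The conditional expectation is almost surely the kernel mean, so the first claim reduces
  to \<open>conditional_moment\<close>. For the second, a deterministic start makes the
  unconditional mean equal to the kernel mean, and for \<open>k = 1\<close> both centrings give
  \<open>0\<close>.\<close>

lemma conditional_central_moment:
  assumes t: "0 \<le> t" and k: "k \<le> q"
    and p: "\<forall>x\<in>orthant. (\<integral>y. (y $ j - kernel_mean_fun t j x) ^ k \<partial>P t x) = p x"
  shows "(\<integral>\<omega>. (X t \<omega> $ j - real_cond_exp M (vimage_algebra (space M) (X 0) borel) (\<lambda>\<omega>'. X t \<omega>' $ j) \<omega>) ^ k \<partial>M)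
      = (\<integral>\<omega>. p (X 0 \<omega>) \<partial>M)"
    "1 \<le> k \<Longrightarrow> k = 1 \<or> (\<exists>x. AE \<omega> in M. X 0 \<omega> = x) \<Longrightarrow>
      (\<integral>\<omega>. (X t \<omega> $ j - (\<integral>\<omega>'. X t \<omega>' $ j \<partial>M)) ^ k \<partial>M) = (\<integral>\<omega>. p (X 0 \<omega>) \<partial>M)"
proof -
  interpret prob_space M by (rule prob_M[OF PS mp X0])
  note cm = conditional_moment[OF PS mp X0 t k p]
  note Xi = X_moments(3)[OF PS mp X0 t, of j] and Ki = X0_kmean_integrable[OF PS mp X0, of t j]
  have Xm: "(\<lambda>\<omega>. X t \<omega> $ j) \<in> borel_measurable M" and Km: "(\<lambda>\<omega>. kernel_mean_fun t j (X 0 \<omega>)) \<in> borel_measurable M"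
    using Xi Ki by auto
  have "(\<integral>\<omega>. (X t \<omega> $ j - real_cond_exp M (vimage_algebra (space M) (X 0) borel) (\<lambda>\<omega>'. X t \<omega>' $ j) \<omega>) ^ k \<partial>M)
      = (\<integral>\<omega>. (X t \<omega> $ j - kernel_mean_fun t j (X 0 \<omega>)) ^ k \<partial>M)"
  proof (rule integral_cong_AE)
    show "AE \<omega> in M. (X t \<omega> $ j - real_cond_exp M (vimage_algebra (space M) (X 0) borel) (\<lambda>\<omega>'. X t \<omega>' $ j) \<omega>) ^ k
        = (X t \<omega> $ j - kernel_mean_fun t j (X 0 \<omega>)) ^ k"
      using cond_exp_X[OF PS mp X0 t, of j] by eventually_elim simp
  qed (intro borel_measurable_power borel_measurable_diff Xm Km borel_measurable_cond_exp2)+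
  with cm show "(\<integral>\<omega>. (X t \<omega> $ j - real_cond_exp M (vimage_algebra (space M) (X 0) borel) (\<lambda>\<omega>'. X t \<omega>' $ j) \<omega>) ^ k \<partial>M)
      = (\<integral>\<omega>. p (X 0 \<omega>) \<partial>M)" by simp
  assume k1: "1 \<le> k" and "k = 1 \<or> (\<exists>x. AE \<omega> in M. X 0 \<omega> = x)"
  then consider "k = 1" | x where "AE \<omega> in M. X 0 \<omega> = x" by blast
  then have "(\<integral>\<omega>. (X t \<omega> $ j - (\<integral>\<omega>'. X t \<omega>' $ j \<partial>M)) ^ k \<partial>M) = (\<integral>\<omega>. (X t \<omega> $ j - kernel_mean_fun t j (X 0 \<omega>)) ^ k \<partial>M)"
  proof cases
    case 1
    then show ?thesis using Xi Ki prob_space mean_X[OF PS mp X0 t, of j] by simp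
  next
    case 2
    have "(\<integral>\<omega>. kernel_mean_fun t j (X 0 \<omega>) \<partial>M) = (\<integral>\<omega>. kernel_mean_fun t j x \<partial>M)"
      by (rule integral_cong_AE[OF Km]) (use 2 in \<open>auto elim: eventually_mono\<close>)
    then have m: "(\<integral>\<omega>'. X t \<omega>' $ j \<partial>M) = kernel_mean_fun t j x"
      using mean_X[OF PS mp X0 t, of j] prob_space by simp
    show ?thesis
    proof (rule integral_cong_AE)
      show "AE \<omega> in M. (X t \<omega> $ j - (\<integral>\<omega>'. X t \<omega>' $ j \<partial>M)) ^ k = (X t \<omega> $ j - kernel_mean_fun t j (X 0 \<omega>)) ^ k"
        using 2 by eventually_elim (simp add: m)
    qed (intro borel_measurable_power borel_measurable_diff Xm Km borel_measurable_const)+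
  qed
  with cm show "(\<integral>\<omega>. (X t \<omega> $ j - (\<integral>\<omega>'. X t \<omega>' $ j \<partial>M)) ^ k \<partial>M) = (\<integral>\<omega>. p (X 0 \<omega>) \<partial>M)" by simp
qed

end

end

text \<open>At \<open>t = 0\<close> and \<open>k = 2\<close> the left side is the variance of a
  coordinate of \<open>X 0\<close>. The integral terms are zero there, and no single polynomial of
  degree at most one represents the variance for all initial laws. Hence the initial term
  \<open>Y 0 ^ k\<close> in the recursion, which drops out for \<open>k = 1\<close> or an almost
  surely constant start, and the centring at the conditional mean given \<open>X 0\<close> in the
  polynomial claim. The integrability claims exclude that an integral takes its default value. The
  polynomials are quantified before the process, so they depend on the parameters only.\<close>

theorem theorem4p5:
  fixes c \<beta> :: "real ^ 'd" and B :: "real ^ 'd ^ 'd"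
    and \<nu> :: "(real ^ 'd) measure" and \<mu> :: "'d \<Rightarrow> (real ^ 'd) measure"
    and q :: nat
  assumes q: "1 \<le> q"
    and adm: "admissible c \<beta> B \<nu> \<mu>"
    and nu: "integrable \<nu> (\<lambda>z. norm z ^ q * indicator {z. 1 \<le> norm z} z)"
    and mu: "\<And>i. integrable (\<mu> i) (\<lambda>z. norm z ^ q * indicator {z. 1 \<le> norm z} z)"
  shows
    "(\<forall>(M :: 'w measure) X.
        cbi_process c \<beta> B \<nu> \<mu> M X \<and> integrable M (\<lambda>\<omega>. norm (X 0 \<omega>) ^ q) \<longrightarrow>
        (\<forall>t\<ge>0. integrable M (\<lambda>\<omega>. norm (X t \<omega>) ^ q)) \<and>
        (\<forall>k\<in>{1..q}. \<forall>j. \<forall>t\<ge>0.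
           let E = (\<lambda>r z. entry (B_tilde B \<mu>) r j z);
               Y = (\<lambda>s \<omega>. centred M X (B_tilde B \<mu>) t j s \<omega>);
               f = (\<lambda>i s. (E (t - s) (axis i 1))\<^sup>2 * (\<integral>\<omega>. Y s \<omega> ^ (k - 2) * X s \<omega> $ i \<partial>M));
               g = (\<lambda>l i s z. E (t - s) z ^ (k - l) * (\<integral>\<omega>. Y s \<omega> ^ l * X s \<omega> $ i \<partial>M));
               h = (\<lambda>l s z. E (t - s) z ^ (k - l) * (\<integral>\<omega>. Y s \<omega> ^ l \<partial>M));
               central = (\<integral>\<omega>. (X t \<omega> $ j - (\<integral>\<omega>'. X t \<omega>' $ j \<partial>M)) ^ k \<partial>M);
               rhs =
                 real (k * (k - 1)) * (\<Sum>i\<in>UNIV. c $ i * (LINT s:{0..t}|lborel. f i s))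
                 + (\<Sum>l<k - 1. real (k choose l) *
                      (\<Sum>i\<in>UNIV. LINT s:{0..t}|lborel. LINT z|\<mu> i. g l i s z))
                 + (\<Sum>l<k - 1. real (k choose l) * (LINT s:{0..t}|lborel. LINT z|\<nu>. h l s z))
           in (2 \<le> k \<longrightarrow> (\<forall>i. set_integrable lborel {0..t} (f i))) \<and>
              (\<forall>l<k - 1. \<forall>i.
                 integrable (restrict_space lborel {0..t} \<Otimes>\<^sub>M \<mu> i) (\<lambda>(s, z). g l i s z)) \<and>
              (\<forall>l<k - 1.
                 integrable (restrict_space lborel {0..t} \<Otimes>\<^sub>M \<nu>) (\<lambda>(s, z). h l s z)) \<and>
              central = (\<integral>\<omega>. Y 0 \<omega> ^ k \<partial>M) + rhs \<and>
              (k = 1 \<or> (\<exists>x. AE \<omega> in M. X 0 \<omega> = x) \<longrightarrow> central = rhs)))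
     \<and>
     (\<exists>P :: real \<Rightarrow> nat \<Rightarrow> 'd \<Rightarrow> real ^ 'd \<Rightarrow> real.
        (\<forall>t\<ge>0. \<forall>k\<in>{1..q}. \<forall>j. polynomial_deg_le (k div 2) (P t k j)) \<and>
        (\<forall>(M :: 'w measure) X.
           cbi_process c \<beta> B \<nu> \<mu> M X \<and> integrable M (\<lambda>\<omega>. norm (X 0 \<omega>) ^ q) \<longrightarrow>
           (\<forall>t\<ge>0. \<forall>k\<in>{1..q}. \<forall>j.
              (k = 1 \<or> (\<exists>x. AE \<omega> in M. X 0 \<omega> = x) \<longrightarrow>
                 (\<integral>\<omega>. (X t \<omega> $ j - (\<integral>\<omega>'. X t \<omega>' $ j \<partial>M)) ^ k \<partial>M)
                   = (\<integral>\<omega>. P t k j (X 0 \<omega>) \<partial>M)) \<and>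
              (\<integral>\<omega>. (X t \<omega> $ j
                     - real_cond_exp M (vimage_algebra (space M) (X 0) borel)
                         (\<lambda>\<omega>'. X t \<omega>' $ j) \<omega>) ^ k \<partial>M)
                = (\<integral>\<omega>. P t k j (X 0 \<omega>) \<partial>M))))"
proof -
  interpret cbi_param c \<beta> B \<nu> \<mu> q
    by unfold_locales (rule q adm nu mu)+
  \<comment> \<open>The choice involves the parameters only: the semigroup is quantified inside, so
    one polynomial serves every process.\<close>
  define p where "p t k j = (SOME p. polynomial_deg_le (k div 2) p \<and> (\<forall>P. cbi_semigroup c \<beta> B \<nu> \<mu> P \<longrightarrow>
      (\<forall>x\<in>orthant. (\<integral>y. (y $ j - kernel_mean_fun t j x) ^ k \<partial>P t x) = p x)))" for t k j
  have p_prop: "polynomial_deg_le (k div 2) (p t k j) \<and> (\<forall>P. cbi_semigroup c \<beta> B \<nu> \<mu> P \<longrightarrow>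
      (\<forall>x\<in>orthant. (\<integral>y. (y $ j - kernel_mean_fun t j x) ^ k \<partial>P t x) = p t k j x))" if "0 \<le> t" "k \<le> q" for t k j
    unfolding p_def by (rule someI_ex[OF kernel_polynomial[OF that(2,1)]])
  show ?thesis
    unfolding Bt_def[symmetric] Let_def
  \<comment> \<open>Cases 1 to 6 are the moment, the three integrability claims, the recursion, and
    the recursion without initial term; cases 7 to 9 are the degree and the two representations by
    polynomials.\<close>
  proof (intro conjI allI impI ballI exI[of _ p], goal_cases)
    case (1 M X t)
    then obtain P where P: "cbi_semigroup c \<beta> B \<nu> \<mu> P" "markov_process M P X" unfolding cbi_process_def by blast
    from 1 have X0: "integrable M (\<lambda>\<omega>. norm (X 0 \<omega>) ^ q)" and t: "0 \<le> t" by simp_all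
    show ?case by (rule X_moments(1)[OF P X0 t order_refl])
  next
    case (2 M X k j t i)
    then obtain P where P: "cbi_semigroup c \<beta> B \<nu> \<mu> P" "markov_process M P X" unfolding cbi_process_def by blast
    from 2 have X0: "integrable M (\<lambda>\<omega>. norm (X 0 \<omega>) ^ q)" and t: "0 \<le> t" and k: "1 \<le> k" "k \<le> q" by simp_all
    show ?case by (rule process_formula(1)[OF P X0 t k 2(4)])
  next
    case (3 M X k j t l i)
    then obtain P where P: "cbi_semigroup c \<beta> B \<nu> \<mu> P" "markov_process M P X" unfolding cbi_process_def by blast
    from 3 have X0: "integrable M (\<lambda>\<omega>. norm (X 0 \<omega>) ^ q)" and t: "0 \<le> t" and k: "1 \<le> k" "k \<le> q" by simp_all
    show ?case by (rule process_formula(2)[OF P X0 t k 3(4)])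
  next
    case (4 M X k j t l)
    then obtain P where P: "cbi_semigroup c \<beta> B \<nu> \<mu> P" "markov_process M P X" unfolding cbi_process_def by blast
    from 4 have X0: "integrable M (\<lambda>\<omega>. norm (X 0 \<omega>) ^ q)" and t: "0 \<le> t" and k: "1 \<le> k" "k \<le> q" by simp_all
    show ?case by (rule process_formula(3)[OF P X0 t k 4(4)])
  next
    case (5 M X k j t)
    then obtain P where P: "cbi_semigroup c \<beta> B \<nu> \<mu> P" "markov_process M P X" unfolding cbi_process_def by blast
    from 5 have X0: "integrable M (\<lambda>\<omega>. norm (X 0 \<omega>) ^ q)" and t: "0 \<le> t" and k: "1 \<le> k" "k \<le> q" by simp_all
    show ?case by (rule process_formula(4)[OF P X0 t k])
  next
    case (6 M X k j t)
    then obtain P where P: "cbi_semigroup c \<beta> B \<nu> \<mu> P" "markov_process M P X" unfolding cbi_process_def by blast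
    from 6 have X0: "integrable M (\<lambda>\<omega>. norm (X 0 \<omega>) ^ q)" and t: "0 \<le> t" and k: "1 \<le> k" "k \<le> q" by simp_all
    show ?case
      using process_formula(4)[OF P X0 t k, of j] initial_moment_zero[OF P X0 t k(1) 6(4), of j] by simp
  next
    case (7 t k j)
    then show ?case by (intro p_prop[THEN conjunct1]) auto
  next
    case (8 M X t k j)
    then obtain P where P: "cbi_semigroup c \<beta> B \<nu> \<mu> P" "markov_process M P X" unfolding cbi_process_def by blast
    from 8 have X0: "integrable M (\<lambda>\<omega>. norm (X 0 \<omega>) ^ q)" and t: "0 \<le> t" and k: "1 \<le> k" "k \<le> q" by simp_all
    show ?case
      by (rule conditional_central_moment(2)[OF P X0 t k(2) p_prop[OF t k(2), THEN conjunct2, THEN spec, THEN mp, OF P(1)] k(1) 8(4)])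
  next
    case (9 M X t k j)
    then obtain P where P: "cbi_semigroup c \<beta> B \<nu> \<mu> P" "markov_process M P X" unfolding cbi_process_def by blast
    from 9 have X0: "integrable M (\<lambda>\<omega>. norm (X 0 \<omega>) ^ q)" and t: "0 \<le> t" and k: "1 \<le> k" "k \<le> q" by simp_all
    show ?case
      by (rule conditional_central_moment(1)[OF P X0 t k(2) p_prop[OF t k(2), THEN conjunct2, THEN spec, THEN mp, OF P(1)]])
  qed
qed

end
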